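(* Let $\varphi\colon A\to B$ be a surjective cdga morphism with kernel $K$ such that $H(\varphi)$ is also surjective. Let $k,l$ be positive integers such that $A=A^{<l}$ (i.e. $A^p=0$ for $p\ge l$) and $H(K)=H^{\ge k}(K)$ (i.e. $H^p(K)=0$ for $p<k$). Then $$\mathrm{secat}(\varphi)\le \frac{l+1}{k}.$$
   Context: A cdga is a non-negatively graded commutative differential graded algebra over $\mathbb{Q}$, with differential of degree $+1$. For a surjective cdga morphism $\varphi\colon A\to B$ with kernel $K$, let $q_m\colon A^{\otimes m+1}\to A^{\otimes m+1}/K^{\otimes m+1}$ be the projection, $i_m\colon A^{\otimes m+1}\to (A^{\otimes m+1}\otimes\Lambda W_m,D)$ a relative Sullivan model of $q_m$ (the inclusion of a relative Sullivan algebra together with a quasi-isomorphism to $A^{\otimes m+1}/K^{\otimes m+1}$ extending $q_m$), and $\mu_{m+1}\colon A^{\otimes m+1}\to A$ the multiplication. Then $\mathrm{secat}(\varphi)$ is the smallest $m$ for which there is a cdga morphism $\tau\colon (A^{\otimes m+1}\otimes\Lambda W_m,D)\to A$ with $\tau\circ i_m=\mu_{m+1}$. *)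

theory Defs
  imports
    "HOL-Library.Poly_Mapping"
    "HOL-Library.Extended_Real"
    "HOL-Algebra.Generated_Rings"
    "HOL-Algebra.QuotRing"
    "HOL-Algebra.Module"
begin

section \<open>Commutative differential graded algebras over the rationals\<close>

definition rat_ring :: "rat ring" where
  "rat_ring = \<lparr>carrier = UNIV, mult = (*), one = 1, zero = 0, add = (+)\<rparr>"

record 'a cdga = "(rat, 'a) module" +
  gr :: "nat \<Rightarrow> 'a set"
  diff :: "'a \<Rightarrow> 'a"

locale cdga = ring A + module rat_ring A for A :: "('a, 'm) cdga_scheme" (structure) +
  assumes smult_mult_left:
      "\<And>a x y. \<lbrakk>x \<in> carrier A; y \<in> carrier A\<rbrakk> \<Longrightarrow> (a \<odot> x) \<otimes> y = a \<odot> (x \<otimes> y)"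
    and smult_mult_right:
      "\<And>a x y. \<lbrakk>x \<in> carrier A; y \<in> carrier A\<rbrakk> \<Longrightarrow> x \<otimes> (a \<odot> y) = a \<odot> (x \<otimes> y)"
    and gr_submodule: "\<And>p. submodule (gr A p) rat_ring A"
    and gr_direct_sum:
      "\<And>x. x \<in> carrier A \<Longrightarrow>
        \<exists>!f. (\<forall>p. f p \<in> gr A p) \<and> finite {p. f p \<noteq> \<zero>} \<and> x = (\<Oplus>p\<in>{p. f p \<noteq> \<zero>}. f p)"
    and gr_one: "\<one> \<in> gr A 0"
    and gr_mult: "\<And>p q x y. \<lbrakk>x \<in> gr A p; y \<in> gr A q\<rbrakk> \<Longrightarrow> x \<otimes> y \<in> gr A (p + q)"
    and graded_comm:
      "\<And>p q x y. \<lbrakk>x \<in> gr A p; y \<in> gr A q\<rbrakk> \<Longrightarrow> x \<otimes> y = (-1) ^ (p * q) \<odot> (y \<otimes> x)"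
    and diff_add:
      "\<And>x y. \<lbrakk>x \<in> carrier A; y \<in> carrier A\<rbrakk> \<Longrightarrow> diff A (x \<oplus> y) = diff A x \<oplus> diff A y"
    and diff_smult: "\<And>a x. x \<in> carrier A \<Longrightarrow> diff A (a \<odot> x) = a \<odot> diff A x"
    and diff_gr: "\<And>p x. x \<in> gr A p \<Longrightarrow> diff A x \<in> gr A (Suc p)"
    and diff_diff: "\<And>x. x \<in> carrier A \<Longrightarrow> diff A (diff A x) = \<zero>"
    and leibniz:
      "\<And>p x y. \<lbrakk>x \<in> gr A p; y \<in> carrier A\<rbrakk> \<Longrightarrow>
        diff A (x \<otimes> y) = diff A x \<otimes> y \<oplus> (-1) ^ p \<odot> (x \<otimes> diff A y)"

definition cdga_hom :: "('a, 'm) cdga_scheme \<Rightarrow> ('b, 'n) cdga_scheme \<Rightarrow> ('a \<Rightarrow> 'b) set" where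
  "cdga_hom A B = {f \<in> ring_hom A B.
     (\<forall>a. \<forall>x\<in>carrier A. f (a \<odot>\<^bsub>A\<^esub> x) = a \<odot>\<^bsub>B\<^esub> f x) \<and>
     (\<forall>p. f ` gr A p \<subseteq> gr B p) \<and>
     (\<forall>x\<in>carrier A. f (diff A x) = diff B (f x))}"

text \<open>The linear span of a subset of the carrier.\<close>
definition lspan :: "('a, 'm) cdga_scheme \<Rightarrow> 'a set \<Rightarrow> 'a set" where
  "lspan A S = \<Inter>{N. submodule N rat_ring A \<and> S \<subseteq> N}"

definition graded_subspace :: "('a, 'm) cdga_scheme \<Rightarrow> 'a set \<Rightarrow> bool" where
  "graded_subspace A V \<longleftrightarrow> submodule V rat_ring A \<and> V = lspan A (\<Union>p. V \<inter> gr A p)"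

section \<open>Cohomology\<close>

definition cocycles :: "('a, 'm) cdga_scheme \<Rightarrow> nat \<Rightarrow> 'a set" where
  "cocycles A p = {x \<in> gr A p. diff A x = \<zero>\<^bsub>A\<^esub>}"

definition coboundaries :: "('a, 'm) cdga_scheme \<Rightarrow> nat \<Rightarrow> 'a set" where
  "coboundaries A p = (case p of 0 \<Rightarrow> {\<zero>\<^bsub>A\<^esub>} | Suc q \<Rightarrow> diff A ` gr A q)"

definition coh_class :: "('a, 'm) cdga_scheme \<Rightarrow> nat \<Rightarrow> 'a \<Rightarrow> 'a set" where
  "coh_class A p z = coboundaries A p +>\<^bsub>A\<^esub> z"

definition cohomology :: "('a, 'm) cdga_scheme \<Rightarrow> nat \<Rightarrow> 'a set set" where
  "cohomology A p = coh_class A p ` cocycles A p"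

definition coh_map :: "('b, 'n) cdga_scheme \<Rightarrow> ('a \<Rightarrow> 'b) \<Rightarrow> nat \<Rightarrow> 'a set \<Rightarrow> 'b set" where
  "coh_map B f p X = (\<Union>x\<in>X. coh_class B p (f x))"

definition quasi_iso :: "('a, 'm) cdga_scheme \<Rightarrow> ('b, 'n) cdga_scheme \<Rightarrow> ('a \<Rightarrow> 'b) \<Rightarrow> bool" where
  "quasi_iso A B f \<longleftrightarrow>
     f \<in> cdga_hom A B \<and> (\<forall>p. bij_betw (coh_map B f p) (cohomology A p) (cohomology B p))"

text \<open>A differential graded subspace (such as a kernel) as a cochain complex in its own right;
  the unit and the multiplication of the resulting record are meaningless in general.\<close>
definition subcomplex :: "('a, 'm) cdga_scheme \<Rightarrow> 'a set \<Rightarrow> ('a, 'm) cdga_scheme" where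
  "subcomplex A K = A\<lparr>carrier := K, gr := (\<lambda>p. gr A p \<inter> K)\<rparr>"

section \<open>Quotients by differential graded ideals\<close>

definition quot_cdga :: "('a, 'm) cdga_scheme \<Rightarrow> 'a set \<Rightarrow> 'a set cdga" where
  "quot_cdga A I =
     \<lparr>carrier = a_rcosets\<^bsub>A\<^esub> I, mult = rcoset_mult A I, one = I +>\<^bsub>A\<^esub> \<one>\<^bsub>A\<^esub>,
      zero = I, add = set_add A,
      smult = (\<lambda>a X. \<Union>x\<in>X. I +>\<^bsub>A\<^esub> (a \<odot>\<^bsub>A\<^esub> x)),
      gr = (\<lambda>p. (\<lambda>x. I +>\<^bsub>A\<^esub> x) ` gr A p),
      diff = (\<lambda>X. \<Union>x\<in>X. I +>\<^bsub>A\<^esub> diff A x)\<rparr>"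

section \<open>Tensor powers\<close>

text \<open>The tensor power \<open>A\<^sup>\<otimes>\<^sup>n\<close> is the rational vector space on the symbols
  \<open>x\<^sub>1 \<otimes> \<dots> \<otimes> x\<^sub>n\<close> with homogeneous entries, modulo linearity in each entry. A symbol
  is a list of pairs (degree, entry); the degree is recorded because \<open>0\<close> lies in every degree.\<close>

type_synonym 'a tsym = "(nat \<times> 'a) list"
type_synonym 'a tensor = "('a tsym \<Rightarrow>\<^sub>0 rat) set"

definition tsyms :: "('a, 'm) cdga_scheme \<Rightarrow> nat \<Rightarrow> 'a tsym set" where
  "tsyms A n = {xs. length xs = n \<and> (\<forall>(p, x)\<in>set xs. x \<in> gr A p)}"

definition tdeg :: "'a tsym \<Rightarrow> nat" where
  "tdeg xs = (\<Sum>i<length xs. fst (xs ! i))"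

abbreviation sym :: "'g \<Rightarrow> 'g \<Rightarrow>\<^sub>0 rat" where
  "sym g \<equiv> Poly_Mapping.single g 1"

definition scl :: "rat \<Rightarrow> ('g \<Rightarrow>\<^sub>0 rat) \<Rightarrow> ('g \<Rightarrow>\<^sub>0 rat)" where
  "scl a f = Poly_Mapping.map (\<lambda>c. a * c) f"

definition lin_ext :: "('g \<Rightarrow> 'h \<Rightarrow>\<^sub>0 rat) \<Rightarrow> ('g \<Rightarrow>\<^sub>0 rat) \<Rightarrow> ('h \<Rightarrow>\<^sub>0 rat)" where
  "lin_ext h f = (\<Sum>g\<in>Poly_Mapping.keys f. scl (Poly_Mapping.lookup f g) (h g))"

text \<open>\<open>(x\<^sub>1 \<otimes> \<dots> \<otimes> x\<^sub>n)(y\<^sub>1 \<otimes> \<dots> \<otimes> y\<^sub>n) = \<plusminus> x\<^sub>1y\<^sub>1 \<otimes> \<dots> \<otimes> x\<^sub>ny\<^sub>n\<close>, with the Koszul sign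
  for moving each \<open>y\<^sub>j\<close> past all \<open>x\<^sub>i\<close> with \<open>i > j\<close>.\<close>
definition tsym_mult :: "('a, 'm) cdga_scheme \<Rightarrow> 'a tsym \<Rightarrow> 'a tsym \<Rightarrow> ('a tsym \<Rightarrow>\<^sub>0 rat)" where
  "tsym_mult A xs ys =
     scl ((-1) ^ (\<Sum>i<length xs. \<Sum>j<i. fst (xs ! i) * fst (ys ! j)))
       (sym (map2 (\<lambda>(p, x) (q, y). (p + q, x \<otimes>\<^bsub>A\<^esub> y)) xs ys))"

definition tsym_diff :: "('a, 'm) cdga_scheme \<Rightarrow> 'a tsym \<Rightarrow> ('a tsym \<Rightarrow>\<^sub>0 rat)" where
  "tsym_diff A xs =
     (\<Sum>i<length xs. scl ((-1) ^ (\<Sum>j<i. fst (xs ! j)))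
        (sym (xs[i := (Suc (fst (xs ! i)), diff A (snd (xs ! i)))])))"

text \<open>The free space on the symbols, before imposing linearity. It is not itself a cdga.\<close>
definition pre_tensor :: "('a, 'm) cdga_scheme \<Rightarrow> nat \<Rightarrow> ('a tsym \<Rightarrow>\<^sub>0 rat) cdga" where
  "pre_tensor A n =
     \<lparr>carrier = {f. Poly_Mapping.keys f \<subseteq> tsyms A n},
      mult = (\<lambda>f g. lin_ext (\<lambda>xs. lin_ext (\<lambda>ys. tsym_mult A xs ys) g) f),
      one = sym (replicate n (0, \<one>\<^bsub>A\<^esub>)),
      zero = 0, add = (+), smult = scl,
      gr = (\<lambda>p. {f. Poly_Mapping.keys f \<subseteq> {xs \<in> tsyms A n. tdeg xs = p}}),
      diff = lin_ext (tsym_diff A)\<rparr>"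

definition tensor_rels :: "('a, 'm) cdga_scheme \<Rightarrow> nat \<Rightarrow> ('a tsym \<Rightarrow>\<^sub>0 rat) set" where
  "tensor_rels A n = lspan (pre_tensor A n)
     ({sym (us @ (p, x \<oplus>\<^bsub>A\<^esub> y) # vs) - sym (us @ (p, x) # vs) - sym (us @ (p, y) # vs)
        | us vs p x y. x \<in> gr A p \<and> y \<in> gr A p \<and> us @ (p, x) # vs \<in> tsyms A n} \<union>
      {sym (us @ (p, a \<odot>\<^bsub>A\<^esub> x) # vs) - scl a (sym (us @ (p, x) # vs))
        | us vs p a x. us @ (p, x) # vs \<in> tsyms A n})"

definition tensor_power :: "('a, 'm) cdga_scheme \<Rightarrow> nat \<Rightarrow> 'a tensor cdga" where
  "tensor_power A n = quot_cdga (pre_tensor A n) (tensor_rels A n)"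

definition pure_tensor :: "('a, 'm) cdga_scheme \<Rightarrow> 'a tsym \<Rightarrow> 'a tensor" where
  "pure_tensor A xs = tensor_rels A (length xs) +>\<^bsub>pre_tensor A (length xs)\<^esub> sym xs"

text \<open>\<open>K\<^sup>\<otimes>\<^sup>n\<close> inside \<open>A\<^sup>\<otimes>\<^sup>n\<close>, for a graded subspace \<open>K\<close> of \<open>A\<close>.\<close>
definition tensor_sub :: "('a, 'm) cdga_scheme \<Rightarrow> 'a set \<Rightarrow> nat \<Rightarrow> 'a tensor set" where
  "tensor_sub A K n = lspan (tensor_power A n)
     (pure_tensor A ` {xs \<in> tsyms A n. snd ` set xs \<subseteq> K})"

definition tensor_eval :: "('a, 'm) cdga_scheme \<Rightarrow> ('a tsym \<Rightarrow>\<^sub>0 rat) \<Rightarrow> 'a" where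
  "tensor_eval A f = (\<Oplus>\<^bsub>A\<^esub>xs\<in>Poly_Mapping.keys f.
     Poly_Mapping.lookup f xs \<odot>\<^bsub>A\<^esub> foldr (\<otimes>\<^bsub>A\<^esub>) (map snd xs) \<one>\<^bsub>A\<^esub>)"

definition multiplication :: "('a, 'm) cdga_scheme \<Rightarrow> 'a tensor \<Rightarrow> 'a" where
  "multiplication A X = the_elem (tensor_eval A ` X)"

section \<open>Relative Sullivan models\<close>

text \<open>Words in the set \<open>X\<close> of homogeneous elements that are weakly increasing for the linear
  order \<open>r\<close> and do not repeat letters of odd degree. When \<open>X\<close> is a basis of \<open>V\<close>, their products
  form the standard basis of \<open>\<Lambda>V\<close>, the symmetric algebra on the even part of \<open>V\<close> tensored with
  the exterior algebra on the odd part.\<close>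
definition monomials :: "('c, 'm) cdga_scheme \<Rightarrow> 'c set \<Rightarrow> 'c rel \<Rightarrow> 'c list set" where
  "monomials C X r = {xs. set xs \<subseteq> X \<and>
     sorted_wrt (\<lambda>x y. (x, y) \<in> r \<and> (x = y \<longrightarrow> (\<exists>p. even p \<and> x \<in> gr C p))) xs}"

text \<open>Multiplication gives an isomorphism \<open>B \<otimes> \<Lambda>V \<rightarrow> C\<close> of graded algebras, where \<open>B\<close> maps to
  \<open>C\<close> by \<open>i\<close>: the monomials in a homogeneous basis of \<open>V\<close> form a basis of \<open>C\<close> over \<open>B\<close>.\<close>
definition free_extension ::
    "('b, 'm) cdga_scheme \<Rightarrow> ('c, 'n) cdga_scheme \<Rightarrow> ('b \<Rightarrow> 'c) \<Rightarrow> 'c set \<Rightarrow> bool" where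
  "free_extension B C i V \<longleftrightarrow>
     (\<exists>X r. X \<subseteq> (\<Union>p. gr C p) \<and> lspan C X = V \<and> linear_order_on X r \<and>
       (\<forall>c\<in>carrier C. \<exists>!f. f ` monomials C X r \<subseteq> carrier B \<and>
          (\<forall>xs. xs \<notin> monomials C X r \<longrightarrow> f xs = \<zero>\<^bsub>B\<^esub>) \<and> finite {xs. f xs \<noteq> \<zero>\<^bsub>B\<^esub>} \<and>
          c = (\<Oplus>\<^bsub>C\<^esub>xs\<in>{xs. f xs \<noteq> \<zero>\<^bsub>B\<^esub>}. i (f xs) \<otimes>\<^bsub>C\<^esub> foldr (\<otimes>\<^bsub>C\<^esub>) xs \<one>\<^bsub>C\<^esub>)))"

text \<open>A relative Sullivan algebra \<open>i: B \<rightarrow> C = (B \<otimes> \<Lambda>V, D)\<close>. As usual \<open>H\<^sup>0(B)\<close> is required to be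
  the ground field. Generators of degree \<open>0\<close> are allowed, so that a surjection \<open>B \<rightarrow> Q\<close> has a
  relative Sullivan model even if it is not injective on \<open>H\<^sup>1\<close>.\<close>
definition relative_sullivan ::
    "('b, 'm) cdga_scheme \<Rightarrow> ('c, 'n) cdga_scheme \<Rightarrow> ('b \<Rightarrow> 'c) \<Rightarrow> bool" where
  "relative_sullivan B C i \<longleftrightarrow>
     cdga B \<and> cdga C \<and> i \<in> cdga_hom B C \<and>
     bij_betw (\<lambda>a. coh_class B 0 (a \<odot>\<^bsub>B\<^esub> \<one>\<^bsub>B\<^esub>)) UNIV (cohomology B 0) \<and>
     (\<exists>V F. graded_subspace C V \<and> free_extension B C i V \<and>
       (\<forall>n. graded_subspace C (F n)) \<and> (\<forall>n. F n \<subseteq> F (Suc n)) \<and> V = (\<Union>n. F n) \<and>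
       diff C ` F 0 \<subseteq> i ` carrier B \<and>
       (\<forall>n. diff C ` F (Suc n) \<subseteq> generate_ring C (i ` carrier B \<union> F n)))"

definition relative_sullivan_model ::
    "('b, 'm) cdga_scheme \<Rightarrow> ('q, 'k) cdga_scheme \<Rightarrow> ('b \<Rightarrow> 'q) \<Rightarrow>
     ('c, 'n) cdga_scheme \<Rightarrow> ('b \<Rightarrow> 'c) \<Rightarrow> bool" where
  "relative_sullivan_model B Q q C i \<longleftrightarrow>
     relative_sullivan B C i \<and> (\<exists>\<pi>. quasi_iso C Q \<pi> \<and> (\<forall>b\<in>carrier B. \<pi> (i b) = q b))"

section \<open>Sectional category\<close>

text \<open>For each \<open>m\<close>, \<open>i m\<close> is a relative Sullivan model of
  \<open>q\<^sub>m: A\<^sup>\<otimes>\<^sup>m\<^sup>+\<^sup>1 \<rightarrow> A\<^sup>\<otimes>\<^sup>m\<^sup>+\<^sup>1 / K\<^sup>\<otimes>\<^sup>m\<^sup>+\<^sup>1\<close>, where \<open>K\<close> is the kernel of \<open>\<phi>\<close>.\<close>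
definition secat_models ::
    "('a, 'm) cdga_scheme \<Rightarrow> ('b, 'n) cdga_scheme \<Rightarrow> ('a \<Rightarrow> 'b) \<Rightarrow>
     (nat \<Rightarrow> ('c, 'k) cdga_scheme) \<Rightarrow> (nat \<Rightarrow> 'a tensor \<Rightarrow> 'c) \<Rightarrow> bool" where
  "secat_models A B \<phi> C i \<longleftrightarrow> (\<forall>m.
     let T = tensor_power A (m + 1); J = tensor_sub A (a_kernel A B \<phi>) (m + 1)
     in relative_sullivan_model T (quot_cdga T J) (\<lambda>x. J +>\<^bsub>T\<^esub> x) (C m) (i m))"

text \<open>The sectional category computed from a family of relative Sullivan models as above
  (it does not depend on the choice of the family); \<open>\<infinity>\<close> if there is no suitable \<open>m\<close>.\<close>
definition secat ::
    "('a, 'm) cdga_scheme \<Rightarrow> (nat \<Rightarrow> ('c, 'k) cdga_scheme) \<Rightarrow>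
     (nat \<Rightarrow> 'a tensor \<Rightarrow> 'c) \<Rightarrow> enat" where
  "secat A C i = Inf {enat m | m. \<exists>\<tau>\<in>cdga_hom (C m) A.
     \<forall>x\<in>carrier (tensor_power A (m + 1)). \<tau> (i m x) = multiplication A x}"

end

theory Submission
  imports Defs
begin

text \<open>Let \<open>T = A\<^sup>\<otimes>\<^sup>n\<close>, let \<open>J = K\<^sup>\<otimes>\<^sup>n\<close> and let \<open>T \<rightarrow> C \<rightarrow> T / J\<close> be a relative Sullivan model, where \<open>n\<close> is so
  large that \<open>n k > l + 1\<close>. A morphism \<open>C \<rightarrow> A\<close> that extends the multiplication \<open>\<mu>\<close> of \<open>A\<close> is to be
  found. By the Kuenneth theorem \<open>J\<close> has no cohomology below degree \<open>n k\<close> (\<open>tensor_sub_acyclic\<close>),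
  hence \<open>C / T\<close> has no cohomology up to degree \<open>l\<close>. On the other hand \<open>A\<close> vanishes from degree \<open>l\<close> on.
  So if \<open>C\<close> were equal to \<open>T\<close> up to degree \<open>m\<close> for some \<open>m \<ge> l - 1\<close>, then \<open>\<mu>\<close> in the degrees up to \<open>m\<close> and \<open>0\<close>
  above would be the required morphism.

  In general \<open>C\<close> has many generators in low degrees. It is therefore mapped to a cdga \<open>E\<close> that contains
  \<open>T\<close>, agrees with \<open>T\<close> up to degree \<open>m\<close> and has the same cohomology as \<open>C\<close>; the map is the identity
  on \<open>T\<close>, and the composite \<open>C \<rightarrow> E \<rightarrow> A\<close> is the extension of \<open>\<mu>\<close> (\<open>extension_problem.exists_extension\<close>).
  One would like to take for \<open>E\<close> a subalgebra of \<open>C\<close>: all of \<open>C\<close> above degree \<open>m + 1\<close>, the algebra \<open>T\<close>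
  up to degree \<open>m\<close>, and in degree \<open>m + 1\<close> the sum of \<open>T\<^sup>m\<^sup>+\<^sup>1\<close> and a complement of the coboundaries.
  This complement has to be stable under multiplication by \<open>T\<^sup>0\<close>, which can be larger than the
  ground field although \<open>H\<^sup>0(T)\<close> is not. To make room for a stable one, \<open>C\<close> is first enlarged by a
  contractible module; the construction is explained at the locale \<open>thinning\<close>.

  The map \<open>C \<rightarrow> E\<close> is constructed generator by generator along the filtration of the relative Sullivan
  algebra. Let \<open>N\<close> be the kernel of the quasi-isomorphism \<open>C \<rightarrow> T / J\<close>. It is an acyclic ideal with \<open>C = T + N\<close>.
  If all values so far are congruent modulo \<open>N\<close> to the identity of \<open>C\<close>, then the value required for the
  differential of the next generator is, up to elements of \<open>T\<close>, a cocycle of \<open>E\<close> over a cocycle in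
  \<open>N\<close>, hence a coboundary, and the congruence can be kept (\<open>lift_value\<close>).\<close>

section \<open>Graded-commutative differential algebras\<close>

lemma rat_ring_simps [simp]:
  "carrier rat_ring = UNIV" "x \<otimes>\<^bsub>rat_ring\<^esub> y = x * y" "\<one>\<^bsub>rat_ring\<^esub> = 1"
  "\<zero>\<^bsub>rat_ring\<^esub> = 0" "x \<oplus>\<^bsub>rat_ring\<^esub> y = x + y"
  by (simp_all add: rat_ring_def)

lemma cring_rat_ring: "cring rat_ring"
proof -
  have "\<exists>y. y + x = 0" for x :: rat by (rule exI[of _ "- x"]) simp
  then show ?thesis
    by (intro cringI abelian_groupI comm_monoidI) (auto simp: algebra_simps)
qed

lemma ringI_rat_module:
  assumes "abelian_group A"
    and "\<And>a x. x \<in> carrier A \<Longrightarrow> a \<odot>\<^bsub>A\<^esub> x \<in> carrier A"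
    and "\<And>a b x. x \<in> carrier A \<Longrightarrow> (a + b) \<odot>\<^bsub>A\<^esub> x = a \<odot>\<^bsub>A\<^esub> x \<oplus>\<^bsub>A\<^esub> b \<odot>\<^bsub>A\<^esub> x"
    and "\<And>a x y. x \<in> carrier A \<Longrightarrow> y \<in> carrier A \<Longrightarrow>
      a \<odot>\<^bsub>A\<^esub> (x \<oplus>\<^bsub>A\<^esub> y) = a \<odot>\<^bsub>A\<^esub> x \<oplus>\<^bsub>A\<^esub> a \<odot>\<^bsub>A\<^esub> y"
    and "\<And>a b x. x \<in> carrier A \<Longrightarrow> (a * b) \<odot>\<^bsub>A\<^esub> x = a \<odot>\<^bsub>A\<^esub> (b \<odot>\<^bsub>A\<^esub> x)"
    and "\<And>x. x \<in> carrier A \<Longrightarrow> 1 \<odot>\<^bsub>A\<^esub> x = x"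
  shows "module rat_ring A"
  using assms by (intro moduleI cring_rat_ring) auto

subsection \<open>Vector spaces over the rationals\<close>

locale ratmod = module rat_ring A for A :: "('a, 'm) cdga_scheme" (structure)

context ratmod
begin

lemma sm_closed [simp, intro]: "x \<in> carrier A \<Longrightarrow> a \<odot> x \<in> carrier A"
  by simp

lemma sm_ldistr: "x \<in> carrier A \<Longrightarrow> (a + b) \<odot> x = a \<odot> x \<oplus> b \<odot> x"
  using smult_l_distr[of a b x] by simp

lemma sm_rdistr:
  "x \<in> carrier A \<Longrightarrow> y \<in> carrier A \<Longrightarrow> a \<odot> (x \<oplus> y) = a \<odot> x \<oplus> a \<odot> y"
  by (rule smult_r_distr) auto

lemma sm_assoc: "x \<in> carrier A \<Longrightarrow> a \<odot> (b \<odot> x) = (a * b) \<odot> x"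
  using smult_assoc1[of a b x] by simp

lemma sm_one [simp]: "x \<in> carrier A \<Longrightarrow> 1 \<odot> x = x"
  using smult_one[of x] by simp

lemma sm_null [simp]: "x \<in> carrier A \<Longrightarrow> 0 \<odot> x = \<zero>"
  using smult_l_null[of x] by simp

lemma sm_zero [simp]: "a \<odot> \<zero> = \<zero>"
  by (rule smult_r_null) simp

lemma sm_uminus: "x \<in> carrier A \<Longrightarrow> \<ominus> x = (-1) \<odot> x"
proof -
  assume x: "x \<in> carrier A"
  have "(-1) \<odot> x \<oplus> x = (-1 + 1) \<odot> x" using x by (simp only: sm_ldistr sm_one)
  also have "\<dots> = \<zero>" using x by simp
  finally show ?thesis using x by (metis M.minus_equality sm_closed)
qed

lemma zero_in [simp]: "\<zero> \<in> carrier A" by (rule M.zero_closed)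

lemma add_in [simp, intro]: "x \<in> carrier A \<Longrightarrow> y \<in> carrier A \<Longrightarrow> x \<oplus> y \<in> carrier A"
  by (rule M.a_closed)

lemma neg_zero [simp]: "\<ominus> \<zero> = \<zero>"
  by (simp add: sm_uminus)

lemma sm_cancel: "x \<in> carrier A \<Longrightarrow> a \<noteq> 0 \<Longrightarrow> a \<odot> x = \<zero> \<Longrightarrow> x = \<zero>"
  using sm_assoc[of x "1 / a" a] by simp

lemmas fs_empty = M.finsum_empty
  and fs_insert = M.finsum_insert
  and fs_closed = M.finsum_closed
  and fs_cong = M.finsum_cong'
  and fs_addf = M.finsum_addf
  and add_ac = M.a_ac
  and add_assoc = M.a_assoc
  and add_comm = M.a_comm
  and r_neg_self = M.r_neg
  and l_neg_self = M.l_neg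
  and neg_add = M.minus_add
  and neg_neg = M.minus_minus
  and neg_unique = M.minus_equality
  and add_zero [simp] = M.r_zero M.l_zero

lemma add_l_cancel:
  "x \<in> carrier A \<Longrightarrow> y \<in> carrier A \<Longrightarrow> z \<in> carrier A \<Longrightarrow> (x \<oplus> y = x \<oplus> z) = (y = z)"
  using M.r_neg1[of x y] M.r_neg1[of x z] by auto

lemma subspaceI:
  assumes "N \<subseteq> carrier A" "\<zero> \<in> N" "\<And>x y. x \<in> N \<Longrightarrow> y \<in> N \<Longrightarrow> x \<oplus> y \<in> N"
    "\<And>a x. x \<in> N \<Longrightarrow> a \<odot> x \<in> N"
  shows "submodule N rat_ring A"
  by (rule submoduleI) (use assms sm_uminus in \<open>auto simp: subset_iff\<close>)

lemma subspaceD: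
  assumes "submodule N rat_ring A"
  shows "N \<subseteq> carrier A" "\<zero> \<in> N" "\<And>x y. x \<in> N \<Longrightarrow> y \<in> N \<Longrightarrow> x \<oplus> y \<in> N"
    "\<And>a x. x \<in> N \<Longrightarrow> a \<odot> x \<in> N" "\<And>x. x \<in> N \<Longrightarrow> \<ominus> x \<in> N"
    "\<And>x y. x \<in> N \<Longrightarrow> y \<in> N \<Longrightarrow> x \<ominus> y \<in> N"
proof -
  show 1: "N \<subseteq> carrier A" "\<And>x y. x \<in> N \<Longrightarrow> y \<in> N \<Longrightarrow> x \<oplus> y \<in> N"
    "\<And>a x. x \<in> N \<Longrightarrow> a \<odot> x \<in> N" "\<And>x. x \<in> N \<Longrightarrow> \<ominus> x \<in> N"
    using submoduleE[OF assms] by auto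
  obtain x where x: "x \<in> N" using submoduleE(2)[OF assms] by auto
  have "0 \<odot> x \<in> N" using 1(3) x by blast
  then show "\<zero> \<in> N" using x 1(1) by auto
  show "\<And>x y. x \<in> N \<Longrightarrow> y \<in> N \<Longrightarrow> x \<ominus> y \<in> N" using 1 by (simp add: a_minus_def)
qed

lemma subspace_carrier: "submodule (carrier A) rat_ring A"
  by (rule subspaceI) auto

lemma subspace_finsum:
  assumes "submodule N rat_ring A" "finite S" "f ` S \<subseteq> N"
  shows "(\<Oplus>s\<in>S. f s) \<in> N"
  using assms(2,3)
proof (induction S)
  case empty
  then show ?case using subspaceD(2)[OF assms(1)] by simp
next
  case (insert s S)
  have "f \<in> S \<rightarrow> carrier A" "f s \<in> carrier A"
    using insert.prems subspaceD(1)[OF assms(1)] by auto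
  then show ?case using insert subspaceD(3)[OF assms(1)] by (simp add: M.finsum_insert)
qed

lemma lspan_subspace: "S \<subseteq> carrier A \<Longrightarrow> submodule (lspan A S) rat_ring A"
  using subspace_carrier unfolding lspan_def
  by (intro subspaceI) (blast intro: subspaceD(2-4))+

lemma lspan_incl: "s \<in> S \<Longrightarrow> s \<in> lspan A S"
  unfolding lspan_def by auto

lemma lspan_least: "submodule N rat_ring A \<Longrightarrow> S \<subseteq> N \<Longrightarrow> lspan A S \<subseteq> N"
  unfolding lspan_def by auto

lemma lspan_carrier: "S \<subseteq> carrier A \<Longrightarrow> lspan A S \<subseteq> carrier A"
  by (rule lspan_least[OF subspace_carrier])

lemma lspan_mono: "S \<subseteq> S' \<Longrightarrow> lspan A S \<subseteq> lspan A S'"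
  unfolding lspan_def by auto

lemma lspan_of_subspace: "submodule N rat_ring A \<Longrightarrow> lspan A N = N"
  by (meson lspan_least lspan_incl subsetI subset_antisym subset_refl)

lemma lspan_induct [consumes 2, case_names zero add smult gen]:
  assumes "x \<in> lspan A S" "S \<subseteq> carrier A" "P \<zero>"
    "\<And>x y. x \<in> carrier A \<Longrightarrow> y \<in> carrier A \<Longrightarrow> P x \<Longrightarrow> P y \<Longrightarrow> P (x \<oplus> y)"
    "\<And>a x. x \<in> carrier A \<Longrightarrow> P x \<Longrightarrow> P (a \<odot> x)"
    "\<And>s. s \<in> S \<Longrightarrow> P s"
  shows "P x"
proof -
  have "submodule {x \<in> carrier A. P x} rat_ring A"
    by (rule subspaceI) (use assms in auto)
  then have "lspan A S \<subseteq> {x \<in> carrier A. P x}"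
    by (rule lspan_least) (use assms in auto)
  then show ?thesis using assms(1) by auto
qed

end

subsection \<open>Finite linear combinations\<close>

lemma lookup_scl [simp]: "Poly_Mapping.lookup (scl a f) g = a * Poly_Mapping.lookup f g"
  unfolding scl_def by (simp add: Poly_Mapping.map.rep_eq when_def)

lemma keys_scl: "Poly_Mapping.keys (scl a f) \<subseteq> Poly_Mapping.keys f"
  by (auto simp: in_keys_iff)

lemma scl_simps [simp]:
  "scl a 0 = 0" "scl 0 f = 0" "scl 1 f = f" "scl a (f + g) = scl a f + scl a g"
  "scl a (scl b f) = scl (a * b) f" "scl a (f - g) = scl a f - scl a g"
  by (rule poly_mapping_eqI; simp add: lookup_add lookup_minus algebra_simps)+

lemma scl_add_left: "scl (a + b) f = scl a f + scl b f"
  by (rule poly_mapping_eqI; simp add: lookup_add algebra_simps)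

lemma scl_minus_one: "scl (-1) f = - f"
  by (rule poly_mapping_eqI; simp)

lemma scl_sum: "scl a (\<Sum>i\<in>I. f i) = (\<Sum>i\<in>I. scl a (f i))"
  by (induction I rule: infinite_finite_induct) auto

lemma keys_add_subset:
  "Poly_Mapping.keys f \<subseteq> S \<Longrightarrow> Poly_Mapping.keys g \<subseteq> S \<Longrightarrow> Poly_Mapping.keys (f + g) \<subseteq> S"
  using keys_add[of f g] by auto

lemma keys_scl_subset: "Poly_Mapping.keys f \<subseteq> S \<Longrightarrow> Poly_Mapping.keys (scl a f) \<subseteq> S"
  using keys_scl[of a f] by auto

lemma poly_mapping_linear_induct [consumes 1, case_names zero sym add scl]:
  fixes f :: "'g \<Rightarrow>\<^sub>0 rat"
  assumes "Poly_Mapping.keys f \<subseteq> S" "P 0" "\<And>s. s \<in> S \<Longrightarrow> P (sym s)"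
    "\<And>f g. Poly_Mapping.keys f \<subseteq> S \<Longrightarrow> Poly_Mapping.keys g \<subseteq> S \<Longrightarrow> P f \<Longrightarrow> P g \<Longrightarrow> P (f + g)"
    "\<And>a f. Poly_Mapping.keys f \<subseteq> S \<Longrightarrow> P f \<Longrightarrow> P (scl a f)"
  shows "P f"
  using assms(1)
proof (induction f rule: update_induct)
  case const
  then show ?case using assms(2) by simp
next
  case (update f a b)
  have eq: "Poly_Mapping.update a b f = f + scl b (sym a)"
    using update(1) by (intro poly_mapping_eqI)
      (auto simp: lookup_update lookup_add lookup_single when_def in_keys_iff)
  have "Poly_Mapping.keys (Poly_Mapping.update a b f) = insert a (Poly_Mapping.keys f)"
    using update(2) by (simp add: keys_update)
  then have *: "a \<in> S" "Poly_Mapping.keys f \<subseteq> S" using update.prems by auto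
  then have s: "Poly_Mapping.keys (scl b (sym a)) \<subseteq> S"
    by (intro keys_scl_subset) simp
  show ?case unfolding eq
    using * s update.IH by (intro assms(4) assms(5) assms(3)) auto
qed

definition lincomb :: "('a, 'm) cdga_scheme \<Rightarrow> ('g \<Rightarrow> 'a) \<Rightarrow> ('g \<Rightarrow>\<^sub>0 rat) \<Rightarrow> 'a" where
  "lincomb A v f =
     (\<Oplus>\<^bsub>A\<^esub>g\<in>Poly_Mapping.keys f. Poly_Mapping.lookup f g \<odot>\<^bsub>A\<^esub> v g)"

context ratmod
begin

lemma finsum_neutral_superset:
  assumes "finite S" "K \<subseteq> S" "f ` K \<subseteq> carrier A" "\<And>s. s \<in> S - K \<Longrightarrow> f s = \<zero>"
  shows "(\<Oplus>s\<in>K. f s) = (\<Oplus>s\<in>S. f s)"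
proof (rule M.add.finprod_mono_neutral_cong_left)
  show "f \<in> S \<rightarrow> carrier A"
  proof
    fix s assume "s \<in> S"
    then show "f s \<in> carrier A" using assms by (cases "s \<in> K") auto
  qed
qed (use assms in auto)

lemma lincomb_superset:
  assumes "finite S" "Poly_Mapping.keys f \<subseteq> S" "v ` S \<subseteq> carrier A"
  shows "lincomb A v f = (\<Oplus>g\<in>S. Poly_Mapping.lookup f g \<odot> v g)"
  unfolding lincomb_def
  by (rule finsum_neutral_superset) (use assms in \<open>auto simp: in_keys_iff image_subset_iff\<close>)

lemma lincomb_closed: "v ` Poly_Mapping.keys f \<subseteq> carrier A \<Longrightarrow> lincomb A v f \<in> carrier A"
  unfolding lincomb_def by (rule M.finsum_closed) auto

lemma lincomb_zero [simp]: "lincomb A v 0 = \<zero>"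
  unfolding lincomb_def by (simp add: M.finsum_empty)

lemma lincomb_add:
  assumes "v ` Poly_Mapping.keys f \<subseteq> carrier A" "v ` Poly_Mapping.keys g \<subseteq> carrier A"
  shows "lincomb A v (f + g) = lincomb A v f \<oplus> lincomb A v g"
proof -
  let ?S = "Poly_Mapping.keys f \<union> Poly_Mapping.keys g"
  have S: "finite ?S" "v ` ?S \<subseteq> carrier A" using assms by auto
  have "lincomb A v (f + g) = (\<Oplus>s\<in>?S. Poly_Mapping.lookup (f + g) s \<odot> v s)"
    by (rule lincomb_superset) (use S keys_add[of f g] in auto)
  also have "\<dots> = (\<Oplus>s\<in>?S. Poly_Mapping.lookup f s \<odot> v s \<oplus> Poly_Mapping.lookup g s \<odot> v s)"
    by (rule M.finsum_cong') (use S in \<open>auto simp: lookup_add sm_ldistr image_subset_iff\<close>)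
  also have "\<dots> = lincomb A v f \<oplus> lincomb A v g"
    using lincomb_superset[OF S(1) _ S(2)] S(2)
    by (subst M.finsum_addf) (auto simp: image_subset_iff)
  finally show ?thesis .
qed

lemma lincomb_scl:
  assumes "v ` Poly_Mapping.keys f \<subseteq> carrier A"
  shows "lincomb A v (scl a f) = a \<odot> lincomb A v f"
proof -
  have "lincomb A v (scl a f) = (\<Oplus>s\<in>Poly_Mapping.keys f. Poly_Mapping.lookup (scl a f) s \<odot> v s)"
    by (rule lincomb_superset) (use assms keys_scl[of a f] in auto)
  also have "\<dots> = (\<Oplus>s\<in>Poly_Mapping.keys f. a \<odot> (Poly_Mapping.lookup f s \<odot> v s))"
    by (rule M.finsum_cong') (use assms in \<open>auto simp: sm_assoc image_subset_iff\<close>)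
  also have "\<dots> = a \<odot> lincomb A v f"
    unfolding lincomb_def by (rule finsum_smult_ldistr[symmetric]) (use assms in auto)
  finally show ?thesis .
qed

lemma lincomb_single: "v g \<in> carrier A \<Longrightarrow> lincomb A v (Poly_Mapping.single g a) = a \<odot> v g"
  using lincomb_superset[of "{g}" "Poly_Mapping.single g a" v] by (simp add: M.finsum_insert)

lemma lincomb_sym: "v g \<in> carrier A \<Longrightarrow> lincomb A v (sym g) = v g"
  by (simp add: lincomb_single)

lemma lincomb_uminus:
  "v ` Poly_Mapping.keys f \<subseteq> carrier A \<Longrightarrow> lincomb A v (- f) = \<ominus> lincomb A v f"
  using lincomb_scl[of v f "-1"] by (simp add: scl_minus_one sm_uminus lincomb_closed)

lemma lincomb_in_subspace:
  assumes "submodule N rat_ring A" "v ` Poly_Mapping.keys f \<subseteq> N"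
  shows "lincomb A v f \<in> N"
  unfolding lincomb_def
  by (rule subspace_finsum[OF assms(1)]) (use assms subspaceD(4)[OF assms(1)] in auto)

lemma lspan_eq_lincombs:
  assumes "S \<subseteq> carrier A"
  shows "lspan A S = {lincomb A (\<lambda>x. x) f |f. Poly_Mapping.keys f \<subseteq> S}"
proof
  show "{lincomb A (\<lambda>x. x) f |f. Poly_Mapping.keys f \<subseteq> S} \<subseteq> lspan A S"
    using lspan_incl by (auto intro!: lincomb_in_subspace lspan_subspace assms)
  show "lspan A S \<subseteq> {lincomb A (\<lambda>x. x) f |f. Poly_Mapping.keys f \<subseteq> S}"
  proof
    fix x assume "x \<in> lspan A S"
    from this assms show "x \<in> {lincomb A (\<lambda>x. x) f |f. Poly_Mapping.keys f \<subseteq> S}"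
    proof (induction rule: lspan_induct)
      case zero
      show ?case by (rule CollectI, rule exI[of _ 0]) simp
    next
      case (add x y)
      then obtain f g where "x = lincomb A (\<lambda>x. x) f" "Poly_Mapping.keys f \<subseteq> S"
        "y = lincomb A (\<lambda>x. x) g" "Poly_Mapping.keys g \<subseteq> S" by auto
      then show ?case using assms
        by (intro CollectI exI[of _ "f + g"]) (auto simp: lincomb_add keys_add_subset)
    next
      case (smult a x)
      then obtain f where "x = lincomb A (\<lambda>x. x) f" "Poly_Mapping.keys f \<subseteq> S" by auto
      then show ?case using assms
        by (intro CollectI exI[of _ "scl a f"]) (auto simp: lincomb_scl keys_scl_subset)
    next
      case (gen s)
      then show ?case using assms
        by (intro CollectI exI[of _ "sym s"]) (auto simp: lincomb_sym)
    qed
  qed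
qed

subsection \<open>Bases adapted to a filtration\<close>

definition indep :: "'a set \<Rightarrow> bool" where
  "indep B \<longleftrightarrow> B \<subseteq> carrier A \<and>
     (\<forall>f. Poly_Mapping.keys f \<subseteq> B \<and> lincomb A (\<lambda>x. x) f = \<zero> \<longrightarrow> f = 0)"

lemma lincomb_inj:
  assumes "indep B" "Poly_Mapping.keys f \<subseteq> B" "Poly_Mapping.keys g \<subseteq> B"
    "lincomb A (\<lambda>x. x) f = lincomb A (\<lambda>x. x) g"
  shows "f = g"
proof -
  have B: "B \<subseteq> carrier A" using assms by (auto simp: indep_def)
  have k: "Poly_Mapping.keys (f + - g) \<subseteq> B"
    using assms by (intro keys_add_subset) auto
  have "lincomb A (\<lambda>x. x) (f + - g) = lincomb A (\<lambda>x. x) f \<oplus> \<ominus> lincomb A (\<lambda>x. x) g"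
    using assms B by (subst lincomb_add) (auto simp: lincomb_uminus)
  also have "\<dots> = \<zero>" using assms B
    by (metis M.r_neg image_ident lincomb_closed order_trans)
  finally have "f + - g = 0" using assms(1) k by (auto simp: indep_def)
  then show ?thesis by simp
qed

definition coords :: "'a set \<Rightarrow> 'a \<Rightarrow> 'a \<Rightarrow>\<^sub>0 rat" where
  "coords B x = (THE f. Poly_Mapping.keys f \<subseteq> B \<and> lincomb A (\<lambda>x. x) f = x)"

lemma coords_lincomb:
  assumes "indep B" "Poly_Mapping.keys f \<subseteq> B"
  shows "coords B (lincomb A (\<lambda>x. x) f) = f"
  unfolding coords_def by (rule the_equality) (use assms lincomb_inj in auto)

lemma linear_extension:
  assumes B: "indep B" and M: "ratmod M" and v: "v ` B \<subseteq> carrier M"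
  obtains L where "\<And>b. b \<in> B \<Longrightarrow> L b = v b"
    "\<And>x. x \<in> lspan A B \<Longrightarrow> L x \<in> lspan M (v ` B)"
    "\<And>x y. x \<in> lspan A B \<Longrightarrow> y \<in> lspan A B \<Longrightarrow> L (x \<oplus> y) = L x \<oplus>\<^bsub>M\<^esub> L y"
    "\<And>a x. x \<in> lspan A B \<Longrightarrow> L (a \<odot> x) = a \<odot>\<^bsub>M\<^esub> L x"
proof
  interpret M: ratmod M by fact
  have Bc: "B \<subseteq> carrier A" using B by (simp add: indep_def)
  define L where "L x = lincomb M v (coords B x)" for x
  have L: "L (lincomb A (\<lambda>x. x) f) = lincomb M v f" if "Poly_Mapping.keys f \<subseteq> B" for f
    unfolding L_def using coords_lincomb[OF B that] by simp
  have span: "\<exists>f. Poly_Mapping.keys f \<subseteq> B \<and> x = lincomb A (\<lambda>x. x) f" if "x \<in> lspan A B" for x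
    using that lspan_eq_lincombs[OF Bc] by auto
  have vk: "v ` Poly_Mapping.keys f \<subseteq> carrier M" if "Poly_Mapping.keys f \<subseteq> B" for f
    using that v by auto
  have kc: "Poly_Mapping.keys f \<subseteq> carrier A" if "Poly_Mapping.keys f \<subseteq> B" for f
    using that Bc by auto
  show "L b = v b" if "b \<in> B" for b
    using L[of "sym b"] that Bc v by (auto simp: lincomb_sym M.lincomb_sym subset_iff)
  show "L x \<in> lspan M (v ` B)" if x: "x \<in> lspan A B" for x
  proof -
    obtain f where f: "Poly_Mapping.keys f \<subseteq> B" "x = lincomb A (\<lambda>x. x) f"
      using span[OF x] by blast
    have "lincomb M v f \<in> lspan M (v ` B)"
      by (rule M.lincomb_in_subspace[OF M.lspan_subspace[OF v]]) (use f M.lspan_incl in auto)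
    then show ?thesis using f L by simp
  qed
  show "L (x \<oplus> y) = L x \<oplus>\<^bsub>M\<^esub> L y" if xy: "x \<in> lspan A B" "y \<in> lspan A B" for x y
  proof -
    obtain f g where "Poly_Mapping.keys f \<subseteq> B" "x = lincomb A (\<lambda>x. x) f"
      "Poly_Mapping.keys g \<subseteq> B" "y = lincomb A (\<lambda>x. x) g"
      using span[OF xy(1)] span[OF xy(2)] by blast
    then show ?thesis
      using L[of f] L[of g] L[of "f + g"] vk[of f] vk[of g] kc[of f] kc[of g]
      by (simp add: lincomb_add M.lincomb_add keys_add_subset)
  qed
  show "L (a \<odot> x) = a \<odot>\<^bsub>M\<^esub> L x" if x: "x \<in> lspan A B" for a x
  proof -
    obtain f where "Poly_Mapping.keys f \<subseteq> B" "x = lincomb A (\<lambda>x. x) f"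
      using span[OF x] by blast
    then show ?thesis
      using L[of f] L[of "scl a f"] vk[of f] kc[of f]
      by (simp add: lincomb_scl M.lincomb_scl keys_scl_subset)
  qed
qed

text \<open>Well-order the elements of \<open>X\<close> by their level first. The elements that are not
  combinations of smaller ones form a basis, and a combination that represents an element of
  level \<open>j\<close> only uses basis elements of level at most \<open>j\<close>.\<close>
lemma adapted_basis:
  fixes lev :: "'a \<Rightarrow> nat"
  assumes X: "X \<subseteq> carrier A"
  obtains B where "B \<subseteq> X" "indep B" "\<And>x. x \<in> X \<Longrightarrow> x \<in> lspan A {b \<in> B. lev b \<le> lev x}"
proof -
  obtain r :: "'a rel" where r: "Well_order r" "Field r = UNIV"
    using well_ordering by metis
  define R where "R = inv_image (less_than <*lex*> (r - Id)) (\<lambda>x. (lev x, x))"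
  have wfR: "wf R" unfolding R_def
    using r by (intro wf_inv_image wf_lex_prod wf_less_than) (auto simp: well_order_on_def)
  have trR: "trans R" unfolding R_def
    using r by (intro trans_inv_image trans_lex_prod trans_less_than trans_diff_Id)
      (auto simp: well_order_on_def linear_order_on_def partial_order_on_def preorder_on_def)
  have totR: "(x, y) \<in> R \<or> (y, x) \<in> R" if "x \<noteq> y" for x y
    using that r unfolding R_def
    by (auto simp: well_order_on_def linear_order_on_def total_on_def)
  have levR: "lev x \<le> lev y" if "(x, y) \<in> R" for x y
    using that unfolding R_def by auto
  define B where "B = {b \<in> X. b \<notin> lspan A {x \<in> X. (x, b) \<in> R}}"
  have BX: "B \<subseteq> X" and Bc: "B \<subseteq> carrier A" using X by (auto simp: B_def)
  have span: "x \<in> lspan A {b \<in> B. b = x \<or> (b, x) \<in> R}" if "x \<in> X" for x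
    using wfR that
  proof (induction x rule: wf_induct_rule)
    case (less x)
    let ?S = "{b \<in> B. b = x \<or> (b, x) \<in> R}"
    show ?case
    proof (cases "x \<in> B")
      case True
      then show ?thesis by (intro lspan_incl) auto
    next
      case False
      then have "x \<in> lspan A {y \<in> X. (y, x) \<in> R}" using less.prems by (auto simp: B_def)
      moreover have "lspan A {y \<in> X. (y, x) \<in> R} \<subseteq> lspan A ?S"
      proof (rule lspan_least)
        show "submodule (lspan A ?S) rat_ring A" by (rule lspan_subspace) (use Bc in auto)
        show "{y \<in> X. (y, x) \<in> R} \<subseteq> lspan A ?S"
        proof
          fix y assume y: "y \<in> {y \<in> X. (y, x) \<in> R}"
          then have "y \<in> lspan A {b \<in> B. b = y \<or> (b, y) \<in> R}" using less by auto
          moreover have "{b \<in> B. b = y \<or> (b, y) \<in> R} \<subseteq> ?S" using y trR by (auto dest: transD)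
          ultimately show "y \<in> lspan A ?S" using lspan_mono by blast
        qed
      qed
      ultimately show ?thesis by auto
    qed
  qed
  have ind: "f = 0" if f: "Poly_Mapping.keys f \<subseteq> B" "lincomb A (\<lambda>x. x) f = \<zero>" for f
  proof (rule ccontr)
    assume "f \<noteq> 0"
    then have ne: "Poly_Mapping.keys f \<noteq> {}" by simp
    have wfC: "wf (converse (Restr R (Poly_Mapping.keys f)))"
    proof (rule finite_acyclic_wf_converse)
      show "finite (Restr R (Poly_Mapping.keys f))" by (rule finite_subset[of _ "Poly_Mapping.keys f \<times> Poly_Mapping.keys f"]) auto
      show "acyclic (Restr R (Poly_Mapping.keys f))"
        by (rule acyclic_subset[OF wf_acyclic[OF wfR]]) auto
    qed
    obtain b0 where b0: "b0 \<in> Poly_Mapping.keys f" using ne by blast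
    from wfC[unfolded wf_eq_minimal, rule_format, OF b0]
    obtain b where b: "b \<in> Poly_Mapping.keys f"
      "\<forall>y. (y, b) \<in> converse (Restr R (Poly_Mapping.keys f)) \<longrightarrow> y \<notin> Poly_Mapping.keys f"
      by (rule bexE)
    define q where "q = Poly_Mapping.lookup f b"
    have q: "q \<noteq> 0" using b(1) by (simp add: q_def in_keys_iff)
    define f' where "f' = f - Poly_Mapping.single b q"
    have kf': "Poly_Mapping.keys f' \<subseteq> Poly_Mapping.keys f - {b}"
      by (auto simp: f'_def q_def in_keys_iff lookup_minus lookup_single when_def split: if_splits)
    have "(y, b) \<in> R" if y: "y \<in> Poly_Mapping.keys f'" for y
    proof (rule ccontr)
      have yf: "y \<in> Poly_Mapping.keys f" "y \<noteq> b" using y kf' by blast+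
      assume "(y, b) \<notin> R"
      then have "(b, y) \<in> R" using totR[OF yf(2)] by blast
      then have "(y, b) \<in> converse (Restr R (Poly_Mapping.keys f))" using yf(1) b(1) by simp
      then show False using b(2) yf(1) by blast
    qed
    then have kR: "Poly_Mapping.keys f' \<subseteq> {x \<in> X. (x, b) \<in> R}" using kf' f(1) BX by auto
    have bc: "b \<in> carrier A" using b(1) f(1) Bc by blast
    have kc: "Poly_Mapping.keys f' \<subseteq> carrier A" using kf' f(1) Bc by blast
    have fe: "lincomb A (\<lambda>x. x) (f' + Poly_Mapping.single b q)
        = lincomb A (\<lambda>x. x) f' \<oplus> q \<odot> b"
      using kc bc q by (subst lincomb_add) (auto simp: lincomb_single)
    have "f = f' + Poly_Mapping.single b q" unfolding f'_def by simp
    then have "lincomb A (\<lambda>x. x) (f' + Poly_Mapping.single b q) = \<zero>" using f(2) by (rule subst)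
    then have "lincomb A (\<lambda>x. x) f' \<oplus> q \<odot> b = \<zero>" unfolding fe .
    then have e: "q \<odot> b = \<ominus> lincomb A (\<lambda>x. x) f'"
      using bc kc lincomb_closed[of "\<lambda>x. x" f'] sm_closed[of b q]
        M.minus_equality[of "q \<odot> b" "lincomb A (\<lambda>x. x) f'"] by (simp add: M.a_comm)
    have sub: "submodule (lspan A {x \<in> X. (x, b) \<in> R}) rat_ring A"
      by (rule lspan_subspace) (use X in auto)
    have "q \<odot> b \<in> lspan A {x \<in> X. (x, b) \<in> R}"
      unfolding e using kR lspan_incl
      by (intro subspaceD(5)[OF sub] lincomb_in_subspace[OF sub]) auto
    then have "(1 / q) \<odot> (q \<odot> b) \<in> lspan A {x \<in> X. (x, b) \<in> R}"
      by (rule subspaceD(4)[OF sub])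
    then have "b \<in> lspan A {x \<in> X. (x, b) \<in> R}" using q bc by (simp add: sm_assoc)
    then show False using b(1) f(1) by (auto simp: B_def)
  qed
  show ?thesis
  proof (rule that)
    show "B \<subseteq> X" by (rule BX)
    show "indep B" using ind Bc by (auto simp: indep_def)
    show "x \<in> lspan A {b \<in> B. lev b \<le> lev x}" if "x \<in> X" for x
    proof -
      have "{b \<in> B. b = x \<or> (b, x) \<in> R} \<subseteq> {b \<in> B. lev b \<le> lev x}" using levR by auto
      then show ?thesis using span[OF that] lspan_mono by blast
    qed
  qed
qed

text \<open>From a basis of \<open>X\<close> adapted to the flag \<open>D \<subseteq> X\<close>, drop the elements in \<open>D\<close>.\<close>
lemma complement_basis:
  assumes X: "submodule X rat_ring A" and D: "submodule D rat_ring A" "D \<subseteq> X"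
  obtains B where "B \<subseteq> X"
    "\<And>x. x \<in> X \<Longrightarrow> \<exists>f. Poly_Mapping.keys f \<subseteq> B \<and> x \<ominus> lincomb A (\<lambda>x. x) f \<in> D"
    "\<And>f. Poly_Mapping.keys f \<subseteq> B \<Longrightarrow> lincomb A (\<lambda>x. x) f \<in> D \<Longrightarrow> f = 0"
proof -
  define lev :: "'a \<Rightarrow> nat" where "lev x = (if x \<in> D then 0 else 1)" for x
  have Xc: "X \<subseteq> carrier A" using subspaceD(1)[OF X] .
  obtain B where B: "B \<subseteq> X" "indep B" "\<And>x. x \<in> X \<Longrightarrow> x \<in> lspan A {b \<in> B. lev b \<le> lev x}"
    using adapted_basis[OF Xc, of lev] by blast
  let ?B = "B - D"
  have Bc: "B \<subseteq> carrier A" using B(1) Xc by auto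
  have DB: "\<exists>g. Poly_Mapping.keys g \<subseteq> B \<inter> D \<and> x = lincomb A (\<lambda>x. x) g" if "x \<in> D" for x
  proof -
    have "x \<in> lspan A {b \<in> B. lev b \<le> lev x}" using B(3) that D(2) by auto
    moreover have "{b \<in> B. lev b \<le> lev x} = B \<inter> D" using that by (auto simp: lev_def)
    ultimately show ?thesis using lspan_eq_lincombs[of "B \<inter> D"] Bc by auto
  qed
  have 1: "\<exists>f. Poly_Mapping.keys f \<subseteq> ?B \<and> x \<ominus> lincomb A (\<lambda>x. x) f \<in> D" if x: "x \<in> X" for x
  proof -
    have "x \<in> lspan A B" using B(3)[OF x] lspan_mono[of "{b \<in> B. lev b \<le> lev x}" B] by auto
    from this Bc show ?thesis
    proof (induction rule: lspan_induct)
      case zero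
      show ?case using subspaceD(2)[OF D(1)]
        by (intro exI[of _ 0]) (simp add: a_minus_def)
    next
      case (add x y)
      then obtain f g where fg: "Poly_Mapping.keys f \<subseteq> ?B" "x \<ominus> lincomb A (\<lambda>x. x) f \<in> D"
        "Poly_Mapping.keys g \<subseteq> ?B" "y \<ominus> lincomb A (\<lambda>x. x) g \<in> D" by auto
      have c: "lincomb A (\<lambda>x. x) f \<in> carrier A" "lincomb A (\<lambda>x. x) g \<in> carrier A"
        using fg Bc by (auto intro!: lincomb_closed)
      have "(x \<ominus> lincomb A (\<lambda>x. x) f) \<oplus> (y \<ominus> lincomb A (\<lambda>x. x) g) \<in> D"
        using fg subspaceD(3)[OF D(1)] by auto
      also have "(x \<ominus> lincomb A (\<lambda>x. x) f) \<oplus> (y \<ominus> lincomb A (\<lambda>x. x) g)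
        = (x \<oplus> y) \<ominus> lincomb A (\<lambda>x. x) (f + g)"
        using fg Bc add.hyps c
        by (subst lincomb_add) (auto simp: a_minus_def M.minus_add M.a_ac)
      finally show ?case using fg keys_add_subset by blast
    next
      case (smult a x)
      then obtain f where f: "Poly_Mapping.keys f \<subseteq> ?B" "x \<ominus> lincomb A (\<lambda>x. x) f \<in> D" by auto
      have c: "lincomb A (\<lambda>x. x) f \<in> carrier A" using f Bc by (auto intro!: lincomb_closed)
      have "a \<odot> (x \<ominus> lincomb A (\<lambda>x. x) f) \<in> D" using f subspaceD(4)[OF D(1)] by auto
      also have "a \<odot> (x \<ominus> lincomb A (\<lambda>x. x) f) = a \<odot> x \<ominus> lincomb A (\<lambda>x. x) (scl a f)"
        using f Bc smult.hyps c
        by (subst lincomb_scl) (auto simp: a_minus_def sm_rdistr smult_r_minus)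
      finally show ?case using f keys_scl_subset by blast
    next
      case (gen s)
      show ?case
      proof (cases "s \<in> D")
        case True
        then show ?thesis using gen Bc by (intro exI[of _ 0]) (auto simp: a_minus_def)
      next
        case False
        have "s \<ominus> s = \<zero>" using gen Bc by (auto simp: a_minus_def M.r_neg)
        then show ?thesis using False gen Bc subspaceD(2)[OF D(1)]
          by (intro exI[of _ "sym s"]) (auto simp: lincomb_sym)
      qed
    qed
  qed
  have 2: "f = 0" if f: "Poly_Mapping.keys f \<subseteq> ?B" "lincomb A (\<lambda>x. x) f \<in> D" for f
  proof -
    obtain g where g: "Poly_Mapping.keys g \<subseteq> B \<inter> D" "lincomb A (\<lambda>x. x) f = lincomb A (\<lambda>x. x) g"
      using DB[OF f(2)] by auto
    have fg: "f = g" by (rule lincomb_inj[OF B(2)]) (use f g in auto)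
    have "Poly_Mapping.keys f \<subseteq> B \<inter> D" using g(1) fg by simp
    then have "Poly_Mapping.keys f \<subseteq> {}" using f(1) by blast
    then show "f = 0" by simp
  qed
  show ?thesis using that[of ?B] B(1) 1 2 by blast
qed

end

text \<open>A differential algebra whose homogeneous elements are not required to span it. This is all
  that is needed of the target of a morphism that is built degree by degree, and it spares
  such a target the proof that its grading is a direct sum.\<close>
locale dgca = ratmod A + ring A for A :: "('a, 'm) cdga_scheme" (structure) +
  assumes smult_mult_left:
      "\<And>a x y. \<lbrakk>x \<in> carrier A; y \<in> carrier A\<rbrakk> \<Longrightarrow> (a \<odot> x) \<otimes> y = a \<odot> (x \<otimes> y)"
    and smult_mult_right:
      "\<And>a x y. \<lbrakk>x \<in> carrier A; y \<in> carrier A\<rbrakk> \<Longrightarrow> x \<otimes> (a \<odot> y) = a \<odot> (x \<otimes> y)"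
    and gr_submodule: "\<And>p. submodule (gr A p) rat_ring A"
    and gr_one: "\<one> \<in> gr A 0"
    and gr_mult: "\<And>p q x y. \<lbrakk>x \<in> gr A p; y \<in> gr A q\<rbrakk> \<Longrightarrow> x \<otimes> y \<in> gr A (p + q)"
    and graded_comm:
      "\<And>p q x y. \<lbrakk>x \<in> gr A p; y \<in> gr A q\<rbrakk> \<Longrightarrow> x \<otimes> y = (-1) ^ (p * q) \<odot> (y \<otimes> x)"
    and diff_closed: "\<And>x. x \<in> carrier A \<Longrightarrow> diff A x \<in> carrier A"
    and diff_add:
      "\<And>x y. \<lbrakk>x \<in> carrier A; y \<in> carrier A\<rbrakk> \<Longrightarrow> diff A (x \<oplus> y) = diff A x \<oplus> diff A y"
    and diff_smult: "\<And>a x. x \<in> carrier A \<Longrightarrow> diff A (a \<odot> x) = a \<odot> diff A x"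
    and diff_gr: "\<And>p x. x \<in> gr A p \<Longrightarrow> diff A x \<in> gr A (Suc p)"
    and diff_diff: "\<And>x. x \<in> carrier A \<Longrightarrow> diff A (diff A x) = \<zero>"
    and leibniz:
      "\<And>p x y. \<lbrakk>x \<in> gr A p; y \<in> carrier A\<rbrakk> \<Longrightarrow>
        diff A (x \<otimes> y) = diff A x \<otimes> y \<oplus> (-1) ^ p \<odot> (x \<otimes> diff A y)"

subsection \<open>Homogeneous components\<close>

context cdga
begin

sublocale ratmod A
  by (rule ratmod.intro[OF cdga.axioms(2)[OF cdga_axioms]])

lemma gr_carrier [simp, intro]: "x \<in> gr A p \<Longrightarrow> x \<in> carrier A"
  using subspaceD(1)[OF gr_submodule] by blast

lemma homogeneous_induct [consumes 1, case_names zero add homogeneous]: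
  assumes "x \<in> carrier A" "P \<zero>"
    "\<And>x y. x \<in> carrier A \<Longrightarrow> y \<in> carrier A \<Longrightarrow> P x \<Longrightarrow> P y \<Longrightarrow> P (x \<oplus> y)"
    "\<And>p x. x \<in> gr A p \<Longrightarrow> P x"
  shows "P x"
proof -
  obtain f where f: "\<forall>p. f p \<in> gr A p" "finite {p. f p \<noteq> \<zero>}" "x = (\<Oplus>p\<in>{p. f p \<noteq> \<zero>}. f p)"
    using gr_direct_sum[OF assms(1)] by (auto dest: ex1_implies_ex)
  have "P (\<Oplus>p\<in>S. f p)" if "finite S" for S
    using that
  proof (induction S)
    case empty
    then show ?case using assms(2) by (simp add: fs_empty)
  next
    case (insert p S)
    have fc: "f \<in> UNIV \<rightarrow> carrier A" using f(1) by auto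
    then have "(\<Oplus>p\<in>insert p S. f p) = f p \<oplus> (\<Oplus>p\<in>S. f p)"
      using insert.hyps by (intro fs_insert) auto
    moreover have "(\<Oplus>p\<in>S. f p) \<in> carrier A" using fc by (intro fs_closed) auto
    ultimately show ?case using assms(3)[of "f p" "\<Oplus>p\<in>S. f p"] assms(4) f(1) fc insert by auto
  qed
  then show ?thesis using f by auto
qed

lemma cdga_diff_closed: "x \<in> carrier A \<Longrightarrow> diff A x \<in> carrier A"
proof (induction x rule: homogeneous_induct)
  case zero
  show ?case using diff_gr[of \<zero> 0] subspaceD(2)[OF gr_submodule] by auto
next
  case (add x y)
  then show ?case by (simp add: diff_add)
next
  case (homogeneous p x)
  then show ?case using diff_gr by auto
qed

end

lemma cdga_dgca: "cdga A \<Longrightarrow> dgca A"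
  by (intro dgca.intro ratmod.intro dgca_axioms.intro)
    (auto simp: cdga.axioms cdga.smult_mult_left cdga.smult_mult_right cdga.gr_submodule
      cdga.gr_one cdga.gr_mult cdga.cdga_diff_closed cdga.diff_add cdga.diff_smult cdga.diff_gr
      cdga.diff_diff cdga.leibniz intro: cdga.graded_comm)

sublocale cdga \<subseteq> dgca
  by (rule cdga_dgca[OF cdga_axioms])

context dgca
begin

lemma gr_in [simp, intro]: "x \<in> gr A p \<Longrightarrow> x \<in> carrier A"
  using subspaceD(1)[OF gr_submodule] by blast

lemmas gr_closed = subspaceD(2-6)[OF gr_submodule]

lemma gr_zero [simp]: "\<zero> \<in> gr A p" by (rule gr_closed(1))

lemma mult_in [simp, intro]: "x \<in> carrier A \<Longrightarrow> y \<in> carrier A \<Longrightarrow> x \<otimes> y \<in> carrier A"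
  by (rule m_closed)

lemma minus_in [simp, intro]: "x \<in> carrier A \<Longrightarrow> y \<in> carrier A \<Longrightarrow> x \<ominus> y \<in> carrier A"
  by (simp add: a_minus_def)

lemmas diff_in [simp, intro] = diff_closed

lemma diff_zero [simp]: "diff A \<zero> = \<zero>"
  using diff_smult[of \<zero> 0] by simp

lemma diff_uminus: "x \<in> carrier A \<Longrightarrow> diff A (\<ominus> x) = \<ominus> diff A x"
  by (simp add: sm_uminus diff_smult)

lemma diff_minus: "x \<in> carrier A \<Longrightarrow> y \<in> carrier A \<Longrightarrow> diff A (x \<ominus> y) = diff A x \<ominus> diff A y"
  by (simp add: a_minus_def diff_add diff_uminus)

lemma diff_one [simp]: "diff A \<one> = \<zero>"
proof -
  have d: "diff A \<one> \<in> carrier A" by (intro diff_in one_closed)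
  have "diff A (\<one> \<otimes> \<one>) = diff A \<one> \<otimes> \<one> \<oplus> (-1) ^ 0 \<odot> (\<one> \<otimes> diff A \<one>)"
    by (rule leibniz[OF gr_one]) simp
  then have "diff A \<one> \<oplus> diff A \<one> = diff A \<one> \<oplus> \<zero>" using d by simp
  then show ?thesis using d by (metis add_l_cancel zero_in)
qed

lemma self_eq_neg_zero:
  assumes "x \<in> carrier A" "x = (-1) \<odot> x"
  shows "x = \<zero>"
proof -
  have "x \<oplus> x = x \<oplus> (-1) \<odot> x" using assms(2) by simp
  also have "\<dots> = \<zero>" using assms(1) by (simp add: sm_uminus[symmetric] r_neg_self)
  finally have "(1 + 1) \<odot> x = \<zero>" using assms(1) by (simp only: sm_ldistr sm_one)
  then show ?thesis using assms(1) by (intro sm_cancel[of x "1 + 1"]) auto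
qed

lemma odd_square_zero:
  assumes "x \<in> gr A p" "odd p"
  shows "x \<otimes> x = \<zero>"
  using graded_comm[OF assms(1) assms(1)] assms
  by (intro self_eq_neg_zero) (auto simp: minus_one_power_iff)

lemma mult_l_distr:
  "x \<in> carrier A \<Longrightarrow> y \<in> carrier A \<Longrightarrow> z \<in> carrier A \<Longrightarrow> (x \<oplus> y) \<otimes> z = x \<otimes> z \<oplus> y \<otimes> z"
  by (rule l_distr)

lemma mult_r_distr:
  "x \<in> carrier A \<Longrightarrow> y \<in> carrier A \<Longrightarrow> z \<in> carrier A \<Longrightarrow> z \<otimes> (x \<oplus> y) = z \<otimes> x \<oplus> z \<otimes> y"
  by (rule r_distr)

end

definition component :: "('a, 'm) cdga_scheme \<Rightarrow> nat \<Rightarrow> 'a \<Rightarrow> 'a" where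
  "component A p x = (THE f. (\<forall>p. f p \<in> gr A p) \<and> finite {p. f p \<noteq> \<zero>\<^bsub>A\<^esub>} \<and>
     x = (\<Oplus>\<^bsub>A\<^esub>p\<in>{p. f p \<noteq> \<zero>\<^bsub>A\<^esub>}. f p)) p"

context cdga
begin

lemma component_decomp:
  assumes "x \<in> carrier A"
  shows "component A p x \<in> gr A p" "finite {p. component A p x \<noteq> \<zero>}"
    "x = (\<Oplus>p\<in>{p. component A p x \<noteq> \<zero>}. component A p x)"
  using theI'[OF gr_direct_sum[OF assms]] unfolding component_def by auto

lemma component_unique:
  assumes "\<And>p. f p \<in> gr A p" "finite S" "\<And>p. p \<notin> S \<Longrightarrow> f p = \<zero>" "x = (\<Oplus>p\<in>S. f p)"
  shows "component A p x = f p"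
proof -
  have S: "{p. f p \<noteq> \<zero>} \<subseteq> S" using assms(3) by auto
  have "x = (\<Oplus>p\<in>{p. f p \<noteq> \<zero>}. f p)"
    unfolding assms(4) by (rule finsum_neutral_superset[symmetric]) (use assms S in auto)
  moreover have "finite {p. f p \<noteq> \<zero>}" using S assms(2) finite_subset by blast
  moreover have "x \<in> carrier A"
    unfolding assms(4) using assms(1) by (intro fs_closed) auto
  ultimately show ?thesis
    unfolding component_def using assms(1) gr_direct_sum[of x]
    by (subst the1_equality[where a = f]) auto
qed

lemma component_gr:
  assumes "x \<in> gr A p"
  shows "component A q x = (if q = p then x else \<zero>)"
  by (rule component_unique[where S = "{p}"]) (use assms in \<open>auto simp: fs_insert\<close>)

lemma component_in [simp, intro]: "x \<in> carrier A \<Longrightarrow> component A p x \<in> carrier A"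
  using component_decomp(1) by blast

lemma component_sum:
  assumes "x \<in> carrier A" "finite S" "\<And>p. p \<notin> S \<Longrightarrow> component A p x = \<zero>"
  shows "x = (\<Oplus>p\<in>S. component A p x)"
proof -
  have "(\<Oplus>p\<in>{p. component A p x \<noteq> \<zero>}. component A p x) = (\<Oplus>p\<in>S. component A p x)"
    by (rule finsum_neutral_superset) (use assms in auto)
  then show ?thesis using component_decomp(3)[OF assms(1)] by simp
qed

lemma component_add:
  assumes "x \<in> carrier A" "y \<in> carrier A"
  shows "component A p (x \<oplus> y) = component A p x \<oplus> component A p y"
proof (rule component_unique)
  let ?S = "{p. component A p x \<noteq> \<zero>} \<union> {p. component A p y \<noteq> \<zero>}"
  show "finite ?S" using component_decomp(2) assms by auto
  then have "x = (\<Oplus>p\<in>?S. component A p x)" "y = (\<Oplus>p\<in>?S. component A p y)"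
    by (auto intro!: component_sum assms)
  then show "x \<oplus> y = (\<Oplus>p\<in>?S. component A p x \<oplus> component A p y)"
    using assms by (subst fs_addf) auto
qed (use component_decomp(1) assms gr_closed in auto)

lemma component_smult:
  assumes "x \<in> carrier A"
  shows "component A p (a \<odot> x) = a \<odot> component A p x"
proof (rule component_unique)
  let ?S = "{p. component A p x \<noteq> \<zero>}"
  show "finite ?S" using component_decomp(2) assms by auto
  then show "a \<odot> x = (\<Oplus>p\<in>?S. a \<odot> component A p x)"
    using component_decomp(3)[OF assms] assms finsum_smult_ldistr[of ?S a "\<lambda>p. component A p x"]
    by auto
qed (use component_decomp(1) assms gr_closed in auto)

lemma component_eqI:
  assumes "x \<in> carrier A" "y \<in> carrier A" "\<And>p. component A p x = component A p y"
  shows "x = y"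
  using component_decomp(3)[OF assms(1)] component_decomp(3)[OF assms(2)] assms(3) by simp

lemma component_lspan:
  assumes "S \<subseteq> (\<Union>p. gr A p)" "x \<in> lspan A S"
  shows "component A p x \<in> lspan A (S \<inter> gr A p)"
proof -
  have S: "S \<subseteq> carrier A" using assms(1) by auto
  have sub: "submodule (lspan A (S \<inter> gr A p)) rat_ring A"
    by (rule lspan_subspace) (use S in auto)
  from assms(2) S show ?thesis
  proof (induction rule: lspan_induct)
    case zero
    show ?case using subspaceD(2)[OF sub] component_gr[of \<zero> 0 p] by simp
  next
    case (add x y)
    then show ?case using subspaceD(3)[OF sub] by (simp add: component_add)
  next
    case (smult a x)
    then show ?case using subspaceD(4)[OF sub] by (simp add: component_smult)
  next
    case (gen s)
    then obtain q where "s \<in> gr A q" using assms(1) by auto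
    then show ?case using gen subspaceD(2)[OF sub] by (auto simp: component_gr intro: lspan_incl)
  qed
qed

lemma homogeneous_lspan:
  assumes "S \<subseteq> (\<Union>p. gr A p)" "x \<in> lspan A S" "x \<in> gr A p"
  shows "x \<in> lspan A (S \<inter> gr A p)"
  using component_lspan[OF assms(1,2), of p] assms(3) by (simp add: component_gr)

end

subsection \<open>The degree involution\<close>

definition involution :: "('a, 'm) cdga_scheme \<Rightarrow> 'a \<Rightarrow> 'a" where
  "involution A x = (\<Oplus>\<^bsub>A\<^esub>p\<in>{p. component A p x \<noteq> \<zero>\<^bsub>A\<^esub>}. (-1) ^ p \<odot>\<^bsub>A\<^esub> component A p x)"

context cdga
begin

lemma involution_in [simp, intro]: "x \<in> carrier A \<Longrightarrow> involution A x \<in> carrier A"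
  unfolding involution_def by (rule fs_closed) auto

lemma component_involution:
  assumes "x \<in> carrier A"
  shows "component A p (involution A x) = (-1) ^ p \<odot> component A p x"
  by (rule component_unique[where S = "{p. component A p x \<noteq> \<zero>}"])
    (use component_decomp assms gr_closed in \<open>auto simp: involution_def\<close>)

lemma involution_add:
  "x \<in> carrier A \<Longrightarrow> y \<in> carrier A \<Longrightarrow> involution A (x \<oplus> y) = involution A x \<oplus> involution A y"
  by (rule component_eqI) (auto simp: component_involution component_add sm_rdistr)

lemma involution_smult: "x \<in> carrier A \<Longrightarrow> involution A (a \<odot> x) = a \<odot> involution A x"
  by (rule component_eqI) (auto simp: component_involution component_smult sm_assoc mult.commute)

lemma involution_gr: "x \<in> gr A p \<Longrightarrow> involution A x = (-1) ^ p \<odot> x"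
  by (rule component_eqI) (auto simp: component_involution component_smult component_gr)

lemma involution_zero [simp]: "involution A \<zero> = \<zero>"
  using involution_gr[of \<zero> 0] by simp

lemma involution_one [simp]: "involution A \<one> = \<one>"
  using involution_gr[OF gr_one] by simp

lemma involution_mult:
  assumes "x \<in> carrier A" "y \<in> carrier A"
  shows "involution A (x \<otimes> y) = involution A x \<otimes> involution A y"
  using assms(1)
proof (induction x rule: homogeneous_induct)
  case (homogeneous p x)
  from assms(2) show ?case
  proof (induction y rule: homogeneous_induct)
    case (homogeneous q y)
    have "involution A (x \<otimes> y) = (-1) ^ (p + q) \<odot> (x \<otimes> y)"
      using gr_mult[OF \<open>x \<in> gr A p\<close> homogeneous] by (rule involution_gr)
    then show ?case
      using homogeneous \<open>x \<in> gr A p\<close>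
      by (simp add: involution_gr smult_mult_left smult_mult_right sm_assoc power_add mult.commute)
  qed (use homogeneous in \<open>auto simp: mult_r_distr involution_add\<close>)
qed (use assms(2) in \<open>auto simp: mult_l_distr involution_add\<close>)

end

section \<open>The universal property of a free extension\<close>

text \<open>Morphisms of graded algebras, without any condition on the differentials: a map out of a
  free extension is first built as such and only later shown to commute with the differentials.\<close>
definition galg_hom :: "('a, 'm) cdga_scheme \<Rightarrow> ('b, 'n) cdga_scheme \<Rightarrow> ('a \<Rightarrow> 'b) \<Rightarrow> bool" where
  "galg_hom A B f \<longleftrightarrow>
     (\<forall>x\<in>carrier A. f x \<in> carrier B) \<and> f \<one>\<^bsub>A\<^esub> = \<one>\<^bsub>B\<^esub> \<and>
     (\<forall>x\<in>carrier A. \<forall>y\<in>carrier A. f (x \<oplus>\<^bsub>A\<^esub> y) = f x \<oplus>\<^bsub>B\<^esub> f y) \<and>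
     (\<forall>x\<in>carrier A. \<forall>y\<in>carrier A. f (x \<otimes>\<^bsub>A\<^esub> y) = f x \<otimes>\<^bsub>B\<^esub> f y) \<and>
     (\<forall>a. \<forall>x\<in>carrier A. f (a \<odot>\<^bsub>A\<^esub> x) = a \<odot>\<^bsub>B\<^esub> f x) \<and>
     (\<forall>p. \<forall>x\<in>gr A p. f x \<in> gr B p)"

lemma galg_homD:
  assumes "galg_hom A B f"
  shows "\<And>x. x \<in> carrier A \<Longrightarrow> f x \<in> carrier B" "f \<one>\<^bsub>A\<^esub> = \<one>\<^bsub>B\<^esub>"
    "\<And>x y. x \<in> carrier A \<Longrightarrow> y \<in> carrier A \<Longrightarrow> f (x \<oplus>\<^bsub>A\<^esub> y) = f x \<oplus>\<^bsub>B\<^esub> f y"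
    "\<And>x y. x \<in> carrier A \<Longrightarrow> y \<in> carrier A \<Longrightarrow> f (x \<otimes>\<^bsub>A\<^esub> y) = f x \<otimes>\<^bsub>B\<^esub> f y"
    "\<And>a x. x \<in> carrier A \<Longrightarrow> f (a \<odot>\<^bsub>A\<^esub> x) = a \<odot>\<^bsub>B\<^esub> f x"
    "\<And>p x. x \<in> gr A p \<Longrightarrow> f x \<in> gr B p"
  using assms unfolding galg_hom_def by blast+

lemma cdga_hom_iff: "f \<in> cdga_hom A B \<longleftrightarrow>
  galg_hom A B f \<and> (\<forall>x\<in>carrier A. f (diff A x) = diff B (f x))"
  unfolding cdga_hom_def galg_hom_def ring_hom_def by (auto simp: image_subset_iff)

lemma galg_hom_zero:
  assumes "galg_hom A B f" "ratmod A" "ratmod B"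
  shows "f \<zero>\<^bsub>A\<^esub> = \<zero>\<^bsub>B\<^esub>"
proof -
  interpret A: ratmod A by fact
  interpret B: ratmod B by fact
  have "f (0 \<odot>\<^bsub>A\<^esub> \<zero>\<^bsub>A\<^esub>) = 0 \<odot>\<^bsub>B\<^esub> f \<zero>\<^bsub>A\<^esub>" using galg_homD(5)[OF assms(1)] by blast
  then show ?thesis using galg_homD(1)[OF assms(1)] by simp
qed

lemma galg_hom_uminus:
  assumes "galg_hom A B f" "ratmod A" "ratmod B" "x \<in> carrier A"
  shows "f (\<ominus>\<^bsub>A\<^esub> x) = \<ominus>\<^bsub>B\<^esub> f x"
  using ratmod.sm_uminus[OF assms(2)] ratmod.sm_uminus[OF assms(3)] galg_homD[OF assms(1)] assms(4)
  by auto

lemma galg_hom_minus: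
  assumes "galg_hom A B f" "ratmod A" "ratmod B" "x \<in> carrier A" "y \<in> carrier A"
  shows "f (x \<ominus>\<^bsub>A\<^esub> y) = f x \<ominus>\<^bsub>B\<^esub> f y"
proof -
  have "\<ominus>\<^bsub>A\<^esub> y \<in> carrier A" using ratmod.sm_uminus[OF assms(2,5)] ratmod.sm_closed[OF assms(2,5)] by simp
  then show ?thesis
    using galg_homD(3)[OF assms(1,4)] galg_hom_uminus[OF assms(1-3,5)] by (simp add: a_minus_def)
qed

abbreviation word_prod :: "('a, 'm) cdga_scheme \<Rightarrow> 'a list \<Rightarrow> 'a" where
  "word_prod A xs \<equiv> foldr (\<otimes>\<^bsub>A\<^esub>) xs \<one>\<^bsub>A\<^esub>"

context dgca
begin

lemma word_prod_in [simp, intro]: "set xs \<subseteq> carrier A \<Longrightarrow> word_prod A xs \<in> carrier A"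
  by (induction xs) auto

lemma one_in [simp, intro]: "\<one> \<in> carrier A" by (rule one_closed)

lemma word_prod_append:
  "set xs \<subseteq> carrier A \<Longrightarrow> set ys \<subseteq> carrier A \<Longrightarrow>
    word_prod A (xs @ ys) = word_prod A xs \<otimes> word_prod A ys"
  by (induction xs) (auto simp: m_assoc)

lemma mult_swap:
  assumes "x \<in> gr A p" "y \<in> gr A q" "z \<in> carrier A"
  shows "x \<otimes> (y \<otimes> z) = (-1) ^ (p * q) \<odot> (y \<otimes> (x \<otimes> z))"
proof -
  have "x \<otimes> (y \<otimes> z) = (x \<otimes> y) \<otimes> z" using assms by (simp add: m_assoc)
  also have "\<dots> = (-1) ^ (p * q) \<odot> ((y \<otimes> x) \<otimes> z)"
    using graded_comm[OF assms(1,2)] assms by (simp add: smult_mult_left)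
  finally show ?thesis using assms by (simp add: m_assoc)
qed

end

locale free_ext = T: cdga T + C: cdga C
  for T :: "('b, 'm) cdga_scheme" and C :: "('c, 'n) cdga_scheme" +
  fixes i :: "'b \<Rightarrow> 'c" and X :: "'c set" and r :: "'c rel"
  assumes i_hom: "galg_hom T C i"
    and X_gr: "X \<subseteq> (\<Union>p. gr C p)"
    and r_lin: "linear_order_on X r"
    and free: "\<And>c. c \<in> carrier C \<Longrightarrow> \<exists>!f. f ` monomials C X r \<subseteq> carrier T \<and>
          (\<forall>xs. xs \<notin> monomials C X r \<longrightarrow> f xs = \<zero>\<^bsub>T\<^esub>) \<and> finite {xs. f xs \<noteq> \<zero>\<^bsub>T\<^esub>} \<and>
          c = (\<Oplus>\<^bsub>C\<^esub>xs\<in>{xs. f xs \<noteq> \<zero>\<^bsub>T\<^esub>}. i (f xs) \<otimes>\<^bsub>C\<^esub> foldr (\<otimes>\<^bsub>C\<^esub>) xs \<one>\<^bsub>C\<^esub>)"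
begin

abbreviation "Mon \<equiv> monomials C X r"

lemmas i_simps = galg_homD[OF i_hom] galg_hom_zero[OF i_hom T.ratmod_axioms C.ratmod_axioms]

lemma X_in: "X \<subseteq> carrier C" using X_gr by auto

lemma Mon_set: "ms \<in> Mon \<Longrightarrow> set ms \<subseteq> X"
  by (auto simp: monomials_def)

lemma Mon_in: "ms \<in> Mon \<Longrightarrow> set ms \<subseteq> carrier C"
  using Mon_set X_in by blast

lemma Mon_prod_in [simp, intro]: "ms \<in> Mon \<Longrightarrow> word_prod C ms \<in> carrier C"
  using Mon_in by auto

lemma Nil_Mon: "[] \<in> Mon" by (simp add: monomials_def)

definition coef :: "'c \<Rightarrow> 'c list \<Rightarrow> 'b" where
  "coef c = (THE f. f ` Mon \<subseteq> carrier T \<and>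
          (\<forall>xs. xs \<notin> Mon \<longrightarrow> f xs = \<zero>\<^bsub>T\<^esub>) \<and> finite {xs. f xs \<noteq> \<zero>\<^bsub>T\<^esub>} \<and>
          c = (\<Oplus>\<^bsub>C\<^esub>xs\<in>{xs. f xs \<noteq> \<zero>\<^bsub>T\<^esub>}. i (f xs) \<otimes>\<^bsub>C\<^esub> foldr (\<otimes>\<^bsub>C\<^esub>) xs \<one>\<^bsub>C\<^esub>))"

lemma coef_props:
  assumes "c \<in> carrier C"
  shows "coef c xs \<in> carrier T" "xs \<notin> Mon \<Longrightarrow> coef c xs = \<zero>\<^bsub>T\<^esub>" "finite {xs. coef c xs \<noteq> \<zero>\<^bsub>T\<^esub>}"
    "c = (\<Oplus>\<^bsub>C\<^esub>xs\<in>{xs. coef c xs \<noteq> \<zero>\<^bsub>T\<^esub>}. i (coef c xs) \<otimes>\<^bsub>C\<^esub> word_prod C xs)"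
proof -
  note * = theI'[OF free[OF assms], folded coef_def]
  show "coef c xs \<in> carrier T" using * by (cases "xs \<in> Mon") auto
  show "xs \<notin> Mon \<Longrightarrow> coef c xs = \<zero>\<^bsub>T\<^esub>" "finite {xs. coef c xs \<noteq> \<zero>\<^bsub>T\<^esub>}"
    "c = (\<Oplus>\<^bsub>C\<^esub>xs\<in>{xs. coef c xs \<noteq> \<zero>\<^bsub>T\<^esub>}. i (coef c xs) \<otimes>\<^bsub>C\<^esub> word_prod C xs)"
    using * by auto
qed

lemma coef_Mon: "c \<in> carrier C \<Longrightarrow> coef c xs \<noteq> \<zero>\<^bsub>T\<^esub> \<Longrightarrow> xs \<in> Mon"
  using coef_props(2) by blast

lemma coef_unique:
  assumes "\<And>xs. f xs \<in> carrier T" "finite S" "S \<subseteq> Mon" "\<And>xs. xs \<notin> S \<Longrightarrow> f xs = \<zero>\<^bsub>T\<^esub>"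
    "c = (\<Oplus>\<^bsub>C\<^esub>xs\<in>S. i (f xs) \<otimes>\<^bsub>C\<^esub> word_prod C xs)"
  shows "coef c = f"
proof -
  have S: "{xs. f xs \<noteq> \<zero>\<^bsub>T\<^esub>} \<subseteq> S" using assms(4) by auto
  have c: "c \<in> carrier C"
    unfolding assms(5) using assms(1,3) i_simps(1) by (intro C.fs_closed) auto
  have "c = (\<Oplus>\<^bsub>C\<^esub>xs\<in>{xs. f xs \<noteq> \<zero>\<^bsub>T\<^esub>}. i (f xs) \<otimes>\<^bsub>C\<^esub> word_prod C xs)"
    unfolding assms(5)
    by (rule C.finsum_neutral_superset[symmetric]) (use assms S i_simps in auto)
  moreover have "finite {xs. f xs \<noteq> \<zero>\<^bsub>T\<^esub>}" using S assms(2) finite_subset by blast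
  ultimately show ?thesis unfolding coef_def
    using assms(1,3,4) by (intro the1_equality free c) auto
qed

lemma expansion_superset:
  assumes "c \<in> carrier C" "finite S" "{xs. coef c xs \<noteq> \<zero>\<^bsub>T\<^esub>} \<subseteq> S" "S \<subseteq> Mon"
  shows "c = (\<Oplus>\<^bsub>C\<^esub>xs\<in>S. i (coef c xs) \<otimes>\<^bsub>C\<^esub> word_prod C xs)"
proof -
  have "(\<Oplus>\<^bsub>C\<^esub>xs\<in>{xs. coef c xs \<noteq> \<zero>\<^bsub>T\<^esub>}. i (coef c xs) \<otimes>\<^bsub>C\<^esub> word_prod C xs)
    = (\<Oplus>\<^bsub>C\<^esub>xs\<in>S. i (coef c xs) \<otimes>\<^bsub>C\<^esub> word_prod C xs)"
    by (rule C.finsum_neutral_superset) (use assms coef_props i_simps in auto)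
  then show ?thesis using coef_props(4)[OF assms(1)] by simp
qed

lemma coef_add:
  assumes "c \<in> carrier C" "c' \<in> carrier C"
  shows "coef (c \<oplus>\<^bsub>C\<^esub> c') = (\<lambda>xs. coef c xs \<oplus>\<^bsub>T\<^esub> coef c' xs)"
proof -
  let ?S = "{xs. coef c xs \<noteq> \<zero>\<^bsub>T\<^esub>} \<union> {xs. coef c' xs \<noteq> \<zero>\<^bsub>T\<^esub>}"
  have S: "finite ?S" "?S \<subseteq> Mon" using coef_props(3) coef_Mon assms by auto
  have in_C: "i (coef d xs) \<otimes>\<^bsub>C\<^esub> word_prod C xs \<in> carrier C" if "d \<in> carrier C" "xs \<in> Mon" for d xs
    using that coef_props(1) i_simps(1) by auto
  have "c \<oplus>\<^bsub>C\<^esub> c' = (\<Oplus>\<^bsub>C\<^esub>xs\<in>?S. i (coef c xs) \<otimes>\<^bsub>C\<^esub> word_prod C xs) \<oplus>\<^bsub>C\<^esub>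
      (\<Oplus>\<^bsub>C\<^esub>xs\<in>?S. i (coef c' xs) \<otimes>\<^bsub>C\<^esub> word_prod C xs)"
    using expansion_superset[OF assms(1) S(1) _ S(2)] expansion_superset[OF assms(2) S(1) _ S(2)]
    by auto
  also have "\<dots> = (\<Oplus>\<^bsub>C\<^esub>xs\<in>?S. i (coef c xs) \<otimes>\<^bsub>C\<^esub> word_prod C xs \<oplus>\<^bsub>C\<^esub> i (coef c' xs) \<otimes>\<^bsub>C\<^esub> word_prod C xs)"
    using S(2) assms in_C by (intro C.fs_addf[symmetric]) auto
  also have "\<dots> = (\<Oplus>\<^bsub>C\<^esub>xs\<in>?S. i (coef c xs \<oplus>\<^bsub>T\<^esub> coef c' xs) \<otimes>\<^bsub>C\<^esub> word_prod C xs)"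
    using S(2) assms coef_props(1) i_simps(1)
    by (intro C.fs_cong) (auto simp: i_simps(3) C.mult_l_distr)
  finally show ?thesis
    using S assms coef_props(1) by (intro coef_unique[of _ ?S]) auto
qed

lemma coef_single:
  assumes "t \<in> carrier T" "ms \<in> Mon"
  shows "coef (i t \<otimes>\<^bsub>C\<^esub> word_prod C ms) = (\<lambda>xs. if xs = ms then t else \<zero>\<^bsub>T\<^esub>)"
  by (rule coef_unique[of _ "{ms}"]) (use assms i_simps(1) in \<open>auto simp: C.fs_insert C.fs_empty\<close>)

lemma i_inj:
  assumes "t \<in> carrier T" "i t = \<zero>\<^bsub>C\<^esub>"
  shows "t = \<zero>\<^bsub>T\<^esub>"
  using coef_single[OF assms(1) Nil_Mon] coef_single[OF T.zero_in Nil_Mon] assms i_simps(7)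
  by (auto dest: fun_cong[of _ _ "[]"])

lemma free_induct [consumes 1, case_names zero add mono]:
  assumes "c \<in> carrier C" "P \<zero>\<^bsub>C\<^esub>"
    "\<And>x y. x \<in> carrier C \<Longrightarrow> y \<in> carrier C \<Longrightarrow> P x \<Longrightarrow> P y \<Longrightarrow> P (x \<oplus>\<^bsub>C\<^esub> y)"
    "\<And>p t ms. t \<in> gr T p \<Longrightarrow> ms \<in> Mon \<Longrightarrow> P (i t \<otimes>\<^bsub>C\<^esub> word_prod C ms)"
  shows "P c"
proof -
  have 1: "P (i t \<otimes>\<^bsub>C\<^esub> word_prod C ms)" if "t \<in> carrier T" "ms \<in> Mon" for t ms
    using that(1)
  proof (induction t rule: T.homogeneous_induct)
    case zero
    then show ?case using that assms(2) by (simp add: i_simps(7))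
  next
    case (add x y)
    then show ?case using that(2) i_simps(1)
      by (auto simp: i_simps(3) C.mult_l_distr intro!: assms(3))
  next
    case (homogeneous p t)
    then show ?case using assms(4) that(2) by blast
  qed
  have "P (\<Oplus>\<^bsub>C\<^esub>xs\<in>S. i (coef c xs) \<otimes>\<^bsub>C\<^esub> word_prod C xs)" if "finite S" "S \<subseteq> Mon" for S
    using that
  proof (induction S)
    case empty
    then show ?case using assms(2) by (simp add: C.fs_empty)
  next
    case (insert x S)
    have cl: "i (coef c xs) \<otimes>\<^bsub>C\<^esub> word_prod C xs \<in> carrier C" if "xs \<in> insert x S" for xs
      using that insert.prems coef_props(1)[OF assms(1)] i_simps(1) by auto
    then have "(\<Oplus>\<^bsub>C\<^esub>xs\<in>S. i (coef c xs) \<otimes>\<^bsub>C\<^esub> word_prod C xs) \<in> carrier C"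
      by (intro C.fs_closed) auto
    then show ?case using insert cl coef_props(1)[OF assms(1)]
      by (subst C.fs_insert) (auto intro!: assms(3) 1)
  qed
  from this[of "{xs. coef c xs \<noteq> \<zero>\<^bsub>T\<^esub>}"] show ?thesis
    unfolding coef_props(4)[OF assms(1), symmetric]
    using coef_props(3)[OF assms(1)] coef_Mon[OF assms(1)] by blast
qed

end

text \<open>A homomorphism \<open>j\<close> on \<open>T\<close> and values \<open>g\<close> on the generators prescribe the values on the standard
  monomials, and \<open>ext\<close> extends them \<open>T\<close>-linearly. That \<open>ext\<close> is multiplicative comes down to the
  product of a generator and a standard monomial, which is treated in \<open>insert_letter\<close>.\<close>
locale free_ext_map = free_ext T C i X r + P: dgca P
  for T :: "('b, 'm) cdga_scheme" and C :: "('c, 'n) cdga_scheme" and i X r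
    and P :: "('p, 'k) cdga_scheme" +
  fixes j :: "'b \<Rightarrow> 'p" and g :: "'c \<Rightarrow> 'p"
  assumes j_hom: "galg_hom T P j"
    and g_gr: "\<And>x p. x \<in> X \<Longrightarrow> x \<in> gr C p \<Longrightarrow> g x \<in> gr P p"
begin

lemmas j_simps = galg_homD[OF j_hom] galg_hom_zero[OF j_hom T.ratmod_axioms P.ratmod_axioms]

lemma g_in: "x \<in> X \<Longrightarrow> g x \<in> carrier P"
  using X_gr g_gr by blast

lemma g_word_in: "set xs \<subseteq> X \<Longrightarrow> set (map g xs) \<subseteq> carrier P"
  using g_in by auto

lemma Mon_g_in [simp, intro]: "ms \<in> Mon \<Longrightarrow> word_prod P (map g ms) \<in> carrier P"
  using g_word_in Mon_set by blast

definition ext :: "'c \<Rightarrow> 'p" where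
  "ext c = (\<Oplus>\<^bsub>P\<^esub>xs\<in>{xs. coef c xs \<noteq> \<zero>\<^bsub>T\<^esub>}. j (coef c xs) \<otimes>\<^bsub>P\<^esub> word_prod P (map g xs))"

lemma ext_superset:
  assumes "c \<in> carrier C" "finite S" "{xs. coef c xs \<noteq> \<zero>\<^bsub>T\<^esub>} \<subseteq> S" "S \<subseteq> Mon"
  shows "ext c = (\<Oplus>\<^bsub>P\<^esub>xs\<in>S. j (coef c xs) \<otimes>\<^bsub>P\<^esub> word_prod P (map g xs))"
  unfolding ext_def
  by (rule P.finsum_neutral_superset) (use assms coef_props j_simps in auto)

lemma ext_in [simp, intro]: "c \<in> carrier C \<Longrightarrow> ext c \<in> carrier P"
  unfolding ext_def using coef_props(1) coef_Mon j_simps(1)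
  by (intro P.fs_closed) (auto intro!: P.mult_in Mon_g_in)

lemma ext_add:
  assumes "c \<in> carrier C" "c' \<in> carrier C"
  shows "ext (c \<oplus>\<^bsub>C\<^esub> c') = ext c \<oplus>\<^bsub>P\<^esub> ext c'"
proof -
  let ?S = "{xs. coef c xs \<noteq> \<zero>\<^bsub>T\<^esub>} \<union> {xs. coef c' xs \<noteq> \<zero>\<^bsub>T\<^esub>}"
  have S: "finite ?S" "?S \<subseteq> Mon" using coef_props(3) coef_Mon assms by auto
  have in_P: "j (coef d xs) \<otimes>\<^bsub>P\<^esub> word_prod P (map g xs) \<in> carrier P"
    if "d \<in> carrier C" "xs \<in> Mon" for d xs
    using that coef_props(1) j_simps(1) by auto
  have "ext (c \<oplus>\<^bsub>C\<^esub> c') = (\<Oplus>\<^bsub>P\<^esub>xs\<in>?S. j (coef (c \<oplus>\<^bsub>C\<^esub> c') xs) \<otimes>\<^bsub>P\<^esub> word_prod P (map g xs))"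
    using assms by (intro ext_superset S) (auto simp: coef_add)
  also have "\<dots> = (\<Oplus>\<^bsub>P\<^esub>xs\<in>?S. j (coef c xs) \<otimes>\<^bsub>P\<^esub> word_prod P (map g xs) \<oplus>\<^bsub>P\<^esub>
      j (coef c' xs) \<otimes>\<^bsub>P\<^esub> word_prod P (map g xs))"
    using S(2) assms coef_props(1) j_simps(1)
    by (intro P.fs_cong) (auto simp: coef_add j_simps(3) P.mult_l_distr)
  also have "\<dots> = ext c \<oplus>\<^bsub>P\<^esub> ext c'"
    using S in_P assms ext_superset[OF assms(1) S(1) _ S(2)] ext_superset[OF assms(2) S(1) _ S(2)]
    by (subst P.fs_addf) auto
  finally show ?thesis .
qed

lemma ext_single:
  assumes "t \<in> carrier T" "ms \<in> Mon"
  shows "ext (i t \<otimes>\<^bsub>C\<^esub> word_prod C ms) = j t \<otimes>\<^bsub>P\<^esub> word_prod P (map g ms)"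
  by (subst ext_superset[of _ "{ms}"])
    (use assms i_simps(1) j_simps(1) in \<open>auto simp: coef_single P.fs_insert P.fs_empty\<close>)

lemma ext_zero: "ext \<zero>\<^bsub>C\<^esub> = \<zero>\<^bsub>P\<^esub>"
  using ext_single[OF T.zero_in Nil_Mon] by (simp add: i_simps(7) j_simps(7))

lemma ext_i: "t \<in> carrier T \<Longrightarrow> ext (i t) = j t"
  using ext_single[OF _ Nil_Mon] i_simps(1) j_simps(1) by simp

lemma ext_i_mult:
  assumes "t \<in> carrier T" "c \<in> carrier C"
  shows "ext (i t \<otimes>\<^bsub>C\<^esub> c) = j t \<otimes>\<^bsub>P\<^esub> ext c"
  using assms(2)
proof (induction c rule: free_induct)
  case zero
  then show ?case using assms(1) by (simp add: ext_zero i_simps(1) j_simps(1))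
next
  case (add x y)
  then show ?case using assms(1) i_simps(1) j_simps(1)
    by (simp add: C.mult_r_distr P.mult_r_distr ext_add)
next
  case (mono p s ms)
  have "i t \<otimes>\<^bsub>C\<^esub> (i s \<otimes>\<^bsub>C\<^esub> word_prod C ms) = i (t \<otimes>\<^bsub>T\<^esub> s) \<otimes>\<^bsub>C\<^esub> word_prod C ms"
    using mono assms(1) i_simps(1) by (simp add: i_simps(4) C.m_assoc)
  then show ?case
    using mono assms(1) j_simps(1) by (simp add: ext_single j_simps(4) P.m_assoc)
qed

text \<open>Inserting a letter into a sorted word. Moving it past the smaller letters costs the same
  sign in \<open>C\<close> and in \<open>P\<close>, and the product vanishes in both if an odd letter is repeated.\<close>
lemma insert_letter:
  assumes "x \<in> X" "ms \<in> Mon"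
  shows "\<exists>a ms'. ms' \<in> Mon \<and> set ms' \<subseteq> insert x (set ms) \<and>
    word_prod C (x # ms) = a \<odot>\<^bsub>C\<^esub> word_prod C ms' \<and>
    word_prod P (map g (x # ms)) = a \<odot>\<^bsub>P\<^esub> word_prod P (map g ms')"
  using assms(2)
proof (induction ms)
  case Nil
  have "[x] \<in> Mon" using assms(1) by (simp add: monomials_def)
  then show ?case using assms(1) X_in g_in by (intro exI[of _ 1] exI[of _ "[x]"]) auto
next
  case (Cons y ys)
  have ys: "ys \<in> Mon" and y: "y \<in> X"
    and y_ys: "\<And>z. z \<in> set ys \<Longrightarrow> (y, z) \<in> r \<and> (y = z \<longrightarrow> (\<exists>p. even p \<and> y \<in> gr C p))"
    using Cons.prems by (auto simp: monomials_def)
  obtain p q where pq: "x \<in> gr C p" "y \<in> gr C q" using X_gr assms(1) y by blast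
  have in_C: "x \<in> carrier C" "y \<in> carrier C" "word_prod C ys \<in> carrier C"
    using ys X_in assms(1) y by auto
  have in_P: "g x \<in> carrier P" "g y \<in> carrier P" "word_prod P (map g ys) \<in> carrier P"
    using ys g_in assms(1) y by auto
  have lin: "refl_on X r" "trans r" "antisym r" "total_on X r"
    using r_lin by (auto simp: linear_order_on_def partial_order_on_def preorder_on_def)
  have keep: ?case if "x # y # ys \<in> Mon"
    using that in_C in_P by (intro exI[of _ 1] exI[of _ "x # y # ys"]) auto
  consider (odd) "x = y" "odd p" | (even) "x = y" "even p"
    | (less) "x \<noteq> y" "(x, y) \<in> r" | (greater) "x \<noteq> y" "(y, x) \<in> r"
    using lin(4) assms(1) y unfolding total_on_def by blast
  then show ?case
  proof cases
    case odd
    have "word_prod C (x # y # ys) = (x \<otimes>\<^bsub>C\<^esub> x) \<otimes>\<^bsub>C\<^esub> word_prod C ys"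
      using in_C odd by (simp add: C.m_assoc)
    also have "\<dots> = \<zero>\<^bsub>C\<^esub>" using C.odd_square_zero[OF pq(1) odd(2)] in_C by simp
    finally have 1: "word_prod C (x # y # ys) = \<zero>\<^bsub>C\<^esub>" .
    have "word_prod P (map g (x # y # ys)) = (g x \<otimes>\<^bsub>P\<^esub> g x) \<otimes>\<^bsub>P\<^esub> word_prod P (map g ys)"
      using in_P odd by (simp add: P.m_assoc)
    also have "\<dots> = \<zero>\<^bsub>P\<^esub>"
      using P.odd_square_zero[OF g_gr[OF assms(1) pq(1)] odd(2)] in_P by simp
    finally show ?thesis using 1 Nil_Mon by (intro exI[of _ 0] exI[of _ "[]"]) auto
  next
    case even
    have "x # y # ys \<in> Mon"
      using Cons.prems assms(1) y_ys even pq(1) lin(1)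
      by (auto simp: monomials_def refl_on_def)
    then show ?thesis by (rule keep)
  next
    case less
    have "x \<noteq> z \<and> (x, z) \<in> r" if "z \<in> set ys" for z
      using y_ys[OF that] less lin(2,3) by (meson antisymD transD)
    then have "x # y # ys \<in> Mon"
      using Cons.prems assms(1) less by (auto simp: monomials_def)
    then show ?thesis by (rule keep)
  next
    case greater
    obtain a ms' where IH: "ms' \<in> Mon" "set ms' \<subseteq> insert x (set ys)"
      "word_prod C (x # ys) = a \<odot>\<^bsub>C\<^esub> word_prod C ms'"
      "word_prod P (map g (x # ys)) = a \<odot>\<^bsub>P\<^esub> word_prod P (map g ms')"
      using Cons.IH[OF ys] by blast
    have mon: "y # ms' \<in> Mon"
      using IH(1,2) y y_ys greater by (auto simp: monomials_def)
    have "word_prod C (x # y # ys) = (-1) ^ (p * q) \<odot>\<^bsub>C\<^esub> (y \<otimes>\<^bsub>C\<^esub> word_prod C (x # ys))"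
      using C.mult_swap[OF pq in_C(3)] by simp
    also have "\<dots> = ((-1) ^ (p * q) * a) \<odot>\<^bsub>C\<^esub> word_prod C (y # ms')"
      unfolding IH(3) using in_C IH(1) by (simp add: C.smult_mult_right C.sm_assoc)
    finally have 1: "word_prod C (x # y # ys) = ((-1) ^ (p * q) * a) \<odot>\<^bsub>C\<^esub> word_prod C (y # ms')" .
    have "word_prod P (map g (x # y # ys)) =
        (-1) ^ (p * q) \<odot>\<^bsub>P\<^esub> (g y \<otimes>\<^bsub>P\<^esub> word_prod P (map g (x # ys)))"
      using P.mult_swap[OF g_gr[OF assms(1) pq(1)] g_gr[OF y pq(2)] in_P(3)] by simp
    also have "\<dots> = ((-1) ^ (p * q) * a) \<odot>\<^bsub>P\<^esub> word_prod P (map g (y # ms'))"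
      unfolding IH(4) using in_P IH(1) by (simp add: P.smult_mult_right P.sm_assoc)
    finally have 2: "word_prod P (map g (x # y # ys)) =
        ((-1) ^ (p * q) * a) \<odot>\<^bsub>P\<^esub> word_prod P (map g (y # ms'))" .
    have "set (y # ms') \<subseteq> insert x (set (y # ys))" using IH(2) by auto
    then show ?thesis using 1 2 mon by blast
  qed
qed

lemma ext_letter_mult:
  assumes "x \<in> X" "c \<in> carrier C"
  shows "ext (x \<otimes>\<^bsub>C\<^esub> c) = g x \<otimes>\<^bsub>P\<^esub> ext c"
  using assms(2)
proof (induction c rule: free_induct)
  case zero
  then show ?case using assms(1) X_in g_in by (auto simp: ext_zero)
next
  case (add c d)
  then show ?case using assms(1) X_in g_in by (auto simp: C.mult_r_distr P.mult_r_distr ext_add)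
next
  case (mono q t ms)
  obtain p where p: "x \<in> gr C p" using X_gr assms(1) by blast
  obtain a ms' where a: "ms' \<in> Mon" "word_prod C (x # ms) = a \<odot>\<^bsub>C\<^esub> word_prod C ms'"
    "word_prod P (map g (x # ms)) = a \<odot>\<^bsub>P\<^esub> word_prod P (map g ms')"
    using insert_letter[OF assms(1) mono(2)] by blast
  let ?s = "(-1) ^ (p * q) * a"
  have tT: "t \<in> carrier T" using mono(1) by auto
  have "x \<otimes>\<^bsub>C\<^esub> (i t \<otimes>\<^bsub>C\<^esub> word_prod C ms) = (-1) ^ (p * q) \<odot>\<^bsub>C\<^esub> (i t \<otimes>\<^bsub>C\<^esub> word_prod C (x # ms))"
    using C.mult_swap[OF p i_simps(6)[OF mono(1)]] mono(2) by simp
  also have "\<dots> = i (?s \<odot>\<^bsub>T\<^esub> t) \<otimes>\<^bsub>C\<^esub> word_prod C ms'"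
    unfolding a(2) using tT i_simps(1)[OF tT] a(1)
    by (simp add: i_simps(5) C.smult_mult_left C.smult_mult_right C.sm_assoc)
  finally have "ext (x \<otimes>\<^bsub>C\<^esub> (i t \<otimes>\<^bsub>C\<^esub> word_prod C ms)) =
      j (?s \<odot>\<^bsub>T\<^esub> t) \<otimes>\<^bsub>P\<^esub> word_prod P (map g ms')"
    using ext_single[OF _ a(1), of "?s \<odot>\<^bsub>T\<^esub> t"] tT by simp
  also have "\<dots> = (-1) ^ (p * q) \<odot>\<^bsub>P\<^esub> (j t \<otimes>\<^bsub>P\<^esub> word_prod P (map g (x # ms)))"
    unfolding a(3) using tT j_simps(1)[OF tT] a(1)
    by (simp add: j_simps(5) P.smult_mult_left P.smult_mult_right P.sm_assoc)
  also have "\<dots> = g x \<otimes>\<^bsub>P\<^esub> ext (i t \<otimes>\<^bsub>C\<^esub> word_prod C ms)"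
    using P.mult_swap[OF g_gr[OF assms(1) p] j_simps(6)[OF mono(1)]] mono(2) tT
    by (simp add: ext_single)
  finally show ?case .
qed

lemma ext_one: "ext \<one>\<^bsub>C\<^esub> = \<one>\<^bsub>P\<^esub>"
  using ext_i[of "\<one>\<^bsub>T\<^esub>"] by (simp add: i_simps(2) j_simps(2))

lemma ext_letter: "x \<in> X \<Longrightarrow> ext x = g x"
  using ext_letter_mult[of x "\<one>\<^bsub>C\<^esub>"] X_in g_in by (auto simp: ext_one)

lemma ext_word_mult:
  assumes "set ms \<subseteq> X" "c \<in> carrier C"
  shows "ext (word_prod C ms \<otimes>\<^bsub>C\<^esub> c) = word_prod P (map g ms) \<otimes>\<^bsub>P\<^esub> ext c"
  using assms(1)
proof (induction ms)
  case (Cons x ms)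
  have 1: "x \<in> carrier C" "word_prod C ms \<in> carrier C" using Cons.prems X_in by auto
  have 2: "g x \<in> carrier P" "word_prod P (map g ms) \<in> carrier P"
    using Cons.prems g_in g_word_in[of ms] by auto
  have "ext (word_prod C (x # ms) \<otimes>\<^bsub>C\<^esub> c) = ext (x \<otimes>\<^bsub>C\<^esub> (word_prod C ms \<otimes>\<^bsub>C\<^esub> c))"
    using 1 assms(2) by (simp add: C.m_assoc)
  also have "\<dots> = g x \<otimes>\<^bsub>P\<^esub> (word_prod P (map g ms) \<otimes>\<^bsub>P\<^esub> ext c)"
    using Cons 1 assms(2) by (simp add: ext_letter_mult)
  finally show ?case using 2 assms(2) by (simp add: P.m_assoc)
qed (use assms(2) in simp)

lemma ext_mult:
  assumes "c \<in> carrier C" "d \<in> carrier C"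
  shows "ext (c \<otimes>\<^bsub>C\<^esub> d) = ext c \<otimes>\<^bsub>P\<^esub> ext d"
  using assms(1)
proof (induction c rule: free_induct)
  case zero
  then show ?case using assms(2) by (simp add: ext_zero)
next
  case (add x y)
  then show ?case using assms(2) by (simp add: C.mult_l_distr P.mult_l_distr ext_add)
next
  case (mono p t ms)
  have "ext (i t \<otimes>\<^bsub>C\<^esub> word_prod C ms \<otimes>\<^bsub>C\<^esub> d) = ext (i t \<otimes>\<^bsub>C\<^esub> (word_prod C ms \<otimes>\<^bsub>C\<^esub> d))"
    using mono i_simps(1) assms(2) by (simp add: C.m_assoc)
  also have "\<dots> = j t \<otimes>\<^bsub>P\<^esub> (word_prod P (map g ms) \<otimes>\<^bsub>P\<^esub> ext d)"
    using mono assms(2) Mon_set[OF mono(2)] by (simp add: ext_i_mult ext_word_mult)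
  finally show ?case using mono assms(2) j_simps(1) by (simp add: ext_single P.m_assoc)
qed

lemma ext_smult: "c \<in> carrier C \<Longrightarrow> ext (a \<odot>\<^bsub>C\<^esub> c) = a \<odot>\<^bsub>P\<^esub> ext c"
  using ext_i_mult[of "a \<odot>\<^bsub>T\<^esub> \<one>\<^bsub>T\<^esub>" c]
  by (simp add: i_simps(2,5) j_simps(2,5) C.smult_mult_left P.smult_mult_left)

end

context free_ext
begin

lemma word_gr:
  "set ms \<subseteq> X \<Longrightarrow> \<exists>p. word_prod C ms \<in> gr C p"
proof (induction ms)
  case (Cons x ms)
  then obtain p q where "x \<in> gr C p" "word_prod C ms \<in> gr C q" using X_gr by auto
  then have "word_prod C (x # ms) \<in> gr C (p + q)" using C.gr_mult by simp
  then show ?case ..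
qed (use C.gr_one in auto)

definition mono_set :: "'c set" where
  "mono_set = {i t \<otimes>\<^bsub>C\<^esub> word_prod C ms |t ms p. t \<in> gr T p \<and> ms \<in> Mon}"

lemma mono_set_gr: "mono_set \<subseteq> (\<Union>p. gr C p)"
proof
  fix x assume "x \<in> mono_set"
  then obtain t ms p where x: "x = i t \<otimes>\<^bsub>C\<^esub> word_prod C ms" "t \<in> gr T p" "ms \<in> Mon"
    by (auto simp: mono_set_def)
  obtain q where "word_prod C ms \<in> gr C q" using word_gr Mon_set x(3) by blast
  then have "x \<in> gr C (p + q)" using x i_simps(6) C.gr_mult by blast
  then show "x \<in> (\<Union>p. gr C p)" by blast
qed

lemma mono_set_span:
  assumes "c \<in> carrier C"
  shows "c \<in> lspan C mono_set"
proof -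
  have *: "submodule (lspan C mono_set) rat_ring C"
    by (rule C.lspan_subspace) (use mono_set_gr in blast)
  from assms show ?thesis
  proof (induction c rule: free_induct)
    case zero
    show ?case by (rule C.subspaceD(2)[OF *])
  next
    case (add x y)
    then show ?case using C.subspaceD(3)[OF *] by blast
  next
    case (mono p t ms)
    then show ?case by (intro C.lspan_incl) (auto simp: mono_set_def)
  qed
qed

text \<open>A graded algebra map out of \<open>C\<close> can be prescribed on \<open>T\<close> and on any homogeneous basis \<open>B\<close> of
  the space of generators, since such values determine linearly the values on \<open>X\<close>.\<close>
lemma galg_extension:
  assumes P: "dgca P" and j: "galg_hom T P j"
    and B: "C.indep B" "B \<subseteq> (\<Union>p. gr C p)" "lspan C B = lspan C X"
    and v: "\<And>b p. b \<in> B \<Longrightarrow> b \<in> gr C p \<Longrightarrow> v b \<in> gr P p"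
  obtains f where "galg_hom C P f" "\<And>t. t \<in> carrier T \<Longrightarrow> f (i t) = j t"
    "\<And>b. b \<in> B \<Longrightarrow> f b = v b"
proof -
  interpret P: dgca P by fact
  have Bc: "B \<subseteq> carrier C" using B(2) by blast
  have "v ` B \<subseteq> carrier P" using B(2) v by blast
  then obtain L where L: "\<And>b. b \<in> B \<Longrightarrow> L b = v b"
    "\<And>x. x \<in> lspan C B \<Longrightarrow> L x \<in> lspan P (v ` B)"
    "\<And>x y. x \<in> lspan C B \<Longrightarrow> y \<in> lspan C B \<Longrightarrow> L (x \<oplus>\<^bsub>C\<^esub> y) = L x \<oplus>\<^bsub>P\<^esub> L y"
    "\<And>a x. x \<in> lspan C B \<Longrightarrow> L (a \<odot>\<^bsub>C\<^esub> x) = a \<odot>\<^bsub>P\<^esub> L x"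
    using C.linear_extension[OF B(1) P.ratmod_axioms] by blast
  have subB: "submodule (lspan C B) rat_ring C" by (rule C.lspan_subspace[OF Bc])
  have L0: "L \<zero>\<^bsub>C\<^esub> = \<zero>\<^bsub>P\<^esub>"
  proof -
    have z: "\<zero>\<^bsub>C\<^esub> \<in> lspan C B" by (rule C.subspaceD(2)[OF subB])
    have "L \<zero>\<^bsub>C\<^esub> \<in> carrier P" using L(2)[OF z] P.lspan_carrier[OF \<open>v ` B \<subseteq> carrier P\<close>] by blast
    then show ?thesis using L(4)[OF z, of 0] by simp
  qed
  have Lgr: "L x \<in> gr P p" if x: "x \<in> lspan C B" "x \<in> gr C p" for x p
  proof -
    have "x \<in> lspan C (B \<inter> gr C p)" "B \<inter> gr C p \<subseteq> carrier C"
      using C.homogeneous_lspan[OF B(2) x] by auto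
    then have "x \<in> lspan C B \<and> L x \<in> gr P p"
    proof (induction rule: C.lspan_induct)
      show "\<zero>\<^bsub>C\<^esub> \<in> lspan C B \<and> L \<zero>\<^bsub>C\<^esub> \<in> gr P p" using L0 C.subspaceD(2)[OF subB] by simp
    qed (use L C.subspaceD(3,4)[OF subB] P.gr_closed v C.lspan_incl in auto)
    then show ?thesis ..
  qed
  interpret E: free_ext_map T C i X r P j L
    using j Lgr B(3) C.lspan_incl[of _ X]
    by unfold_locales auto
  have LX: "E.ext x = L x \<and> x \<in> lspan C B" if "x \<in> lspan C X" for x
    using that X_in
  proof (induction rule: C.lspan_induct)
    case zero
    then show ?case using L0 E.ext_zero C.subspaceD(2)[OF subB] by simp
  next
    case (add x y)
    then show ?case using L C.subspaceD(3)[OF subB] by (simp add: E.ext_add)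
  next
    case (smult a x)
    then show ?case using L C.subspaceD(4)[OF subB] by (simp add: E.ext_smult)
  next
    case (gen x)
    then show ?case using E.ext_letter B(3) C.lspan_incl by auto
  qed
  have ext_gr: "E.ext c \<in> gr P p" if c: "c \<in> gr C p" for c p
  proof -
    have ms: "mono_set \<inter> gr C p \<subseteq> carrier C" by auto
    have *: "E.ext s \<in> gr P q" if s: "s \<in> mono_set" "s \<in> gr C q" for s q
    proof -
      obtain t ms n where t: "s = i t \<otimes>\<^bsub>C\<^esub> word_prod C ms" "t \<in> gr T n" "ms \<in> Mon"
        using s(1) by (auto simp: mono_set_def)
      have w: "\<exists>p. word_prod C ms \<in> gr C p \<and> word_prod P (map L ms) \<in> gr P p"
        if "set ms \<subseteq> X" for ms
        using that
      proof (induction ms)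
        case (Cons x ms)
        obtain a where "x \<in> gr C a" using Cons.prems X_gr by auto
        moreover have "L x \<in> gr P a"
          using Cons.prems \<open>x \<in> gr C a\<close> B(3) C.lspan_incl[of x X] by (intro Lgr) auto
        moreover obtain b where "word_prod C ms \<in> gr C b" "word_prod P (map L ms) \<in> gr P b"
          using Cons by auto
        ultimately have "word_prod C (x # ms) \<in> gr C (a + b)"
          "word_prod P (map L (x # ms)) \<in> gr P (a + b)"
          using C.gr_mult P.gr_mult by auto
        then show ?case by blast
      qed (use C.gr_one P.gr_one in auto)
      obtain m where m: "word_prod C ms \<in> gr C m" "word_prod P (map L ms) \<in> gr P m"
        using w Mon_set[OF t(3)] by blast
      have sn: "s \<in> gr C (n + m)" using t m i_simps(6) C.gr_mult by blast
      have en: "E.ext s \<in> gr P (n + m)"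
        using t m E.j_simps(6) P.gr_mult by (auto simp: E.ext_single)
      show ?thesis
      proof (cases "q = n + m")
        case False
        then have "s = \<zero>\<^bsub>C\<^esub>" using C.component_gr[OF s(2), of q] C.component_gr[OF sn, of q] by simp
        then show ?thesis using E.ext_zero by simp
      qed (use en in simp)
    qed
    have "c \<in> lspan C (mono_set \<inter> gr C p)"
      by (rule C.homogeneous_lspan[OF mono_set_gr mono_set_span c]) (use c in auto)
    then have "c \<in> carrier C \<and> E.ext c \<in> gr P p" using ms
      by (induction rule: C.lspan_induct)
        (use * P.gr_closed in \<open>auto simp: E.ext_add E.ext_smult E.ext_zero\<close>)
    then show ?thesis ..
  qed
  show ?thesis
  proof (rule that)
    show "galg_hom C P E.ext"
      unfolding galg_hom_def
      using E.ext_add E.ext_mult E.ext_smult E.ext_one ext_gr by auto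
    show "E.ext (i t) = j t" if "t \<in> carrier T" for t using that by (rule E.ext_i)
    show "E.ext b = v b" if "b \<in> B" for b
    proof -
      have "b \<in> lspan C X" using that B(3) C.lspan_incl by blast
      then show ?thesis using LX L(1)[OF that] by simp
    qed
  qed
qed

end

lemma (in dgca) mult_assoc:
  "x \<in> carrier A \<Longrightarrow> y \<in> carrier A \<Longrightarrow> z \<in> carrier A \<Longrightarrow> x \<otimes> y \<otimes> z = x \<otimes> (y \<otimes> z)"
  by (rule m_assoc)

section \<open>Attaching contractible modules\<close>

text \<open>The square-zero extension of \<open>C\<close> by the contractible module that is freely generated by
  elements \<open>w\<^sub>o\<close> of even degree \<open>m\<close> and their differentials \<open>dw\<^sub>o\<close>, for \<open>o \<in> \<Omega>\<close>. The family \<open>\<gamma>\<close> stands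
  for \<open>\<gamma> Base + (\<Sum>o. w\<^sub>o \<gamma> (W o) + dw\<^sub>o \<gamma> (DW o))\<close>, with coefficients on the right, so that the
  only sign in the product comes from moving a left factor past \<open>dw\<^sub>o\<close>.\<close>

datatype 'k ext_index = Base | W 'k | DW 'k

fun index_deg :: "nat \<Rightarrow> 'k ext_index \<Rightarrow> nat" where
  "index_deg m Base = 0"
| "index_deg m (W _) = m"
| "index_deg m (DW _) = Suc m"

definition gr_shift :: "('c, 'm) cdga_scheme \<Rightarrow> nat \<Rightarrow> nat \<Rightarrow> 'c set" where
  "gr_shift C d p = (if d \<le> p then gr C (p - d) else {\<zero>\<^bsub>C\<^esub>})"

definition disk_ext :: "('c, 'm) cdga_scheme \<Rightarrow> nat \<Rightarrow> 'k set \<Rightarrow> ('k ext_index \<Rightarrow> 'c) cdga" where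
  "disk_ext C m \<Omega> = (let
     cc = {\<gamma>. (\<forall>k. \<gamma> k \<in> carrier C) \<and> finite {k. \<gamma> k \<noteq> \<zero>\<^bsub>C\<^esub>} \<and>
               (\<forall>k. k \<notin> insert Base (W ` \<Omega> \<union> DW ` \<Omega>) \<longrightarrow> \<gamma> k = \<zero>\<^bsub>C\<^esub>)}
     in \<lparr>carrier = cc,
      mult = (\<lambda>\<gamma> \<delta> k. case k of
          Base \<Rightarrow> \<gamma> Base \<otimes>\<^bsub>C\<^esub> \<delta> Base
        | W _ \<Rightarrow> \<gamma> Base \<otimes>\<^bsub>C\<^esub> \<delta> k \<oplus>\<^bsub>C\<^esub> \<gamma> k \<otimes>\<^bsub>C\<^esub> \<delta> Base
        | DW _ \<Rightarrow> involution C (\<gamma> Base) \<otimes>\<^bsub>C\<^esub> \<delta> k \<oplus>\<^bsub>C\<^esub> \<gamma> k \<otimes>\<^bsub>C\<^esub> \<delta> Base),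
      one = (\<lambda>k. if k = Base then \<one>\<^bsub>C\<^esub> else \<zero>\<^bsub>C\<^esub>),
      zero = (\<lambda>k. \<zero>\<^bsub>C\<^esub>), add = (\<lambda>\<gamma> \<delta> k. \<gamma> k \<oplus>\<^bsub>C\<^esub> \<delta> k), smult = (\<lambda>a \<gamma> k. a \<odot>\<^bsub>C\<^esub> \<gamma> k),
      gr = (\<lambda>p. {\<gamma> \<in> cc. \<forall>k. \<gamma> k \<in> gr_shift C (index_deg m k) p}),
      diff = (\<lambda>\<gamma> k. case k of
          Base \<Rightarrow> diff C (\<gamma> Base)
        | W _ \<Rightarrow> diff C (\<gamma> k)
        | DW o' \<Rightarrow> \<gamma> (W o') \<ominus>\<^bsub>C\<^esub> diff C (\<gamma> k))\<rparr>)"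

locale disk_extension = C: cdga C for C :: "('c, 'm) cdga_scheme" (structure) +
  fixes m :: nat and \<Omega> :: "'k set"
  assumes even_m: "even m"
begin

abbreviation "G \<equiv> disk_ext C m \<Omega>"

definition idx :: "'k ext_index set" where "idx = insert Base (W ` \<Omega> \<union> DW ` \<Omega>)"

lemma G_carrier: "\<gamma> \<in> carrier G \<longleftrightarrow>
    (\<forall>k. \<gamma> k \<in> carrier C) \<and> finite {k. \<gamma> k \<noteq> \<zero>\<^bsub>C\<^esub>} \<and> (\<forall>k. k \<notin> idx \<longrightarrow> \<gamma> k = \<zero>\<^bsub>C\<^esub>)"
  unfolding disk_ext_def idx_def by (simp add: Let_def)

lemma G_gr: "\<gamma> \<in> gr G p \<longleftrightarrow> \<gamma> \<in> carrier G \<and> (\<forall>k. \<gamma> k \<in> gr_shift C (index_deg m k) p)"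
  unfolding disk_ext_def by (simp add: Let_def)

lemma G_simps [simp]:
  "(\<gamma> \<otimes>\<^bsub>G\<^esub> \<delta>) Base = \<gamma> Base \<otimes>\<^bsub>C\<^esub> \<delta> Base"
  "(\<gamma> \<otimes>\<^bsub>G\<^esub> \<delta>) (W w) = \<gamma> Base \<otimes>\<^bsub>C\<^esub> \<delta> (W w) \<oplus>\<^bsub>C\<^esub> \<gamma> (W w) \<otimes>\<^bsub>C\<^esub> \<delta> Base"
  "(\<gamma> \<otimes>\<^bsub>G\<^esub> \<delta>) (DW w) = involution C (\<gamma> Base) \<otimes>\<^bsub>C\<^esub> \<delta> (DW w) \<oplus>\<^bsub>C\<^esub> \<gamma> (DW w) \<otimes>\<^bsub>C\<^esub> \<delta> Base"
  "\<one>\<^bsub>G\<^esub> Base = \<one>\<^bsub>C\<^esub>" "\<one>\<^bsub>G\<^esub> (W w) = \<zero>\<^bsub>C\<^esub>" "\<one>\<^bsub>G\<^esub> (DW w) = \<zero>\<^bsub>C\<^esub>"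
  "\<zero>\<^bsub>G\<^esub> k = \<zero>\<^bsub>C\<^esub>" "(\<gamma> \<oplus>\<^bsub>G\<^esub> \<delta>) k = \<gamma> k \<oplus>\<^bsub>C\<^esub> \<delta> k" "(a \<odot>\<^bsub>G\<^esub> \<gamma>) k = a \<odot>\<^bsub>C\<^esub> \<gamma> k"
  "diff G \<gamma> Base = diff C (\<gamma> Base)" "diff G \<gamma> (W w) = diff C (\<gamma> (W w))"
  "diff G \<gamma> (DW w) = \<gamma> (W w) \<ominus>\<^bsub>C\<^esub> diff C (\<gamma> (DW w))"
  unfolding disk_ext_def by (simp_all add: Let_def)

lemma ext_eqI:
  assumes "\<gamma> Base = \<delta> Base" "\<And>w. \<gamma> (W w) = \<delta> (W w)" "\<And>w. \<gamma> (DW w) = \<delta> (DW w)"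
  shows "\<gamma> = \<delta>"
proof
  fix k show "\<gamma> k = \<delta> k" using assms by (cases k) auto
qed

lemma gr_shift_subspace: "submodule (gr_shift C d p) rat_ring C"
  unfolding gr_shift_def
  using C.gr_submodule by (auto intro!: C.subspaceI)

lemma G_in: "\<gamma> \<in> carrier G \<Longrightarrow> \<gamma> k \<in> carrier C"
  by (simp add: G_carrier)

lemma G_carrierI:
  assumes "\<And>k. \<gamma> k \<in> carrier C" "finite F" "\<And>k. k \<notin> F \<Longrightarrow> \<gamma> k = \<zero>\<^bsub>C\<^esub>"
    "\<And>w. w \<notin> \<Omega> \<Longrightarrow> \<gamma> (W w) = \<zero>\<^bsub>C\<^esub> \<and> \<gamma> (DW w) = \<zero>\<^bsub>C\<^esub>"
  shows "\<gamma> \<in> carrier G"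
proof -
  have "{k. \<gamma> k \<noteq> \<zero>\<^bsub>C\<^esub>} \<subseteq> F" using assms(3) by auto
  then have "finite {k. \<gamma> k \<noteq> \<zero>\<^bsub>C\<^esub>}" using assms(2) finite_subset by blast
  moreover have "\<gamma> k = \<zero>\<^bsub>C\<^esub>" if "k \<notin> idx" for k
    using that assms(4) by (cases k) (auto simp: idx_def)
  ultimately show ?thesis using assms(1) by (simp add: G_carrier)
qed

lemma G_outside:
  "\<gamma> \<in> carrier G \<Longrightarrow> w \<notin> \<Omega> \<Longrightarrow> \<gamma> (W w) = \<zero>\<^bsub>C\<^esub> \<and> \<gamma> (DW w) = \<zero>\<^bsub>C\<^esub>"
  by (auto simp: G_carrier idx_def)

lemma G_finite: "\<gamma> \<in> carrier G \<Longrightarrow> finite {k. \<gamma> k \<noteq> \<zero>\<^bsub>C\<^esub>}"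
  by (simp add: G_carrier)

lemma G_add_in: "\<gamma> \<in> carrier G \<Longrightarrow> \<delta> \<in> carrier G \<Longrightarrow> \<gamma> \<oplus>\<^bsub>G\<^esub> \<delta> \<in> carrier G"
  by (rule G_carrierI[of _ "{k. \<gamma> k \<noteq> \<zero>\<^bsub>C\<^esub>} \<union> {k. \<delta> k \<noteq> \<zero>\<^bsub>C\<^esub>}"])
    (auto simp: G_in G_finite G_outside)

lemma G_smult_in: "\<gamma> \<in> carrier G \<Longrightarrow> a \<odot>\<^bsub>G\<^esub> \<gamma> \<in> carrier G"
  by (rule G_carrierI[of _ "{k. \<gamma> k \<noteq> \<zero>\<^bsub>C\<^esub>}"]) (auto simp: G_in G_finite dest: G_outside)

lemma G_zero_in: "\<zero>\<^bsub>G\<^esub> \<in> carrier G"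
  by (rule G_carrierI[of _ "{}"]) auto

lemma G_one_in: "\<one>\<^bsub>G\<^esub> \<in> carrier G"
proof (rule G_carrierI[of _ "{Base}"])
  show "\<one>\<^bsub>G\<^esub> k \<in> carrier C" for k by (cases k) auto
  show "k \<notin> {Base} \<Longrightarrow> \<one>\<^bsub>G\<^esub> k = \<zero>\<^bsub>C\<^esub>" for k by (cases k) auto
qed auto

lemma G_mult_in:
  assumes "\<gamma> \<in> carrier G" "\<delta> \<in> carrier G"
  shows "\<gamma> \<otimes>\<^bsub>G\<^esub> \<delta> \<in> carrier G"
proof (rule G_carrierI[of _ "insert Base ({k. \<gamma> k \<noteq> \<zero>\<^bsub>C\<^esub>} \<union> {k. \<delta> k \<noteq> \<zero>\<^bsub>C\<^esub>})"])
  show "(\<gamma> \<otimes>\<^bsub>G\<^esub> \<delta>) k \<in> carrier C" for k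
    using assms by (cases k) (auto simp: G_in)
  show "(\<gamma> \<otimes>\<^bsub>G\<^esub> \<delta>) k = \<zero>\<^bsub>C\<^esub>"
    if "k \<notin> insert Base ({k. \<gamma> k \<noteq> \<zero>\<^bsub>C\<^esub>} \<union> {k. \<delta> k \<noteq> \<zero>\<^bsub>C\<^esub>})" for k
    using that assms by (cases k) (auto simp: G_in)
qed (use assms in \<open>auto simp: G_in G_finite G_outside\<close>)

lemma G_diff_in:
  assumes "\<gamma> \<in> carrier G"
  shows "diff G \<gamma> \<in> carrier G"
proof (rule G_carrierI)
  let ?F = "{k. \<gamma> k \<noteq> \<zero>\<^bsub>C\<^esub>}"
  show "finite (?F \<union> (\<lambda>k. case k of W w \<Rightarrow> DW w | _ \<Rightarrow> k) ` ?F)" using G_finite[OF assms] by simp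
  show "diff G \<gamma> k = \<zero>\<^bsub>C\<^esub>" if "k \<notin> ?F \<union> (\<lambda>k. case k of W w \<Rightarrow> DW w | _ \<Rightarrow> k) ` ?F" for k
  proof (cases k)
    case (DW w)
    have "\<gamma> (W w) = \<zero>\<^bsub>C\<^esub>"
    proof (rule ccontr)
      assume "\<gamma> (W w) \<noteq> \<zero>\<^bsub>C\<^esub>"
      then have "DW w \<in> (\<lambda>k. case k of W w \<Rightarrow> DW w | _ \<Rightarrow> k) ` ?F"
        by (intro image_eqI[of _ _ "W w"]) auto
      then show False using that DW by blast
    qed
    then show ?thesis using that DW by (auto simp: a_minus_def)
  qed (use that in auto)
  show "diff G \<gamma> k \<in> carrier C" for k using assms by (cases k) (auto simp: G_in)
qed (use assms in \<open>auto simp: a_minus_def dest: G_outside\<close>)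

lemma G_group: "abelian_group G"
proof (rule abelian_groupI)
  fix \<gamma> \<delta> \<epsilon> assume *: "\<gamma> \<in> carrier G" "\<delta> \<in> carrier G" "\<epsilon> \<in> carrier G"
  show "\<gamma> \<oplus>\<^bsub>G\<^esub> \<delta> \<oplus>\<^bsub>G\<^esub> \<epsilon> = \<gamma> \<oplus>\<^bsub>G\<^esub> (\<delta> \<oplus>\<^bsub>G\<^esub> \<epsilon>)"
    using * by (intro ext) (simp add: G_in C.add_assoc)
next
  fix \<gamma> \<delta> assume *: "\<gamma> \<in> carrier G" "\<delta> \<in> carrier G"
  show "\<gamma> \<oplus>\<^bsub>G\<^esub> \<delta> = \<delta> \<oplus>\<^bsub>G\<^esub> \<gamma>"
    using * by (intro ext) (simp add: G_in C.add_comm)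
next
  fix \<gamma> assume *: "\<gamma> \<in> carrier G"
  show "\<zero>\<^bsub>G\<^esub> \<oplus>\<^bsub>G\<^esub> \<gamma> = \<gamma>" using * by (intro ext) (simp add: G_in)
  have "(-1) \<odot>\<^bsub>G\<^esub> \<gamma> \<oplus>\<^bsub>G\<^esub> \<gamma> = \<zero>\<^bsub>G\<^esub>"
    using * by (intro ext) (simp add: G_in C.sm_uminus[symmetric] C.l_neg_self)
  then show "\<exists>\<delta>\<in>carrier G. \<delta> \<oplus>\<^bsub>G\<^esub> \<gamma> = \<zero>\<^bsub>G\<^esub>" using G_smult_in[OF *] by blast
qed (auto intro: G_add_in G_zero_in)

lemma G_ratmod: "ratmod G"
  unfolding ratmod_def
  by (rule ringI_rat_module)
    (auto intro!: G_group G_smult_in simp: fun_eq_iff G_in C.sm_ldistr C.sm_rdistr C.sm_assoc)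

lemma G_ring: "ring G"
proof (rule ringI)
  show "abelian_group G" by (rule G_group)
  show "monoid G"
  proof (rule monoidI)
    fix \<gamma> \<delta> \<epsilon> assume *: "\<gamma> \<in> carrier G" "\<delta> \<in> carrier G" "\<epsilon> \<in> carrier G"
    show "\<gamma> \<otimes>\<^bsub>G\<^esub> \<delta> \<otimes>\<^bsub>G\<^esub> \<epsilon> = \<gamma> \<otimes>\<^bsub>G\<^esub> (\<delta> \<otimes>\<^bsub>G\<^esub> \<epsilon>)"
      by (rule ext_eqI) (use * in \<open>simp_all add: G_in C.mult_assoc C.mult_l_distr C.mult_r_distr
        C.involution_mult C.add_assoc\<close>)
  next
    fix \<gamma> assume *: "\<gamma> \<in> carrier G"
    show "\<one>\<^bsub>G\<^esub> \<otimes>\<^bsub>G\<^esub> \<gamma> = \<gamma>" "\<gamma> \<otimes>\<^bsub>G\<^esub> \<one>\<^bsub>G\<^esub> = \<gamma>"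
      by (rule ext_eqI; use * in \<open>simp add: G_in\<close>)+
  qed (auto intro: G_mult_in G_one_in)
  fix \<gamma> \<delta> \<epsilon> assume *: "\<gamma> \<in> carrier G" "\<delta> \<in> carrier G" "\<epsilon> \<in> carrier G"
  show "(\<gamma> \<oplus>\<^bsub>G\<^esub> \<delta>) \<otimes>\<^bsub>G\<^esub> \<epsilon> = \<gamma> \<otimes>\<^bsub>G\<^esub> \<epsilon> \<oplus>\<^bsub>G\<^esub> \<delta> \<otimes>\<^bsub>G\<^esub> \<epsilon>"
    by (rule ext_eqI) (use * in \<open>simp_all add: G_in C.mult_l_distr C.involution_add C.add_ac\<close>)
  show "\<epsilon> \<otimes>\<^bsub>G\<^esub> (\<gamma> \<oplus>\<^bsub>G\<^esub> \<delta>) = \<epsilon> \<otimes>\<^bsub>G\<^esub> \<gamma> \<oplus>\<^bsub>G\<^esub> \<epsilon> \<otimes>\<^bsub>G\<^esub> \<delta>"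
    by (rule ext_eqI) (use * in \<open>simp_all add: G_in C.mult_r_distr C.add_ac\<close>)
qed

lemma gr_shift_mult_right:
  "x \<in> gr C p \<Longrightarrow> y \<in> gr_shift C d q \<Longrightarrow> x \<otimes>\<^bsub>C\<^esub> y \<in> gr_shift C d (p + q)"
  using C.gr_mult[of x p y "q - d"] by (auto simp: gr_shift_def split: if_splits)

lemma gr_shift_mult_left:
  "x \<in> gr_shift C d p \<Longrightarrow> y \<in> gr C q \<Longrightarrow> x \<otimes>\<^bsub>C\<^esub> y \<in> gr_shift C d (p + q)"
  using C.gr_mult[of x "p - d" y q] by (auto simp: gr_shift_def split: if_splits)

lemma gr_shift_diff: "x \<in> gr_shift C d p \<Longrightarrow> diff C x \<in> gr_shift C d (Suc p)"
  using C.diff_gr[of x "p - d"] by (auto simp: gr_shift_def Suc_diff_le split: if_splits)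

lemma G_grD:
  assumes "\<gamma> \<in> gr G p"
  shows "\<gamma> \<in> carrier G" "\<gamma> Base \<in> gr C p" "\<gamma> (W w) \<in> gr_shift C m p" "\<gamma> (DW w) \<in> gr_shift C (Suc m) p"
proof -
  have *: "\<gamma> k \<in> gr_shift C (index_deg m k) p" for k using assms by (simp add: G_gr)
  show "\<gamma> Base \<in> gr C p" using *[of Base] by (simp add: gr_shift_def)
  show "\<gamma> (W w) \<in> gr_shift C m p" "\<gamma> (DW w) \<in> gr_shift C (Suc m) p"
    using *[of "W w"] *[of "DW w"] by simp_all
qed (use assms in \<open>simp add: G_gr\<close>)

lemma G_grI:
  assumes "\<gamma> \<in> carrier G" "\<gamma> Base \<in> gr C p" "\<And>w. \<gamma> (W w) \<in> gr_shift C m p"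
    "\<And>w. \<gamma> (DW w) \<in> gr_shift C (Suc m) p"
  shows "\<gamma> \<in> gr G p"
proof -
  have "\<gamma> k \<in> gr_shift C (index_deg m k) p" for k
    using assms(2-4) by (cases k) (auto simp: gr_shift_def)
  then show ?thesis using assms(1) by (simp add: G_gr)
qed

lemma shift_comm_W:
  assumes "x \<in> gr C p" "y \<in> gr_shift C m q"
  shows "y \<otimes>\<^bsub>C\<^esub> x = (-1) ^ (p * q) \<odot>\<^bsub>C\<^esub> (x \<otimes>\<^bsub>C\<^esub> y)"
proof (cases "m \<le> q")
  case True
  have "even (p * (q - m) + p * q)"
    using True even_m by (metis even_add even_diff_nat even_mult_iff dvd_add_right_iff not_le)
  then have "(-1 :: rat) ^ ((q - m) * p) = (-1) ^ (p * q)"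
    by (simp add: minus_one_power_iff mult.commute)
  then show ?thesis
    using C.graded_comm[of y "q - m" x p] assms True by (simp add: gr_shift_def)
qed (use assms in \<open>auto simp: gr_shift_def\<close>)

lemma shift_comm_DW:
  assumes "x \<in> gr C p" "y \<in> gr_shift C (Suc m) q"
  shows "y \<otimes>\<^bsub>C\<^esub> x = (-1) ^ (p * q) \<odot>\<^bsub>C\<^esub> (involution C x \<otimes>\<^bsub>C\<^esub> y)"
proof (cases "Suc m \<le> q")
  case True
  have "even (p * (q - Suc m)) \<longleftrightarrow> even (p * q + p)"
    using True even_m by (auto simp: even_diff_nat)
  then have "(-1 :: rat) ^ ((q - Suc m) * p) = (-1) ^ (p * q) * (-1) ^ p"
    by (simp add: minus_one_power_iff mult.commute power_add[symmetric])
  then show ?thesis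
    using C.graded_comm[of y "q - Suc m" x p] assms True
    by (simp add: gr_shift_def C.involution_gr C.smult_mult_left C.sm_assoc)
qed (use assms in \<open>auto simp: gr_shift_def C.involution_gr\<close>)

lemma shift_leibniz_W:
  assumes "x \<in> gr_shift C m p" "y \<in> carrier C"
  shows "diff C (x \<otimes>\<^bsub>C\<^esub> y) = diff C x \<otimes>\<^bsub>C\<^esub> y \<oplus>\<^bsub>C\<^esub> (-1) ^ p \<odot>\<^bsub>C\<^esub> (x \<otimes>\<^bsub>C\<^esub> diff C y)"
proof (cases "m \<le> p")
  case True
  then have "(-1 :: rat) ^ (p - m) = (-1) ^ p" using even_m by (simp add: minus_one_power_iff)
  then show ?thesis using C.leibniz[of x "p - m" y] assms True by (simp add: gr_shift_def)
qed (use assms in \<open>auto simp: gr_shift_def\<close>)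

lemma shift_leibniz_DW:
  assumes "x \<in> gr_shift C (Suc m) p" "y \<in> carrier C"
  shows "diff C (x \<otimes>\<^bsub>C\<^esub> y) = diff C x \<otimes>\<^bsub>C\<^esub> y \<ominus>\<^bsub>C\<^esub> (-1) ^ p \<odot>\<^bsub>C\<^esub> (x \<otimes>\<^bsub>C\<^esub> diff C y)"
proof (cases "Suc m \<le> p")
  case True
  then have "(-1 :: rat) ^ (p - Suc m) = (-1) * (-1) ^ p" using even_m by (auto simp: minus_one_power_iff)
  then show ?thesis using C.leibniz[of x "p - Suc m" y] assms True
    by (simp add: gr_shift_def a_minus_def C.sm_uminus C.sm_assoc)
qed (use assms in \<open>auto simp: gr_shift_def a_minus_def\<close>)

lemma G_dgca: "dgca G"
proof (intro dgca.intro dgca_axioms.intro G_ratmod G_ring)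
  fix a \<gamma> \<delta> assume *: "\<gamma> \<in> carrier G" "\<delta> \<in> carrier G"
  show "(a \<odot>\<^bsub>G\<^esub> \<gamma>) \<otimes>\<^bsub>G\<^esub> \<delta> = a \<odot>\<^bsub>G\<^esub> (\<gamma> \<otimes>\<^bsub>G\<^esub> \<delta>)" "\<gamma> \<otimes>\<^bsub>G\<^esub> (a \<odot>\<^bsub>G\<^esub> \<delta>) = a \<odot>\<^bsub>G\<^esub> (\<gamma> \<otimes>\<^bsub>G\<^esub> \<delta>)"
    by (rule ext_eqI; use * in \<open>simp add: G_in C.smult_mult_left C.smult_mult_right C.sm_rdistr
      C.involution_smult\<close>)+
  show "diff G (\<gamma> \<oplus>\<^bsub>G\<^esub> \<delta>) = diff G \<gamma> \<oplus>\<^bsub>G\<^esub> diff G \<delta>"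
    by (rule ext_eqI) (use * in \<open>simp_all add: G_in C.diff_add a_minus_def C.neg_add C.add_ac\<close>)
next
  fix a \<gamma> assume *: "\<gamma> \<in> carrier G"
  show "diff G \<gamma> \<in> carrier G" by (rule G_diff_in[OF *])
  show "diff G (a \<odot>\<^bsub>G\<^esub> \<gamma>) = a \<odot>\<^bsub>G\<^esub> diff G \<gamma>"
    by (rule ext_eqI) (use * in \<open>simp_all add: G_in C.diff_smult a_minus_def C.sm_rdistr
      C.sm_uminus C.sm_assoc mult.commute\<close>)
  have "diff C (\<gamma> (W w) \<ominus>\<^bsub>C\<^esub> diff C (\<gamma> (DW w))) = diff C (\<gamma> (W w))" for w
    using * by (simp add: G_in C.diff_minus C.diff_diff) (simp add: G_in a_minus_def)
  then show "diff G (diff G \<gamma>) = \<zero>\<^bsub>G\<^esub>"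
    by (intro ext_eqI) (use * in \<open>simp_all add: G_in C.diff_diff a_minus_def C.r_neg_self\<close>)
next
  show "submodule (gr G p) rat_ring G" for p
  proof (rule ratmod.subspaceI[OF G_ratmod])
    show "gr G p \<subseteq> carrier G" by (auto simp: G_gr)
    show "\<zero>\<^bsub>G\<^esub> \<in> gr G p"
      using C.subspaceD(2)[OF gr_shift_subspace] by (auto simp: G_gr G_zero_in)
    show "\<gamma> \<oplus>\<^bsub>G\<^esub> \<delta> \<in> gr G p" if "\<gamma> \<in> gr G p" "\<delta> \<in> gr G p" for \<gamma> \<delta>
      using that C.subspaceD(3)[OF gr_shift_subspace] by (auto simp: G_gr G_add_in)
    show "a \<odot>\<^bsub>G\<^esub> \<gamma> \<in> gr G p" if "\<gamma> \<in> gr G p" for a \<gamma>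
      using that C.subspaceD(4)[OF gr_shift_subspace] by (auto simp: G_gr G_smult_in)
  qed
  show "\<one>\<^bsub>G\<^esub> \<in> gr G 0"
    by (rule G_grI) (auto simp: G_one_in C.gr_one C.subspaceD(2)[OF gr_shift_subspace])
next
  fix p q \<gamma> \<delta> assume *: "\<gamma> \<in> gr G p" "\<delta> \<in> gr G q"
  note g = G_grD[OF *(1)] and d = G_grD[OF *(2)]
  show "\<gamma> \<otimes>\<^bsub>G\<^esub> \<delta> \<in> gr G (p + q)"
  proof (rule G_grI)
    show "(\<gamma> \<otimes>\<^bsub>G\<^esub> \<delta>) Base \<in> gr C (p + q)" using g(2) d(2) by (simp add: C.gr_mult)
    show "(\<gamma> \<otimes>\<^bsub>G\<^esub> \<delta>) (W w) \<in> gr_shift C m (p + q)" for w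
      using C.subspaceD(3)[OF gr_shift_subspace gr_shift_mult_right[OF g(2) d(3)]
          gr_shift_mult_left[OF g(3) d(2)]] by simp
    show "(\<gamma> \<otimes>\<^bsub>G\<^esub> \<delta>) (DW w) \<in> gr_shift C (Suc m) (p + q)" for w
      using C.subspaceD(3)[OF gr_shift_subspace gr_shift_mult_right[OF C.gr_closed(3)[OF g(2)] d(4)]
          gr_shift_mult_left[OF g(4) d(2)]] by (simp add: C.involution_gr[OF g(2)])
  qed (rule G_mult_in[OF g(1) d(1)])
  show "\<gamma> \<otimes>\<^bsub>G\<^esub> \<delta> = (-1) ^ (p * q) \<odot>\<^bsub>G\<^esub> (\<delta> \<otimes>\<^bsub>G\<^esub> \<gamma>)"
  proof (rule ext_eqI)
    show "(\<gamma> \<otimes>\<^bsub>G\<^esub> \<delta>) Base = ((-1) ^ (p * q) \<odot>\<^bsub>G\<^esub> (\<delta> \<otimes>\<^bsub>G\<^esub> \<gamma>)) Base"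
      using C.graded_comm[OF g(2) d(2)] by simp
  next
    fix w
    have c: "\<gamma> Base \<in> carrier C" "\<delta> Base \<in> carrier C" "\<gamma> (W w) \<in> carrier C" "\<delta> (W w) \<in> carrier C"
      "\<gamma> (DW w) \<in> carrier C" "\<delta> (DW w) \<in> carrier C" using g(1) d(1) by (auto intro: G_in)
    show "(\<gamma> \<otimes>\<^bsub>G\<^esub> \<delta>) (W w) = ((-1) ^ (p * q) \<odot>\<^bsub>G\<^esub> (\<delta> \<otimes>\<^bsub>G\<^esub> \<gamma>)) (W w)"
      using shift_comm_W[OF g(2) d(3), of w] shift_comm_W[OF d(2) g(3), of w] c
      by (simp add: C.sm_rdistr C.sm_assoc mult.commute C.add_comm)
    show "(\<gamma> \<otimes>\<^bsub>G\<^esub> \<delta>) (DW w) = ((-1) ^ (p * q) \<odot>\<^bsub>G\<^esub> (\<delta> \<otimes>\<^bsub>G\<^esub> \<gamma>)) (DW w)"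
      using shift_comm_DW[OF g(2) d(4), of w] shift_comm_DW[OF d(2) g(4), of w] c
      by (simp add: C.sm_rdistr C.sm_assoc mult.commute C.add_comm)
  qed
next
  fix p \<gamma> assume *: "\<gamma> \<in> gr G p"
  note g = G_grD[OF *]
  have sh: "x \<in> gr_shift C (Suc m) (Suc p)" if "x \<in> gr_shift C m p" for x
    using that by (auto simp: gr_shift_def split: if_splits)
  show "diff G \<gamma> \<in> gr G (Suc p)"
    by (rule G_grI) (use g sh in \<open>auto simp: C.diff_gr intro!: G_diff_in gr_shift_diff
      C.subspaceD(6)[OF gr_shift_subspace]\<close>)
next
  fix p \<gamma> \<delta> assume *: "\<gamma> \<in> gr G p" "\<delta> \<in> carrier G"
  note g = G_grD[OF *(1)]
  show "diff G (\<gamma> \<otimes>\<^bsub>G\<^esub> \<delta>) = diff G \<gamma> \<otimes>\<^bsub>G\<^esub> \<delta> \<oplus>\<^bsub>G\<^esub> (-1) ^ p \<odot>\<^bsub>G\<^esub> (\<gamma> \<otimes>\<^bsub>G\<^esub> diff G \<delta>)"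
  proof (rule ext_eqI)
    show "diff G (\<gamma> \<otimes>\<^bsub>G\<^esub> \<delta>) Base =
      (diff G \<gamma> \<otimes>\<^bsub>G\<^esub> \<delta> \<oplus>\<^bsub>G\<^esub> (-1) ^ p \<odot>\<^bsub>G\<^esub> (\<gamma> \<otimes>\<^bsub>G\<^esub> diff G \<delta>)) Base"
      using C.leibniz[OF g(2)] * by (simp add: G_in)
  next
    fix w
    have c: "\<gamma> Base \<in> carrier C" "\<delta> Base \<in> carrier C" "\<gamma> (W w) \<in> carrier C" "\<delta> (W w) \<in> carrier C"
      "\<gamma> (DW w) \<in> carrier C" "\<delta> (DW w) \<in> carrier C" using g(1) *(2) by (auto intro: G_in)
    show "diff G (\<gamma> \<otimes>\<^bsub>G\<^esub> \<delta>) (W w) =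
      (diff G \<gamma> \<otimes>\<^bsub>G\<^esub> \<delta> \<oplus>\<^bsub>G\<^esub> (-1) ^ p \<odot>\<^bsub>G\<^esub> (\<gamma> \<otimes>\<^bsub>G\<^esub> diff G \<delta>)) (W w)"
      using C.leibniz[OF g(2) c(4)] shift_leibniz_W[OF g(3) c(2)] c
      by (simp add: C.diff_add C.sm_rdistr C.add_ac)
    have i: "involution C (\<gamma> Base) = (-1) ^ p \<odot>\<^bsub>C\<^esub> \<gamma> Base"
      "involution C (diff C (\<gamma> Base)) = (-1) ^ Suc p \<odot>\<^bsub>C\<^esub> diff C (\<gamma> Base)"
      using C.involution_gr[OF g(2)] C.involution_gr[OF C.diff_gr[OF g(2)]] by auto
    show "diff G (\<gamma> \<otimes>\<^bsub>G\<^esub> \<delta>) (DW w) =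
      (diff G \<gamma> \<otimes>\<^bsub>G\<^esub> \<delta> \<oplus>\<^bsub>G\<^esub> (-1) ^ p \<odot>\<^bsub>G\<^esub> (\<gamma> \<otimes>\<^bsub>G\<^esub> diff G \<delta>)) (DW w)"
      using C.leibniz[OF g(2) c(6)] shift_leibniz_DW[OF g(4) c(2)] c
      by (simp add: i C.diff_add C.diff_smult C.sm_rdistr C.mult_l_distr C.mult_r_distr
          a_minus_def C.sm_uminus C.smult_mult_left C.smult_mult_right C.sm_assoc C.add_ac)
  qed
qed

definition base_incl :: "'c \<Rightarrow> 'k ext_index \<Rightarrow> 'c" where
  "base_incl c = (\<lambda>k. if k = Base then c else \<zero>\<^bsub>C\<^esub>)"

lemma base_incl_simps [simp]:
  "base_incl c Base = c" "base_incl c (W w) = \<zero>\<^bsub>C\<^esub>" "base_incl c (DW w) = \<zero>\<^bsub>C\<^esub>"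
  by (simp_all add: base_incl_def)

lemma base_incl_in: "c \<in> carrier C \<Longrightarrow> base_incl c \<in> carrier G"
  by (rule G_carrierI[of _ "{Base}"]) (auto simp: base_incl_def)

lemma base_incl_hom: "galg_hom C G base_incl"
  unfolding galg_hom_def
proof (intro conjI ballI allI)
  show "\<And>p x. x \<in> gr C p \<Longrightarrow> base_incl x \<in> gr G p"
    by (rule G_grI) (auto simp: base_incl_in C.subspaceD(2)[OF gr_shift_subspace])
qed (auto simp: base_incl_in intro!: ext_eqI)

lemma base_incl_diff: "c \<in> carrier C \<Longrightarrow> base_incl (diff C c) = diff G (base_incl c)"
  by (rule ext_eqI) (auto simp: a_minus_def)

text \<open>A cocycle of \<open>G\<close> is exact as soon as its component in \<open>C\<close> is, as the added module is
  contractible.\<close>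
lemma disk_contractible:
  assumes "y \<in> gr G (Suc p)" "diff G y = \<zero>\<^bsub>G\<^esub>" "c \<in> gr C p" "y Base = diff C c"
  shows "\<exists>g\<in>gr G p. g Base = c \<and> diff G g = y"
proof -
  note y = G_grD[OF assms(1)]
  define g where "g k = (case k of Base \<Rightarrow> c | W w \<Rightarrow> y (DW w) | DW w \<Rightarrow> \<zero>\<^bsub>C\<^esub>)" for k
  have g [simp]: "g Base = c" "g (W w) = y (DW w)" "g (DW w) = \<zero>\<^bsub>C\<^esub>" for w
    by (simp_all add: g_def)
  have "g \<in> carrier G"
  proof (rule G_carrierI)
    let ?F = "insert Base ((\<lambda>k. case k of DW w \<Rightarrow> W w | _ \<Rightarrow> k) ` {k. y k \<noteq> \<zero>\<^bsub>C\<^esub>})"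
    show "finite ?F" using G_finite[OF y(1)] by simp
    show "g k = \<zero>\<^bsub>C\<^esub>" if "k \<notin> ?F" for k
    proof (cases k)
      case (W w)
      show ?thesis
      proof (rule ccontr)
        assume "g k \<noteq> \<zero>\<^bsub>C\<^esub>"
        then have "W w \<in> (\<lambda>k. case k of DW w \<Rightarrow> W w | _ \<Rightarrow> k) ` {k. y k \<noteq> \<zero>\<^bsub>C\<^esub>}"
          using W by (intro image_eqI[of _ _ "DW w"]) auto
        then show False using that W by blast
      qed
    qed (use that in auto)
    show "g k \<in> carrier C" for k using y(1) assms(3) by (cases k) (auto simp: G_in)
  qed (use G_outside[OF y(1)] in auto)
  then have "g \<in> gr G p"
    using assms(3) y(4) by (intro G_grI) (auto simp: gr_shift_def split: if_splits)
  moreover have "diff G g = y"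
  proof (rule ext_eqI)
    fix w
    have "diff G y (DW w) = \<zero>\<^bsub>C\<^esub>" using assms(2) by simp
    then have "y (W w) \<ominus>\<^bsub>C\<^esub> diff C (y (DW w)) = \<zero>\<^bsub>C\<^esub>" by simp
    then show "diff G g (W w) = y (W w)"
      using y(1) G_in[OF y(1)] by (simp add: C.r_right_minus_eq)
    show "diff G g (DW w) = y (DW w)" using G_in[OF y(1)] by (simp add: a_minus_def)
  qed (use assms(4) in simp)
  ultimately show ?thesis using g(1) by blast
qed

end

section \<open>Thinning out the low degrees\<close>

context cdga
begin

text \<open>Finitely supported families of coefficients for the elements of \<open>X\<close>. The coefficients are elements
  of the algebra, in contrast to those of \<open>lincomb\<close>.\<close>
definition wfam :: "'a set \<Rightarrow> ('a \<Rightarrow> 'a) \<Rightarrow> bool" where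
  "wfam X t \<longleftrightarrow> (\<forall>x. t x \<in> carrier A) \<and> finite {x. t x \<noteq> \<zero>} \<and> (\<forall>x. x \<notin> X \<longrightarrow> t x = \<zero>)"

definition wsum :: "('a \<Rightarrow> 'a) \<Rightarrow> 'a" where
  "wsum t = (\<Oplus>x\<in>{x. t x \<noteq> \<zero>}. t x \<otimes> x)"

lemma wsum_superset:
  assumes "wfam X t" "X \<subseteq> carrier A" "finite F" "{x. t x \<noteq> \<zero>} \<subseteq> F" "F \<subseteq> X"
  shows "wsum t = (\<Oplus>x\<in>F. t x \<otimes> x)"
  unfolding wsum_def
  by (rule finsum_neutral_superset) (use assms in \<open>auto simp: wfam_def\<close>)

lemma wsum_in [intro]: "wfam X t \<Longrightarrow> X \<subseteq> carrier A \<Longrightarrow> wsum t \<in> carrier A"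
  unfolding wsum_def by (rule fs_closed) (auto simp: wfam_def)

lemma wsum_zero: "wsum (\<lambda>x. \<zero>) = \<zero>"
  unfolding wsum_def by (simp add: fs_empty)

lemma wfam_add:
  assumes "wfam X t" "wfam X u"
  shows "wfam X (\<lambda>x. t x \<oplus> u x)"
proof -
  have "{x. t x \<oplus> u x \<noteq> \<zero>} \<subseteq> {x. t x \<noteq> \<zero>} \<union> {x. u x \<noteq> \<zero>}" by auto
  then have "finite {x. t x \<oplus> u x \<noteq> \<zero>}"
    by (rule finite_subset) (use assms in \<open>auto simp: wfam_def\<close>)
  then show ?thesis using assms by (auto simp: wfam_def)
qed

lemma wsum_add:
  assumes "wfam X t" "wfam X u" "X \<subseteq> carrier A"
  shows "wsum (\<lambda>x. t x \<oplus> u x) = wsum t \<oplus> wsum u"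
proof -
  let ?F = "{x. t x \<noteq> \<zero>} \<union> {x. u x \<noteq> \<zero>}"
  have F: "finite ?F" "?F \<subseteq> X" using assms by (auto simp: wfam_def)
  have c: "t x \<in> carrier A" "u x \<in> carrier A" for x using assms by (auto simp: wfam_def)
  have "wsum (\<lambda>x. t x \<oplus> u x) = (\<Oplus>x\<in>?F. (t x \<oplus> u x) \<otimes> x)"
    by (rule wsum_superset[OF wfam_add[OF assms(1,2)] assms(3) F(1) _ F(2)]) auto
  also have "\<dots> = (\<Oplus>x\<in>?F. t x \<otimes> x \<oplus> u x \<otimes> x)"
    using F assms(3) c by (intro fs_cong) (auto simp: mult_l_distr)
  also have "\<dots> = wsum t \<oplus> wsum u"
    using F assms(3) c wsum_superset[OF assms(1,3) F(1) _ F(2)] wsum_superset[OF assms(2,3) F(1) _ F(2)]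
    by (subst fs_addf) auto
  finally show ?thesis .
qed

lemma wfam_mult:
  assumes "wfam X t" "a \<in> carrier A"
  shows "wfam X (\<lambda>x. a \<otimes> t x)"
proof -
  have "{x. a \<otimes> t x \<noteq> \<zero>} \<subseteq> {x. t x \<noteq> \<zero>}" using assms by auto
  then have "finite {x. a \<otimes> t x \<noteq> \<zero>}"
    by (rule finite_subset) (use assms in \<open>auto simp: wfam_def\<close>)
  then show ?thesis using assms by (auto simp: wfam_def)
qed

lemma mult_finsum:
  assumes "finite F" "h \<in> F \<rightarrow> carrier A" "a \<in> carrier A"
  shows "a \<otimes> (\<Oplus>x\<in>F. h x) = (\<Oplus>x\<in>F. a \<otimes> h x)"
  using assms(1,2)
proof (induction F)
  case empty
  then show ?case using assms(3) by (simp add: fs_empty)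
next
  case (insert x F)
  then have "h \<in> F \<rightarrow> carrier A" "h x \<in> carrier A" "(\<lambda>x. a \<otimes> h x) \<in> F \<rightarrow> carrier A"
    using assms(3) by auto
  then show ?case using insert assms(3) by (simp add: fs_insert mult_r_distr fs_closed)
qed

lemma wsum_mult:
  assumes "wfam X t" "X \<subseteq> carrier A" "a \<in> carrier A"
  shows "wsum (\<lambda>x. a \<otimes> t x) = a \<otimes> wsum t"
proof -
  let ?F = "{x. t x \<noteq> \<zero>}"
  have F: "finite ?F" "?F \<subseteq> X" using assms by (auto simp: wfam_def)
  have c: "t x \<in> carrier A" for x using assms by (auto simp: wfam_def)
  have "wsum (\<lambda>x. a \<otimes> t x) = (\<Oplus>x\<in>?F. (a \<otimes> t x) \<otimes> x)"
    by (rule wsum_superset[OF wfam_mult[OF assms(1,3)] assms(2) F(1) _ F(2)]) (use assms(3) in auto)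
  also have "\<dots> = (\<Oplus>x\<in>?F. a \<otimes> (t x \<otimes> x))"
    using F assms(2,3) c by (intro fs_cong) (auto simp: mult_assoc)
  also have "\<dots> = a \<otimes> wsum t"
    unfolding wsum_def using F assms(2,3) c by (intro mult_finsum[symmetric]) auto
  finally show ?thesis .
qed

lemma wsum_smult:
  assumes "wfam X t" "X \<subseteq> carrier A"
  shows "wsum (\<lambda>x. q \<odot> t x) = q \<odot> wsum t"
proof -
  have "t x \<in> carrier A" for x using assms by (auto simp: wfam_def)
  then have "(\<lambda>x. q \<odot> t x) = (\<lambda>x. (q \<odot> \<one>) \<otimes> t x)" by (simp add: smult_mult_left)
  then show ?thesis
    using wsum_mult[OF assms, of "q \<odot> \<one>"] wsum_in[OF assms] by (simp add: smult_mult_left)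
qed

lemma wsum_gr:
  assumes "wfam X t" "X \<subseteq> gr A p" "\<And>x. t x \<in> gr A 0"
  shows "wsum t \<in> gr A p"
  unfolding wsum_def
proof (rule subspace_finsum[OF gr_submodule])
  show "finite {x. t x \<noteq> \<zero>}" using assms(1) by (auto simp: wfam_def)
  show "(\<lambda>x. t x \<otimes> x) ` {x. t x \<noteq> \<zero>} \<subseteq> gr A p"
    using gr_mult[OF assms(3)] assms(1,2) by (fastforce simp: wfam_def)
qed

lemma wsum_lincomb:
  assumes "Poly_Mapping.keys f \<subseteq> X" "X \<subseteq> carrier A"
  shows "wfam X (\<lambda>x. Poly_Mapping.lookup f x \<odot> \<one>)"
    "wsum (\<lambda>x. Poly_Mapping.lookup f x \<odot> \<one>) = lincomb A (\<lambda>x. x) f"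
proof -
  have s: "{x. Poly_Mapping.lookup f x \<odot> \<one> \<noteq> \<zero>} \<subseteq> Poly_Mapping.keys f"
    by (auto simp: in_keys_iff)
  then have fin: "finite {x. Poly_Mapping.lookup f x \<odot> \<one> \<noteq> \<zero>}"
    by (rule finite_subset) simp
  have z: "Poly_Mapping.lookup f x \<odot> \<one> = \<zero>" if "x \<notin> X" for x
  proof -
    have "Poly_Mapping.lookup f x = 0" using that assms(1) by (auto simp: in_keys_iff)
    then show ?thesis by simp
  qed
  show 1: "wfam X (\<lambda>x. Poly_Mapping.lookup f x \<odot> \<one>)" using fin z by (auto simp: wfam_def)
  have "wsum (\<lambda>x. Poly_Mapping.lookup f x \<odot> \<one>) =
      (\<Oplus>x\<in>Poly_Mapping.keys f. (Poly_Mapping.lookup f x \<odot> \<one>) \<otimes> x)"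
    by (rule wsum_superset[OF 1 assms(2) _ s assms(1)]) simp
  also have "\<dots> = lincomb A (\<lambda>x. x) f"
    unfolding lincomb_def using assms by (intro fs_cong) (auto simp: smult_mult_left subset_iff)
  finally show "wsum (\<lambda>x. Poly_Mapping.lookup f x \<odot> \<one>) = lincomb A (\<lambda>x. x) f" .
qed

lemma wfam_constants:
  assumes "wfam X t" "\<And>x. \<exists>q. t x = q \<odot> \<one>"
  obtains f where "Poly_Mapping.keys f \<subseteq> X" "t = (\<lambda>x. Poly_Mapping.lookup f x \<odot> \<one>)"
proof -
  obtain q where q: "\<And>x. t x = q x \<odot> \<one>" using assms(2) by metis
  define q' where "q' x = (if t x = \<zero> then 0 else q x)" for x
  have s: "{x. q' x \<noteq> 0} \<subseteq> {x. t x \<noteq> \<zero>}" by (auto simp: q'_def)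
  have fin: "finite {x. q' x \<noteq> 0}"
    by (rule finite_subset[OF s]) (use assms(1) in \<open>auto simp: wfam_def\<close>)
  define f where "f = Abs_poly_mapping q'"
  have lf: "Poly_Mapping.lookup f = q'" unfolding f_def using fin by simp
  have "Poly_Mapping.keys f \<subseteq> X"
    using s assms(1) by (auto simp: in_keys_iff lf wfam_def)
  moreover have "t = (\<lambda>x. Poly_Mapping.lookup f x \<odot> \<one>)"
  proof
    fix x show "t x = Poly_Mapping.lookup f x \<odot> \<one>"
      unfolding lf q'_def using q[of x] by auto
  qed
  ultimately show ?thesis by (rule that)
qed

end

(* Quantifiers over the indices of the generators are kept over pairs. *)
declare split_paired_All [simp del] split_paired_Ex [simp del]

text \<open>Let \<open>S\<close> be a connected sub-cdga of \<open>C\<close> such that \<open>C / S\<close> has no cohomology up to degree \<open>m\<close>.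
  After enlarging \<open>C\<close> by a contractible module there is a quasi-isomorphic sub-cdga \<open>E\<close> that agrees
  with \<open>S\<close> up to degree \<open>m\<close> and is everything above degree \<open>m + 1\<close>. The point is to choose \<open>E\<close> in
  degree \<open>m + 1\<close>: modulo \<open>S\<close> it has to be an \<open>S\<^sup>0\<close>-submodule that is a complement of the
  coboundaries. If \<open>S\<^sup>0 = \<rat>\<close>, any complement of the coboundaries does. In general take elements
  \<open>b + dw\<^sub>b\<close> with \<open>b\<close> in a basis \<open>B0\<close> of such a complement. Now \<open>s (b + dw\<^sub>b)\<close>, with \<open>s\<close> of degree \<open>0\<close>,
  involves \<open>s dw\<^sub>b \<sim> - ds w\<^sub>b\<close>, and to reach all elements \<open>c w\<^sub>b\<close> with \<open>c\<close> of degree \<open>1\<close> one also needs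
  elements \<open>h w\<^sub>b + dw\<^sub>h\<^sub>b\<close> with \<open>h\<close> in a basis \<open>BH\<close> of a complement of \<open>d S\<^sup>0\<close> in degree \<open>1\<close>, and so on.
  Hence the generators \<open>w\<close> are indexed by an element of \<open>B0\<close> and a list over \<open>BH\<close>.\<close>
locale thinning = C: cdga C for C :: "('c, 'm) cdga_scheme" (structure) +
  fixes S :: "nat \<Rightarrow> 'c set" and m :: nat and BH B0 :: "'c set"
  assumes S_sub: "\<And>p. submodule (S p) rat_ring C"
    and S_gr: "\<And>p. S p \<subseteq> gr C p"
    and S_one: "\<one> \<in> S 0"
    and S_mult: "\<And>p q x y. x \<in> S p \<Longrightarrow> y \<in> S q \<Longrightarrow> x \<otimes> y \<in> S (p + q)"
    and S_diff: "\<And>p x. x \<in> S p \<Longrightarrow> diff C x \<in> S (Suc p)"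
    and S_conn: "\<And>x. x \<in> S 0 \<Longrightarrow> diff C x = \<zero> \<Longrightarrow> \<exists>a. x = a \<odot> \<one>"
    and S_exact: "\<And>p c. p \<le> m \<Longrightarrow> c \<in> gr C p \<Longrightarrow> diff C c \<in> S (Suc p) \<Longrightarrow>
      \<exists>s\<in>S p. \<exists>b\<in>coboundaries C p. c = s \<oplus> b"
    and m_even: "even m"
    and BH_gr: "BH \<subseteq> gr C 1"
    and BH_span: "\<And>c. c \<in> gr C 1 \<Longrightarrow>
      \<exists>f. Poly_Mapping.keys f \<subseteq> BH \<and> c \<ominus> lincomb C (\<lambda>x. x) f \<in> diff C ` S 0"
    and BH_indep: "\<And>f. Poly_Mapping.keys f \<subseteq> BH \<Longrightarrow>
      lincomb C (\<lambda>x. x) f \<in> diff C ` S 0 \<Longrightarrow> f = 0"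
    and B0_gr: "B0 \<subseteq> gr C (Suc m)"
    and B0_span: "\<And>c. c \<in> gr C (Suc m) \<Longrightarrow> \<exists>f. Poly_Mapping.keys f \<subseteq> B0 \<and>
      c \<ominus> lincomb C (\<lambda>x. x) f \<in> {s \<oplus> diff C c |s c. s \<in> S (Suc m) \<and> c \<in> gr C m}"
    and B0_indep: "\<And>f. Poly_Mapping.keys f \<subseteq> B0 \<Longrightarrow>
      lincomb C (\<lambda>x. x) f \<in> {s \<oplus> diff C c |s c. s \<in> S (Suc m) \<and> c \<in> gr C m} \<Longrightarrow> f = 0"
begin

definition lists :: "('c \<times> 'c list) set" where
  "lists = {(b, hs). b \<in> B0 \<and> set hs \<subseteq> BH}"

sublocale disk_extension C m lists
  using m_even by unfold_locales

sublocale G: dgca G by (rule G_dgca)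

lemmas S_closed = C.subspaceD(2-6)[OF S_sub]

lemma S_in: "x \<in> S p \<Longrightarrow> x \<in> carrier C"
  using S_gr by blast

lemma S_const: "a \<odot> \<one> \<in> S 0"
  using S_one S_closed(3) by blast

lemma BH_in: "BH \<subseteq> carrier C" and B0_in: "B0 \<subseteq> carrier C"
  using BH_gr B0_gr by auto

lemma wfam_W: "\<gamma> \<in> carrier G \<Longrightarrow> C.wfam BH (\<lambda>h. \<gamma> (DW (b, h # hs)))"
proof -
  assume g: "\<gamma> \<in> carrier G"
  have "finite ((\<lambda>h. DW (b, h # hs)) -` {k. \<gamma> k \<noteq> \<zero>})"
    by (rule finite_vimageI[OF G_finite[OF g]]) (auto intro: injI)
  moreover have "\<gamma> (DW (b, h # hs)) = \<zero>" if "h \<notin> BH" for h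
    using G_outside[OF g, of "(b, h # hs)"] that by (auto simp: lists_def)
  ultimately show ?thesis using G_in[OF g] by (auto simp: C.wfam_def vimage_def)
qed

lemma wfam_B: "\<gamma> \<in> carrier G \<Longrightarrow> C.wfam B0 (\<lambda>b. \<gamma> (DW (b, [])))"
proof -
  assume g: "\<gamma> \<in> carrier G"
  have "finite ((\<lambda>b. DW (b, [])) -` {k. \<gamma> k \<noteq> \<zero>})"
    by (rule finite_vimageI[OF G_finite[OF g]]) (auto intro: injI)
  moreover have "\<gamma> (DW (b, [])) = \<zero>" if "b \<notin> B0" for b
    using G_outside[OF g, of "(b, [])"] that by (auto simp: lists_def)
  ultimately show ?thesis using G_in[OF g] by (auto simp: C.wfam_def vimage_def)
qed

text \<open>In degree \<open>m + 1\<close> the coefficients \<open>t\<close> of the \<open>dw\<close> are arbitrary elements of \<open>S\<^sup>0\<close> and determine the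
  rest modulo \<open>S\<close>: these are the combinations, with coefficients \<open>t\<close>, of the elements \<open>b + dw\<^sub>b\<close> and
  \<open>h w + dw\<^sub>h\<^sub>w\<close>.\<close>
definition E :: "nat \<Rightarrow> (('c \<times> 'c list) ext_index \<Rightarrow> 'c) set" where
  "E p = (if p \<le> m then base_incl ` S p else if p = Suc m then
     {\<gamma> \<in> gr G (Suc m). (\<forall>w. \<gamma> (DW w) \<in> S 0) \<and>
        (\<forall>b hs. \<gamma> (W (b, hs)) = C.wsum (\<lambda>h. \<gamma> (DW (b, h # hs)))) \<and>
        \<gamma> Base \<ominus> C.wsum (\<lambda>b. \<gamma> (DW (b, []))) \<in> S (Suc m)}
     else gr G p)"

lemma E_low: "p \<le> m \<Longrightarrow> E p = base_incl ` S p"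
  and E_high: "Suc m < p \<Longrightarrow> E p = gr G p"
  by (simp_all add: E_def)

lemma E_mid: "\<gamma> \<in> E (Suc m) \<longleftrightarrow> \<gamma> \<in> gr G (Suc m) \<and> (\<forall>w. \<gamma> (DW w) \<in> S 0) \<and>
        (\<forall>b hs. \<gamma> (W (b, hs)) = C.wsum (\<lambda>h. \<gamma> (DW (b, h # hs)))) \<and>
        \<gamma> Base \<ominus> C.wsum (\<lambda>b. \<gamma> (DW (b, []))) \<in> S (Suc m)"
  by (simp add: E_def)

lemma incl_gr: "s \<in> S p \<Longrightarrow> base_incl s \<in> gr G p"
  using galg_homD(6)[OF base_incl_hom] S_gr by blast

lemma E_gr: "E p \<subseteq> gr G p"
  using incl_gr by (auto simp: E_def)

lemma E_incl: "s \<in> S p \<Longrightarrow> base_incl s \<in> E p"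
proof -
  assume s: "s \<in> S p"
  consider "p \<le> m" | "p = Suc m" | "Suc m < p" by linarith
  then show ?thesis
  proof cases
    case 2
    then show ?thesis using s incl_gr[OF s] S_in[OF s] S_closed(1)
      by (auto simp: E_mid C.wsum_zero a_minus_def)
  qed (use s incl_gr E_low E_high in auto)
qed

lemma minus_add_minus:
  assumes "a \<in> carrier C" "b \<in> carrier C" "c \<in> carrier C" "d \<in> carrier C"
  shows "(a \<oplus> b) \<ominus> (c \<oplus> d) = (a \<ominus> c) \<oplus> (b \<ominus> d)"
  using assms by (simp add: a_minus_def C.neg_add C.add_ac)

lemma smult_minus:
  assumes "a \<in> carrier C" "b \<in> carrier C"
  shows "q \<odot> (a \<ominus> b) = q \<odot> a \<ominus> q \<odot> b"
  using assms by (simp add: a_minus_def C.sm_rdistr C.sm_uminus C.sm_assoc mult.commute)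

lemma mult_minus:
  assumes "x \<in> carrier C" "a \<in> carrier C" "b \<in> carrier C"
  shows "x \<otimes> (a \<ominus> b) = x \<otimes> a \<ominus> x \<otimes> b"
  using assms by (simp add: a_minus_def C.mult_r_distr C.sm_uminus C.smult_mult_right)

lemma neg_minus_add:
  assumes "a \<in> carrier C" "b \<in> carrier C"
  shows "\<ominus> (a \<ominus> b) \<oplus> a = b"
proof -
  have "\<ominus> (a \<ominus> b) = b \<oplus> \<ominus> a"
    using assms by (simp add: a_minus_def C.neg_add C.neg_neg C.add_comm)
  then show ?thesis using assms by (simp add: C.add_assoc C.l_neg_self)
qed

lemma E_sub: "submodule (E p) rat_ring G"
proof (rule G.subspaceI)
  show "E p \<subseteq> carrier G" using E_gr by (auto simp: G_gr)
  show "\<zero>\<^bsub>G\<^esub> \<in> E p"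
  proof -
    have "\<zero>\<^bsub>G\<^esub> = base_incl \<zero>" by (rule ext_eqI) auto
    then show ?thesis using E_incl S_closed(1) by simp
  qed
  show "\<gamma> \<oplus>\<^bsub>G\<^esub> \<delta> \<in> E p" if *: "\<gamma> \<in> E p" "\<delta> \<in> E p" for \<gamma> \<delta>
  proof -
    have c: "\<gamma> \<in> gr G p" "\<delta> \<in> gr G p" "\<gamma> \<in> carrier G" "\<delta> \<in> carrier G"
      using * E_gr by auto
    consider "p \<le> m" | "p = Suc m" | "Suc m < p" by linarith
    then show ?thesis
    proof cases
      case 1
      then obtain s t where st: "s \<in> S p" "t \<in> S p" "\<gamma> = base_incl s" "\<delta> = base_incl t"
        using * by (auto simp: E_low)
      then have "\<gamma> \<oplus>\<^bsub>G\<^esub> \<delta> = base_incl (s \<oplus> t)"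
        using galg_homD(3)[OF base_incl_hom] S_in by auto
      then show ?thesis using st S_closed(2) E_incl by simp
    next
      case 2
      note w = wfam_W[OF c(3)] wfam_W[OF c(4)] wfam_B[OF c(3)] wfam_B[OF c(4)]
      have "(\<gamma> Base \<oplus> \<delta> Base) \<ominus> C.wsum (\<lambda>b. \<gamma> (DW (b, [])) \<oplus> \<delta> (DW (b, []))) =
        (\<gamma> Base \<ominus> C.wsum (\<lambda>b. \<gamma> (DW (b, [])))) \<oplus> (\<delta> Base \<ominus> C.wsum (\<lambda>b. \<delta> (DW (b, []))))"
        unfolding C.wsum_add[OF w(3,4) B0_in] using w(3,4) B0_in c(3,4)
        by (intro minus_add_minus) (auto intro: G_in C.wsum_in)
      then show ?thesis
        using * 2 c G.gr_closed(2) S_closed(2) C.wsum_add[OF w(1,2) BH_in]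
        by (auto simp: E_mid)
    qed (use * E_high G.gr_closed(2) in auto)
  qed
  show "a \<odot>\<^bsub>G\<^esub> \<gamma> \<in> E p" if *: "\<gamma> \<in> E p" for a \<gamma>
  proof -
    have c: "\<gamma> \<in> gr G p" "\<gamma> \<in> carrier G" using * E_gr by auto
    consider "p \<le> m" | "p = Suc m" | "Suc m < p" by linarith
    then show ?thesis
    proof cases
      case 1
      then obtain s where st: "s \<in> S p" "\<gamma> = base_incl s" using * by (auto simp: E_low)
      then have "a \<odot>\<^bsub>G\<^esub> \<gamma> = base_incl (a \<odot> s)"
        using galg_homD(5)[OF base_incl_hom] S_in by auto
      then show ?thesis using st S_closed(3) E_incl by simp
    next
      case 2
      note w = wfam_W[OF c(2)] wfam_B[OF c(2)]
      have "a \<odot> \<gamma> Base \<ominus> C.wsum (\<lambda>b. a \<odot> \<gamma> (DW (b, []))) =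
        a \<odot> (\<gamma> Base \<ominus> C.wsum (\<lambda>b. \<gamma> (DW (b, []))))"
        unfolding C.wsum_smult[OF w(2) B0_in] using w(2) B0_in c(2)
        by (intro smult_minus[symmetric]) (auto intro: G_in C.wsum_in)
      then show ?thesis
        using * 2 c G.gr_closed(3) S_closed(3) C.wsum_smult[OF w(1) BH_in]
        by (auto simp: E_mid)
    qed (use * E_high G.gr_closed(3) in auto)
  qed
qed

lemmas E_closed = G.subspaceD(2-6)[OF E_sub]

text \<open>The only product that has to be examined. Elements of degrees that add up to at most \<open>m\<close> have
  their product in \<open>S\<close>, nothing is required above degree \<open>m + 1\<close>, and if two elements of positive
  degree have a product of degree \<open>m + 1\<close>, then both lie in \<open>S\<close>.\<close>
lemma E_mult_left:
  assumes "s \<in> S 0" "\<gamma> \<in> E (Suc m)"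
  shows "base_incl s \<otimes>\<^bsub>G\<^esub> \<gamma> \<in> E (Suc m)"
proof -
  have c: "\<gamma> \<in> gr G (Suc m)" "\<gamma> \<in> carrier G" "s \<in> carrier C" "s \<in> gr C 0"
    using assms E_gr[of "Suc m"] S_gr[of 0] by auto
  note w = wfam_W[OF c(2)] wfam_B[OF c(2)]
  have i: "involution C s = s" using C.involution_gr[OF c(4)] c(3) by simp
  have b: "s \<otimes> \<gamma> Base \<ominus> C.wsum (\<lambda>b. s \<otimes> \<gamma> (DW (b, []))) =
    s \<otimes> (\<gamma> Base \<ominus> C.wsum (\<lambda>b. \<gamma> (DW (b, []))))"
    unfolding C.wsum_mult[OF w(2) B0_in c(3)] using w(2) B0_in c(2,3)
    by (intro mult_minus[symmetric]) (auto intro: G_in C.wsum_in)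
  have g: "\<gamma> Base \<ominus> C.wsum (\<lambda>b. \<gamma> (DW (b, []))) \<in> S (Suc m)" "\<And>w. \<gamma> (DW w) \<in> S 0"
    "\<And>b hs. \<gamma> (W (b, hs)) = C.wsum (\<lambda>h. \<gamma> (DW (b, h # hs)))"
    using assms(2) by (simp_all add: E_mid)
  have p: "s \<otimes> C.wsum (\<lambda>h. \<gamma> (DW (b, h # hs))) \<in> carrier C" for b hs
    using C.wsum_in[OF w(1) BH_in] c(3) by simp
  have "base_incl s \<otimes>\<^bsub>G\<^esub> \<gamma> \<in> gr G (0 + Suc m)" using incl_gr[OF assms(1)] c(1) by (rule G.gr_mult)
  moreover have "s \<otimes> \<gamma> (DW w) \<in> S 0" for w using S_mult[OF assms(1) g(2)] by simp
  moreover have "s \<otimes> (\<gamma> Base \<ominus> C.wsum (\<lambda>b. \<gamma> (DW (b, [])))) \<in> S (Suc m)"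
    using S_mult[OF assms(1) g(1)] by simp
  ultimately show ?thesis
    using c g(3) C.wsum_mult[OF w(1) BH_in c(3)] p
    by (simp add: E_mid i b G_in)
qed

lemma E_mult:
  assumes "\<gamma> \<in> E p" "\<delta> \<in> E q"
  shows "\<gamma> \<otimes>\<^bsub>G\<^esub> \<delta> \<in> E (p + q)"
proof -
  have c: "\<gamma> \<in> gr G p" "\<delta> \<in> gr G q" using assms E_gr by auto
  consider "p \<le> m" "q \<le> m" "p + q \<le> Suc m" | "Suc m < p + q"
    | "p = Suc m" "q = 0" | "p = 0" "q = Suc m" by linarith
  then show ?thesis
  proof cases
    case 1
    then obtain s t where st: "s \<in> S p" "t \<in> S q" "\<gamma> = base_incl s" "\<delta> = base_incl t"
      using assms by (auto simp: E_low)
    then have "\<gamma> \<otimes>\<^bsub>G\<^esub> \<delta> = base_incl (s \<otimes> t)"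
      using galg_homD(4)[OF base_incl_hom] S_in by auto
    then show ?thesis using st S_mult E_incl by simp
  next
    case 2
    then show ?thesis using E_high G.gr_mult[OF c] by simp
  next
    case 3
    then obtain t where t: "t \<in> S 0" "\<delta> = base_incl t" using assms by (auto simp: E_low)
    have "\<gamma> \<otimes>\<^bsub>G\<^esub> \<delta> = \<delta> \<otimes>\<^bsub>G\<^esub> \<gamma>"
      using G.graded_comm[OF c] 3 c G_mult_in by simp
    then show ?thesis using E_mult_left[OF t(1)] t(2) assms(1) 3 by simp
  next
    case 4
    then obtain t where t: "t \<in> S 0" "\<gamma> = base_incl t" using assms by (auto simp: E_low)
    then show ?thesis using E_mult_left[OF t(1)] assms(2) 4 by simp
  qed
qed

text \<open>If \<open>t\<close> are the \<open>dw\<close>-coefficients of an element \<open>e\<close> of \<open>E\<close> of degree \<open>m + 1\<close>, then \<open>defect t\<close> are the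
  \<open>w\<close>-coefficients of \<open>e - d (\<Sum>w. w t\<^sub>w)\<close>, which has no \<open>dw\<close>-coefficients. So the elements of \<open>E\<close> represent
  all classes modulo coboundaries if the equation \<open>defect t = r\<close> can be solved.\<close>

definition sfam :: "('c \<times> 'c list \<Rightarrow> 'c) \<Rightarrow> bool" where
  "sfam t \<longleftrightarrow> (\<forall>w. t w \<in> S 0) \<and> finite {w. t w \<noteq> \<zero>} \<and> (\<forall>w. w \<notin> lists \<longrightarrow> t w = \<zero>)"

definition defect :: "('c \<times> 'c list \<Rightarrow> 'c) \<Rightarrow> 'c \<times> 'c list \<Rightarrow> 'c" where
  "defect t w = (case w of (b, hs) \<Rightarrow> C.wsum (\<lambda>h. t (b, h # hs)) \<ominus> diff C (t (b, hs)))"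

lemma sfam_wfam: "sfam t \<Longrightarrow> C.wfam BH (\<lambda>h. t (b, h # hs))" "sfam t \<Longrightarrow> C.wfam B0 (\<lambda>b. t (b, []))"
proof -
  assume t: "sfam t"
  have "finite ((\<lambda>h. (b, h # hs)) -` {w. t w \<noteq> \<zero>})" "finite ((\<lambda>b. (b, [])) -` {w. t w \<noteq> \<zero>})"
    using t unfolding sfam_def by (blast intro!: finite_vimageI injI)+
  moreover have "t (b, h # hs) = \<zero>" if "h \<notin> BH" for h
    using t that by (auto simp: sfam_def lists_def)
  moreover have "t (b, []) = \<zero>" if "b \<notin> B0" for b
    using t that by (auto simp: sfam_def lists_def)
  ultimately show "C.wfam BH (\<lambda>h. t (b, h # hs))" "C.wfam B0 (\<lambda>b. t (b, []))"
    using t S_in[of _ 0] by (auto simp: C.wfam_def sfam_def vimage_def)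
qed

lemma sfam_add:
  assumes "sfam t" "sfam u"
  shows "sfam (\<lambda>w. t w \<oplus> u w)"
proof -
  have "{w. t w \<oplus> u w \<noteq> \<zero>} \<subseteq> {w. t w \<noteq> \<zero>} \<union> {w. u w \<noteq> \<zero>}" by auto
  then have "finite {w. t w \<oplus> u w \<noteq> \<zero>}"
    by (rule finite_subset) (use assms in \<open>auto simp: sfam_def\<close>)
  then show ?thesis using assms S_closed(2) by (auto simp: sfam_def)
qed

lemma defect_add:
  assumes "sfam t" "sfam u"
  shows "defect (\<lambda>w. t w \<oplus> u w) w = defect t w \<oplus> defect u w"
proof -
  obtain b hs where w: "w = (b, hs)" by (cases w)
  have c: "t w \<in> carrier C" "u w \<in> carrier C" for w
    using assms S_in[of _ 0] unfolding sfam_def by blast+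
  show ?thesis
    unfolding defect_def w prod.case C.wsum_add[OF sfam_wfam(1)[OF assms(1)] sfam_wfam(1)[OF assms(2)] BH_in]
      C.diff_add[OF c]
    by (rule minus_add_minus)
      (use c C.wsum_in[OF sfam_wfam(1)[OF assms(1)] BH_in]
        C.wsum_in[OF sfam_wfam(1)[OF assms(2)] BH_in] in auto)
qed

text \<open>Write \<open>x = \<Sum>h. f\<^sub>h h + ds\<close>. The coefficients \<open>f\<^sub>h\<close> at \<open>(b, h # hs)\<close> and \<open>- s\<close> at \<open>(b, hs)\<close> produce \<open>x\<close> at \<open>(b, hs)\<close>.
  They also produce a multiple of the first element of \<open>hs\<close> at the tail of \<open>hs\<close>, which is removed
  by induction on \<open>hs\<close>.\<close>
lemma defect_solve_single:
  assumes "b \<in> B0" "set hs \<subseteq> BH" "x \<in> gr C 1"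
  shows "\<exists>t. sfam t \<and> (\<forall>w. defect t w = (if w = (b, hs) then x else \<zero>))"
  using assms(2,3)
proof (induction hs arbitrary: x)
  have main: "\<exists>t s. sfam t \<and> s \<in> S 0 \<and> (\<forall>w. defect t w = (if w = (b, hs) then x
      else if hs \<noteq> [] \<and> w = (b, tl hs) then \<ominus> s \<otimes> hd hs else \<zero>))"
    if hs: "set hs \<subseteq> BH" and x: "x \<in> gr C 1" for x hs
  proof -
    obtain f s where f: "Poly_Mapping.keys f \<subseteq> BH" "s \<in> S 0" "x \<ominus> lincomb C (\<lambda>x. x) f = diff C s"
      using BH_span[OF x] by blast
    have sc: "s \<in> carrier C" using f(2) S_in by blast
    have lc: "lincomb C (\<lambda>x. x) f \<in> carrier C" using f(1) BH_in by (auto intro!: C.lincomb_closed)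
    have xc: "x \<in> carrier C" using x by blast
    have xe: "lincomb C (\<lambda>x. x) f \<ominus> diff C (\<ominus> s) = x"
    proof -
      have "lincomb C (\<lambda>x. x) f \<ominus> diff C (\<ominus> s) = lincomb C (\<lambda>x. x) f \<oplus> diff C s"
        using sc lc by (simp add: C.diff_uminus a_minus_def C.neg_neg)
      also have "\<dots> = x" unfolding f(3)[symmetric] a_minus_def
        using lc xc by (simp add: C.add_ac C.r_neg_self)
      finally show ?thesis .
    qed
    define t where "t w = (case w of (b', ks) \<Rightarrow> if b' \<noteq> b then \<zero> else if ks = hs then \<ominus> s
      else (case ks of [] \<Rightarrow> \<zero> | h # ks' \<Rightarrow> if ks' = hs then Poly_Mapping.lookup f h \<odot> \<one> else \<zero>))"
      for w
    have k0: "h \<in> Poly_Mapping.keys f" if "Poly_Mapping.lookup f h \<odot> \<one> \<noteq> \<zero>" for h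
      using that by (cases "Poly_Mapping.lookup f h = 0") (auto simp: in_keys_iff)
    have tsupp: "{w. t w \<noteq> \<zero>} \<subseteq> insert (b, hs) ((\<lambda>h. (b, h # hs)) ` Poly_Mapping.keys f)"
      using k0 by (auto simp: t_def split: if_splits list.splits)
    have "t w \<in> S 0" for w
      using f(2) S_closed S_const by (auto simp: t_def split: prod.splits list.splits)
    moreover have "t w = \<zero>" if "w \<notin> lists" for w
      using that tsupp assms(1) hs f(1) by (force simp: lists_def)
    ultimately have sf: "sfam t"
      using tsupp by (auto simp: sfam_def intro: finite_subset)
    have def_t: "defect t (b', ks) = (if (b', ks) = (b, hs) then x
      else if hs \<noteq> [] \<and> (b', ks) = (b, tl hs) then \<ominus> s \<otimes> hd hs else \<zero>)" for b' ks
    proof (cases "b' = b")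
      case False
      then show ?thesis by (simp add: defect_def t_def C.wsum_zero a_minus_def)
    next
      case b: True
      show ?thesis
      proof (cases "ks = hs")
        case True
        have "(\<lambda>h. t (b, h # hs)) = (\<lambda>h. Poly_Mapping.lookup f h \<odot> \<one>)" by (auto simp: t_def)
        then have "defect t (b, hs) = lincomb C (\<lambda>x. x) f \<ominus> diff C (\<ominus> s)"
          using C.wsum_lincomb(2)[OF f(1) BH_in] by (simp add: defect_def) (simp add: t_def)
        then show ?thesis using b True xe by simp
      next
        case ks: False
        have dt: "diff C (t (b, ks)) = \<zero>"
          using ks by (auto simp: t_def C.diff_smult split: list.splits)
        show ?thesis
        proof (cases "hs \<noteq> [] \<and> ks = tl hs")
          case True
          then have hks: "hs = hd hs # ks" by simp
          have "(\<lambda>h. t (b, h # ks)) = (\<lambda>h. if h = hd hs then \<ominus> s else \<zero>)"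
            using hks ks by (auto simp: t_def fun_eq_iff)
          moreover have hd: "hd hs \<in> BH" using hs hks by (metis list.set_intros(1) subsetD)
          have supp: "{h. (if h = hd hs then \<ominus> s else \<zero>) \<noteq> \<zero>} \<subseteq> {hd hs}" by auto
          have "finite {h. (if h = hd hs then \<ominus> s else \<zero>) \<noteq> \<zero>}"
            by (rule finite_subset[OF supp]) simp
          then have "C.wsum (\<lambda>h. if h = hd hs then \<ominus> s else \<zero>) = \<ominus> s \<otimes> hd hs"
            using C.wsum_superset[OF _ _ _ supp, of "{hd hs}"]
              hd BH_in sc by (auto simp: C.wfam_def C.fs_insert C.fs_empty)
          ultimately have "defect t (b, ks) = \<ominus> s \<otimes> hd hs"
            using dt sc hd BH_in by (auto simp: defect_def a_minus_def)
          then show ?thesis using b ks True by simp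
        next
          case False
          have "(\<lambda>h. t (b, h # ks)) = (\<lambda>h. \<zero>)" using ks False by (auto simp: t_def fun_eq_iff)
          then have "defect t (b, ks) = \<zero>"
            using dt by (simp add: defect_def C.wsum_zero a_minus_def)
          then show ?thesis using b ks False by auto
        qed
      qed
    qed
    have "defect t w = (if w = (b, hs) then x
      else if hs \<noteq> [] \<and> w = (b, tl hs) then \<ominus> s \<otimes> hd hs else \<zero>)" for w
      using def_t[of "fst w" "snd w"] by (simp only: prod.collapse)
    then show ?thesis using sf f(2) by blast
  qed
  {
    case Nil
    obtain t s where "sfam t" "\<forall>w. defect t w = (if w = (b, []) then x else \<zero>)"
      using main[OF Nil(1,2)] by auto
    then show ?case by blast
  next
    case (Cons h hs)
    obtain t s where t: "sfam t" "s \<in> S 0" "\<And>w. defect t w = (if w = (b, h # hs) then x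
      else if w = (b, hs) then \<ominus> s \<otimes> h else \<zero>)"
      using main[OF Cons.prems] by auto
    have hc: "h \<in> gr C 1" using Cons.prems BH_gr by auto
    have "s \<otimes> h \<in> gr C (0 + 1)" using t(2) S_gr hc by (intro C.gr_mult) auto
    then obtain u where u: "sfam u" "\<And>w. defect u w = (if w = (b, hs) then s \<otimes> h else \<zero>)"
      using Cons.IH[of "s \<otimes> h"] Cons.prems by auto
    have c: "s \<in> carrier C" "h \<in> carrier C" "x \<in> carrier C" using t(2) S_in hc Cons.prems by auto
    have "defect (\<lambda>w. t w \<oplus> u w) w = (if w = (b, h # hs) then x else \<zero>)" for w
      unfolding defect_add[OF t(1) u(1)] t(3) u(2)
      using c by (auto simp: C.sm_uminus C.smult_mult_left) (metis C.l_neg_self C.mult_in C.sm_uminus)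
    then show ?case using sfam_add[OF t(1) u(1)] by blast
  }
qed

lemma defect_solve:
  assumes "finite F" "\<And>w. w \<notin> F \<Longrightarrow> r w = \<zero>" "\<And>w. r w \<in> gr C 1" "\<And>w. w \<notin> lists \<Longrightarrow> r w = \<zero>"
  shows "\<exists>t. sfam t \<and> (\<forall>w. defect t w = r w)"
  using assms
proof (induction F arbitrary: r)
  case empty
  have "sfam (\<lambda>w. \<zero>)" using S_closed(1) by (simp add: sfam_def)
  moreover have "defect (\<lambda>w. \<zero>) w = r w" for w
    using empty by (cases w) (simp add: defect_def C.wsum_zero a_minus_def)
  ultimately show ?case by blast
next
  case (insert w F)
  define r' where "r' = r(w := \<zero>)"
  have "\<exists>t. sfam t \<and> (\<forall>v. defect t v = r' v)"
    by (rule insert.IH) (use insert.prems in \<open>auto simp: r'_def\<close>)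
  then obtain t where t: "sfam t" "\<And>v. defect t v = r' v" by blast
  have rc: "r v \<in> carrier C" for v using insert.prems(2) by blast
  show ?case
  proof (cases "w \<in> lists")
    case True
    then obtain b hs where bhs: "w = (b, hs)" "b \<in> B0" "set hs \<subseteq> BH" by (auto simp: lists_def)
    obtain u where u: "sfam u" "\<And>v. defect u v = (if v = w then r w else \<zero>)"
      using defect_solve_single[OF bhs(2,3) insert.prems(2)[of w]] bhs(1) by auto
    have "defect (\<lambda>v. t v \<oplus> u v) v = r v" for v
      unfolding defect_add[OF t(1) u(1)] t(2) u(2) using rc by (auto simp: r'_def)
    then show ?thesis using sfam_add[OF t(1) u(1)] by blast
  next
    case False
    then have "r' = r" using insert.prems(3) by (auto simp: r'_def fun_eq_iff)
    then show ?thesis using t by blast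
  qed
qed

text \<open>The quotient of \<open>G\<close> by \<open>E\<close> is acyclic: in degree \<open>m + 1\<close> because the complement is large
  enough, in degree \<open>m\<close> because it is small enough.\<close>
lemma E_mid_surj:
  assumes g: "g \<in> gr G (Suc m)"
  shows "\<exists>e\<in>E (Suc m). \<exists>g'\<in>gr G m. g = e \<oplus>\<^bsub>G\<^esub> diff G g'"
proof -
  note g' = G_grD[OF g]
  have gW: "g (W w) \<in> gr C 1" and gD: "g (DW w) \<in> gr C 0" for w
    using g'(3,4)[of w] by (auto simp: gr_shift_def)
  define r where "r w = g (W w) \<ominus> diff C (g (DW w))" for w
  have r1: "r w \<in> gr C 1" for w
    unfolding r_def using gW gD C.diff_gr[OF gD] by (intro C.gr_closed(5)) auto
  have "\<exists>t. sfam t \<and> (\<forall>w. defect t w = r w)"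
  proof (rule defect_solve)
    show "finite (W -` {k. g k \<noteq> \<zero>} \<union> DW -` {k. g k \<noteq> \<zero>})"
      using G_finite[OF g'(1)] unfolding finite_Un by (blast intro!: finite_vimageI injI)
    show "r w = \<zero>" if "w \<notin> W -` {k. g k \<noteq> \<zero>} \<union> DW -` {k. g k \<noteq> \<zero>}" for w
      using that by (auto simp: r_def a_minus_def)
    show "r w = \<zero>" if "w \<notin> lists" for w
      using G_outside[OF g'(1) that] by (auto simp: r_def a_minus_def)
  qed (rule r1)
  then obtain t where t: "sfam t" "\<And>w. defect t w = r w" by blast
  define c where "c = g Base \<ominus> C.wsum (\<lambda>b. t (b, []))"
  have S0: "s \<in> S 0 \<Longrightarrow> s \<in> gr C 0" for s using S_gr by blast
  have tS: "t w \<in> S 0" for w using t(1) by (simp add: sfam_def)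
  have tb: "C.wsum (\<lambda>b. t (b, [])) \<in> gr C (Suc m)"
    by (rule C.wsum_gr[OF sfam_wfam(2)[OF t(1)] B0_gr]) (use S0 tS in blast)
  have "c \<in> gr C (Suc m)" unfolding c_def using g'(2) tb by (rule C.gr_closed(5))
  then obtain f s c' where f: "Poly_Mapping.keys f \<subseteq> B0" "s \<in> S (Suc m)" "c' \<in> gr C m"
    "c \<ominus> lincomb C (\<lambda>x. x) f = s \<oplus> diff C c'" using B0_span by blast
  define u :: "'c \<times> 'c list \<Rightarrow> 'c" where "u w = (case w of (b, hs) \<Rightarrow> if hs = [] then Poly_Mapping.lookup f b \<odot> \<one> else \<zero>)" for w
  have k0: "b \<in> Poly_Mapping.keys f" if "Poly_Mapping.lookup f b \<odot> \<one> \<noteq> \<zero>" for b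
    using that by (cases "Poly_Mapping.lookup f b = 0") (auto simp: in_keys_iff)
  have usupp: "{w. u w \<noteq> \<zero>} \<subseteq> (\<lambda>b. (b, [])) ` Poly_Mapping.keys f"
    using k0 by (auto simp: u_def split: if_splits)
  have u: "sfam u"
  proof -
    have "u w \<in> S 0" for w using S_const S_closed(1) by (auto simp: u_def split: prod.splits)
    moreover have "u w = \<zero>" if "w \<notin> lists" for w
      using that usupp f(1) by (force simp: lists_def)
    ultimately show ?thesis using usupp by (auto simp: sfam_def intro: finite_subset)
  qed
  have du: "diff C (u w) = \<zero>" for w by (auto simp: u_def C.diff_smult split: prod.splits)
  have "(\<lambda>h. u (b, h # hs)) = (\<lambda>h. \<zero>)" for b hs by (simp add: u_def)
  then have defu: "defect u w = \<zero>" for w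
    using du by (cases w) (simp add: defect_def C.wsum_zero a_minus_def)
  define t' where "t' w = t w \<oplus> u w" for w
  have t': "sfam t'" unfolding t'_def by (rule sfam_add[OF t(1) u])
  have t'S: "t' w \<in> S 0" for w using t' by (simp add: sfam_def)
  have t'c: "t' w \<in> carrier C" for w using t'S S_in by blast
  have def': "defect t' w = r w" for w
    unfolding t'_def defect_add[OF t(1) u] t(2) defu using r1[of w] by (simp add: C.gr_in)
  have lc: "lincomb C (\<lambda>x. x) f \<in> carrier C" using f(1) B0_in by (auto intro!: C.lincomb_closed)
  have t'b: "C.wsum (\<lambda>b. t' (b, [])) = C.wsum (\<lambda>b. t (b, [])) \<oplus> lincomb C (\<lambda>x. x) f"
  proof -
    have "(\<lambda>b. u (b, [])) = (\<lambda>b. Poly_Mapping.lookup f b \<odot> \<one>)" by (simp add: u_def)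
    then have "C.wsum (\<lambda>b. u (b, [])) = lincomb C (\<lambda>x. x) f"
      using C.wsum_lincomb(2)[OF f(1) B0_in] by simp
    then show ?thesis unfolding t'_def
      using C.wsum_add[OF sfam_wfam(2)[OF t(1)] sfam_wfam(2)[OF u] B0_in] by simp
  qed
  define e where "e k = (case k of Base \<Rightarrow> g Base \<ominus> diff C c'
    | W w \<Rightarrow> (case w of (b, hs) \<Rightarrow> C.wsum (\<lambda>h. t' (b, h # hs))) | DW w \<Rightarrow> t' w)" for k
  have e [simp]: "e Base = g Base \<ominus> diff C c'" "e (W (b, hs)) = C.wsum (\<lambda>h. t' (b, h # hs))"
    "e (DW w) = t' w" for b hs w by (simp_all add: e_def)
  define g0 where "g0 k = (case k of Base \<Rightarrow> c' | W w \<Rightarrow> g (DW w) \<ominus> t' w | DW w \<Rightarrow> \<zero>)" for k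
  have g0 [simp]: "g0 Base = c'" "g0 (W w) = g (DW w) \<ominus> t' w" "g0 (DW w) = \<zero>" for w
    by (simp_all add: g0_def)
  have g0c: "g0 \<in> carrier G"
  proof (rule G_carrierI)
    let ?F = "insert Base (W ` (DW -` {k. g k \<noteq> \<zero>} \<union> {w. t' w \<noteq> \<zero>}))"
    have "finite (DW -` {k. g k \<noteq> \<zero>})"
      by (rule finite_vimageI[OF G_finite[OF g'(1)]]) (auto intro: injI)
    then show "finite ?F" using t' unfolding sfam_def by blast
    show "g0 k = \<zero>" if "k \<notin> ?F" for k
      using that by (cases k) (auto simp: a_minus_def)
    show "g0 k \<in> carrier C" for k
      using f(3) t'c G_in[OF g'(1)] by (cases k) auto
    show "g0 (W w) = \<zero> \<and> g0 (DW w) = \<zero>" if "w \<notin> lists" for w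
      using that G_outside[OF g'(1) that] t' by (auto simp: sfam_def a_minus_def)
  qed
  have g0g: "g0 \<in> gr G m"
    using f(3) g0c C.gr_closed(5)[OF gD S0[OF t'S]]
    by (intro G_grI) (auto simp: gr_shift_def)
  have ge: "g = e \<oplus>\<^bsub>G\<^esub> diff G g0"
  proof (rule ext_eqI)
    have "g Base \<in> carrier C" "diff C c' \<in> carrier C" using g'(2) f(3) by auto
    then show "g Base = (e \<oplus>\<^bsub>G\<^esub> diff G g0) Base"
      by (simp add: a_minus_def C.add_assoc C.l_neg_self)
    fix w :: "'c \<times> 'c list"
    obtain b hs where w: "w = (b, hs)" by (cases w)
    have cs: "g (DW w) \<in> carrier C" "t' w \<in> carrier C" "g (W w) \<in> carrier C"
      "C.wsum (\<lambda>h. t' (b, h # hs)) \<in> carrier C"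
      using G_in[OF g'(1)] t'c C.wsum_in[OF sfam_wfam(1)[OF t'] BH_in] by auto
    have "C.wsum (\<lambda>h. t' (b, h # hs)) \<ominus> diff C (t' w) = g (W w) \<ominus> diff C (g (DW w))"
      using def'[of w] by (simp add: defect_def r_def w)
    then have "g (W w) = C.wsum (\<lambda>h. t' (b, h # hs)) \<ominus> diff C (t' w) \<oplus> diff C (g (DW w))"
      using cs by (simp add: a_minus_def C.add_assoc C.l_neg_self)
    then show "g (W w) = (e \<oplus>\<^bsub>G\<^esub> diff G g0) (W w)"
      using cs by (simp add: w[symmetric] C.diff_minus) (simp add: w a_minus_def C.add_ac)
    have "t' w \<oplus> (g (DW w) \<oplus> \<ominus> t' w) = (g (DW w) \<oplus> \<ominus> t' w) \<oplus> t' w"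
      using cs by (intro C.add_comm) auto
    also have "\<dots> = g (DW w)" using cs by (simp add: C.add_assoc C.l_neg_self)
    finally show "g (DW w) = (e \<oplus>\<^bsub>G\<^esub> diff G g0) (DW w)"
      using cs by (simp add: a_minus_def)
  qed
  have eg: "e \<in> gr G (Suc m)"
  proof -
    have "e = g \<ominus>\<^bsub>G\<^esub> diff G g0"
    proof -
      have 1: "diff G g0 \<in> carrier G" by (rule G_diff_in[OF g0c])
      have "e \<in> carrier G"
      proof (rule G_carrierI)
        let ?F = "insert Base ({k. g k \<noteq> \<zero>} \<union> {k. diff G g0 k \<noteq> \<zero>})"
        have ek: "e k \<in> carrier C" for k
        proof (cases k)
          case (W w)
          then show ?thesis
            using C.wsum_in[OF sfam_wfam(1)[OF t'] BH_in] by (cases w) auto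
        qed (use g'(2) f(3) t'c in auto)
        have e0: "e k = \<zero>" if "g k = \<zero>" "diff G g0 k = \<zero>" for k
          using ge that ek[of k] by (metis C.add_zero(1) G_simps(8))
        show "finite ?F" using G_finite[OF g'(1)] G_finite[OF 1] by simp
        show "e k \<in> carrier C" for k by (rule ek)
        show "e k = \<zero>" if "k \<notin> ?F" for k using that by (intro e0) auto
        show "e (W w) = \<zero> \<and> e (DW w) = \<zero>" if "w \<notin> lists" for w
          using G_outside[OF g'(1) that] G_outside[OF 1 that] e0 by blast
      qed
      then show ?thesis using 1 ge
        by (simp add: a_minus_def G.add_assoc G.r_neg_self)
    qed
    then show ?thesis using g G.diff_gr[OF g0g] G.gr_closed(5) by simp
  qed
  have "e \<in> E (Suc m)"
  proof -
    have "e Base \<ominus> C.wsum (\<lambda>b. e (DW (b, []))) = s"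
    proof -
      have cs: "g Base \<in> carrier C" "diff C c' \<in> carrier C" "s \<in> carrier C"
        "C.wsum (\<lambda>b. t (b, [])) \<in> carrier C" using g'(2) f tb S_in by auto
      have "g Base \<ominus> C.wsum (\<lambda>b. t (b, [])) \<ominus> lincomb C (\<lambda>x. x) f = s \<oplus> diff C c'"
        using f(4) unfolding c_def .
      then have "s = g Base \<ominus> C.wsum (\<lambda>b. t (b, [])) \<ominus> lincomb C (\<lambda>x. x) f \<ominus> diff C c'"
        using cs lc by (simp add: a_minus_def C.add_assoc C.r_neg_self)
      then show ?thesis using cs lc
        by (simp add: t'b a_minus_def C.add_ac C.neg_add)
    qed
    then show ?thesis using eg t'S f(2) by (simp add: E_mid)
  qed
  then show ?thesis using ge g0g by blast
qed

text \<open>Consider the longest lists with a non-zero coefficient. At these lists the coefficients are cocycles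
  of degree \<open>0\<close>, hence constants, so their contribution to the coefficient at the tail of the list is
  a linear combination of elements of \<open>BH\<close>, or of \<open>B0\<close> if the list is empty. It lies in the subspace that
  \<open>BH\<close> or \<open>B0\<close> complements, hence vanishes.\<close>
lemma E_mid_inj:
  assumes g: "g \<in> gr G m" "diff G g \<in> E (Suc m)"
  shows "g (W w) = \<zero>"
proof (rule ccontr)
  assume nz: "g (W w) \<noteq> \<zero>"
  note g' = G_grD[OF g(1)]
  have gD: "g (DW v) = \<zero>" for v using g'(4)[of v] by (auto simp: gr_shift_def)
  define t where "t v = g (W v)" for v
  have dgD: "diff G g (DW v) = t v" for v using G_in[OF g'(1)] by (simp add: gD t_def a_minus_def)
  have ts: "sfam t"
  proof -
    have "finite (W -` {k. g k \<noteq> \<zero>})"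
      by (rule finite_vimageI[OF G_finite[OF g'(1)]]) (auto intro: injI)
    then show ?thesis
      using g(2) G_outside[OF g'(1)] dgD by (auto simp: sfam_def E_mid t_def vimage_def)
  qed
  have dt: "diff C (t (b, hs)) = C.wsum (\<lambda>h. t (b, h # hs))" for b hs
    using g(2) dgD by (auto simp: E_mid t_def)
  have base: "diff C (g Base) \<ominus> C.wsum (\<lambda>b. t (b, [])) \<in> S (Suc m)"
    using g(2) dgD by (auto simp: E_mid)
  have fin: "finite {v. t v \<noteq> \<zero>}" using ts by (simp add: sfam_def)
  define L where "L = Max ((\<lambda>v. length (snd v)) ` {v. t v \<noteq> \<zero>})"
  have Lmax: "length (snd v) \<le> L" if "t v \<noteq> \<zero>" for v
    unfolding L_def using that fin by (intro Max_ge) auto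
  have "L \<in> (\<lambda>v. length (snd v)) ` {v. t v \<noteq> \<zero>}"
    unfolding L_def using fin nz by (intro Max_in) (auto simp: t_def)
  then obtain b hs where bhs: "t (b, hs) \<noteq> \<zero>" "length hs = L" by force
  have const: "\<exists>q. t (b', ks) = q \<odot> \<one>" if "length ks = L" for b' ks
  proof -
    have "t (b', h # ks) = \<zero>" for h using Lmax[of "(b', h # ks)"] that by auto
    then have "diff C (t (b', ks)) = \<zero>" by (simp add: dt C.wsum_zero)
    then show ?thesis using ts by (intro S_conn) (auto simp: sfam_def)
  qed
  show False
  proof (cases hs)
    case Nil
    then have "\<exists>q. t (b', []) = q \<odot> \<one>" for b' using const[of "[]"] bhs(2) by simp
    then obtain f where f: "Poly_Mapping.keys f \<subseteq> B0"
      "(\<lambda>b. t (b, [])) = (\<lambda>x. Poly_Mapping.lookup f x \<odot> \<one>)"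
      using C.wfam_constants[OF sfam_wfam(2)[OF ts]] by blast
    have ws: "C.wsum (\<lambda>b. t (b, [])) = lincomb C (\<lambda>x. x) f"
      unfolding f(2) by (rule C.wsum_lincomb(2)[OF f(1) B0_in])
    have lc: "lincomb C (\<lambda>x. x) f \<in> carrier C" using f(1) B0_in by (auto intro!: C.lincomb_closed)
    have dc: "diff C (g Base) \<in> carrier C" using g'(2) by auto
    have "lincomb C (\<lambda>x. x) f = \<ominus> (diff C (g Base) \<ominus> C.wsum (\<lambda>b. t (b, []))) \<oplus> diff C (g Base)"
      unfolding ws by (rule neg_minus_add[OF dc lc, symmetric])
    then have "f = 0" using S_closed(4)[OF base] g'(2) by (intro B0_indep[OF f(1)]) blast
    then have "t (b, []) = \<zero>" using fun_cong[OF f(2), of b] by simp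
    then show False using bhs(1) Nil by simp
  next
    case (Cons h0 ks)
    then have "\<exists>q. t (b, h # ks) = q \<odot> \<one>" for h using const[of "h # ks"] bhs(2) by simp
    then obtain f where f: "Poly_Mapping.keys f \<subseteq> BH"
      "(\<lambda>h. t (b, h # ks)) = (\<lambda>x. Poly_Mapping.lookup f x \<odot> \<one>)"
      using C.wfam_constants[OF sfam_wfam(1)[OF ts]] by blast
    have "lincomb C (\<lambda>x. x) f = diff C (t (b, ks))"
      unfolding dt f(2) by (rule C.wsum_lincomb(2)[OF f(1) BH_in, symmetric])
    moreover have "t (b, ks) \<in> S 0" using ts by (simp add: sfam_def)
    ultimately have "f = 0" by (intro BH_indep[OF f(1)]) auto
    then have "t (b, h0 # ks) = \<zero>" using fun_cong[OF f(2), of h0] by simp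
    then show False using bhs(1) Cons by simp
  qed
qed

lemma E_quotient_acyclic:
  assumes g: "g \<in> gr G p" "diff G g \<in> E (Suc p)"
  shows "\<exists>e\<in>E p. \<exists>x\<in>coboundaries G p. g = e \<oplus>\<^bsub>G\<^esub> x"
proof -
  have z: "\<zero>\<^bsub>G\<^esub> \<in> coboundaries G p"
  proof (cases p)
    case (Suc q)
    then show ?thesis using G.gr_zero[of q] G.diff_zero
      by (metis coboundaries_def image_eqI nat.simps(5))
  qed (simp add: coboundaries_def)
  consider "p \<le> m" | "p = Suc m" | "Suc m < p" by linarith
  then show ?thesis
  proof cases
    case 1
    note g' = G_grD[OF g(1)]
    have gD: "g (DW v) = \<zero>" for v using g'(4)[of v] 1 by (auto simp: gr_shift_def)
    have gW: "g (W v) = \<zero>" for v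
    proof (cases "p = m")
      case True
      then show ?thesis using E_mid_inj g by simp
    qed (use g'(3)[of v] 1 in \<open>auto simp: gr_shift_def\<close>)
    have gb: "g = base_incl (g Base)" by (rule ext_eqI) (simp_all add: gD gW)
    have "diff C (g Base) \<in> S (Suc p)"
    proof (cases "p = m")
      case True
      have "diff G g (DW v) = \<zero>" for v by (simp add: gD gW a_minus_def)
      then show ?thesis using g(2) True g'(2) by (simp add: E_mid C.wsum_zero a_minus_def)
    next
      case False
      then have "diff G g \<in> base_incl ` S (Suc p)" using g(2) 1 E_low by simp
      then show ?thesis by (metis G_simps(10) base_incl_simps(1) imageE)
    qed
    then obtain s b where sb: "s \<in> S p" "b \<in> coboundaries C p" "g Base = s \<oplus> b"
      using S_exact[OF 1 g'(2)] by blast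
    have bc: "b \<in> carrier C" and bb: "base_incl b \<in> coboundaries G p"
    proof -
      show "b \<in> carrier C"
        using sb(2) by (cases p) (auto simp: coboundaries_def)
      show "base_incl b \<in> coboundaries G p"
      proof (cases p)
        case 0
        then have "base_incl b = \<zero>\<^bsub>G\<^esub>" using sb(2) by (intro ext_eqI) (auto simp: coboundaries_def)
        then show ?thesis using z by simp
      next
        case (Suc q)
        then obtain x where x: "x \<in> gr C q" "b = diff C x" using sb(2) by (auto simp: coboundaries_def)
        then have "base_incl b = diff G (base_incl x)" using base_incl_diff by auto
        then show ?thesis using Suc galg_homD(6)[OF base_incl_hom x(1)] by (auto simp: coboundaries_def)
      qed
    qed
    have "g = base_incl s \<oplus>\<^bsub>G\<^esub> base_incl b"
      using gb sb galg_homD(3)[OF base_incl_hom S_in[OF sb(1)] bc] by simp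
    then show ?thesis using E_incl[OF sb(1)] bb by blast
  next
    case 2
    then show ?thesis using E_mid_surj g(1) by (auto simp: coboundaries_def)
  next
    case 3
    then show ?thesis using g(1) z E_high by (intro bexI[of _ g] bexI[of _ "\<zero>\<^bsub>G\<^esub>"]) (auto simp: G_gr)
  qed
qed

text \<open>There is a primitive in \<open>G\<close> because the added module is contractible. It can be moved into \<open>E\<close>
  because \<open>G / E\<close> is acyclic, and this changes its component in \<open>C\<close> by a coboundary only.\<close>
lemma E_lift_primitive:
  assumes "y \<in> E (Suc p)" "diff G y = \<zero>\<^bsub>G\<^esub>" "c \<in> gr C p" "y Base = diff C c"
  shows "\<exists>e\<in>E p. diff G e = y \<and> (\<exists>b\<in>coboundaries C p. c = e Base \<oplus> b)"
proof -
  obtain g where g: "g \<in> gr G p" "g Base = c" "diff G g = y"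
    using disk_contractible[OF _ assms(2-4)] assms(1) E_gr by blast
  obtain e x where e: "e \<in> E p" "x \<in> coboundaries G p" "g = e \<oplus>\<^bsub>G\<^esub> x"
    using E_quotient_acyclic[OF g(1)] g(3) assms(1) by blast
  have ec: "e \<in> carrier G" using e(1) E_gr by auto
  have "x \<in> carrier G \<and> diff G x = \<zero>\<^bsub>G\<^esub> \<and> x Base \<in> coboundaries C p"
  proof (cases p)
    case 0
    then have "x = \<zero>\<^bsub>G\<^esub>" using e(2) by (simp add: coboundaries_def)
    then show ?thesis using 0 G.zero_in G.diff_zero by (simp add: coboundaries_def)
  next
    case (Suc q)
    then obtain u where u: "u \<in> gr G q" "x = diff G u" using e(2) by (auto simp: coboundaries_def)
    have uc: "u \<in> carrier G" using u(1) by (simp add: G_gr)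
    show ?thesis using u Suc G_grD(2)[OF u(1)] G.diff_diff[OF uc] G_diff_in[OF uc]
      by (auto simp: coboundaries_def)
  qed
  then have "diff G e = y" "c = e Base \<oplus> x Base" "x Base \<in> coboundaries C p"
    using e(3) g ec G.diff_add[OF ec] G_diff_in[OF ec] by auto
  then show ?thesis using e(1) by blast
qed

end

section \<open>Extending a morphism to a relative Sullivan algebra\<close>

text \<open>The ideal \<open>N\<close> is the kernel of a quasi-isomorphism from the relative Sullivan algebra \<open>C\<close> over \<open>T\<close>
  onto a quotient of \<open>T\<close>, and \<open>F\<close> is the filtration of the generators. The conditions are stated in terms
  of \<open>N\<close>, so that the quotient itself need not be mentioned: surjectivity of \<open>T \<rightarrow> C / N\<close> is \<open>C = T + N\<close>, and
  the condition \<open>N_T\<close> on the cohomology concerns the kernel \<open>T \<inter> N\<close> of this map.\<close>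
locale extension_problem = free_ext T C i X r + A: cdga A
  for T :: "('b, 'm) cdga_scheme" and C :: "('c, 'n) cdga_scheme" and i X r
    and A :: "('a, 'l) cdga_scheme" +
  fixes F :: "nat \<Rightarrow> 'c set" and N :: "'c set" and m :: nat and \<mu> :: "'b \<Rightarrow> 'a"
  assumes i_diff: "\<And>t. t \<in> carrier T \<Longrightarrow> i (diff T t) = diff C (i t)"
    and F_graded: "\<And>n. graded_subspace C (F n)"
    and F_mono: "\<And>n. F n \<subseteq> F (Suc n)"
    and F_union: "lspan C X = (\<Union>n. F n)"
    and F_zero: "diff C ` F 0 \<subseteq> i ` carrier T"
    and F_Suc: "\<And>n. diff C ` F (Suc n) \<subseteq> generate_ring C (i ` carrier T \<union> F n)"
    and T_conn: "\<And>t. t \<in> gr T 0 \<Longrightarrow> diff T t = \<zero>\<^bsub>T\<^esub> \<Longrightarrow> \<exists>a. t = a \<odot>\<^bsub>T\<^esub> \<one>\<^bsub>T\<^esub>"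
    and N_sub: "submodule N rat_ring C"
    and N_left: "\<And>c x. c \<in> carrier C \<Longrightarrow> x \<in> N \<Longrightarrow> c \<otimes>\<^bsub>C\<^esub> x \<in> N"
    and N_right: "\<And>c x. c \<in> carrier C \<Longrightarrow> x \<in> N \<Longrightarrow> x \<otimes>\<^bsub>C\<^esub> c \<in> N"
    and N_diff: "\<And>x. x \<in> N \<Longrightarrow> diff C x \<in> N"
    and N_acyclic: "\<And>p x. x \<in> N \<Longrightarrow> x \<in> gr C (Suc p) \<Longrightarrow> diff C x = \<zero>\<^bsub>C\<^esub> \<Longrightarrow>
      \<exists>y\<in>N \<inter> gr C p. diff C y = x"
    and N_acyclic_0: "\<And>x. x \<in> N \<Longrightarrow> x \<in> gr C 0 \<Longrightarrow> diff C x = \<zero>\<^bsub>C\<^esub> \<Longrightarrow> x = \<zero>\<^bsub>C\<^esub>"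
    and N_surj: "\<And>p c. c \<in> gr C p \<Longrightarrow> \<exists>t\<in>gr T p. c \<ominus>\<^bsub>C\<^esub> i t \<in> N"
    and N_T: "\<And>p t. p \<le> m \<Longrightarrow> t \<in> gr T (Suc p) \<Longrightarrow> i t \<in> N \<Longrightarrow> diff T t = \<zero>\<^bsub>T\<^esub> \<Longrightarrow>
      \<exists>j\<in>gr T p. i j \<in> N \<and> diff T j = t"
    and even_m: "even m"
    and \<mu>_hom: "\<mu> \<in> cdga_hom T A"
    and A_top: "\<And>p. m < p \<Longrightarrow> gr A p = {\<zero>\<^bsub>A\<^esub>}"
begin

lemmas N_closed = C.subspaceD(2-6)[OF N_sub]

lemma N_in: "x \<in> N \<Longrightarrow> x \<in> carrier C"
  using C.subspaceD(1)[OF N_sub] by blast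

definition S :: "nat \<Rightarrow> 'c set" where "S p = i ` gr T p"

text \<open>The vanishing of the cohomology of \<open>C / T\<close> up to degree \<open>m\<close>. An element of \<open>C\<close> with differential
  in \<open>T\<close> can be moved into \<open>N\<close> by subtracting an element of \<open>T\<close>. Its differential is then in \<open>T \<inter> N\<close>, where it
  is a coboundary by assumption, and what remains is a cocycle of the acyclic \<open>N\<close>.\<close>
lemma S_exact:
  assumes "p \<le> m" "c \<in> gr C p" "diff C c \<in> S (Suc p)"
  shows "\<exists>s\<in>S p. \<exists>b\<in>coboundaries C p. c = s \<oplus>\<^bsub>C\<^esub> b"
proof -
  obtain t where t: "t \<in> gr T (Suc p)" "diff C c = i t" using assms(3) by (auto simp: S_def)
  obtain s where s: "s \<in> gr T p" "c \<ominus>\<^bsub>C\<^esub> i s \<in> N" using N_surj[OF assms(2)] by blast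
  have T: "t \<in> carrier T" "s \<in> carrier T" "diff T s \<in> gr T (Suc p)" using t s T.diff_gr by auto
  have cc: "c \<in> carrier C" "i s \<in> carrier C" using assms(2) i_simps(1)[OF T(2)] by auto
  let ?t = "t \<ominus>\<^bsub>T\<^esub> diff T s"
  have it: "i ?t = diff C (c \<ominus>\<^bsub>C\<^esub> i s)"
    using galg_hom_minus[OF i_hom T.ratmod_axioms C.ratmod_axioms T(1), of "diff T s"] T cc
    by (simp add: C.diff_minus i_diff t(2))
  have "diff C (diff C c) = \<zero>\<^bsub>C\<^esub>" using cc by (simp add: C.diff_diff)
  then have "i (diff T t) = \<zero>\<^bsub>C\<^esub>" using t i_diff T by simp
  then have dt: "diff T t = \<zero>\<^bsub>T\<^esub>" using i_inj T by blast
  have "diff T ?t = \<zero>\<^bsub>T\<^esub>"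
    using T dt by (simp add: T.diff_minus T.diff_diff T.r_neg_self a_minus_def[of T "\<zero>\<^bsub>T\<^esub>"])
  moreover have "i ?t \<in> N" unfolding it using N_diff s(2) by blast
  moreover have "?t \<in> gr T (Suc p)" using t(1) T(3) by (rule T.gr_closed(5))
  ultimately obtain j where j: "j \<in> gr T p" "i j \<in> N" "diff T j = ?t"
    using N_T[OF assms(1)] by blast
  have jc: "j \<in> carrier T" "i j \<in> carrier C" "i j \<in> gr C p" "i s \<in> gr C p"
    using j i_simps(6) s(1) N_in by auto
  let ?n = "c \<ominus>\<^bsub>C\<^esub> i s \<ominus>\<^bsub>C\<^esub> i j"
  have nN: "?n \<in> N" using s(2) j(2) by (rule N_closed(5))
  have ngr: "?n \<in> gr C p" using assms(2) jc by (intro C.gr_closed(5)) auto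
  have dn: "diff C ?n = \<zero>\<^bsub>C\<^esub>"
  proof -
    have "diff C ?n = diff C (c \<ominus>\<^bsub>C\<^esub> i s) \<ominus>\<^bsub>C\<^esub> diff C (i j)"
      using cc jc by (intro C.diff_minus) auto
    also have "diff C (i j) = diff C (c \<ominus>\<^bsub>C\<^esub> i s)"
      using i_diff[OF jc(1)] j(3) it by simp
    finally show ?thesis using cc by (simp add: a_minus_def C.r_neg_self)
  qed
  have "?n \<in> coboundaries C p"
  proof (cases p)
    case 0
    then show ?thesis using N_acyclic_0[OF nN] ngr dn by (simp add: coboundaries_def)
  next
    case (Suc q)
    then obtain y where "y \<in> gr C q" "diff C y = ?n" using N_acyclic[OF nN _ dn, of q] ngr by blast
    then have "?n \<in> diff C ` gr C q" by (metis imageI)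
    then show ?thesis using Suc by (simp add: coboundaries_def)
  qed
  moreover have "i (s \<oplus>\<^bsub>T\<^esub> j) \<in> S p" unfolding S_def using s(1) j(1) T.gr_closed(2) by blast
  moreover have "c = i (s \<oplus>\<^bsub>T\<^esub> j) \<oplus>\<^bsub>C\<^esub> ?n"
  proof -
    have "i (s \<oplus>\<^bsub>T\<^esub> j) \<oplus>\<^bsub>C\<^esub> ?n = (i s \<oplus>\<^bsub>C\<^esub> i j) \<oplus>\<^bsub>C\<^esub> (c \<oplus>\<^bsub>C\<^esub> \<ominus>\<^bsub>C\<^esub> (i s \<oplus>\<^bsub>C\<^esub> i j))"
      using T jc cc by (simp add: i_simps(3) a_minus_def C.neg_add C.add_assoc)
    also have "\<dots> = c \<oplus>\<^bsub>C\<^esub> ((i s \<oplus>\<^bsub>C\<^esub> i j) \<oplus>\<^bsub>C\<^esub> \<ominus>\<^bsub>C\<^esub> (i s \<oplus>\<^bsub>C\<^esub> i j))"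
      using jc cc by (intro C.add_ac(3)) auto
    also have "\<dots> = c" using jc cc by (simp only: C.r_neg_self C.add_in C.add_zero)
    finally show ?thesis by simp
  qed
  ultimately show ?thesis by blast
qed

lemma S_sub: "submodule (S p) rat_ring C"
proof (rule C.subspaceI)
  show "S p \<subseteq> carrier C" using i_simps(1) by (auto simp: S_def)
  show "\<zero>\<^bsub>C\<^esub> \<in> S p" using i_simps(7) T.gr_zero by (metis S_def imageI)
  show "x \<oplus>\<^bsub>C\<^esub> y \<in> S p" if "x \<in> S p" "y \<in> S p" for x y
  proof -
    obtain s t where st: "s \<in> gr T p" "t \<in> gr T p" "x = i s" "y = i t" using \<open>x \<in> S p\<close> \<open>y \<in> S p\<close> by (auto simp: S_def)
    then have "x \<oplus>\<^bsub>C\<^esub> y = i (s \<oplus>\<^bsub>T\<^esub> t)" using i_simps(3) by auto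
    then show ?thesis using st T.gr_closed(2) by (auto simp: S_def)
  qed
  show "a \<odot>\<^bsub>C\<^esub> x \<in> S p" if "x \<in> S p" for a x
  proof -
    obtain s where st: "s \<in> gr T p" "x = i s" using \<open>x \<in> S p\<close> by (auto simp: S_def)
    then have "a \<odot>\<^bsub>C\<^esub> x = i (a \<odot>\<^bsub>T\<^esub> s)" using i_simps(5) by auto
    then show ?thesis using st T.gr_closed(3) by (auto simp: S_def)
  qed
qed

lemma exists_thinning: "\<exists>BH B0. thinning C S m BH B0"
proof -
  note Sc = C.subspaceD(2-4)[OF S_sub]
  have S_in: "S p \<subseteq> gr C p" for p using i_simps(6) by (auto simp: S_def)
  have S_inC: "x \<in> S p \<Longrightarrow> x \<in> carrier C" for x p using S_in by blast
  have S_diff: "diff C x \<in> S (Suc p)" if x: "x \<in> S p" for x p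
  proof -
    obtain s where st: "s \<in> gr T p" "x = i s" using x by (auto simp: S_def)
    then have "diff C x = i (diff T s)" using i_diff by auto
    then show ?thesis using st T.diff_gr by (auto simp: S_def)
  qed
  have D1: "submodule (diff C ` S 0) rat_ring C"
  proof (rule C.subspaceI)
    show "diff C ` S 0 \<subseteq> carrier C" using S_inC by auto
    show "\<zero>\<^bsub>C\<^esub> \<in> diff C ` S 0" using Sc(1)[of 0] C.diff_zero by (metis imageI)
    show "x \<oplus>\<^bsub>C\<^esub> y \<in> diff C ` S 0" if "x \<in> diff C ` S 0" "y \<in> diff C ` S 0" for x y
    proof -
      obtain s t where "s \<in> S 0" "t \<in> S 0" "x = diff C s" "y = diff C t" using \<open>x \<in> _\<close> \<open>y \<in> _\<close> by auto
      then show ?thesis using C.diff_add[of s t] Sc(2)[of s 0 t] S_inC by (metis imageI)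
    qed
    show "a \<odot>\<^bsub>C\<^esub> x \<in> diff C ` S 0" if "x \<in> diff C ` S 0" for a x
    proof -
      obtain s where "s \<in> S 0" "x = diff C s" using \<open>x \<in> _\<close> by auto
      then show ?thesis using C.diff_smult[of s a] Sc(3)[of s 0 a] S_inC by (metis imageI)
    qed
  qed
  have D1': "diff C ` S 0 \<subseteq> gr C 1" using S_diff[of _ 0] S_in[of 1] by auto
  let ?D = "{s \<oplus>\<^bsub>C\<^esub> diff C c |s c. s \<in> S (Suc m) \<and> c \<in> gr C m}"
  have D2: "submodule ?D rat_ring C"
  proof (rule C.subspaceI)
    show "?D \<subseteq> carrier C" using S_inC by auto
    show "\<zero>\<^bsub>C\<^esub> \<in> ?D"
      using Sc(1)[of "Suc m"] C.gr_zero[of m] by (intro CollectI exI[of _ "\<zero>\<^bsub>C\<^esub>"]) simp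
    show "x \<oplus>\<^bsub>C\<^esub> y \<in> ?D" if xy: "x \<in> ?D" "y \<in> ?D" for x y
    proof -
      obtain s c t d where *: "s \<in> S (Suc m)" "c \<in> gr C m" "x = s \<oplus>\<^bsub>C\<^esub> diff C c"
        "t \<in> S (Suc m)" "d \<in> gr C m" "y = t \<oplus>\<^bsub>C\<^esub> diff C d" using xy by blast
      then have "x \<oplus>\<^bsub>C\<^esub> y = (s \<oplus>\<^bsub>C\<^esub> t) \<oplus>\<^bsub>C\<^esub> diff C (c \<oplus>\<^bsub>C\<^esub> d)"
        using S_inC by (simp add: C.diff_add C.gr_in C.add_ac)
      then show ?thesis using * Sc(2) C.gr_closed(2) by blast
    qed
    show "a \<odot>\<^bsub>C\<^esub> x \<in> ?D" if xy: "x \<in> ?D" for a x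
    proof -
      obtain s c where *: "s \<in> S (Suc m)" "c \<in> gr C m" "x = s \<oplus>\<^bsub>C\<^esub> diff C c" using xy by blast
      then have "a \<odot>\<^bsub>C\<^esub> x = (a \<odot>\<^bsub>C\<^esub> s) \<oplus>\<^bsub>C\<^esub> diff C (a \<odot>\<^bsub>C\<^esub> c)"
        using S_inC by (simp add: C.diff_smult C.gr_in C.sm_rdistr)
      then show ?thesis using * Sc(3) C.gr_closed(3) by blast
    qed
  qed
  have D2': "?D \<subseteq> gr C (Suc m)"
    using S_in[of "Suc m"] C.diff_gr[of _ m] C.gr_closed(2)[of _ "Suc m"] by blast
  obtain BH where BH: "BH \<subseteq> gr C 1"
    "\<And>x. x \<in> gr C 1 \<Longrightarrow> \<exists>f. Poly_Mapping.keys f \<subseteq> BH \<and> x \<ominus>\<^bsub>C\<^esub> lincomb C (\<lambda>x. x) f \<in> diff C ` S 0"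
    "\<And>f. Poly_Mapping.keys f \<subseteq> BH \<Longrightarrow> lincomb C (\<lambda>x. x) f \<in> diff C ` S 0 \<Longrightarrow> f = 0"
    using C.complement_basis[OF C.gr_submodule[of 1] D1 D1'] by blast
  obtain B0 where B0: "B0 \<subseteq> gr C (Suc m)"
    "\<And>x. x \<in> gr C (Suc m) \<Longrightarrow> \<exists>f. Poly_Mapping.keys f \<subseteq> B0 \<and> x \<ominus>\<^bsub>C\<^esub> lincomb C (\<lambda>x. x) f \<in> ?D"
    "\<And>f. Poly_Mapping.keys f \<subseteq> B0 \<Longrightarrow> lincomb C (\<lambda>x. x) f \<in> ?D \<Longrightarrow> f = 0"
    using C.complement_basis[OF C.gr_submodule[of "Suc m"] D2 D2'] by blast
  have "thinning C S m BH B0"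
  proof (intro thinning.intro C.cdga_axioms thinning_axioms.intro)
    show "\<one>\<^bsub>C\<^esub> \<in> S 0" using i_simps(2) T.gr_one by (metis S_def imageI)
    show "x \<otimes>\<^bsub>C\<^esub> y \<in> S (p + q)" if xy: "x \<in> S p" "y \<in> S q" for p q x y
    proof -
      obtain s t where st: "s \<in> gr T p" "t \<in> gr T q" "x = i s" "y = i t"
        using xy by (auto simp: S_def)
      then have "x \<otimes>\<^bsub>C\<^esub> y = i (s \<otimes>\<^bsub>T\<^esub> t)" using i_simps(4) by auto
      then show ?thesis using st T.gr_mult by (auto simp: S_def)
    qed
    show "\<exists>a. x = a \<odot>\<^bsub>C\<^esub> \<one>\<^bsub>C\<^esub>" if x: "x \<in> S 0" "diff C x = \<zero>\<^bsub>C\<^esub>" for x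
    proof -
      obtain s where s: "s \<in> gr T 0" "x = i s" using x by (auto simp: S_def)
      have "i (diff T s) = \<zero>\<^bsub>C\<^esub>" using x s i_diff by auto
      then have "diff T s = \<zero>\<^bsub>T\<^esub>" using i_inj s by auto
      then obtain a where "s = a \<odot>\<^bsub>T\<^esub> \<one>\<^bsub>T\<^esub>" using T_conn s by blast
      then show ?thesis using s i_simps(2,5) by auto
    qed
  qed (use S_sub S_in S_diff S_exact even_m BH B0 in \<open>simp_all\<close>)
  then show ?thesis by blast
qed

end

locale thin_extension_problem = extension_problem T C i X r A F N m \<mu>
  + thin: thinning C "extension_problem.S T i" m BH B0
  for T :: "('b, 'm) cdga_scheme" and C :: "('c, 'n) cdga_scheme" and i X r
    and A :: "('a, 'l) cdga_scheme" and F N m \<mu> BH B0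
begin

abbreviation "G \<equiv> disk_ext C m thin.lists"
abbreviation "E \<equiv> thin.E"
abbreviation "incl \<equiv> thin.base_incl"

lemma incl_i_E: "t \<in> gr T p \<Longrightarrow> incl (i t) \<in> E p"
  by (rule thin.E_incl) (simp add: S_def)

lemma F_sub: "submodule (F n) rat_ring C" and F_span: "F n = lspan C (\<Union>p. F n \<inter> gr C p)"
  using F_graded[of n] unfolding graded_subspace_def by blast+

definition lev :: "'c \<Rightarrow> nat" where "lev v = (LEAST n. v \<in> F n)"

lemma lev_le: "v \<in> F n \<Longrightarrow> lev v \<le> n"
  unfolding lev_def by (rule Least_le)

lemma lev_F: "v \<in> F n \<Longrightarrow> v \<in> F (lev v)"
  unfolding lev_def by (rule LeastI)

text \<open>The words in the letters \<open>L\<close>, in any order and with repetitions, span the subalgebra generated by \<open>T\<close> and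
  \<open>L\<close>.\<close>
definition words :: "'c set \<Rightarrow> 'c set" where
  "words L = {i t \<otimes>\<^bsub>C\<^esub> word_prod C bs |t bs p. t \<in> gr T p \<and> set bs \<subseteq> L}"

end

text \<open>The basis \<open>X\<close> that exhibits \<open>C\<close> as a free extension need not be compatible with the filtration \<open>F\<close>. It is
  replaced by a homogeneous basis \<open>B\<close> such that the elements of \<open>B\<close> up to level \<open>n\<close> span \<open>F n\<close>.\<close>
locale basis_extension_problem = thin_extension_problem T C i X r A F N m \<mu> BH B0
  for T :: "('b, 'm) cdga_scheme" and C :: "('c, 'n) cdga_scheme" and i X r
    and A :: "('a, 'l) cdga_scheme" and F N m \<mu> BH B0 +
  fixes B :: "'c set"
  assumes B_indep: "C.indep B"
    and B_hom: "B \<subseteq> (\<Union>n. \<Union>p. F n \<inter> gr C p)"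
    and B_lev: "\<And>x. x \<in> (\<Union>n. \<Union>p. F n \<inter> gr C p) \<Longrightarrow> x \<in> lspan C {b \<in> B. lev b \<le> lev x}"
begin

lemma B_gr: "B \<subseteq> (\<Union>p. gr C p)" using B_hom by blast

lemma B_in: "B \<subseteq> carrier C" using B_gr by blast

lemma B_nonzero: "b \<in> B \<Longrightarrow> b \<noteq> \<zero>\<^bsub>C\<^esub>"
proof
  assume "b \<in> B" "b = \<zero>\<^bsub>C\<^esub>"
  then have "sym b = (0 :: 'c \<Rightarrow>\<^sub>0 rat)"
    using B_indep C.lincomb_sym[of "\<lambda>x. x" b] by (auto simp: C.indep_def)
  then show False by (metis keys_zero keys_single insert_not_empty zero_neq_one)
qed

lemma degree_unique: "x \<in> gr C p \<Longrightarrow> x \<in> gr C q \<Longrightarrow> x \<noteq> \<zero>\<^bsub>C\<^esub> \<Longrightarrow> p = q"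
  using C.component_gr[of x p p] C.component_gr[of x q p] by (auto split: if_splits)

lemma B_F: "b \<in> B \<Longrightarrow> b \<in> F (lev b)"
  using B_hom lev_F by blast

lemma F_lspan: "F n \<subseteq> lspan C {b \<in> B. lev b \<le> n}"
proof -
  have "(\<Union>p. F n \<inter> gr C p) \<subseteq> lspan C {b \<in> B. lev b \<le> n}"
  proof
    fix x assume x: "x \<in> (\<Union>p. F n \<inter> gr C p)"
    then have "x \<in> lspan C {b \<in> B. lev b \<le> lev x}" by (intro B_lev) blast
    moreover have "lev x \<le> n" using x lev_le by blast
    then have "{b \<in> B. lev b \<le> lev x} \<subseteq> {b \<in> B. lev b \<le> n}" by auto
    ultimately show "x \<in> lspan C {b \<in> B. lev b \<le> n}" using C.lspan_mono by blast
  qed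
  moreover have "submodule (lspan C {b \<in> B. lev b \<le> n}) rat_ring C"
    by (rule C.lspan_subspace) (use B_in in auto)
  ultimately have "lspan C (\<Union>p. F n \<inter> gr C p) \<subseteq> lspan C {b \<in> B. lev b \<le> n}"
    by (intro C.lspan_least)
  then show ?thesis using F_span[of n] by simp
qed

lemma B_span: "lspan C B = lspan C X"
proof
  have "lspan C B \<subseteq> lspan C (\<Union>n. F n)" using B_hom by (intro C.lspan_mono) blast
  also have "lspan C (\<Union>n. F n) = lspan C X"
    unfolding F_union[symmetric] by (rule C.lspan_of_subspace[OF C.lspan_subspace[OF X_in]])
  finally show "lspan C B \<subseteq> lspan C X" .
  have "lspan C {b \<in> B. lev b \<le> n} \<subseteq> lspan C B" for n by (rule C.lspan_mono) auto
  then show "lspan C X \<subseteq> lspan C B" unfolding F_union using F_lspan by blast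
qed

lemma words_in: "L \<subseteq> B \<Longrightarrow> words L \<subseteq> carrier C"
  using i_simps(1) B_in by (auto simp: words_def intro!: C.mult_in C.word_prod_in)

lemma word_prod_gr: "set bs \<subseteq> B \<Longrightarrow> \<exists>p. word_prod C bs \<in> gr C p"
proof (induction bs)
  case (Cons x bs)
  then obtain p q where "x \<in> gr C p" "word_prod C bs \<in> gr C q" using B_gr by auto
  then have "word_prod C (x # bs) \<in> gr C (p + q)" using C.gr_mult by simp
  then show ?case ..
qed (use C.gr_one in auto)

lemma words_gr: "L \<subseteq> B \<Longrightarrow> words L \<subseteq> (\<Union>p. gr C p)"
proof
  fix x assume L: "L \<subseteq> B" and "x \<in> words L"
  then obtain t bs p where x: "x = i t \<otimes>\<^bsub>C\<^esub> word_prod C bs" "t \<in> gr T p" "set bs \<subseteq> L"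
    by (auto simp: words_def)
  obtain q where "word_prod C bs \<in> gr C q" using word_prod_gr x(3) L by blast
  then have "x \<in> gr C (p + q)" using x i_simps(6) C.gr_mult by blast
  then show "x \<in> (\<Union>p. gr C p)" by blast
qed

lemma words_mult:
  assumes "L \<subseteq> B" "x \<in> words L" "y \<in> words L"
  shows "x \<otimes>\<^bsub>C\<^esub> y \<in> lspan C (words L)"
proof -
  obtain t bs p where x: "x = i t \<otimes>\<^bsub>C\<^esub> word_prod C bs" "t \<in> gr T p" "set bs \<subseteq> L"
    using assms(2) by (auto simp: words_def)
  obtain u cs q where y: "y = i u \<otimes>\<^bsub>C\<^esub> word_prod C cs" "u \<in> gr T q" "set cs \<subseteq> L"
    using assms(3) by (auto simp: words_def)
  obtain a where a: "word_prod C bs \<in> gr C a" using word_prod_gr x(3) assms(1) by blast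
  have c: "word_prod C cs \<in> carrier C" "word_prod C bs \<in> carrier C" "i t \<in> carrier C" "i u \<in> carrier C"
    "t \<in> carrier T" "u \<in> carrier T"
    using y x assms(1) B_in i_simps(1) by (auto intro!: C.word_prod_in)
  have "x \<otimes>\<^bsub>C\<^esub> y = i t \<otimes>\<^bsub>C\<^esub> (word_prod C bs \<otimes>\<^bsub>C\<^esub> (i u \<otimes>\<^bsub>C\<^esub> word_prod C cs))"
    unfolding x(1) y(1) using c by (simp add: C.mult_assoc)
  also have "\<dots> = (-1) ^ (a * q) \<odot>\<^bsub>C\<^esub> (i t \<otimes>\<^bsub>C\<^esub> (i u \<otimes>\<^bsub>C\<^esub> (word_prod C bs \<otimes>\<^bsub>C\<^esub> word_prod C cs)))"
    using C.mult_swap[OF a i_simps(6)[OF y(2)] c(1)] c by (simp add: C.smult_mult_right)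
  also have "\<dots> = (-1) ^ (a * q) \<odot>\<^bsub>C\<^esub> (i (t \<otimes>\<^bsub>T\<^esub> u) \<otimes>\<^bsub>C\<^esub> word_prod C (bs @ cs))"
    using c x y assms(1) B_in C.word_prod_append[of bs cs]
    by (simp add: i_simps(4) C.mult_assoc subset_iff)
  finally have e: "x \<otimes>\<^bsub>C\<^esub> y = (-1) ^ (a * q) \<odot>\<^bsub>C\<^esub> (i (t \<otimes>\<^bsub>T\<^esub> u) \<otimes>\<^bsub>C\<^esub> word_prod C (bs @ cs))" .
  have "set (bs @ cs) \<subseteq> L" using x(3) y(3) by simp
  then have "i (t \<otimes>\<^bsub>T\<^esub> u) \<otimes>\<^bsub>C\<^esub> word_prod C (bs @ cs) \<in> words L"
    using T.gr_mult[OF x(2) y(2)] unfolding words_def by blast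
  then show ?thesis
    unfolding e
    by (intro C.subspaceD(4)[OF C.lspan_subspace[OF words_in[OF assms(1)]]] C.lspan_incl)
qed

lemma words_span_mult:
  assumes "L \<subseteq> B" "x \<in> lspan C (words L)" "y \<in> lspan C (words L)"
  shows "x \<otimes>\<^bsub>C\<^esub> y \<in> lspan C (words L)"
proof -
  note w = words_in[OF assms(1)] and s = C.lspan_subspace[OF words_in[OF assms(1)]]
  note sc = C.subspaceD(2-4)[OF s]
  have yc: "y \<in> carrier C" using assms(3) C.lspan_carrier[OF w] by blast
  from assms(2) w show ?thesis
  proof (induction x rule: C.lspan_induct)
    case (gen x)
    from assms(3) w show ?case
      by (induction y rule: C.lspan_induct)
        (use gen w sc words_mult[OF assms(1)] in \<open>auto simp: C.mult_r_distr C.smult_mult_right subset_iff\<close>)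
  qed (use yc sc in \<open>auto simp: C.mult_l_distr C.smult_mult_left\<close>)
qed

lemma i_words: "t \<in> carrier T \<Longrightarrow> L \<subseteq> B \<Longrightarrow> i t \<in> lspan C (words L)"
proof (induction t rule: T.homogeneous_induct)
  case zero
  then show ?case using C.subspaceD(2)[OF C.lspan_subspace[OF words_in]] by (simp add: i_simps(7))
next
  case (add x y)
  then show ?case using C.subspaceD(3)[OF C.lspan_subspace[OF words_in]] by (simp add: i_simps(3))
next
  case (homogeneous p t)
  have "i t = i t \<otimes>\<^bsub>C\<^esub> word_prod C []" using homogeneous i_simps(1) by auto
  then have "i t \<in> words L" using homogeneous(1) unfolding words_def
    by (intro CollectI exI[of _ t] exI[of _ "[]"]) auto
  then show ?case by (rule C.lspan_incl)
qed

lemma letter_words: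
  assumes "b \<in> L" "L \<subseteq> B"
  shows "b \<in> lspan C (words L)"
proof -
  have b: "b \<in> carrier C" using assms B_in by blast
  then have "b = i \<one>\<^bsub>T\<^esub> \<otimes>\<^bsub>C\<^esub> word_prod C [b]" by (simp add: i_simps(2))
  then have "b \<in> words L" using assms(1) T.gr_one unfolding words_def
    by (intro CollectI exI[of _ "\<one>\<^bsub>T\<^esub>"] exI[of _ "[b]"]) auto
  then show ?thesis by (rule C.lspan_incl)
qed

lemma span_words: "L \<subseteq> B \<Longrightarrow> lspan C L \<subseteq> lspan C (words L)"
  using letter_words by (intro C.lspan_least C.lspan_subspace words_in) auto

abbreviation "below n \<equiv> {b \<in> B. lev b < n}"

lemma diff_letter_words:
  assumes "b \<in> B"
  shows "diff C b \<in> lspan C (words (below (lev b)))"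
proof (cases "lev b")
  case 0
  then have "diff C b \<in> i ` carrier T" using B_F[OF assms] F_zero by auto
  then show ?thesis using i_words by auto
next
  case (Suc n)
  let ?L = "below (Suc n)"
  have L: "?L \<subseteq> B" by auto
  note s = C.lspan_subspace[OF words_in[OF L]]
  have FL: "F n \<subseteq> lspan C (words ?L)"
    using F_lspan[of n] span_words[OF L] by (auto simp: less_Suc_eq_le)
  have "x \<in> lspan C (words ?L)" if "x \<in> generate_ring C (i ` carrier T \<union> F n)" for x
    using that
  proof (induction x rule: generate_ring.induct)
    case one
    then show ?case using i_words[OF T.one_in L] by (simp add: i_simps(2))
  qed (use FL i_words L C.subspaceD(3,5)[OF s] words_span_mult[OF L] in auto)
  then show ?thesis using B_F[OF assms] F_Suc[of n] Suc by auto
qed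

lemma all_words: "c \<in> carrier C \<Longrightarrow> c \<in> lspan C (words B)"
proof (induction c rule: free_induct)
  note s = C.lspan_subspace[OF words_in[OF subset_refl]]
  {
    case zero
    then show ?case by (rule C.subspaceD(2)[OF s])
  next
    case (add x y)
    then show ?case using C.subspaceD(3)[OF s] by blast
  next
    case (mono p t ms)
    have "word_prod C ms \<in> lspan C (words B)" if "set ms \<subseteq> X" for ms
      using that
    proof (induction ms)
      case Nil
      then show ?case using i_words[OF T.one_in subset_refl] by (simp add: i_simps(2))
    next
      case (Cons x ms)
      have "x \<in> lspan C B" unfolding B_span using Cons.prems by (intro C.lspan_incl) auto
      then show ?case
        using Cons words_span_mult[OF subset_refl] span_words[OF subset_refl] by auto
    qed
    then show ?case using mono Mon_set i_words[of t B]
      by (intro words_span_mult) auto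
  }
qed

text \<open>The conditions imposed on a map to \<open>E\<close> at a generator. The last one, congruence modulo \<open>N\<close> to the
  identity of \<open>C\<close>, confines the obstruction at the next generator to the acyclic ideal \<open>N\<close>.\<close>

definition over_T :: "('c \<Rightarrow> ('c \<times> 'c list) ext_index \<Rightarrow> 'c) \<Rightarrow> bool" where
  "over_T f \<longleftrightarrow> galg_hom C G f \<and> (\<forall>t\<in>carrier T. f (i t) = incl (i t))"

definition lifts :: "('c \<Rightarrow> ('c \<times> 'c list) ext_index \<Rightarrow> 'c) \<Rightarrow> 'c \<Rightarrow> bool" where
  "lifts f x \<longleftrightarrow> (\<forall>p. x \<in> gr C p \<longrightarrow> f x \<in> E p) \<and> diff G (f x) = f (diff C x) \<and>
     f x Base \<ominus>\<^bsub>C\<^esub> x \<in> N"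

lemma over_T_agree:
  assumes "over_T f" "over_T f'" "L \<subseteq> B" "\<And>b. b \<in> L \<Longrightarrow> f b = f' b" "x \<in> lspan C (words L)"
  shows "f x = f' x"
proof -
  have h: "galg_hom C G f" "galg_hom C G f'" using assms by (auto simp: over_T_def)
  note f = galg_homD[OF h(1)] and f' = galg_homD[OF h(2)]
  note z = galg_hom_zero[OF h(1) C.ratmod_axioms thin.G_ratmod]
    galg_hom_zero[OF h(2) C.ratmod_axioms thin.G_ratmod]
  have w: "f (word_prod C bs) = f' (word_prod C bs)" if "set bs \<subseteq> L" for bs
    using that
  proof (induction bs)
    case (Cons b bs)
    have "b \<in> carrier C" "word_prod C bs \<in> carrier C" using Cons.prems assms(3) B_in by auto
    then show ?case using Cons assms(4) f(4) f'(4) by auto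
  qed (simp add: f(2) f'(2))
  from assms(5) words_in[OF assms(3)] show ?thesis
  proof (induction x rule: C.lspan_induct)
    case (gen x)
    then obtain t bs p where x: "x = i t \<otimes>\<^bsub>C\<^esub> word_prod C bs" "t \<in> gr T p" "set bs \<subseteq> L"
      by (auto simp: words_def)
    have "i t \<in> carrier C" "word_prod C bs \<in> carrier C" "t \<in> carrier T"
      using x i_simps(1) assms(3) B_in by (auto intro!: C.word_prod_in)
    then show ?case unfolding x(1) using w[OF x(3)] f(4) f'(4) assms(1,2) by (auto simp: over_T_def)
  qed (auto simp: z f(3,5) f'(3,5))
qed

lemma word_lifts:
  assumes f: "over_T f" and L: "L \<subseteq> B" "\<And>b. b \<in> L \<Longrightarrow> lifts f b" and x: "x \<in> words L"
  shows "\<exists>p. x \<in> gr C p \<and> f x \<in> E p \<and> diff G (f x) = f (diff C x) \<and> f x Base \<ominus>\<^bsub>C\<^esub> x \<in> N"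
proof -
  define P where "P x \<longleftrightarrow> (\<exists>p. x \<in> gr C p \<and> f x \<in> E p \<and> diff G (f x) = f (diff C x) \<and>
    f x Base \<ominus>\<^bsub>C\<^esub> x \<in> N)" for x
  have h: "galg_hom C G f" and fi: "\<And>t. t \<in> carrier T \<Longrightarrow> f (i t) = incl (i t)"
    using f by (auto simp: over_T_def)
  note fh = galg_homD[OF h]
  have Pi: "P (i t)" if t: "t \<in> gr T p" for t p
  proof -
    have c: "t \<in> carrier T" "i t \<in> carrier C" "diff T t \<in> carrier T" using t i_simps(1) by auto
    have "f (diff C (i t)) = diff G (f (i t))"
      using fi[OF c(1)] fi[OF c(3)] i_diff[OF c(1)] thin.base_incl_diff[OF c(2)] by simp
    moreover have "f (i t) Base \<ominus>\<^bsub>C\<^esub> i t \<in> N"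
      using fi[OF c(1)] c N_closed(1) by (simp add: a_minus_def C.r_neg_self)
    ultimately show ?thesis
      unfolding P_def using i_simps(6)[OF t] incl_i_E[OF t] fi[OF c(1)] by auto
  qed
  have Pmult: "P (x \<otimes>\<^bsub>C\<^esub> y)" if xy: "P x" "P y" for x y
  proof -
    obtain p q where p: "x \<in> gr C p" "f x \<in> E p" "diff G (f x) = f (diff C x)" "f x Base \<ominus>\<^bsub>C\<^esub> x \<in> N"
      and q: "y \<in> gr C q" "f y \<in> E q" "diff G (f y) = f (diff C y)" "f y Base \<ominus>\<^bsub>C\<^esub> y \<in> N"
      using xy unfolding P_def by blast
    have c: "x \<in> carrier C" "y \<in> carrier C" "diff C x \<in> carrier C" "diff C y \<in> carrier C"
      using p(1) q(1) by auto
    have g: "f x \<in> gr G p" "f x \<in> carrier G" "f y \<in> carrier G" using p(2) q(2) thin.E_gr fh(1) c by auto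
    have b: "f x Base \<in> carrier C" "f y Base \<in> carrier C" using g thin.G_in by auto
    have "diff G (f (x \<otimes>\<^bsub>C\<^esub> y)) = f (diff C (x \<otimes>\<^bsub>C\<^esub> y))"
      using thin.G.leibniz[OF g(1,3)] C.leibniz[OF p(1) c(2)] c p(3) q(3)
      by (simp add: fh(3,4,5))
    moreover have "f (x \<otimes>\<^bsub>C\<^esub> y) Base \<ominus>\<^bsub>C\<^esub> (x \<otimes>\<^bsub>C\<^esub> y) \<in> N"
    proof -
      have "f (x \<otimes>\<^bsub>C\<^esub> y) Base \<ominus>\<^bsub>C\<^esub> (x \<otimes>\<^bsub>C\<^esub> y) =
        (f x Base \<ominus>\<^bsub>C\<^esub> x) \<otimes>\<^bsub>C\<^esub> f y Base \<oplus>\<^bsub>C\<^esub> x \<otimes>\<^bsub>C\<^esub> (f y Base \<ominus>\<^bsub>C\<^esub> y)"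
        using c b by (simp add: fh(4) a_minus_def C.mult_l_distr C.mult_r_distr C.sm_uminus
            C.smult_mult_left C.smult_mult_right C.add_assoc)
          (simp add: C.sm_uminus[symmetric] C.add_assoc[symmetric] C.l_neg_self
            C.add_assoc C.add_ac C.l_neg_self C.r_neg_self)
      then show ?thesis using N_left N_right N_closed(2) p(4) q(4) b c by simp
    qed
    moreover have "f (x \<otimes>\<^bsub>C\<^esub> y) \<in> E (p + q)" using thin.E_mult p(2) q(2) fh(4) c by simp
    ultimately show ?thesis unfolding P_def using C.gr_mult[OF p(1) q(1)] by blast
  qed
  have Pb: "P b" if b: "b \<in> L" for b
    using L(2)[OF b] B_gr L(1) b unfolding P_def lifts_def by blast
  have Pw: "P (word_prod C bs)" if "set bs \<subseteq> L" for bs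
    using that
  proof (induction bs)
    case Nil
    then show ?case using Pi[OF T.gr_one] by (simp add: i_simps(2))
  qed (use Pb Pmult in auto)
  obtain t bs p where "x = i t \<otimes>\<^bsub>C\<^esub> word_prod C bs" "t \<in> gr T p" "set bs \<subseteq> L"
    using x by (auto simp: words_def)
  then have "P x" using Pmult Pi Pw by auto
  then show ?thesis by (simp add: P_def)
qed

lemma span_lifts:
  assumes f: "over_T f" and L: "L \<subseteq> B" "\<And>b. b \<in> L \<Longrightarrow> lifts f b" and x: "x \<in> lspan C (words L)"
  shows "lifts f x"
proof -
  have h: "galg_hom C G f" using f by (simp add: over_T_def)
  note fh = galg_homD[OF h]
  note fz = galg_hom_zero[OF h C.ratmod_axioms thin.G_ratmod]
  have 1: "f x \<in> E p" if xp: "x \<in> gr C p" for p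
  proof -
    have "x \<in> lspan C (words L \<inter> gr C p)"
      by (rule C.homogeneous_lspan[OF words_gr[OF L(1)] x xp])
    moreover have "words L \<inter> gr C p \<subseteq> carrier C" by auto
    ultimately have "x \<in> carrier C \<and> f x \<in> E p"
    proof (induction x rule: C.lspan_induct)
      case (gen s)
      then obtain q where q: "s \<in> gr C q" "f s \<in> E q" using word_lifts[OF f L] by blast
      show ?case
      proof (cases "s = \<zero>\<^bsub>C\<^esub>")
        case True
        show ?thesis unfolding True fz using thin.E_closed(1)[of p] C.zero_in by blast
      next
        case False
        then have "q = p" using degree_unique q(1) gen by blast
        then show ?thesis using q by auto
      qed
    qed (use fz thin.E_closed in \<open>auto simp: fh(3,5) simp del: thin.G_simps\<close>)
    then show ?thesis ..
  qed
  have "x \<in> carrier C \<and> diff G (f x) = f (diff C x) \<and> f x Base \<ominus>\<^bsub>C\<^esub> x \<in> N"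
    using x words_in[OF L(1)]
  proof (induction x rule: C.lspan_induct)
    case zero
    have "diff G (f \<zero>\<^bsub>C\<^esub>) = f (diff C \<zero>\<^bsub>C\<^esub>)" by (simp only: fz C.diff_zero thin.G.diff_zero)
    moreover have "f \<zero>\<^bsub>C\<^esub> Base \<ominus>\<^bsub>C\<^esub> \<zero>\<^bsub>C\<^esub> = \<zero>\<^bsub>C\<^esub>" unfolding fz by (simp add: a_minus_def)
    ultimately show ?case using N_closed(1) C.zero_in by metis
  next
    case (add x y)
    then have c: "f x \<in> carrier G" "f y \<in> carrier G" using fh(1) by auto
    then have b: "f x Base \<in> carrier C" "f y Base \<in> carrier C" using thin.G_in by auto
    have "(f x \<oplus>\<^bsub>G\<^esub> f y) Base \<ominus>\<^bsub>C\<^esub> (x \<oplus>\<^bsub>C\<^esub> y) = (f x Base \<ominus>\<^bsub>C\<^esub> x) \<oplus>\<^bsub>C\<^esub> (f y Base \<ominus>\<^bsub>C\<^esub> y)"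
      using add b thin.minus_add_minus by auto
    then have "f (x \<oplus>\<^bsub>C\<^esub> y) Base \<ominus>\<^bsub>C\<^esub> (x \<oplus>\<^bsub>C\<^esub> y) \<in> N"
      using add N_closed(2) fh(3)[of x y] by metis
    moreover have "diff G (f (x \<oplus>\<^bsub>C\<^esub> y)) = f (diff C (x \<oplus>\<^bsub>C\<^esub> y))"
      using add c thin.G.diff_add C.diff_add by (simp add: fh(3) del: thin.G_simps)
    ultimately show ?case using add by simp
  next
    case (smult a x)
    then have c: "f x \<in> carrier G" using fh(1) by auto
    then have b: "f x Base \<in> carrier C" using thin.G_in by auto
    have "(a \<odot>\<^bsub>G\<^esub> f x) Base \<ominus>\<^bsub>C\<^esub> (a \<odot>\<^bsub>C\<^esub> x) = a \<odot>\<^bsub>C\<^esub> (f x Base \<ominus>\<^bsub>C\<^esub> x)"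
      using smult b thin.smult_minus by auto
    then have "f (a \<odot>\<^bsub>C\<^esub> x) Base \<ominus>\<^bsub>C\<^esub> (a \<odot>\<^bsub>C\<^esub> x) \<in> N"
      using smult N_closed(3) fh(5)[of x a] by metis
    moreover have "diff G (f (a \<odot>\<^bsub>C\<^esub> x)) = f (diff C (a \<odot>\<^bsub>C\<^esub> x))"
      using smult c thin.G.diff_smult C.diff_smult by (simp add: fh(5) del: thin.G_simps)
    ultimately show ?case using smult by simp
  next
    case (gen s)
    then have "s \<in> carrier C" using words_in[OF L(1)] by blast
    then show ?case using word_lifts[OF f L gen] by blast
  qed
  then show ?thesis using 1 by (simp add: lifts_def)
qed

text \<open>Choose \<open>t\<close> in \<open>T\<close> with \<open>b - t\<close> in \<open>N\<close>. The cocycle \<open>y = f (db) - dt\<close> of \<open>E\<close> has its component in \<open>N\<close>, and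
  this component has a primitive \<open>m'\<close> in \<open>N\<close>. So \<open>y\<close> has a primitive in \<open>E\<close> with component \<open>m'\<close> up to a
  coboundary \<open>du\<close>. Writing \<open>u\<close> as the sum of an element \<open>s\<close> of \<open>T\<close> and an element of \<open>N\<close>, and adding \<open>ds\<close> to
  the primitive, one achieves that its component lies in \<open>N\<close>. Finally add \<open>t\<close>.\<close>
lemma lift_value:
  assumes f: "over_T f" "\<And>b. b \<in> below n \<Longrightarrow> lifts f b" and b: "b \<in> B" "lev b = n" "b \<in> gr C p"
  shows "\<exists>e\<in>E p. diff G e = f (diff C b) \<and> e Base \<ominus>\<^bsub>C\<^esub> b \<in> N"
proof -
  have h: "galg_hom C G f" using f by (simp add: over_T_def)
  note fh = galg_homD[OF h]
  have L: "below n \<subseteq> B" by auto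
  have "diff C b \<in> lspan C (words (below n))" using diff_letter_words[OF b(1)] b(2) by simp
  then have lf: "lifts f (diff C b)" using span_lifts[OF f(1) L] f(2) by blast
  have bc: "b \<in> carrier C" "diff C b \<in> carrier C" "diff C b \<in> gr C (Suc p)" using b(3) C.diff_gr by auto
  define y0 where "y0 = f (diff C b)"
  have y0: "y0 \<in> E (Suc p)" "diff G y0 = \<zero>\<^bsub>G\<^esub>" "y0 Base \<ominus>\<^bsub>C\<^esub> diff C b \<in> N" "y0 \<in> carrier G"
    using lf bc C.diff_diff[OF bc(1)] galg_hom_zero[OF h C.ratmod_axioms thin.G_ratmod] fh(1)
    by (auto simp: lifts_def y0_def)
  obtain t where t: "t \<in> gr T p" "b \<ominus>\<^bsub>C\<^esub> i t \<in> N" using N_surj[OF b(3)] by blast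
  have tc: "t \<in> carrier T" "i t \<in> carrier C" "diff T t \<in> gr T (Suc p)" "diff C (i t) \<in> carrier C"
    "i t \<in> gr C p"
    using t(1) i_simps(1,6) T.diff_gr by auto
  let ?dt = "incl (diff C (i t))"
  have dt: "?dt \<in> E (Suc p)" "?dt \<in> carrier G" "diff G ?dt = \<zero>\<^bsub>G\<^esub>"
    "?dt = diff G (incl (i t))"
  proof -
    show "?dt \<in> E (Suc p)" using incl_i_E[OF tc(3)] i_diff[OF tc(1)] by simp
    show *: "?dt \<in> carrier G" "?dt = diff G (incl (i t))"
      using tc thin.base_incl_in thin.base_incl_diff by auto
    show "diff G ?dt = \<zero>\<^bsub>G\<^esub>" unfolding *(2) using thin.base_incl_in[OF tc(2)] by (rule thin.G.diff_diff)
  qed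
  define y where "y = y0 \<ominus>\<^bsub>G\<^esub> ?dt"
  have y: "y \<in> E (Suc p)" "y \<in> carrier G" "diff G y = \<zero>\<^bsub>G\<^esub>"
  proof -
    show "y \<in> E (Suc p)" unfolding y_def using y0(1) dt(1) by (rule thin.E_closed(5))
    show "y \<in> carrier G" unfolding y_def using y0(4) dt(2) by (rule thin.G.minus_in)
    show "diff G y = \<zero>\<^bsub>G\<^esub>" unfolding y_def thin.G.diff_minus[OF y0(4) dt(2)]
      using y0(2) dt(3) by (simp add: a_minus_def)
  qed
  have ysum: "y \<oplus>\<^bsub>G\<^esub> ?dt = y0"
    unfolding y_def a_minus_def using y0(4) dt(2) by (simp add: thin.G.add_assoc thin.G.l_neg_self)
  have yb: "y Base \<in> carrier C" "y0 Base \<in> carrier C" using y y0 thin.G_in by auto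
  have ybe: "y Base = (y0 Base \<ominus>\<^bsub>C\<^esub> diff C b) \<oplus>\<^bsub>C\<^esub> diff C (b \<ominus>\<^bsub>C\<^esub> i t)"
  proof -
    have "y Base \<oplus>\<^bsub>C\<^esub> diff C (i t) = y0 Base" using arg_cong[OF ysum, of "\<lambda>g. g Base"] by simp
    from this[symmetric] have "y0 Base \<ominus>\<^bsub>C\<^esub> diff C (i t) = y Base"
      using yb tc by (simp add: a_minus_def C.add_assoc C.r_neg_self)
    moreover have "(y0 Base \<ominus>\<^bsub>C\<^esub> diff C b) \<oplus>\<^bsub>C\<^esub> diff C (b \<ominus>\<^bsub>C\<^esub> i t) =
      y0 Base \<oplus>\<^bsub>C\<^esub> ((\<ominus>\<^bsub>C\<^esub> diff C b \<oplus>\<^bsub>C\<^esub> diff C b) \<oplus>\<^bsub>C\<^esub> \<ominus>\<^bsub>C\<^esub> diff C (i t))"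
    proof -
      have "diff C (b \<ominus>\<^bsub>C\<^esub> i t) = diff C b \<ominus>\<^bsub>C\<^esub> diff C (i t)" using bc tc by (intro C.diff_minus)
      then show ?thesis using yb bc tc by (simp add: a_minus_def C.add_assoc)
    qed
    moreover have "\<dots> = y0 Base \<ominus>\<^bsub>C\<^esub> diff C (i t)"
      using yb bc tc by (simp add: C.l_neg_self a_minus_def)
    ultimately show ?thesis by simp
  qed
  have yN: "y Base \<in> N" unfolding ybe using y0(3) N_diff[OF t(2)] by (rule N_closed(2))
  have dyb: "diff C (y Base) = \<zero>\<^bsub>C\<^esub>" using arg_cong[OF y(3), of "\<lambda>g. g Base"] by simp
  have ybg: "y Base \<in> gr C (Suc p)" by (rule thin.G_grD(2)[OF subsetD[OF thin.E_gr y(1)]])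
  obtain m' where m': "m' \<in> N" "m' \<in> gr C p" "y Base = diff C m'"
    using N_acyclic[OF yN ybg dyb] by auto
  obtain e0 x where e0: "e0 \<in> E p" "diff G e0 = y" "x \<in> coboundaries C p" "m' = e0 Base \<oplus>\<^bsub>C\<^esub> x"
    using thin.E_lift_primitive[OF y(1,3) m'(2,3)] by (elim bexE conjE)
  have e0g: "e0 \<in> carrier G" using e0(1) thin.E_gr by auto
  note e0c = e0g thin.G_in[OF e0g, of Base]
  have "\<exists>z\<in>E p. diff G z = y \<and> z Base \<in> N"
  proof (cases p)
    case 0
    then have "x = \<zero>\<^bsub>C\<^esub>" using e0(3) by (simp add: coboundaries_def)
    then show ?thesis using e0 e0c m'(1) by auto
  next
    case (Suc q)
    then obtain u where u: "u \<in> gr C q" "x = diff C u" using e0(3) by (auto simp: coboundaries_def)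
    obtain s where s: "s \<in> gr T q" "u \<ominus>\<^bsub>C\<^esub> i s \<in> N" using N_surj[OF u(1)] by blast
    have sc: "s \<in> carrier T" "i s \<in> carrier C" "diff T s \<in> gr T p" "diff C (i s) \<in> carrier C"
      "u \<in> carrier C" "diff C u \<in> carrier C"
      using s(1) i_simps(1) T.diff_gr Suc u(1) by auto
    let ?z = "e0 \<oplus>\<^bsub>G\<^esub> incl (diff C (i s))"
    have ds: "incl (diff C (i s)) \<in> E p" using incl_i_E[OF sc(3)] i_diff[OF sc(1)] by simp
    have dsc: "incl (diff C (i s)) \<in> carrier G" using thin.base_incl_in[OF sc(4)] .
    have "diff G (incl (diff C (i s))) = \<zero>\<^bsub>G\<^esub>"
      unfolding thin.base_incl_diff[OF sc(2)] by (rule thin.G.diff_diff[OF thin.base_incl_in[OF sc(2)]])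
    then have "diff G ?z = y" using thin.G.diff_add[OF e0c(1) dsc] e0(2) y(2) by simp
    moreover have "?z Base = m' \<ominus>\<^bsub>C\<^esub> diff C (u \<ominus>\<^bsub>C\<^esub> i s)"
    proof -
      have du: "diff C (u \<ominus>\<^bsub>C\<^esub> i s) = diff C u \<ominus>\<^bsub>C\<^esub> diff C (i s)"
        using sc by (intro C.diff_minus)
      have "m' \<ominus>\<^bsub>C\<^esub> diff C (u \<ominus>\<^bsub>C\<^esub> i s) =
        (e0 Base \<oplus>\<^bsub>C\<^esub> diff C u) \<oplus>\<^bsub>C\<^esub> (diff C (i s) \<oplus>\<^bsub>C\<^esub> \<ominus>\<^bsub>C\<^esub> diff C u)"
        unfolding e0(4) u(2) du using sc e0c
        by (simp add: a_minus_def C.neg_add C.neg_neg C.add_comm)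
      also have "\<dots> = (e0 Base \<oplus>\<^bsub>C\<^esub> diff C (i s)) \<oplus>\<^bsub>C\<^esub> (diff C u \<oplus>\<^bsub>C\<^esub> \<ominus>\<^bsub>C\<^esub> diff C u)"
        using sc e0c by (simp add: C.add_ac)
      finally show ?thesis using sc e0c by (simp add: C.r_neg_self)
    qed
    then have "?z Base \<in> N" using N_closed(5)[OF m'(1) N_diff[OF s(2)]] by simp
    moreover have "?z \<in> E p" using e0(1) ds by (rule thin.E_closed(2))
    ultimately show ?thesis by blast
  qed
  then obtain z where z: "z \<in> E p" "diff G z = y" "z Base \<in> N" by blast
  have zg: "z \<in> carrier G" using z(1) thin.E_gr by auto
  note zc = zg thin.G_in[OF zg, of Base]
  let ?e = "z \<oplus>\<^bsub>G\<^esub> incl (i t)"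
  have "?e \<in> E p" using z(1) incl_i_E[OF t(1)] by (rule thin.E_closed(2))
  moreover have "diff G ?e = y0"
    using thin.G.diff_add[OF zc(1) thin.base_incl_in[OF tc(2)]] z(2) dt(4) ysum by simp
  moreover have "?e Base \<ominus>\<^bsub>C\<^esub> b = z Base \<ominus>\<^bsub>C\<^esub> (b \<ominus>\<^bsub>C\<^esub> i t)"
    using zc tc bc by (simp add: a_minus_def C.neg_add C.neg_neg C.add_ac)
  then have "?e Base \<ominus>\<^bsub>C\<^esub> b \<in> N" using N_closed(5)[OF z(3) t(2)] by simp
  ultimately show ?thesis unfolding y0_def by blast
qed

lemma extend_over_T:
  assumes "\<And>b p. b \<in> B \<Longrightarrow> b \<in> gr C p \<Longrightarrow> v b \<in> gr G p"
  obtains f where "over_T f" "\<And>b. b \<in> B \<Longrightarrow> f b = v b"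
proof -
  have j: "galg_hom T G (\<lambda>t. incl (i t))"
    using i_hom thin.base_incl_hom unfolding galg_hom_def by auto
  obtain f where "galg_hom C G f" "\<And>t. t \<in> carrier T \<Longrightarrow> f (i t) = incl (i t)"
    "\<And>b. b \<in> B \<Longrightarrow> f b = v b"
    using galg_extension[OF thin.G_dgca j B_indep B_gr B_span, of v] assms by blast
  then show ?thesis using that by (auto simp: over_T_def)
qed

lemma lift_step:
  assumes f: "over_T f" "\<And>b. b \<in> below n \<Longrightarrow> lifts f b"
  shows "\<exists>f'. (over_T f' \<and> (\<forall>b\<in>below (Suc n). lifts f' b)) \<and> (\<forall>b\<in>below n. f' b = f b)"
proof -
  define val where "val b = (SOME e. \<forall>p. b \<in> gr C p \<longrightarrow>
    e \<in> E p \<and> diff G e = f (diff C b) \<and> e Base \<ominus>\<^bsub>C\<^esub> b \<in> N)" for b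
  have val: "val b \<in> E p \<and> diff G (val b) = f (diff C b) \<and> val b Base \<ominus>\<^bsub>C\<^esub> b \<in> N"
    if b: "b \<in> B" "lev b = n" "b \<in> gr C p" for b p
  proof -
    obtain e where e: "e \<in> E p" "diff G e = f (diff C b)" "e Base \<ominus>\<^bsub>C\<^esub> b \<in> N"
      using lift_value[OF f b] by blast
    have "\<forall>q. b \<in> gr C q \<longrightarrow> e \<in> E q \<and> diff G e = f (diff C b) \<and> e Base \<ominus>\<^bsub>C\<^esub> b \<in> N"
    proof (intro allI impI)
      fix q assume "b \<in> gr C q"
      then have "q = p" using degree_unique b B_nonzero by blast
      then show "e \<in> E q \<and> diff G e = f (diff C b) \<and> e Base \<ominus>\<^bsub>C\<^esub> b \<in> N" using e by simp
    qed
    from someI[of "\<lambda>e. \<forall>q. b \<in> gr C q \<longrightarrow>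
        e \<in> E q \<and> diff G e = f (diff C b) \<and> e Base \<ominus>\<^bsub>C\<^esub> b \<in> N", OF this]
    have "\<forall>q. b \<in> gr C q \<longrightarrow>
      val b \<in> E q \<and> diff G (val b) = f (diff C b) \<and> val b Base \<ominus>\<^bsub>C\<^esub> b \<in> N"
      unfolding val_def .
    then show ?thesis using b(3) by blast
  qed
  define v where "v b = (if lev b = n then val b else f b)" for b
  have h: "galg_hom C G f" using f by (simp add: over_T_def)
  have "v b \<in> gr G p" if "b \<in> B" "b \<in> gr C p" for b p
    using that val thin.E_gr galg_homD(6)[OF h] by (auto simp: v_def)
  then obtain f' where f': "over_T f'" "\<And>b. b \<in> B \<Longrightarrow> f' b = v b"
    using extend_over_T[of v] by blast
  have same: "f' b = f b" if "b \<in> below n" for b using that f'(2) by (simp add: v_def)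
  have d: "f' (diff C b) = f (diff C b)" if b: "b \<in> B" "lev b \<le> n" for b
  proof -
    have "below (lev b) \<subseteq> below n" using b(2) by auto
    then have "words (below (lev b)) \<subseteq> words (below n)" unfolding words_def by blast
    then have "diff C b \<in> lspan C (words (below n))"
      using diff_letter_words[OF b(1)] C.lspan_mono by blast
    then show ?thesis using over_T_agree[OF f'(1) f(1) _ same, of "below n"] by blast
  qed
  have "lifts f' b" if b: "b \<in> below (Suc n)" for b
  proof (cases "lev b = n")
    case True
    obtain p where p: "b \<in> gr C p" using B_gr b by blast
    have "f' b = val b" using b True f'(2) by (simp add: v_def)
    then show ?thesis using val[OF _ True] d[of b] b True p by (auto simp: lifts_def)
  next
    case False
    then have bn: "b \<in> below n" using b by auto
    then show ?thesis using f(2)[OF bn] same[OF bn] d[of b] by (auto simp: lifts_def)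
  qed
  then show ?thesis using f'(1) same by blast
qed

text \<open>The stages of the filtration are treated one after the other. A stage keeps the values at the
  generators below it, so the maps obtained have a limit.\<close>
lemma exists_lift: "\<exists>f. over_T f \<and> (\<forall>b\<in>B. lifts f b)"
proof -
  have "\<exists>f. over_T f"
  proof -
    obtain f where "over_T f" "\<And>b. b \<in> B \<Longrightarrow> f b = \<zero>\<^bsub>G\<^esub>"
      using extend_over_T[of "\<lambda>_. \<zero>\<^bsub>G\<^esub>"] thin.G.gr_zero by blast
    then show ?thesis by blast
  qed
  then have "\<exists>f. \<forall>n. (over_T (f n) \<and> (\<forall>b\<in>below n. lifts (f n) b)) \<and>
    (\<forall>b\<in>below n. f (Suc n) b = f n b)"
    using lift_step by (intro dependent_nat_choice) auto
  then obtain f where f: "\<And>n. over_T (f n)" "\<And>n b. b \<in> below n \<Longrightarrow> lifts (f n) b"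
    "\<And>n b. b \<in> below n \<Longrightarrow> f (Suc n) b = f n b" by blast
  have st: "f n b = f (Suc (lev b)) b" if b: "b \<in> B" "lev b < n" for n b
    using b(2)
  proof (induction n)
    case (Suc n)
    show ?case
    proof (cases "lev b = n")
      case False
      then have "lev b < n" using Suc.prems by simp
      then show ?thesis using Suc.IH f(3)[of b n] b(1) by simp
    qed simp
  qed simp
  define v where "v b = f (Suc (lev b)) b" for b
  have "v b \<in> gr G p" if "b \<in> B" "b \<in> gr C p" for b p
    using f(1)[of "Suc (lev b)"] that galg_homD(6) by (auto simp: v_def over_T_def)
  then obtain g where g: "over_T g" "\<And>b. b \<in> B \<Longrightarrow> g b = v b"
    using extend_over_T[of v] by blast
  have "lifts g b" if b: "b \<in> B" for b
  proof -
    let ?n = "Suc (lev b)"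
    have ag: "g c = f ?n c" if "c \<in> below (lev b)" for c
      using that g(2) st[of c ?n] by (simp add: v_def)
    have "g (diff C b) = f ?n (diff C b)"
      by (rule over_T_agree[OF g(1) f(1) _ ag diff_letter_words[OF b]]) auto
    moreover have "g b = f ?n b" using g(2)[OF b] by (simp add: v_def)
    ultimately show ?thesis using f(2)[of b ?n] b by (simp add: lifts_def)
  qed
  then show ?thesis using g(1) by blast
qed

end

context thin_extension_problem
begin

lemma exists_lift:
  obtains f where "galg_hom C G f" "\<And>t. t \<in> carrier T \<Longrightarrow> f (i t) = incl (i t)"
    "\<And>c. c \<in> carrier C \<Longrightarrow> diff G (f c) = f (diff C c)"
    "\<And>p c. c \<in> gr C p \<Longrightarrow> f c \<in> E p"
proof -
  let ?X = "\<Union>n. \<Union>p. F n \<inter> gr C p"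
  have "?X \<subseteq> carrier C" by auto
  then obtain B where B: "B \<subseteq> ?X" "C.indep B"
    "\<And>x. x \<in> ?X \<Longrightarrow> x \<in> lspan C {b \<in> B. lev b \<le> lev x}"
    using C.adapted_basis[of ?X lev] by blast
  interpret basis_extension_problem T C i X r A F N m \<mu> BH B0 B
    using B by unfold_locales auto
  obtain f where f: "over_T f" "\<And>b. b \<in> B \<Longrightarrow> lifts f b" using exists_lift by blast
  have "lifts f c" if "c \<in> carrier C" for c
    by (rule span_lifts[OF f(1) subset_refl f(2) all_words[OF that]])
  then show ?thesis using that f(1) by (auto simp: over_T_def lifts_def)
qed

text \<open>Below degree \<open>m + 1\<close> the cdga \<open>E\<close> is \<open>T\<close>, where \<open>\<mu>\<close> is defined, and above that degree \<open>A\<close>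
  vanishes.\<close>
lemma exists_extension: "\<exists>\<tau>\<in>cdga_hom C A. \<forall>t\<in>carrier T. \<tau> (i t) = \<mu> t"
proof -
  obtain f where f: "galg_hom C G f" "\<And>t. t \<in> carrier T \<Longrightarrow> f (i t) = incl (i t)"
    "\<And>c. c \<in> carrier C \<Longrightarrow> diff G (f c) = f (diff C c)"
    "\<And>p c. c \<in> gr C p \<Longrightarrow> f c \<in> E p" using exists_lift by blast
  note fh = galg_homD[OF f(1)]
  have \<mu>: "galg_hom T A \<mu>" "\<And>t. t \<in> carrier T \<Longrightarrow> \<mu> (diff T t) = diff A (\<mu> t)"
    using \<mu>_hom unfolding cdga_hom_iff by auto
  note \<mu>h = galg_homD[OF \<mu>(1)] galg_hom_zero[OF \<mu>(1) T.ratmod_axioms A.ratmod_axioms]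
  have inj: "s = t" if st: "s \<in> carrier T" "t \<in> carrier T" "i s = i t" for s t
  proof -
    have "i (s \<ominus>\<^bsub>T\<^esub> t) = \<zero>\<^bsub>C\<^esub>"
      using galg_hom_minus[OF i_hom T.ratmod_axioms C.ratmod_axioms st(1,2)] st i_simps(1)[OF st(2)]
      by (simp add: a_minus_def C.r_neg_self)
    then have "s \<ominus>\<^bsub>T\<^esub> t = \<zero>\<^bsub>T\<^esub>" using i_inj st by blast
    then show ?thesis using st by (simp add: T.r_right_minus_eq)
  qed
  define \<rho> where "\<rho> c = \<mu> (THE t. t \<in> carrier T \<and> f c = incl (i t))" for c
  have \<rho>: "\<rho> c = \<mu> t" if "t \<in> carrier T" "f c = incl (i t)" for t c
  proof -
    have "(THE t. t \<in> carrier T \<and> f c = incl (i t)) = t"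
    proof (rule the_equality)
      fix s assume "s \<in> carrier T \<and> f c = incl (i s)"
      then show "s = t" using that inj by (metis thin.base_incl_simps(1))
    qed (use that in auto)
    then show ?thesis by (simp add: \<rho>_def)
  qed
  have low: "\<exists>t\<in>gr T p. f c = incl (i t) \<and> \<rho> c = \<mu> t" if "c \<in> gr C p" "p \<le> m" for c p
  proof -
    have "f c \<in> incl ` S p" using f(4)[OF that(1)] thin.E_low[OF that(2)] by simp
    then show ?thesis using \<rho> by (auto simp: S_def)
  qed
  define \<tau> where "\<tau> c = (\<Oplus>\<^bsub>A\<^esub>p\<in>{..m}. \<rho> (component C p c))" for c
  have \<rho>_gr: "\<rho> c \<in> gr A p" if "c \<in> gr C p" "p \<le> m" for c p
    using low[OF that] \<mu>h(6) by auto
  have \<rho>c: "(\<lambda>p. \<rho> (component C p c)) \<in> {..m} \<rightarrow> carrier A" if "c \<in> carrier C" for c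
    using \<rho>_gr C.component_decomp(1)[OF that] by auto
  have \<rho>0: "\<rho> \<zero>\<^bsub>C\<^esub> = \<zero>\<^bsub>A\<^esub>"
    using \<rho>[of "\<zero>\<^bsub>T\<^esub>" "\<zero>\<^bsub>C\<^esub>"] f(2)[of "\<zero>\<^bsub>T\<^esub>"] i_simps(7) \<mu>h(7) by simp
  have \<tau>_in: "\<tau> c \<in> carrier A" if "c \<in> carrier C" for c
    unfolding \<tau>_def using \<rho>c[OF that] by (rule A.fs_closed)
  have \<tau>_add: "\<tau> (c \<oplus>\<^bsub>C\<^esub> d) = \<tau> c \<oplus>\<^bsub>A\<^esub> \<tau> d" if cd: "c \<in> carrier C" "d \<in> carrier C" for c d
  proof -
    have "\<rho> (component C p (c \<oplus>\<^bsub>C\<^esub> d)) = \<rho> (component C p c) \<oplus>\<^bsub>A\<^esub> \<rho> (component C p d)"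
      if p: "p \<le> m" for p
    proof -
      obtain s t where s: "s \<in> gr T p" "f (component C p c) = incl (i s)" "\<rho> (component C p c) = \<mu> s"
        and t: "t \<in> gr T p" "f (component C p d) = incl (i t)" "\<rho> (component C p d) = \<mu> t"
        using low[OF C.component_decomp(1)[OF cd(1)] p] low[OF C.component_decomp(1)[OF cd(2)] p]
        by blast
      have "f (component C p (c \<oplus>\<^bsub>C\<^esub> d)) = incl (i (s \<oplus>\<^bsub>T\<^esub> t))"
        using cd s t galg_homD(3)[OF thin.base_incl_hom] i_simps(1)
        by (auto simp: C.component_add fh(3) i_simps(3))
      then show ?thesis using \<rho>[of "s \<oplus>\<^bsub>T\<^esub> t"] s t \<mu>h(3) by auto
    qed
    then have "\<tau> (c \<oplus>\<^bsub>C\<^esub> d) = (\<Oplus>\<^bsub>A\<^esub>p\<in>{..m}. \<rho> (component C p c) \<oplus>\<^bsub>A\<^esub> \<rho> (component C p d))"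
      unfolding \<tau>_def using \<rho>c[OF cd(1)] \<rho>c[OF cd(2)] by (intro A.fs_cong) auto
    then show ?thesis unfolding \<tau>_def using A.fs_addf[OF \<rho>c[OF cd(1)] \<rho>c[OF cd(2)]] by simp
  qed
  have \<tau>_hom: "\<tau> c = (if p \<le> m then \<rho> c else \<zero>\<^bsub>A\<^esub>)" if c: "c \<in> gr C p" for c p
  proof -
    have cm: "component C q c = (if q = p then c else \<zero>\<^bsub>C\<^esub>)" for q by (rule C.component_gr[OF c])
    have "\<tau> c = (\<Oplus>\<^bsub>A\<^esub>q\<in>{..m} \<inter> {p}. \<rho> (component C q c))"
      unfolding \<tau>_def
    proof (rule A.finsum_neutral_superset[symmetric])
      show "(\<lambda>q. \<rho> (component C q c)) ` ({..m} \<inter> {p}) \<subseteq> carrier A" using \<rho>c[of c] c by auto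
    qed (auto simp: cm \<rho>0)
    also have "\<dots> = (if p \<le> m then \<rho> c else \<zero>\<^bsub>A\<^esub>)"
      using \<rho>_gr[OF c] by (auto simp: cm A.fs_insert A.fs_empty)
    finally show ?thesis .
  qed
  have \<tau>_low: "\<exists>t\<in>gr T p. f c = incl (i t) \<and> \<tau> c = \<mu> t" if "c \<in> gr C p" "p \<le> m" for c p
    using low[OF that] \<tau>_hom[OF that(1)] that(2) by auto
  have \<tau>_val: "\<tau> c = \<mu> t" if "c \<in> gr C p" "p \<le> m" "t \<in> carrier T" "f c = incl (i t)" for c p t
    using \<rho>[OF that(3,4)] \<tau>_hom[OF that(1)] that(2) by simp
  have \<tau>_high: "\<tau> c = \<zero>\<^bsub>A\<^esub>" if "c \<in> gr C p" "m < p" for c p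
    using \<tau>_hom[OF that(1)] that(2) by simp
  have \<tau>_gr: "\<tau> c \<in> gr A p" if "c \<in> gr C p" for c p
    using \<tau>_hom[OF that] \<rho>_gr[OF that] A.gr_zero by simp
  have \<tau>0: "\<tau> \<zero>\<^bsub>C\<^esub> = \<zero>\<^bsub>A\<^esub>" using \<tau>_hom[OF C.gr_zero[of 0]] \<rho>0 by simp
  have top: "x = \<zero>\<^bsub>A\<^esub>" if "x \<in> gr A p" "m < p" for x p using A_top[OF that(2)] that(1) by simp
  have mult_hom: "\<tau> (c \<otimes>\<^bsub>C\<^esub> d) = \<tau> c \<otimes>\<^bsub>A\<^esub> \<tau> d" if c: "c \<in> gr C p" and d: "d \<in> gr C q" for c d p q
  proof (cases "p + q \<le> m")
    case True
    then obtain s t where s: "s \<in> gr T p" "f c = incl (i s)" "\<tau> c = \<mu> s"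
      and t: "t \<in> gr T q" "f d = incl (i t)" "\<tau> d = \<mu> t"
      using \<tau>_low[OF c] \<tau>_low[OF d] by auto
    have "f (c \<otimes>\<^bsub>C\<^esub> d) = incl (i (s \<otimes>\<^bsub>T\<^esub> t))"
      using c d s t galg_homD(4)[OF thin.base_incl_hom] i_simps(1) by (auto simp: fh(4) i_simps(4))
    then have "\<tau> (c \<otimes>\<^bsub>C\<^esub> d) = \<mu> (s \<otimes>\<^bsub>T\<^esub> t)"
      using \<tau>_val[OF C.gr_mult[OF c d] True, of "s \<otimes>\<^bsub>T\<^esub> t"] s(1) t(1) by auto
    then show ?thesis using s t \<mu>h(4) by auto
  next
    case False
    have "\<tau> c \<otimes>\<^bsub>A\<^esub> \<tau> d \<in> gr A (p + q)" using \<tau>_gr c d A.gr_mult by blast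
    then show ?thesis using \<tau>_high[OF C.gr_mult[OF c d]] False top by auto
  qed
  have mult: "\<tau> (c \<otimes>\<^bsub>C\<^esub> d) = \<tau> c \<otimes>\<^bsub>A\<^esub> \<tau> d" if c: "c \<in> carrier C" and d: "d \<in> carrier C" for c d
    using c
  proof (induction c rule: C.homogeneous_induct)
    case (homogeneous p c)
    from d show ?case
      by (induction d rule: C.homogeneous_induct)
        (use homogeneous \<tau>_in mult_hom in \<open>auto simp: \<tau>0 \<tau>_add C.mult_r_distr A.mult_r_distr\<close>)
  qed (use d \<tau>_in in \<open>auto simp: \<tau>0 \<tau>_add C.mult_l_distr A.mult_l_distr\<close>)
  have \<tau>i_hom: "\<tau> (i t) = \<mu> t" if t: "t \<in> gr T p" for t p
  proof (cases "p \<le> m")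
    case True
    then show ?thesis using \<tau>_val[OF i_simps(6)[OF t] True _ f(2)] t by auto
  next
    case False
    then show ?thesis using \<tau>_high[OF i_simps(6)[OF t]] top[OF \<mu>h(6)[OF t]] by simp
  qed
  have \<tau>i: "\<tau> (i t) = \<mu> t" if "t \<in> carrier T" for t
    using that
    by (induction t rule: T.homogeneous_induct)
      (use \<tau>i_hom i_simps(1) in \<open>auto simp: i_simps(3,7) \<tau>0 \<tau>_add \<mu>h(3,7)\<close>)
  have \<tau>_smult: "\<tau> (a \<odot>\<^bsub>C\<^esub> c) = a \<odot>\<^bsub>A\<^esub> \<tau> c" if c: "c \<in> carrier C" for a c
  proof -
    have "a \<odot>\<^bsub>C\<^esub> c = i (a \<odot>\<^bsub>T\<^esub> \<one>\<^bsub>T\<^esub>) \<otimes>\<^bsub>C\<^esub> c"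
      using c by (simp add: i_simps(2,5) C.smult_mult_left)
    then have "\<tau> (a \<odot>\<^bsub>C\<^esub> c) = \<mu> (a \<odot>\<^bsub>T\<^esub> \<one>\<^bsub>T\<^esub>) \<otimes>\<^bsub>A\<^esub> \<tau> c"
      using c mult \<tau>i i_simps(1) by simp
    then show ?thesis using \<tau>_in[OF c] by (simp add: \<mu>h(2,5) A.smult_mult_left)
  qed
  have diff_hom: "\<tau> (diff C c) = diff A (\<tau> c)" if c: "c \<in> gr C p" for c p
  proof (cases "Suc p \<le> m")
    case True
    then obtain t where t: "t \<in> gr T p" "f c = incl (i t)" "\<tau> c = \<mu> t" using \<tau>_low[OF c] by auto
    have "f (diff C c) = incl (i (diff T t))"
      using f(3)[of c] c t thin.base_incl_diff[of "i t"] i_simps(1) i_diff by auto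
    then have "\<tau> (diff C c) = \<mu> (diff T t)"
      using \<tau>_val[OF C.diff_gr[OF c] True, of "diff T t"] t(1) by auto
    then show ?thesis using t \<mu>(2) by auto
  next
    case False
    then show ?thesis
      using \<tau>_high[OF C.diff_gr[OF c]] top[OF A.diff_gr[OF \<tau>_gr[OF c]]] by simp
  qed
  have diff: "\<tau> (diff C c) = diff A (\<tau> c)" if "c \<in> carrier C" for c
    using that
    by (induction c rule: C.homogeneous_induct)
      (use diff_hom \<tau>_in in \<open>auto simp: \<tau>0 \<tau>_add C.diff_add A.diff_add\<close>)
  have "\<tau> \<one>\<^bsub>C\<^esub> = \<one>\<^bsub>A\<^esub>" using \<tau>i[of "\<one>\<^bsub>T\<^esub>"] by (simp add: i_simps(2) \<mu>h(2))
  then have "\<tau> \<in> cdga_hom C A"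
    unfolding cdga_hom_iff galg_hom_def
    by (intro conjI ballI allI) (simp_all add: \<tau>_in \<tau>_add mult \<tau>_smult \<tau>_gr diff)
  then show ?thesis using \<tau>i by blast
qed

end

theorem (in extension_problem) exists_extension:
  "\<exists>\<tau>\<in>cdga_hom C A. \<forall>t\<in>carrier T. \<tau> (i t) = \<mu> t"
proof -
  obtain BH B0 where "thinning C S m BH B0" using exists_thinning by blast
  then interpret thin_extension_problem T C i X r A F N m \<mu> BH B0
    by (intro thin_extension_problem.intro extension_problem_axioms)
  show ?thesis by (rule exists_extension)
qed

section \<open>Quotients\<close>

text \<open>The record \<open>quot_cdga A I\<close> is studied for an arbitrary subspace \<open>I\<close>. The product and the
  differential of cosets are unions over all representatives, so as soon as such a union is a
  coset at all, it is the coset of the value at any representatives. This is how \<open>Q_mult\<close> and \<open>Q_diff\<close> are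
  stated: when the quotient is known to be a cdga, they apply without a proof that \<open>I\<close> is a
  differential ideal.\<close>
locale quotient_space = ratmod A for A :: "('a, 'm) cdga_scheme" (structure) +
  fixes I :: "'a set"
  assumes I_sub: "submodule I rat_ring A"
begin

abbreviation "Q \<equiv> quot_cdga A I"

definition cl :: "'a \<Rightarrow> 'a set" where "cl x = I +> x"

lemmas I_closed = subspaceD(2-6)[OF I_sub]

lemma I_in: "I \<subseteq> carrier A" by (rule subspaceD(1)[OF I_sub])

lemma mem_cl: "y \<in> cl x \<longleftrightarrow> (\<exists>h\<in>I. y = h \<oplus> x)"
  by (auto simp: cl_def a_r_coset_def')

lemma minus_self: "x \<in> carrier A \<Longrightarrow> x \<ominus> x = \<zero>"
  by (simp add: a_minus_def r_neg_self)

lemma minus_add_cancel: "x \<in> carrier A \<Longrightarrow> y \<in> carrier A \<Longrightarrow> (x \<ominus> y) \<oplus> y = x"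
  by (simp add: a_minus_def add_assoc l_neg_self)

lemma mem_cl_iff: "x \<in> carrier A \<Longrightarrow> y \<in> cl x \<longleftrightarrow> y \<in> carrier A \<and> y \<ominus> x \<in> I"
proof
  assume x: "x \<in> carrier A" and "y \<in> cl x"
  then obtain h where h: "h \<in> I" "y = h \<oplus> x" by (auto simp: mem_cl)
  have hc: "h \<in> carrier A" using h I_in by blast
  have "y \<ominus> x = h" using h(2) x hc by (simp add: a_minus_def add_assoc r_neg_self)
  then show "y \<in> carrier A \<and> y \<ominus> x \<in> I" using h x hc by auto
next
  assume x: "x \<in> carrier A" and y: "y \<in> carrier A \<and> y \<ominus> x \<in> I"
  then have "y = (y \<ominus> x) \<oplus> x" using minus_add_cancel by auto
  then show "y \<in> cl x" using y unfolding mem_cl by blast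
qed

lemma self_in_cl: "x \<in> carrier A \<Longrightarrow> x \<in> cl x"
  by (simp add: mem_cl_iff minus_self I_closed)

lemma minus_trans:
  "x \<in> carrier A \<Longrightarrow> y \<in> carrier A \<Longrightarrow> z \<in> carrier A \<Longrightarrow> (x \<ominus> y) \<oplus> (y \<ominus> z) = x \<ominus> z"
proof -
  assume *: "x \<in> carrier A" "y \<in> carrier A" "z \<in> carrier A"
  have "(x \<ominus> y) \<oplus> (y \<ominus> z) = ((x \<ominus> y) \<oplus> y) \<oplus> \<ominus> z"
    using * unfolding a_minus_def by (simp add: add_assoc)
  then show ?thesis using * by (simp add: minus_add_cancel a_minus_def[of A x z])
qed

lemma neg_minus: "x \<in> carrier A \<Longrightarrow> y \<in> carrier A \<Longrightarrow> \<ominus> (x \<ominus> y) = y \<ominus> x"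
  unfolding a_minus_def by (simp add: neg_add neg_neg add_comm)

lemma cl_eq_iff: "x \<in> carrier A \<Longrightarrow> y \<in> carrier A \<Longrightarrow> cl x = cl y \<longleftrightarrow> x \<ominus> y \<in> I"
proof
  assume *: "x \<in> carrier A" "y \<in> carrier A"
  show "x \<ominus> y \<in> I" if "cl x = cl y"
    using self_in_cl[OF *(1)] that mem_cl_iff[OF *(2)] by auto
  assume xy: "x \<ominus> y \<in> I"
  have "z \<ominus> x \<in> I \<longleftrightarrow> z \<ominus> y \<in> I" if z: "z \<in> carrier A" for z
  proof
    assume "z \<ominus> x \<in> I"
    then show "z \<ominus> y \<in> I" using I_closed(2) xy minus_trans[OF z *] by metis
  next
    assume "z \<ominus> y \<in> I"
    moreover have "y \<ominus> x \<in> I" using I_closed(4)[OF xy] neg_minus[OF *] by simp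
    ultimately show "z \<ominus> x \<in> I" using I_closed(2) minus_trans[OF z *(2,1)] by metis
  qed
  then show "cl x = cl y" using mem_cl_iff[OF *(1)] mem_cl_iff[OF *(2)] by auto
qed

lemma cl_zero_iff: "x \<in> carrier A \<Longrightarrow> cl x = I \<longleftrightarrow> x \<in> I"
proof -
  assume x: "x \<in> carrier A"
  have "cl \<zero> = I" using mem_cl_iff[of \<zero>] I_in by (auto simp: a_minus_def)
  then show ?thesis using cl_eq_iff[OF x, of \<zero>] x by (simp add: a_minus_def)
qed

lemma Q_carrier: "carrier Q = cl ` carrier A"
  by (auto simp: quot_cdga_def A_RCOSETS_def' cl_def)

lemma Q_gr: "gr Q p = cl ` gr A p"
  by (simp add: quot_cdga_def cl_def image_def)

lemma Q_zero: "\<zero>\<^bsub>Q\<^esub> = I" by (simp add: quot_cdga_def)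

lemma cl_of_mem: "x \<in> carrier A \<Longrightarrow> y \<in> cl x \<Longrightarrow> cl y = cl x"
  using cl_eq_iff mem_cl_iff by blast

lemma Q_add:
  assumes "x \<in> carrier A" "y \<in> carrier A"
  shows "cl x \<oplus>\<^bsub>Q\<^esub> cl y = cl (x \<oplus> y)"
proof -
  have e: "cl x \<oplus>\<^bsub>Q\<^esub> cl y = (\<Union>u\<in>cl x. \<Union>v\<in>cl y. {u \<oplus> v})"
    by (simp add: quot_cdga_def set_add_def')
  show ?thesis unfolding e
  proof (intro equalityI subsetI)
    fix z assume "z \<in> (\<Union>u\<in>cl x. \<Union>v\<in>cl y. {u \<oplus> v})"
    then obtain g h where *: "g \<in> I" "h \<in> I" "z = (g \<oplus> x) \<oplus> (h \<oplus> y)" by (auto simp: mem_cl)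
    moreover have "g \<in> carrier A" "h \<in> carrier A" using * I_in by auto
    ultimately have "z = (g \<oplus> h) \<oplus> (x \<oplus> y)" using assms by (simp add: add_ac)
    then show "z \<in> cl (x \<oplus> y)" using * I_closed(2) unfolding mem_cl by blast
  next
    fix z assume "z \<in> cl (x \<oplus> y)"
    then obtain h where h: "h \<in> I" "z = h \<oplus> (x \<oplus> y)" by (auto simp: mem_cl)
    then have "z = (h \<oplus> x) \<oplus> y" using assms I_in by (auto simp: add_assoc)
    moreover have "h \<oplus> x \<in> cl x" using h(1) unfolding mem_cl by blast
    ultimately show "z \<in> (\<Union>u\<in>cl x. \<Union>v\<in>cl y. {u \<oplus> v})" using self_in_cl[OF assms(2)] by blast
  qed
qed

lemma Q_smult:
  assumes "x \<in> carrier A"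
  shows "a \<odot>\<^bsub>Q\<^esub> cl x = cl (a \<odot> x)"
proof -
  have "cl (a \<odot> u) = cl (a \<odot> x)" if u: "u \<in> cl x" for u
  proof -
    obtain h where h: "h \<in> I" "u = h \<oplus> x" using u by (auto simp: mem_cl)
    then have hc: "h \<in> carrier A" using I_in by blast
    have "a \<odot> u = a \<odot> h \<oplus> a \<odot> x" using h hc assms by (simp add: sm_rdistr)
    then have "a \<odot> u \<in> cl (a \<odot> x)" using I_closed(3)[OF h(1)] unfolding mem_cl by blast
    then show ?thesis using assms by (intro cl_of_mem) auto
  qed
  then have "(\<Union>u\<in>cl x. cl (a \<odot> u)) = (\<Union>u\<in>cl x. cl (a \<odot> x))" by (intro SUP_cong refl)
  also have "\<dots> = cl (a \<odot> x)" using self_in_cl[OF assms] by blast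
  finally show ?thesis by (simp add: quot_cdga_def cl_def[symmetric])
qed

lemma Q_mult:
  assumes "x \<in> carrier A" "y \<in> carrier A" "cl x \<otimes>\<^bsub>Q\<^esub> cl y \<in> carrier Q" "x \<otimes> y \<in> carrier A"
  shows "cl x \<otimes>\<^bsub>Q\<^esub> cl y = cl (x \<otimes> y)"
proof -
  obtain z where z: "z \<in> carrier A" "cl x \<otimes>\<^bsub>Q\<^esub> cl y = cl z" using assms(3) by (auto simp: Q_carrier)
  have "cl (x \<otimes> y) \<subseteq> cl x \<otimes>\<^bsub>Q\<^esub> cl y"
    using self_in_cl assms(1,2) by (auto simp: quot_cdga_def rcoset_mult_def cl_def[symmetric])
  then have "x \<otimes> y \<in> cl z" using self_in_cl[OF assms(4)] z(2) by blast
  then show ?thesis using cl_of_mem[OF z(1)] z(2) by simp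
qed

lemma Q_diff:
  assumes "x \<in> carrier A" "diff Q (cl x) \<in> carrier Q" "diff A x \<in> carrier A"
  shows "diff Q (cl x) = cl (diff A x)"
proof -
  obtain z where z: "z \<in> carrier A" "diff Q (cl x) = cl z" using assms(2) by (auto simp: Q_carrier)
  have "cl (diff A x) \<subseteq> diff Q (cl x)"
    using self_in_cl assms(1) by (auto simp: quot_cdga_def cl_def[symmetric])
  then have "diff A x \<in> cl z" using self_in_cl[OF assms(3)] z(2) by blast
  then show ?thesis using cl_of_mem[OF z(1)] z(2) by simp
qed

lemma Q_ratmod: "ratmod Q"
  unfolding ratmod_def
proof (rule ringI_rat_module)
  have z: "\<zero>\<^bsub>Q\<^esub> = cl \<zero>" using cl_zero_iff[of \<zero>] I_closed(1) by (simp add: Q_zero)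
  show "abelian_group Q"
  proof (rule abelian_groupI)
    fix X assume "X \<in> carrier Q"
    then obtain x where x: "x \<in> carrier A" "X = cl x" by (auto simp: Q_carrier)
    have "cl (\<ominus> x) \<oplus>\<^bsub>Q\<^esub> X = \<zero>\<^bsub>Q\<^esub>" using x by (simp add: Q_add z l_neg_self)
    then show "\<exists>Y\<in>carrier Q. Y \<oplus>\<^bsub>Q\<^esub> X = \<zero>\<^bsub>Q\<^esub>" using x by (auto simp: Q_carrier)
  qed (auto simp: Q_carrier Q_add z add_ac)
qed (auto simp: Q_carrier Q_add Q_smult sm_ldistr sm_rdistr sm_assoc)

end

section \<open>Tensor powers\<close>

subsection \<open>Linear extension of maps on symbols\<close>

lemma lin_ext_superset:
  assumes "finite S" "Poly_Mapping.keys f \<subseteq> S"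
  shows "lin_ext h f = (\<Sum>g\<in>S. scl (Poly_Mapping.lookup f g) (h g))"
  unfolding lin_ext_def
  by (rule sum.mono_neutral_left) (use assms in \<open>auto simp: in_keys_iff\<close>)

lemma lin_ext_zero [simp]: "lin_ext h 0 = 0"
  by (simp add: lin_ext_def)

lemma lin_ext_add: "lin_ext h (f + g) = lin_ext h f + lin_ext h g"
proof -
  let ?S = "Poly_Mapping.keys f \<union> Poly_Mapping.keys g"
  have "lin_ext h (f + g) = (\<Sum>x\<in>?S. scl (Poly_Mapping.lookup (f + g) x) (h x))"
    by (rule lin_ext_superset) (use keys_add[of f g] in auto)
  also have "\<dots> = (\<Sum>x\<in>?S. scl (Poly_Mapping.lookup f x) (h x)) +
      (\<Sum>x\<in>?S. scl (Poly_Mapping.lookup g x) (h x))"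
    by (simp add: lookup_add scl_add_left sum.distrib)
  also have "\<dots> = lin_ext h f + lin_ext h g"
    using lin_ext_superset[of ?S f h] lin_ext_superset[of ?S g h] by simp
  finally show ?thesis .
qed

lemma lin_ext_scl: "lin_ext h (scl a f) = scl a (lin_ext h f)"
proof -
  have "lin_ext h (scl a f) =
      (\<Sum>x\<in>Poly_Mapping.keys f. scl (Poly_Mapping.lookup (scl a f) x) (h x))"
    by (rule lin_ext_superset) (use keys_scl[of a f] in auto)
  then show ?thesis by (simp add: lin_ext_def scl_sum)
qed

lemma lin_ext_sym [simp]: "lin_ext h (sym g) = h g"
  by (simp add: lin_ext_def)

lemma lin_ext_minus: "lin_ext h (f - g) = lin_ext h f - lin_ext h g"
  using lin_ext_add[of h f "scl (-1) g"] lin_ext_scl[of h "-1" g] by (simp add: scl_minus_one)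

lemma lin_ext_sum: "lin_ext h (\<Sum>j\<in>J. f j) = (\<Sum>j\<in>J. lin_ext h (f j))"
  by (induction J rule: infinite_finite_induct) (auto simp: lin_ext_add)

lemma keys_lin_ext:
  assumes "\<And>g. g \<in> Poly_Mapping.keys f \<Longrightarrow> Poly_Mapping.keys (h g) \<subseteq> S"
  shows "Poly_Mapping.keys (lin_ext h f) \<subseteq> S"
proof -
  have "Poly_Mapping.keys (lin_ext h f) \<subseteq>
      (\<Union>g\<in>Poly_Mapping.keys f. Poly_Mapping.keys (scl (Poly_Mapping.lookup f g) (h g)))"
    unfolding lin_ext_def by (rule keys_sum)
  then show ?thesis using assms keys_scl by fastforce
qed

lemma lin_ext_comp: "lin_ext h (lin_ext k f) = lin_ext (\<lambda>x. lin_ext h (k x)) f"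
  using subset_UNIV[of "Poly_Mapping.keys f"]
  by (induction f rule: poly_mapping_linear_induct) (auto simp: lin_ext_add lin_ext_scl)

subsection \<open>The presentation of the tensor power\<close>

lemma pre_tensor_simps [simp]:
  "carrier (pre_tensor A n) = {f. Poly_Mapping.keys f \<subseteq> tsyms A n}"
  "\<zero>\<^bsub>pre_tensor A n\<^esub> = 0" "f \<oplus>\<^bsub>pre_tensor A n\<^esub> g = f + g" "a \<odot>\<^bsub>pre_tensor A n\<^esub> f = scl a f"
  "f \<otimes>\<^bsub>pre_tensor A n\<^esub> g = lin_ext (\<lambda>xs. lin_ext (\<lambda>ys. tsym_mult A xs ys) g) f"
  "\<one>\<^bsub>pre_tensor A n\<^esub> = sym (replicate n (0, \<one>\<^bsub>A\<^esub>))"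
  "gr (pre_tensor A n) p = {f. Poly_Mapping.keys f \<subseteq> {xs \<in> tsyms A n. tdeg xs = p}}"
  "diff (pre_tensor A n) = lin_ext (tsym_diff A)"
  by (simp_all add: pre_tensor_def)

lemma pre_tensor_ratmod: "ratmod (pre_tensor A n)"
  unfolding ratmod_def
proof (rule ringI_rat_module)
  show "abelian_group (pre_tensor A n)"
  proof (rule abelian_groupI)
    fix x assume "x \<in> carrier (pre_tensor A n)"
    then show "\<exists>y\<in>carrier (pre_tensor A n). y \<oplus>\<^bsub>pre_tensor A n\<^esub> x = \<zero>\<^bsub>pre_tensor A n\<^esub>"
      by (intro bexI[of _ "- x"]) auto
  qed (auto simp: keys_add_subset add.assoc add.commute dest: subsetD[OF keys_add])
qed (auto simp: keys_scl_subset scl_add_left dest: subsetD[OF keys_scl])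

lemma pre_tensor_uminus:
  "f \<in> carrier (pre_tensor A n) \<Longrightarrow> \<ominus>\<^bsub>pre_tensor A n\<^esub> f = - f"
  using ratmod.sm_uminus[OF pre_tensor_ratmod, of f A n] by (simp add: scl_minus_one)

lemma tsymsD: "xs \<in> tsyms A n \<Longrightarrow> length xs = n"
  "xs \<in> tsyms A n \<Longrightarrow> i < n \<Longrightarrow> snd (xs ! i) \<in> gr A (fst (xs ! i))"
  unfolding tsyms_def by (auto simp: case_prod_beta)

lemma tsymsI: "length xs = n \<Longrightarrow> (\<And>i. i < n \<Longrightarrow> snd (xs ! i) \<in> gr A (fst (xs ! i))) \<Longrightarrow> xs \<in> tsyms A n"
  unfolding tsyms_def by (auto simp: in_set_conv_nth) (metis fst_conv snd_conv)

lemma tsyms_update: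
  "xs \<in> tsyms A n \<Longrightarrow> x \<in> gr A p \<Longrightarrow> xs[i := (p, x)] \<in> tsyms A n"
proof (cases "i < length xs")
  case True
  assume "xs \<in> tsyms A n" "x \<in> gr A p"
  then show ?thesis using True tsymsD[of xs A n]
    by (intro tsymsI) (auto simp: nth_list_update)
next
  case False
  assume "xs \<in> tsyms A n"
  then show ?thesis using False by (simp add: list_update_beyond)
qed

lemma tsyms_Cons: "(p, x) # xs \<in> tsyms A n \<longleftrightarrow> (\<exists>m. n = Suc m \<and> xs \<in> tsyms A m) \<and> x \<in> gr A p"
  by (auto simp: tsyms_def)

definition rels :: "('a, 'm) cdga_scheme \<Rightarrow> nat \<Rightarrow> ('a tsym \<Rightarrow>\<^sub>0 rat) set" where
  "rels A n =
     {sym (xs[i := (p, x \<oplus>\<^bsub>A\<^esub> y)]) - sym (xs[i := (p, x)]) - sym (xs[i := (p, y)]) |xs i p x y.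
        xs \<in> tsyms A n \<and> i < n \<and> x \<in> gr A p \<and> y \<in> gr A p} \<union>
     {sym (xs[i := (p, a \<odot>\<^bsub>A\<^esub> x)]) - scl a (sym (xs[i := (p, x)])) |xs i p a x.
        xs \<in> tsyms A n \<and> i < n \<and> x \<in> gr A p}"

context cdga
begin

text \<open>Writing the defining relations with updates of a symbol makes it evident that operators
  acting in another position preserve them.\<close>
lemma tensor_rels_eq: "tensor_rels A n = lspan (pre_tensor A n) (rels A n)"
proof -
  have upd: "xs[i := a] = take i xs @ a # drop (Suc i) xs" if "xs \<in> tsyms A n" "i < n"
    for xs i and a :: "nat \<times> 'a"
    using tsymsD(1)[OF that(1)] that(2) upd_conv_take_nth_drop[of i xs a] by simp
  have upd': "(us @ a # vs)[length us := b] = us @ b # vs" for us vs and a b :: "nat \<times> 'a" by simp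
  have "{sym (us @ (p, x \<oplus> y) # vs) - sym (us @ (p, x) # vs) - sym (us @ (p, y) # vs)
        | us vs p x y. x \<in> gr A p \<and> y \<in> gr A p \<and> us @ (p, x) # vs \<in> tsyms A n} =
     {sym (xs[i := (p, x \<oplus> y)]) - sym (xs[i := (p, x)]) - sym (xs[i := (p, y)]) |xs i p x y.
        xs \<in> tsyms A n \<and> i < n \<and> x \<in> gr A p \<and> y \<in> gr A p}" (is "?L1 = ?R1")
  proof (intro equalityI subsetI)
    fix z assume "z \<in> ?L1"
    then obtain us vs p x y where z: "z = sym (us @ (p, x \<oplus> y) # vs) - sym (us @ (p, x) # vs)
        - sym (us @ (p, y) # vs)" "x \<in> gr A p" "y \<in> gr A p" "us @ (p, x) # vs \<in> tsyms A n" by blast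
    show "z \<in> ?R1"
      using z tsymsD(1)[OF z(4)]
      by (intro CollectI exI[of _ "us @ (p, x) # vs"] exI[of _ "length us"] exI[of _ p] exI[of _ x]
          exI[of _ y]) auto
  next
    fix z assume "z \<in> ?R1"
    then obtain xs i p x y where z: "z = sym (xs[i := (p, x \<oplus> y)]) - sym (xs[i := (p, x)])
        - sym (xs[i := (p, y)])" "xs \<in> tsyms A n" "i < n" "x \<in> gr A p" "y \<in> gr A p" by blast
    show "z \<in> ?L1"
      using z upd[OF z(2,3)] tsyms_update[OF z(2) z(4), of i]
      by (intro CollectI exI[of _ "take i xs"] exI[of _ "drop (Suc i) xs"] exI[of _ p] exI[of _ x]
          exI[of _ y]) auto
  qed
  moreover have "{sym (us @ (p, a \<odot> x) # vs) - scl a (sym (us @ (p, x) # vs))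
        | us vs p a x. us @ (p, x) # vs \<in> tsyms A n} =
     {sym (xs[i := (p, a \<odot> x)]) - scl a (sym (xs[i := (p, x)])) |xs i p a x.
        xs \<in> tsyms A n \<and> i < n \<and> x \<in> gr A p}" (is "?L2 = ?R2")
  proof (intro equalityI subsetI)
    fix z assume "z \<in> ?L2"
    then obtain us vs p x a where z: "z = sym (us @ (p, a \<odot> x) # vs) - scl a (sym (us @ (p, x) # vs))"
        "us @ (p, x) # vs \<in> tsyms A n" by blast
    have "x \<in> gr A p" using z(2) by (auto simp: tsyms_def)
    then show "z \<in> ?R2"
      using z tsymsD(1)[OF z(2)]
      by (intro CollectI exI[of _ "us @ (p, x) # vs"] exI[of _ "length us"] exI[of _ p] exI[of _ a]
          exI[of _ x]) auto
  next
    fix z assume "z \<in> ?R2"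
    then obtain xs i p x a where z: "z = sym (xs[i := (p, a \<odot> x)]) - scl a (sym (xs[i := (p, x)]))"
        "xs \<in> tsyms A n" "i < n" "x \<in> gr A p" by blast
    show "z \<in> ?L2"
      using z upd[OF z(2,3)] tsyms_update[OF z(2) z(4), of i]
      by (intro CollectI exI[of _ "take i xs"] exI[of _ "drop (Suc i) xs"] exI[of _ p] exI[of _ a]
          exI[of _ x]) auto
  qed
  ultimately show ?thesis unfolding tensor_rels_def rels_def by simp
qed

lemma rels_in: "rels A n \<subseteq> carrier (pre_tensor A n)"
proof -
  have m: "Poly_Mapping.keys (f - g) \<subseteq> S"
    if "Poly_Mapping.keys f \<subseteq> S" "Poly_Mapping.keys g \<subseteq> S" for f g :: "'a tsym \<Rightarrow>\<^sub>0 rat" and S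
    using that keys_diff[of f g] by auto
  have s: "Poly_Mapping.keys (sym (xs[i := (p, x)])) \<subseteq> tsyms A n"
    if "xs \<in> tsyms A n" "x \<in> gr A p" for xs i p x
    using tsyms_update[OF that] by simp
  show ?thesis
  proof
    fix f assume "f \<in> rels A n"
    then consider (add) xs i p x y where "xs \<in> tsyms A n" "x \<in> gr A p" "y \<in> gr A p"
        "f = sym (xs[i := (p, x \<oplus> y)]) - sym (xs[i := (p, x)]) - sym (xs[i := (p, y)])"
      | (smult) xs i p a x where "xs \<in> tsyms A n" "x \<in> gr A p"
        "f = sym (xs[i := (p, a \<odot> x)]) - scl a (sym (xs[i := (p, x)]))"
      unfolding rels_def by blast
    then have "Poly_Mapping.keys f \<subseteq> tsyms A n"
    proof cases
      case add
      show ?thesis unfolding add(4)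
        by (intro m s add gr_closed(2))
    next
      case smult
      show ?thesis unfolding smult(3)
        by (intro m s smult gr_closed(3) keys_scl_subset)
    qed
    then show "f \<in> carrier (pre_tensor A n)" by simp
  qed
qed

sublocale tens: quotient_space "pre_tensor A n" "tensor_rels A n" for n
proof (intro quotient_space.intro pre_tensor_ratmod quotient_space_axioms.intro)
  show "submodule (tensor_rels A n) rat_ring (pre_tensor A n)"
    unfolding tensor_rels_eq by (rule ratmod.lspan_subspace[OF pre_tensor_ratmod rels_in])
qed

lemma tensor_power_eq: "tensor_power A n = quot_cdga (pre_tensor A n) (tensor_rels A n)"
  by (simp add: tensor_power_def)

lemma tens_minus: "f \<in> carrier (pre_tensor A n) \<Longrightarrow> g \<in> carrier (pre_tensor A n) \<Longrightarrow>
  f \<ominus>\<^bsub>pre_tensor A n\<^esub> g = f - g"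
  unfolding a_minus_def using pre_tensor_uminus[of g A n] by simp

lemma rel_add:
  assumes "xs \<in> tsyms A n" "i < n" "x \<in> gr A p" "y \<in> gr A p"
  shows "sym (xs[i := (p, x \<oplus> y)]) - sym (xs[i := (p, x)]) - sym (xs[i := (p, y)]) \<in> tensor_rels A n"
  unfolding tensor_rels_eq
  by (rule ratmod.lspan_incl[OF pre_tensor_ratmod]) (use assms in \<open>unfold rels_def, blast\<close>)

lemma rel_smult:
  assumes "xs \<in> tsyms A n" "i < n" "x \<in> gr A p"
  shows "sym (xs[i := (p, a \<odot> x)]) - scl a (sym (xs[i := (p, x)])) \<in> tensor_rels A n"
  unfolding tensor_rels_eq
  by (rule ratmod.lspan_incl[OF pre_tensor_ratmod]) (use assms in \<open>unfold rels_def, blast\<close>)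

lemma linear_kills_rels:
  assumes R: "submodule R rat_ring M" and M: "ratmod M"
    and add: "\<And>f g. f \<in> carrier (pre_tensor A n) \<Longrightarrow> g \<in> carrier (pre_tensor A n) \<Longrightarrow>
      L (f + g) = L f \<oplus>\<^bsub>M\<^esub> L g"
    and smult: "\<And>a f. f \<in> carrier (pre_tensor A n) \<Longrightarrow> L (scl a f) = a \<odot>\<^bsub>M\<^esub> L f"
    and zero: "L 0 = \<zero>\<^bsub>M\<^esub>"
    and gens: "\<And>f. f \<in> rels A n \<Longrightarrow> L f \<in> R"
    and f: "f \<in> tensor_rels A n"
  shows "L f \<in> R"
proof -
  note Rc = ratmod.subspaceD(2-4)[OF M R]
  from f rels_in show ?thesis unfolding tensor_rels_eq
  proof (induction f rule: ratmod.lspan_induct[OF pre_tensor_ratmod, consumes 2])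
    case 1
    then show ?case using zero Rc by simp
  next
    case (2 f g)
    then show ?case using add Rc by auto
  next
    case (3 a f)
    then show ?case using smult Rc by auto
  next
    case (4 s)
    then show ?case using gens by simp
  qed
qed

end

subsection \<open>The multiplication map\<close>

lemma word_prod_snd_in: "dgca A \<Longrightarrow> xs \<in> tsyms A n \<Longrightarrow> set (map snd xs) \<subseteq> carrier A"
  by (auto simp: tsyms_def dgca.gr_in)

context cdga
begin

abbreviation "eval_sym xs \<equiv> word_prod A (map snd xs)"

lemma eval_sym_in: "xs \<in> tsyms A n \<Longrightarrow> eval_sym xs \<in> carrier A"
  using word_prod_snd_in[OF dgca_axioms] by blast

lemma eval_sym_gr: "xs \<in> tsyms A n \<Longrightarrow> eval_sym xs \<in> gr A (tdeg xs)"
proof (induction xs arbitrary: n)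
  case Nil
  then show ?case by (simp add: tdeg_def gr_one)
next
  case (Cons a xs)
  obtain p x where a: "a = (p, x)" by (cases a)
  have "tdeg (a # xs) = p + tdeg xs"
    unfolding tdeg_def by (simp add: a sum.lessThan_Suc_shift del: sum.lessThan_Suc)
  then show ?case using Cons a gr_mult[of x p "eval_sym xs" "tdeg xs"] by (auto simp: tsyms_Cons)
qed

lemma tensor_eval_eq: "tensor_eval A f = lincomb A eval_sym f"
  by (simp add: tensor_eval_def lincomb_def)

lemma eval_keys: "Poly_Mapping.keys f \<subseteq> tsyms A n \<Longrightarrow> eval_sym ` Poly_Mapping.keys f \<subseteq> carrier A"
  using eval_sym_in by blast

lemma eval_in: "Poly_Mapping.keys f \<subseteq> tsyms A n \<Longrightarrow> tensor_eval A f \<in> carrier A"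
  unfolding tensor_eval_eq by (rule lincomb_closed[OF eval_keys])

lemma eval_add: "Poly_Mapping.keys f \<subseteq> tsyms A n \<Longrightarrow> Poly_Mapping.keys g \<subseteq> tsyms A n \<Longrightarrow>
    tensor_eval A (f + g) = tensor_eval A f \<oplus> tensor_eval A g"
  unfolding tensor_eval_eq by (intro lincomb_add eval_keys)

lemma eval_scl: "Poly_Mapping.keys f \<subseteq> tsyms A n \<Longrightarrow> tensor_eval A (scl a f) = a \<odot> tensor_eval A f"
  unfolding tensor_eval_eq by (intro lincomb_scl eval_keys)

lemma eval_of_sym: "xs \<in> tsyms A n \<Longrightarrow> tensor_eval A (sym xs) = eval_sym xs"
  unfolding tensor_eval_eq by (intro lincomb_sym eval_sym_in)

lemma eval_zero [simp]: "tensor_eval A 0 = \<zero>"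
  by (simp add: tensor_eval_eq)

lemma eval_minus: "Poly_Mapping.keys f \<subseteq> tsyms A n \<Longrightarrow> Poly_Mapping.keys g \<subseteq> tsyms A n \<Longrightarrow>
    tensor_eval A (f - g) = tensor_eval A f \<ominus> tensor_eval A g"
  using eval_add[of f n "scl (-1) g"] eval_scl[of g n "-1"] keys_scl_subset[of g "tsyms A n" "-1"]
    eval_in[of g n]
  by (simp add: scl_minus_one a_minus_def sm_uminus)

lemma eval_sym_update:
  assumes "xs \<in> tsyms A n" "i < n"
  obtains u v where "u \<in> carrier A" "v \<in> carrier A"
    "\<And>p x. x \<in> carrier A \<Longrightarrow> eval_sym (xs[i := (p, x)]) = u \<otimes> (x \<otimes> v)"
proof
  have s: "set (map snd xs) \<subseteq> carrier A" by (rule word_prod_snd_in[OF dgca_axioms assms(1)])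
  have s1: "set (take i (map snd xs)) \<subseteq> carrier A" using s set_take_subset by fastforce
  have s2: "set (drop (Suc i) (map snd xs)) \<subseteq> carrier A" using s set_drop_subset by fastforce
  show "word_prod A (take i (map snd xs)) \<in> carrier A" "word_prod A (drop (Suc i) (map snd xs)) \<in> carrier A"
    using s1 s2 by auto
  fix p x assume x: "x \<in> carrier A"
  have "map snd (xs[i := (p, x)]) = take i (map snd xs) @ x # drop (Suc i) (map snd xs)"
    using assms tsymsD(1)[OF assms(1)] by (simp add: map_update upd_conv_take_nth_drop take_map drop_map)
  then show "eval_sym (xs[i := (p, x)]) =
      word_prod A (take i (map snd xs)) \<otimes> (x \<otimes> word_prod A (drop (Suc i) (map snd xs)))"
    using word_prod_append[of "take i (map snd xs)" "x # drop (Suc i) (map snd xs)"] s1 s2 x by simp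
qed

lemma eval_rels:
  assumes "f \<in> tensor_rels A n"
  shows "tensor_eval A f = \<zero>"
proof -
  have z: "submodule {\<zero>} rat_ring A" by (rule subspaceI) auto
  have "tensor_eval A f \<in> {\<zero>}"
  proof (rule linear_kills_rels[OF z ratmod_axioms _ _ _ _ assms])
    show "tensor_eval A f \<in> {\<zero>}" if f: "f \<in> rels A n" for f
    proof -
      consider (add) xs i p x y where "xs \<in> tsyms A n" "i < n" "x \<in> gr A p" "y \<in> gr A p"
          "f = sym (xs[i := (p, x \<oplus> y)]) - sym (xs[i := (p, x)]) - sym (xs[i := (p, y)])"
        | (smult) xs i p a x where "xs \<in> tsyms A n" "i < n" "x \<in> gr A p"
          "f = sym (xs[i := (p, a \<odot> x)]) - scl a (sym (xs[i := (p, x)]))"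
        using f unfolding rels_def by blast
      then show ?thesis
      proof cases
        case add
        obtain u v where uv: "u \<in> carrier A" "v \<in> carrier A"
          "\<And>p x. x \<in> carrier A \<Longrightarrow> eval_sym (xs[i := (p, x)]) = u \<otimes> (x \<otimes> v)"
          using eval_sym_update[OF add(1,2)] by blast
        have ts: "xs[i := (p, x \<oplus> y)] \<in> tsyms A n" "xs[i := (p, x)] \<in> tsyms A n" "xs[i := (p, y)] \<in> tsyms A n"
          using tsyms_update[OF add(1)] add(3,4) gr_closed(2) by auto
        have k: "Poly_Mapping.keys (sym (xs[i := (p, x \<oplus> y)]) - sym (xs[i := (p, x)])) \<subseteq> tsyms A n"
          using keys_diff[of "sym (xs[i := (p, x \<oplus> y)])" "sym (xs[i := (p, x)])"] ts by auto
        have "tensor_eval A f = (u \<otimes> ((x \<oplus> y) \<otimes> v) \<ominus> u \<otimes> (x \<otimes> v)) \<ominus> u \<otimes> (y \<otimes> v)"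
          unfolding add(5) using k ts add(3,4) by (simp add: eval_minus[of _ n] eval_of_sym[of _ n] uv)
        also have "\<dots> = (u \<otimes> (x \<otimes> v) \<oplus> u \<otimes> (y \<otimes> v)) \<oplus> \<ominus> (u \<otimes> (x \<otimes> v) \<oplus> u \<otimes> (y \<otimes> v))"
          using uv(1,2) add(3,4)
          by (simp add: mult_l_distr mult_r_distr a_minus_def add_assoc neg_add)
        also have "\<dots> = \<zero>" using uv(1,2) add(3,4) by (intro r_neg_self) auto
        finally show ?thesis by simp
      next
        case smult
        obtain u v where uv: "u \<in> carrier A" "v \<in> carrier A"
          "\<And>p x. x \<in> carrier A \<Longrightarrow> eval_sym (xs[i := (p, x)]) = u \<otimes> (x \<otimes> v)"
          using eval_sym_update[OF smult(1,2)] by blast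
        have ts: "xs[i := (p, a \<odot> x)] \<in> tsyms A n" "xs[i := (p, x)] \<in> tsyms A n"
          using tsyms_update[OF smult(1)] smult(3) gr_closed(3) by auto
        have "tensor_eval A f = u \<otimes> ((a \<odot> x) \<otimes> v) \<ominus> a \<odot> (u \<otimes> (x \<otimes> v))"
          unfolding smult(4) using ts smult(3) keys_scl_subset[of "sym (xs[i := (p, x)])" "tsyms A n" a]
          by (simp add: eval_minus[of _ n] eval_of_sym[of _ n] eval_scl[of _ n] uv)
        then show ?thesis using uv(1,2) smult(3)
          by (simp add: smult_mult_left smult_mult_right a_minus_def r_neg_self)
      qed
    qed
  qed (use eval_add[of _ n] eval_scl[of _ n] in auto)
  then show ?thesis by simp
qed

lemma multiplication_cl:
  assumes "Poly_Mapping.keys f \<subseteq> tsyms A n"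
  shows "multiplication A (tens.cl n f) = tensor_eval A f"
proof -
  have "tensor_eval A g = tensor_eval A f" if g: "g \<in> tens.cl n f" for g
  proof -
    obtain h where h: "h \<in> tensor_rels A n" "g = h + f" using g by (auto simp: tens.mem_cl)
    have "Poly_Mapping.keys h \<subseteq> tsyms A n" using tens.I_in[of n] h(1) by auto
    then show ?thesis unfolding h(2)
      using assms eval_rels[OF h(1)] eval_in[OF assms] by (simp add: eval_add[of _ n])
  qed
  then have "tensor_eval A ` tens.cl n f = (\<lambda>_. tensor_eval A f) ` tens.cl n f"
    by (intro image_cong refl)
  also have "\<dots> = {tensor_eval A f}" using tens.self_in_cl[of f n] assms by (simp add: image_constant)
  finally show ?thesis by (simp add: multiplication_def)
qed

lemma eval_tsym_mult:
  assumes "xs \<in> tsyms A n" "ys \<in> tsyms A n"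
  shows "tensor_eval A (tsym_mult A xs ys) = eval_sym xs \<otimes> eval_sym ys"
proof -
  let ?m = "\<lambda>xs ys. map2 (\<lambda>(p, x) (q, y). (p + q, x \<otimes> y)) xs ys"
  let ?s = "\<lambda>xs ys :: 'a tsym. \<Sum>i<length xs. \<Sum>j<i. fst (xs ! i) * fst (ys ! j)"
  have "?m xs ys \<in> tsyms A n \<and> (-1) ^ ?s xs ys \<odot> eval_sym (?m xs ys) = eval_sym xs \<otimes> eval_sym ys"
    using assms
  proof (induction xs arbitrary: ys n)
    case Nil
    then show ?case by (auto simp: tsyms_def)
  next
    case (Cons a xs)
    obtain p x where a: "a = (p, x)" by (cases a)
    obtain m where m: "n = Suc m" "xs \<in> tsyms A m" "x \<in> gr A p"
      using Cons.prems(1) a by (auto simp: tsyms_Cons)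
    obtain b zs where ys: "ys = b # zs" using Cons.prems(2) m(1) by (cases ys) (auto simp: tsyms_def)
    obtain q y where b: "b = (q, y)" by (cases b)
    have zs: "zs \<in> tsyms A m" "y \<in> gr A q" using Cons.prems(2) m(1) ys b by (auto simp: tsyms_Cons)
    have IH: "?m xs zs \<in> tsyms A m" "(-1) ^ ?s xs zs \<odot> eval_sym (?m xs zs) = eval_sym xs \<otimes> eval_sym zs"
      using Cons.IH[OF m(2) zs(1)] by auto
    have s: "?s (a # xs) ys = tdeg xs * q + ?s xs zs"
      unfolding tdeg_def
      by (simp add: a b ys sum.lessThan_Suc_shift sum_distrib_left sum.distrib algebra_simps
          del: sum.lessThan_Suc)
    have c: "x \<in> carrier A" "y \<in> carrier A" "eval_sym xs \<in> carrier A" "eval_sym zs \<in> carrier A"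
      "eval_sym (?m xs zs) \<in> carrier A"
      using m zs eval_sym_in eval_sym_in[OF IH(1)] by auto
    have "(-1) ^ ?s (a # xs) ys \<odot> eval_sym (?m (a # xs) ys) =
      (-1) ^ (tdeg xs * q) \<odot> (x \<otimes> (y \<otimes> ((-1) ^ ?s xs zs \<odot> eval_sym (?m xs zs))))"
      unfolding s using c
      by (simp add: a b ys mult_assoc smult_mult_right sm_assoc power_add)
    also have "\<dots> = (-1) ^ (tdeg xs * q) \<odot> (x \<otimes> (y \<otimes> (eval_sym xs \<otimes> eval_sym zs)))"
      unfolding IH(2) ..
    also have "\<dots> = x \<otimes> (eval_sym xs \<otimes> (y \<otimes> eval_sym zs))"
      using mult_swap[OF eval_sym_gr[OF m(2)] zs(2) c(4)] c by (simp add: smult_mult_right)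
    also have "\<dots> = eval_sym (a # xs) \<otimes> eval_sym ys"
      using c by (simp add: a b ys mult_assoc)
    finally show ?case using IH(1) m zs gr_mult[OF m(3) zs(2)] by (simp add: a b ys tsyms_Cons)
  qed
  then show ?thesis
    unfolding tsym_mult_def
    by (subst eval_scl[of _ n]) (auto simp: eval_of_sym)
qed

lemma tsym_mult_keys:
  assumes "xs \<in> tsyms A n" "ys \<in> tsyms A n"
  shows "Poly_Mapping.keys (tsym_mult A xs ys) \<subseteq> tsyms A n"
proof -
  have "map2 (\<lambda>(p, x) (q, y). (p + q, x \<otimes> y)) xs ys \<in> tsyms A n"
    using assms tsymsD(1)[OF assms(1)] tsymsD(1)[OF assms(2)] tsymsD(2)[OF assms(1)] tsymsD(2)[OF assms(2)]
    by (intro tsymsI) (auto simp: case_prod_beta gr_mult)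
  then show ?thesis unfolding tsym_mult_def by (intro keys_scl_subset) simp
qed

lemma pre_mult_in:
  assumes "Poly_Mapping.keys f \<subseteq> tsyms A n" "Poly_Mapping.keys g \<subseteq> tsyms A n"
  shows "Poly_Mapping.keys (lin_ext (\<lambda>xs. lin_ext (\<lambda>ys. tsym_mult A xs ys) g) f) \<subseteq> tsyms A n"
  using assms tsym_mult_keys by (intro keys_lin_ext) blast

lemma eval_mult:
  assumes "Poly_Mapping.keys f \<subseteq> tsyms A n" "Poly_Mapping.keys g \<subseteq> tsyms A n"
  shows "tensor_eval A (lin_ext (\<lambda>xs. lin_ext (\<lambda>ys. tsym_mult A xs ys) g) f) =
    tensor_eval A f \<otimes> tensor_eval A g"
  using assms(1)
proof (induction f rule: poly_mapping_linear_induct)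
  case zero
  then show ?case using eval_in[OF assms(2)] by simp
next
  case (sym xs)
  have k: "Poly_Mapping.keys (lin_ext (\<lambda>ys. tsym_mult A xs ys) h) \<subseteq> tsyms A n"
    if "Poly_Mapping.keys h \<subseteq> tsyms A n" for h
    using that tsym_mult_keys[OF sym] by (intro keys_lin_ext) blast
  have "tensor_eval A (lin_ext (\<lambda>ys. tsym_mult A xs ys) g) = eval_sym xs \<otimes> tensor_eval A g"
    using assms(2)
  proof (induction g rule: poly_mapping_linear_induct)
    case (add f g)
    then show ?case using k eval_in eval_sym_in[OF sym]
      by (simp add: lin_ext_add eval_add[of _ n] mult_r_distr)
  next
    case (scl a f)
    then show ?case using k eval_in eval_sym_in[OF sym]
      by (simp add: lin_ext_scl eval_scl[of _ n] smult_mult_right)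
  qed (use sym eval_sym_in[OF sym] in \<open>auto simp: eval_tsym_mult eval_of_sym\<close>)
  then show ?case using sym by (simp add: eval_of_sym)
next
  case (add f h)
  then show ?case using pre_mult_in[OF _ assms(2)] eval_in assms(2)
    by (simp add: lin_ext_add eval_add[of _ n] mult_l_distr)
next
  case (scl a f)
  then show ?case using pre_mult_in[OF _ assms(2)] eval_in assms(2)
    by (simp add: lin_ext_scl eval_scl[of _ n] smult_mult_left)
qed

lemma tsym_diff_keys:
  assumes "xs \<in> tsyms A n"
  shows "Poly_Mapping.keys (tsym_diff A xs) \<subseteq> tsyms A n"
proof -
  have "Poly_Mapping.keys (scl a (sym (xs[i := (Suc (fst (xs ! i)), diff A (snd (xs ! i)))]))) \<subseteq> tsyms A n"
    if "i < n" for a i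
    using tsyms_update[OF assms diff_gr[OF tsymsD(2)[OF assms that]], of i]
    by (intro keys_scl_subset) simp
  then have "(\<Union>i<length xs. Poly_Mapping.keys (scl ((-1) ^ (\<Sum>j<i. fst (xs ! j)))
        (sym (xs[i := (Suc (fst (xs ! i)), diff A (snd (xs ! i)))])))) \<subseteq> tsyms A n"
    using tsymsD(1)[OF assms] by blast
  then show ?thesis unfolding tsym_diff_def using keys_sum by (rule order_trans[rotated])
qed

lemma tsym_diff_Cons:
  "tsym_diff A ((p, x) # xs) =
    sym ((Suc p, diff A x) # xs) + scl ((-1) ^ p) (lin_ext (\<lambda>zs. sym ((p, x) # zs)) (tsym_diff A xs))"
  unfolding tsym_diff_def
  by (simp add: sum.lessThan_Suc_shift lin_ext_sum lin_ext_scl scl_sum power_add del: sum.lessThan_Suc)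

lemma eval_tsym_diff:
  assumes "xs \<in> tsyms A n"
  shows "tensor_eval A (tsym_diff A xs) = diff A (eval_sym xs)"
  using assms
proof (induction xs arbitrary: n)
  case Nil
  then show ?case by (simp add: tsym_diff_def)
next
  case (Cons a xs)
  obtain p x where a: "a = (p, x)" by (cases a)
  obtain m where m: "n = Suc m" "xs \<in> tsyms A m" "x \<in> gr A p"
    using Cons.prems(1) a by (auto simp: tsyms_Cons)
  have k: "Poly_Mapping.keys (lin_ext (\<lambda>zs. sym ((p, x) # zs)) f) \<subseteq> tsyms A n"
    if "Poly_Mapping.keys f \<subseteq> tsyms A m" for f
    using that m by (intro keys_lin_ext) (auto simp: tsyms_Cons)
  have e: "tensor_eval A (lin_ext (\<lambda>zs. sym ((p, x) # zs)) f) = x \<otimes> tensor_eval A f"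
    if "Poly_Mapping.keys f \<subseteq> tsyms A m" for f
    using that
  proof (induction f rule: poly_mapping_linear_induct)
    case zero
    then show ?case using m by simp
  next
    case (sym zs)
    then have "(p, x) # zs \<in> tsyms A n" using m by (simp add: tsyms_Cons)
    then show ?case using sym by (simp add: eval_of_sym)
  next
    case (add f g)
    then show ?case using k m eval_in[of _ m]
      by (simp add: lin_ext_add eval_add[of _ n] eval_add[of _ m] mult_r_distr gr_in)
  next
    case (scl a f)
    then show ?case using k m eval_in[of _ m]
      by (simp add: lin_ext_scl eval_scl[of _ n] eval_scl[of _ m] smult_mult_right gr_in)
  qed
  have kd: "Poly_Mapping.keys (tsym_diff A xs) \<subseteq> tsyms A m" by (rule tsym_diff_keys[OF m(2)])
  have ts: "(Suc p, diff A x) # xs \<in> tsyms A n" using m diff_gr by (simp add: tsyms_Cons)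
  have "tensor_eval A (tsym_diff A (a # xs)) =
      diff A x \<otimes> eval_sym xs \<oplus> (-1) ^ p \<odot> (x \<otimes> diff A (eval_sym xs))"
    unfolding a tsym_diff_Cons using ts k[OF kd] keys_scl_subset[OF k[OF kd]]
    by (simp add: eval_add[of _ n] eval_scl[of _ n] eval_of_sym e[OF kd] Cons.IH[OF m(2)])
  then show ?case using leibniz[OF m(3) eval_sym_in[OF m(2)]] by (simp add: a)
qed

lemma pre_diff_in:
  "Poly_Mapping.keys f \<subseteq> tsyms A n \<Longrightarrow> Poly_Mapping.keys (lin_ext (tsym_diff A) f) \<subseteq> tsyms A n"
  using tsym_diff_keys by (intro keys_lin_ext) blast

lemma eval_diff:
  assumes "Poly_Mapping.keys f \<subseteq> tsyms A n"
  shows "tensor_eval A (lin_ext (tsym_diff A) f) = diff A (tensor_eval A f)"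
  using assms
proof (induction f rule: poly_mapping_linear_induct)
  case (add f g)
  then show ?case using pre_diff_in eval_in
    by (simp add: lin_ext_add eval_add[of _ n] diff_add)
next
  case (scl a f)
  then show ?case using pre_diff_in eval_in
    by (simp add: lin_ext_scl eval_scl[of _ n] diff_smult)
qed (auto simp: eval_tsym_diff eval_of_sym)

lemma multiplication_hom:
  assumes T: "cdga (tensor_power A n)"
  shows "multiplication A \<in> cdga_hom (tensor_power A n) A"
proof -
  interpret T: cdga "tensor_power A n" by fact
  note Tq = tensor_power_eq[of n]
  have car: "\<exists>f. Poly_Mapping.keys f \<subseteq> tsyms A n \<and> X = tens.cl n f" if "X \<in> carrier (tensor_power A n)" for X
    using that unfolding Tq tens.Q_carrier by auto
  show ?thesis unfolding cdga_hom_iff galg_hom_def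
  proof (intro conjI ballI allI)
    fix X assume X: "X \<in> carrier (tensor_power A n)"
    obtain f where f: "Poly_Mapping.keys f \<subseteq> tsyms A n" "X = tens.cl n f" using car[OF X] by blast
    show "multiplication A X \<in> carrier A" using f by (simp add: multiplication_cl eval_in)
    show "multiplication A (a \<odot>\<^bsub>tensor_power A n\<^esub> X) = a \<odot> multiplication A X" for a
      using f tens.Q_smult[of f n a] keys_scl_subset[OF f(1), of a]
      by (simp add: Tq multiplication_cl eval_scl[of _ n])
    have "diff (tensor_power A n) X = tens.cl n (lin_ext (tsym_diff A) f)"
      using tens.Q_diff[of f n] f X T.diff_in[OF X] pre_diff_in[OF f(1)] by (simp add: Tq)
    then show "multiplication A (diff (tensor_power A n) X) = diff A (multiplication A X)"
      using f pre_diff_in[OF f(1)] by (simp add: multiplication_cl[of _ n] eval_diff[of _ n])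
    fix Y assume Y: "Y \<in> carrier (tensor_power A n)"
    obtain g where g: "Poly_Mapping.keys g \<subseteq> tsyms A n" "Y = tens.cl n g" using car[OF Y] by blast
    show "multiplication A (X \<oplus>\<^bsub>tensor_power A n\<^esub> Y) = multiplication A X \<oplus> multiplication A Y"
      using f g tens.Q_add[of f n g] keys_add_subset[OF f(1) g(1)]
      by (simp add: Tq multiplication_cl eval_add[of _ n])
    have "X \<otimes>\<^bsub>tensor_power A n\<^esub> Y = tens.cl n (lin_ext (\<lambda>xs. lin_ext (\<lambda>ys. tsym_mult A xs ys) g) f)"
      using tens.Q_mult[of f n g] f g T.mult_in[OF X Y] pre_mult_in[OF f(1) g(1)] by (simp add: Tq)
    then show "multiplication A (X \<otimes>\<^bsub>tensor_power A n\<^esub> Y) = multiplication A X \<otimes> multiplication A Y"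
      using f g pre_mult_in[OF f(1) g(1)]
      by (simp add: multiplication_cl[of _ n] eval_mult[of _ n])
  next
    have one: "replicate n (0, \<one>) \<in> tsyms A n" using gr_one by (auto simp: tsyms_def)
    have "\<one>\<^bsub>tensor_power A n\<^esub> = tens.cl n (sym (replicate n (0, \<one>)))"
      by (simp add: Tq quot_cdga_def tens.cl_def)
    moreover have "eval_sym (replicate n (0, \<one>)) = \<one>" by (induction n) auto
    ultimately show "multiplication A \<one>\<^bsub>tensor_power A n\<^esub> = \<one>"
      using one by (simp add: multiplication_cl[of _ n] eval_of_sym[of _ n])
  next
    fix p X assume "X \<in> gr (tensor_power A n) p"
    then obtain f where f: "Poly_Mapping.keys f \<subseteq> {xs \<in> tsyms A n. tdeg xs = p}" "X = tens.cl n f"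
      unfolding Tq tens.Q_gr by auto
    have "tensor_eval A f \<in> gr A p"
      unfolding tensor_eval_eq
      by (rule lincomb_in_subspace[OF gr_submodule]) (use f(1) eval_sym_gr in auto)
    moreover have "Poly_Mapping.keys f \<subseteq> tsyms A n" using f(1) by auto
    ultimately show "multiplication A X \<in> gr A p" using f by (simp add: multiplication_cl)
  qed
qed

end

section \<open>The low-degree cohomology of a tensor power\<close>

locale low_acyclic = cdga A for A :: "('a, 'm) cdga_scheme" (structure) +
  fixes K :: "'a set" and k :: nat
  assumes K_sub: "submodule K rat_ring A"
    and K_diff: "\<And>x. x \<in> K \<Longrightarrow> diff A x \<in> K"
    and K_acyclic_0: "\<And>x. 0 < k \<Longrightarrow> x \<in> K \<Longrightarrow> x \<in> gr A 0 \<Longrightarrow> diff A x = \<zero> \<Longrightarrow> x = \<zero>"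
    and K_acyclic: "\<And>p x. Suc p < k \<Longrightarrow> x \<in> K \<Longrightarrow> x \<in> gr A (Suc p) \<Longrightarrow> diff A x = \<zero> \<Longrightarrow>
      \<exists>y\<in>K \<inter> gr A p. diff A y = x"
begin

lemmas K_closed = subspaceD(2-6)[OF K_sub]

lemma K_gr_sub: "submodule (K \<inter> gr A p) rat_ring A"
  using K_closed gr_closed by (intro subspaceI) auto

text \<open>A section of the differential \<open>K\<^sup>p \<rightarrow> d K\<^sup>p\<close>, extended by zero on a complement of \<open>d K\<^sup>p\<close> in \<open>A\<^sup>p\<^sup>+\<^sup>1\<close>.\<close>
lemma exists_section:
  "\<exists>h. (\<forall>x\<in>gr A (Suc p). h x \<in> K \<inter> gr A p) \<and>
     (\<forall>x\<in>gr A (Suc p). \<forall>y\<in>gr A (Suc p). h (x \<oplus> y) = h x \<oplus> h y) \<and>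
     (\<forall>a. \<forall>x\<in>gr A (Suc p). h (a \<odot> x) = a \<odot> h x) \<and>
     (\<forall>y\<in>K \<inter> gr A p. diff A (h (diff A y)) = diff A y)"
proof -
  let ?X = "gr A (Suc p)" and ?D = "diff A ` (K \<inter> gr A p)"
  define lev :: "'a \<Rightarrow> nat" where "lev x = (if x \<in> ?D then 0 else 1)" for x
  have X: "?X \<subseteq> carrier A" by auto
  have DX: "?D \<subseteq> ?X" using diff_gr by auto
  obtain B where B: "B \<subseteq> ?X" "indep B" "\<And>x. x \<in> ?X \<Longrightarrow> x \<in> lspan A {b \<in> B. lev b \<le> lev x}"
    using adapted_basis[OF X, of lev] by blast
  have Bc: "B \<subseteq> carrier A" using B(1) X by blast
  have XB: "x \<in> lspan A B" if "x \<in> ?X" for x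
    using B(3)[OF that] lspan_mono[of "{b \<in> B. lev b \<le> lev x}" B] by auto
  have DB: "x \<in> lspan A (B \<inter> ?D)" if "x \<in> ?D" for x
  proof -
    have "x \<in> lspan A {b \<in> B. lev b \<le> lev x}" using B(3) that DX by blast
    moreover have "{b \<in> B. lev b \<le> lev x} = B \<inter> ?D" using that by (auto simp: lev_def)
    ultimately show ?thesis by simp
  qed
  define v where "v b = (if b \<in> ?D then (SOME y. y \<in> K \<inter> gr A p \<and> diff A y = b) else \<zero>)" for b
  have vD: "v b \<in> K \<inter> gr A p \<and> diff A (v b) = b" if "b \<in> ?D" for b
  proof -
    have "\<exists>y. y \<in> K \<inter> gr A p \<and> diff A y = b" using that by auto
    from someI_ex[OF this] show ?thesis unfolding v_def using that by simp
  qed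
  have vK: "v b \<in> K \<inter> gr A p" for b
  proof (cases "b \<in> ?D")
    case False
    then have "v b = \<zero>" by (simp add: v_def)
    then show ?thesis using K_closed(1) by simp
  qed (use vD in blast)
  then have "v ` B \<subseteq> carrier A" by auto
  then obtain L where L: "\<And>b. b \<in> B \<Longrightarrow> L b = v b" "\<And>x. x \<in> lspan A B \<Longrightarrow> L x \<in> lspan A (v ` B)"
    "\<And>x y. x \<in> lspan A B \<Longrightarrow> y \<in> lspan A B \<Longrightarrow> L (x \<oplus> y) = L x \<oplus> L y"
    "\<And>a x. x \<in> lspan A B \<Longrightarrow> L (a \<odot> x) = a \<odot> L x"
    using linear_extension[OF B(2) ratmod_axioms] by blast
  have LK: "L x \<in> K \<inter> gr A p" if "x \<in> ?X" for x
  proof -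
    have "lspan A (v ` B) \<subseteq> K \<inter> gr A p" by (rule lspan_least[OF K_gr_sub]) (use vK in blast)
    then show ?thesis using L(2)[OF XB[OF that]] by blast
  qed
  have BDc: "B \<inter> ?D \<subseteq> carrier A" using Bc by blast
  note sB = subspaceD(2-4)[OF lspan_subspace[OF Bc]]
  have Lc: "L x \<in> carrier A" if "x \<in> lspan A B" for x
    using L(2)[OF that] lspan_carrier[OF \<open>v ` B \<subseteq> carrier A\<close>] by blast
  have "diff A (L x) = x" if x: "x \<in> ?D" for x
  proof -
    have "x \<in> lspan A B \<and> diff A (L x) = x" using DB[OF x] BDc
    proof (induction x rule: lspan_induct)
      case zero
      have "L (0 \<odot> \<zero>) = 0 \<odot> L \<zero>" using L(4) sB(1) by blast
      then show ?case using sB(1) Lc[OF sB(1)] by simp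
    next
      case (add x y)
      then show ?case using L(3) sB(2) Lc by (simp add: diff_add)
    next
      case (smult a x)
      then show ?case using L(4) sB(3) Lc by (simp add: diff_smult)
    next
      case (gen s)
      then show ?case using L(1) vD lspan_incl by auto
    qed
    then show ?thesis ..
  qed
  then show ?thesis using LK L(3,4) XB by (intro exI[of _ L]) blast
qed

definition h :: "nat \<Rightarrow> 'a \<Rightarrow> 'a" where
  "h p = (SOME h. (\<forall>x\<in>gr A (Suc p). h x \<in> K \<inter> gr A p) \<and>
     (\<forall>x\<in>gr A (Suc p). \<forall>y\<in>gr A (Suc p). h (x \<oplus> y) = h x \<oplus> h y) \<and>
     (\<forall>a. \<forall>x\<in>gr A (Suc p). h (a \<odot> x) = a \<odot> h x) \<and>
     (\<forall>y\<in>K \<inter> gr A p. diff A (h (diff A y)) = diff A y))"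

lemma h_props:
  shows "\<And>x. x \<in> gr A (Suc p) \<Longrightarrow> h p x \<in> K" "\<And>x. x \<in> gr A (Suc p) \<Longrightarrow> h p x \<in> gr A p"
    "\<And>x y. x \<in> gr A (Suc p) \<Longrightarrow> y \<in> gr A (Suc p) \<Longrightarrow> h p (x \<oplus> y) = h p x \<oplus> h p y"
    "\<And>a x. x \<in> gr A (Suc p) \<Longrightarrow> h p (a \<odot> x) = a \<odot> h p x"
    "\<And>y. y \<in> K \<Longrightarrow> y \<in> gr A p \<Longrightarrow> diff A (h p (diff A y)) = diff A y"
  using someI_ex[OF exists_section[of p], folded h_def] by blast+

lemma h_zero: "h p \<zero> = \<zero>"
  using h_props(4)[of \<zero> p 0] h_props(2)[of \<zero> p] by simp

definition dh :: "nat \<Rightarrow> 'a \<Rightarrow> 'a" where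
  "dh p x = (case p of 0 \<Rightarrow> \<zero> | Suc q \<Rightarrow> diff A (h q x))"

text \<open>The map \<open>id - d h - h d\<close>, which is homotopic to the identity.\<close>
definition defect_map :: "nat \<Rightarrow> 'a \<Rightarrow> 'a" where
  "defect_map p x = x \<ominus> (h p (diff A x) \<oplus> dh p x)"

lemma dh_gr: "x \<in> gr A p \<Longrightarrow> dh p x \<in> gr A p"
  and dh_K: "x \<in> gr A p \<Longrightarrow> dh p x \<in> K"
  using h_props(1,2) diff_gr K_diff K_closed(1) by (auto simp: dh_def split: nat.splits)

lemma hd_gr: "x \<in> gr A p \<Longrightarrow> h p (diff A x) \<in> gr A p"
  and hd_K: "x \<in> gr A p \<Longrightarrow> h p (diff A x) \<in> K"
  using h_props(1,2) diff_gr by auto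

lemma defect_gr: "x \<in> gr A p \<Longrightarrow> defect_map p x \<in> gr A p"
  unfolding defect_map_def by (intro gr_closed hd_gr dh_gr)

lemma defect_K: "x \<in> gr A p \<Longrightarrow> x \<in> K \<Longrightarrow> defect_map p x \<in> K"
  unfolding defect_map_def by (intro K_closed hd_K dh_K)

lemma defect_sum:
  "x \<in> gr A p \<Longrightarrow> defect_map p x \<oplus> (h p (diff A x) \<oplus> dh p x) = x"
proof -
  assume x: "x \<in> gr A p"
  have c: "h p (diff A x) \<oplus> dh p x \<in> carrier A" using hd_gr[OF x] dh_gr[OF x] by auto
  then show ?thesis using x unfolding defect_map_def
    by (simp add: a_minus_def add_assoc l_neg_self)
qed

text \<open>On \<open>K\<close> in degrees below \<open>k\<close> the map \<open>id - d h - h d\<close> takes values in the cocycles, and it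
  kills the coboundaries.\<close>
lemma defect_defect:
  assumes x: "x \<in> K" "x \<in> gr A p" and p: "p < k"
  shows "defect_map p (defect_map p x) = \<zero>"
proof -
  let ?e = "defect_map p x"
  have e: "?e \<in> gr A p" "?e \<in> K" using defect_gr defect_K x by auto
  have ddh: "diff A (dh p x) = \<zero>"
  proof (cases p)
    case (Suc q)
    then have "h q x \<in> carrier A" using h_props(2)[of x q] x(2) gr_in by blast
    then show ?thesis using Suc by (simp add: dh_def diff_diff)
  qed (simp add: dh_def)
  have c: "h p (diff A x) \<in> carrier A" "dh p x \<in> carrier A" "x \<in> carrier A"
    using hd_gr[OF x(2)] dh_gr[OF x(2)] x(2) by auto
  have "diff A ?e = diff A x \<ominus> (diff A (h p (diff A x)) \<oplus> diff A (dh p x))"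
    unfolding defect_map_def using c by (simp add: diff_minus diff_add)
  also have "\<dots> = \<zero>" using h_props(5)[OF x] ddh c by (simp add: a_minus_def r_neg_self)
  finally have de: "diff A ?e = \<zero>" .
  show ?thesis
  proof (cases p)
    case 0
    then have "?e = \<zero>" using K_acyclic_0 e de p by auto
    then show ?thesis using 0 by (simp add: defect_map_def dh_def h_zero a_minus_def)
  next
    case (Suc q)
    then obtain y where y: "y \<in> K" "y \<in> gr A q" "diff A y = ?e" using K_acyclic[of q ?e] e de p by auto
    have "dh p ?e = ?e" using h_props(5)[OF y(1,2)] y(3) Suc by (simp add: dh_def)
    then have "defect_map p ?e = ?e \<ominus> (h p \<zero> \<oplus> ?e)" by (simp add: defect_map_def[of p ?e] de)
    then show ?thesis using e(1) by (simp add: h_zero a_minus_def r_neg_self)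
  qed
qed

subsection \<open>Homotopies acting on one tensor factor\<close>

definition sgn_at :: "'a tsym \<Rightarrow> nat \<Rightarrow> rat" where
  "sgn_at xs i = (-1) ^ (\<Sum>j<i. fst (xs ! j))"

lemma sgn_sq: "sgn_at xs i * sgn_at xs i = 1"
  by (simp add: sgn_at_def)

lemma sgn_update_same: "j \<ge> i \<Longrightarrow> sgn_at (xs[j := a]) i = sgn_at xs i"
  unfolding sgn_at_def by (intro arg_cong[of _ _ "\<lambda>n. (-1) ^ n"] sum.cong) auto

lemma sgn_update_fst: "fst a = fst (xs ! j) \<Longrightarrow> sgn_at (xs[j := a]) i = sgn_at xs i"
  unfolding sgn_at_def
  by (intro arg_cong[of _ _ "\<lambda>n. (-1) ^ n"] sum.cong refl, cases "j < length xs")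
    (simp_all add: nth_list_update list_update_beyond)

lemma sgn_update_Suc:
  assumes "j < i" "j < length xs" "fst a = Suc (fst (xs ! j))"
  shows "sgn_at (xs[j := a]) i = - sgn_at xs i"
proof -
  have "(\<Sum>l<i. fst (xs[j := a] ! l)) = fst a + (\<Sum>l\<in>{..<i} - {j}. fst (xs[j := a] ! l))"
    using assms by (subst sum.remove[of _ j]) auto
  also have "(\<Sum>l\<in>{..<i} - {j}. fst (xs[j := a] ! l)) = (\<Sum>l\<in>{..<i} - {j}. fst (xs ! l))"
    by (rule sum.cong) auto
  also have "fst a + \<dots> = Suc (\<Sum>l<i. fst (xs ! l))"
    using assms by (subst (2) sum.remove[of _ j]) auto
  finally show ?thesis by (simp add: sgn_at_def)
qed

definition diff_at :: "'a tsym \<Rightarrow> nat \<Rightarrow> 'a tsym" where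
  "diff_at xs j = xs[j := (Suc (fst (xs ! j)), diff A (snd (xs ! j)))]"

lemma tsym_diff_eq: "tsym_diff A xs = (\<Sum>j<length xs. scl (sgn_at xs j) (sym (diff_at xs j)))"
  by (simp add: tsym_diff_def sgn_at_def diff_at_def)

definition h_at :: "nat \<Rightarrow> 'a tsym \<Rightarrow> ('a tsym \<Rightarrow>\<^sub>0 rat)" where
  "h_at i xs = (case fst (xs ! i) of 0 \<Rightarrow> 0
     | Suc q \<Rightarrow> scl (sgn_at xs i) (sym (xs[i := (q, h q (snd (xs ! i)))])))"

definition defect_at :: "nat \<Rightarrow> 'a tsym \<Rightarrow> 'a tsym" where
  "defect_at i xs = xs[i := (fst (xs ! i), defect_map (fst (xs ! i)) (snd (xs ! i)))]"

lemma R_closed: "f \<in> tensor_rels A n \<Longrightarrow> g \<in> tensor_rels A n \<Longrightarrow> f + g \<in> tensor_rels A n"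
  "f \<in> tensor_rels A n \<Longrightarrow> scl a f \<in> tensor_rels A n" "0 \<in> tensor_rels A n"
  "f \<in> tensor_rels A n \<Longrightarrow> - f \<in> tensor_rels A n"
  "f \<in> tensor_rels A n \<Longrightarrow> g \<in> tensor_rels A n \<Longrightarrow> f - g \<in> tensor_rels A n"
proof -
  show 1: "f \<in> tensor_rels A n \<Longrightarrow> g \<in> tensor_rels A n \<Longrightarrow> f + g \<in> tensor_rels A n" for f g
    using tens.I_closed(2)[of f n g] by simp
  show 2: "f \<in> tensor_rels A n \<Longrightarrow> scl a f \<in> tensor_rels A n" for f a
    using tens.I_closed(3)[of f n a] by simp
  show "0 \<in> tensor_rels A n" using tens.I_closed(1)[of n] by simp
  show 3: "f \<in> tensor_rels A n \<Longrightarrow> - f \<in> tensor_rels A n" for f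
    using 2[of f "-1"] by (simp add: scl_minus_one)
  show "f \<in> tensor_rels A n \<Longrightarrow> g \<in> tensor_rels A n \<Longrightarrow> f - g \<in> tensor_rels A n"
    using 1[of f "- g"] 3[of g] by simp
qed

lemma h_at_rels:
  assumes i: "i < n" and f: "f \<in> tensor_rels A n"
  shows "lin_ext (h_at i) f \<in> tensor_rels A n"
proof (rule linear_kills_rels[OF tens.I_sub pre_tensor_ratmod[of A n] _ _ _ _ f])
  fix f assume "f \<in> rels A n"
  then consider (add) xs l p x y where "xs \<in> tsyms A n" "l < n" "x \<in> gr A p" "y \<in> gr A p"
      "f = sym (xs[l := (p, x \<oplus> y)]) - sym (xs[l := (p, x)]) - sym (xs[l := (p, y)])"
    | (smult) xs l p a x where "xs \<in> tsyms A n" "l < n" "x \<in> gr A p"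
      "f = sym (xs[l := (p, a \<odot> x)]) - scl a (sym (xs[l := (p, x)]))"
    unfolding rels_def by blast
  then show "lin_ext (h_at i) f \<in> tensor_rels A n"
  proof cases
    case add
    have len: "length xs = n" using tsymsD(1)[OF add(1)] .
    have e: "lin_ext (h_at i) f = h_at i (xs[l := (p, x \<oplus> y)]) - h_at i (xs[l := (p, x)])
        - h_at i (xs[l := (p, y)])"
      unfolding add(5) by (simp add: lin_ext_minus)
    show ?thesis
    proof (cases "l = i")
      case True
      show ?thesis
      proof (cases p)
        case 0
        then show ?thesis unfolding e using True len i R_closed(3) by (simp add: h_at_def)
      next
        case (Suc q)
        have "lin_ext (h_at i) f = scl (sgn_at xs i) (sym (xs[i := (q, h q x \<oplus> h q y)])
            - sym (xs[i := (q, h q x)]) - sym (xs[i := (q, h q y)]))"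
          unfolding e using True len i Suc add(3,4)
          by (simp add: h_at_def sgn_update_same h_props(3))
        then show ?thesis
          using rel_add[OF add(1) i, of "h q x" q "h q y"] h_props(2) add(3,4) Suc
          by (simp only: R_closed(2))
      qed
    next
      case False
      show ?thesis
      proof (cases "fst (xs ! i)")
        case 0
        then show ?thesis unfolding e using False R_closed(3) by (simp add: h_at_def)
      next
        case (Suc q)
        let ?c = "(q, h q (snd (xs ! i)))"
        have "snd ?c \<in> gr A (fst ?c)" using h_props(2) tsymsD(2)[OF add(1) i] Suc by simp
        then have ts: "xs[i := ?c] \<in> tsyms A n" using tsyms_update[OF add(1)] by simp
        have s: "sgn_at (xs[l := (p, z)]) i = sgn_at (xs[l := (p, x)]) i" for z
          using sgn_update_fst[of "(p, z)" "xs[l := (p, x)]" l i] add(2) len by simp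
        have "lin_ext (h_at i) f = scl (sgn_at (xs[l := (p, x)]) i)
            (sym (xs[i := ?c, l := (p, x \<oplus> y)]) - sym (xs[i := ?c, l := (p, x)]) - sym (xs[i := ?c, l := (p, y)]))"
          unfolding e using False Suc s[of "x \<oplus> y"] s[of y]
          by (simp add: h_at_def list_update_swap[of l i])
        then show ?thesis using R_closed(2)[OF rel_add[OF ts add(2-4)]] by (simp only:)
      qed
    qed
  next
    case smult
    have len: "length xs = n" using tsymsD(1)[OF smult(1)] .
    have e: "lin_ext (h_at i) f = h_at i (xs[l := (p, a \<odot> x)]) - scl a (h_at i (xs[l := (p, x)]))"
      unfolding smult(4) by (simp add: lin_ext_minus lin_ext_scl)
    show ?thesis
    proof (cases "l = i")
      case True
      show ?thesis
      proof (cases p)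
        case 0
        then show ?thesis unfolding e using True len i R_closed(3) by (simp add: h_at_def)
      next
        case (Suc q)
        have "lin_ext (h_at i) f = scl (sgn_at xs i) (sym (xs[i := (q, a \<odot> h q x)])
            - scl a (sym (xs[i := (q, h q x)])))"
          unfolding e using True len i Suc smult(3)
          by (simp add: h_at_def sgn_update_same h_props(4) mult.commute)
        then show ?thesis
          using rel_smult[OF smult(1) i, of "h q x" q a] h_props(2) smult(3) Suc
          by (simp only: R_closed(2))
      qed
    next
      case False
      show ?thesis
      proof (cases "fst (xs ! i)")
        case 0
        then show ?thesis unfolding e using False R_closed(3) by (simp add: h_at_def)
      next
        case (Suc q)
        let ?c = "(q, h q (snd (xs ! i)))"
        have "snd ?c \<in> gr A (fst ?c)" using h_props(2) tsymsD(2)[OF smult(1) i] Suc by simp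
        then have ts: "xs[i := ?c] \<in> tsyms A n" using tsyms_update[OF smult(1)] by simp
        have s: "sgn_at (xs[l := (p, z)]) i = sgn_at (xs[l := (p, x)]) i" for z
          using sgn_update_fst[of "(p, z)" "xs[l := (p, x)]" l i] smult(2) len by simp
        have "lin_ext (h_at i) f = scl (sgn_at (xs[l := (p, x)]) i)
            (sym (xs[i := ?c, l := (p, a \<odot> x)]) - scl a (sym (xs[i := ?c, l := (p, x)])))"
          unfolding e using False Suc s[of "a \<odot> x"]
          by (simp add: h_at_def list_update_swap[of l i] mult.commute)
        then show ?thesis using R_closed(2)[OF rel_smult[OF ts smult(2,3)]] by (simp only:)
      qed
    qed
  qed
qed (auto simp: lin_ext_add lin_ext_scl)

text \<open>The homotopy at position \<open>i\<close> commutes up to sign with the differentials at the other positions, so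
  these cancel and the usual identity in the single factor remains.\<close>
lemma homotopy_at:
  assumes xs: "xs \<in> tsyms A n" and i: "i < n"
  shows "lin_ext (tsym_diff A) (h_at i xs) + lin_ext (h_at i) (tsym_diff A xs)
    - (sym xs - sym (defect_at i xs)) \<in> tensor_rels A n"
proof -
  obtain p x where px: "xs ! i = (p, x)" by (cases "xs ! i")
  have len: "length xs = n" and x: "x \<in> gr A p" using tsymsD(1)[OF xs] tsymsD(2)[OF xs i] px by simp_all
  have hdx: "h p (diff A x) \<in> gr A p" "dh p x \<in> gr A p" using hd_gr dh_gr x by auto
  have second: "lin_ext (h_at i) (tsym_diff A xs) = (\<Sum>j<n. scl (sgn_at xs j) (h_at i (diff_at xs j)))"
    unfolding tsym_diff_eq len by (simp add: lin_ext_sum lin_ext_scl)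
  have self: "scl (sgn_at xs i) (h_at i (diff_at xs i)) = sym (xs[i := (p, h p (diff A x))])"
    using px len i by (simp add: h_at_def diff_at_def sgn_update_same sgn_sq)
  have sum: "lin_ext (tsym_diff A) (h_at i xs) + lin_ext (h_at i) (tsym_diff A xs) =
    sym (xs[i := (p, h p (diff A x))]) + (if p = 0 then 0 else sym (xs[i := (p, dh p x)]))"
  proof (cases p)
    case 0
    have "h_at i (diff_at xs j) = 0" if "j \<noteq> i" for j
      using that px 0 by (simp add: h_at_def diff_at_def)
    then have "(\<Sum>j<n. scl (sgn_at xs j) (h_at i (diff_at xs j))) = sym (xs[i := (p, h p (diff A x))])"
      using i self by (subst sum.remove[of _ i]) auto
    then show ?thesis using px 0 by (simp add: second) (simp add: h_at_def)
  next
    case (Suc q)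
    let ?y = "xs[i := (q, h q x)]"
    have first: "lin_ext (tsym_diff A) (h_at i xs) =
        (\<Sum>j<n. scl (sgn_at xs i * sgn_at ?y j) (sym (diff_at ?y j)))"
      using px Suc len by (simp add: h_at_def lin_ext_scl tsym_diff_eq scl_sum)
    have cancel: "scl (sgn_at xs i * sgn_at ?y j) (sym (diff_at ?y j)) +
        scl (sgn_at xs j) (h_at i (diff_at xs j)) = 0" if j: "j < n" "j \<noteq> i" for j
    proof -
      have e: "(diff_at xs j)[i := (q, h q x)] = diff_at ?y j"
        using j by (simp add: diff_at_def list_update_swap)
      have "h_at i (diff_at xs j) = scl (sgn_at (diff_at xs j) i) (sym (diff_at ?y j))"
        using px Suc j e by (simp add: h_at_def) (simp add: diff_at_def)
      moreover have "sgn_at xs i * sgn_at ?y j + sgn_at xs j * sgn_at (diff_at xs j) i = 0"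
      proof (cases "j < i")
        case True
        have "sgn_at ?y j = sgn_at xs j" using True by (intro sgn_update_same) simp
        moreover have "sgn_at (diff_at xs j) i = - sgn_at xs i"
          unfolding diff_at_def using True j len by (intro sgn_update_Suc) auto
        ultimately show ?thesis by simp
      next
        case False
        then have ij: "i < j" using j by simp
        have "sgn_at (?y[i := xs ! i]) j = - sgn_at ?y j"
          using ij j len px Suc by (intro sgn_update_Suc) auto
        moreover have "?y[i := xs ! i] = xs" by simp
        ultimately have "sgn_at ?y j = - sgn_at xs j" by simp
        moreover have "sgn_at (diff_at xs j) i = sgn_at xs i"
          unfolding diff_at_def using ij by (intro sgn_update_same) simp
        ultimately show ?thesis by simp
      qed
      ultimately show ?thesis by (simp add: scl_add_left[symmetric])
    qed
    have ii: "scl (sgn_at xs i * sgn_at ?y i) (sym (diff_at ?y i)) = sym (xs[i := (p, dh p x)])"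
      using len i Suc by (simp add: sgn_update_same sgn_sq diff_at_def dh_def)
    have "lin_ext (tsym_diff A) (h_at i xs) + lin_ext (h_at i) (tsym_diff A xs) =
      (\<Sum>j<n. scl (sgn_at xs i * sgn_at ?y j) (sym (diff_at ?y j)) +
        scl (sgn_at xs j) (h_at i (diff_at xs j)))"
      by (simp add: first second sum.distrib)
    also have "\<dots> = sym (xs[i := (p, dh p x)]) + sym (xs[i := (p, h p (diff A x))])"
      using i cancel by (subst sum.remove[of _ i]) (auto simp: ii self)
    finally show ?thesis using Suc by (simp add: add.commute)
  qed
  let ?w = "h p (diff A x) \<oplus> dh p x"
  have w: "?w \<in> gr A p" using hdx gr_closed(2) by blast
  have "sym (xs[i := (p, defect_map p x \<oplus> ?w)]) - sym (xs[i := (p, defect_map p x)]) - sym (xs[i := (p, ?w)])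
      \<in> tensor_rels A n"
    using rel_add[OF xs i defect_gr[OF x] w] .
  moreover have "xs[i := (p, x)] = xs" using px by (metis list_update_id)
  ultimately have r1: "sym xs - sym (defect_at i xs) - sym (xs[i := (p, ?w)]) \<in> tensor_rels A n"
    using defect_sum[OF x] px by (simp add: defect_at_def)
  have r2: "sym (xs[i := (p, ?w)]) - sym (xs[i := (p, h p (diff A x))])
      - (if p = 0 then 0 else sym (xs[i := (p, dh p x)])) \<in> tensor_rels A n"
  proof (cases "p = 0")
    case True
    then have "?w = h p (diff A x)" using hdx(1) by (simp add: dh_def gr_in)
    then show ?thesis using True R_closed(3) by simp
  qed (use rel_add[OF xs i hdx] in simp)
  have "lin_ext (tsym_diff A) (h_at i xs) + lin_ext (h_at i) (tsym_diff A xs)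
    - (sym xs - sym (defect_at i xs)) =
    - ((sym xs - sym (defect_at i xs) - sym (xs[i := (p, ?w)])) +
      (sym (xs[i := (p, ?w)]) - sym (xs[i := (p, h p (diff A x))])
      - (if p = 0 then 0 else sym (xs[i := (p, dh p x)]))))"
    unfolding sum by (simp add: algebra_simps)
  then show ?thesis by (rule ssubst) (rule R_closed(4)[OF R_closed(1)[OF r1 r2]])
qed

definition Ksyms :: "nat \<Rightarrow> nat \<Rightarrow> 'a tsym set" where
  "Ksyms n p = {xs \<in> tsyms A n. snd ` set xs \<subseteq> K \<and> tdeg xs = p}"

lemma KsymsD: "xs \<in> Ksyms n p \<Longrightarrow> xs \<in> tsyms A n" "xs \<in> Ksyms n p \<Longrightarrow> i < n \<Longrightarrow> snd (xs ! i) \<in> K"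
  using tsymsD(1)[of xs A n] unfolding Ksyms_def by (auto simp: image_subset_iff)

lemma tdeg_update:
  assumes "i < length xs"
  shows "tdeg (xs[i := a]) + fst (xs ! i) = tdeg xs + fst a"
proof -
  have "tdeg (xs[i := a]) = fst a + (\<Sum>l\<in>{..<length xs} - {i}. fst (xs[i := a] ! l))"
    unfolding tdeg_def using assms by (subst sum.remove[of _ i]) auto
  also have "(\<Sum>l\<in>{..<length xs} - {i}. fst (xs[i := a] ! l)) = (\<Sum>l\<in>{..<length xs} - {i}. fst (xs ! l))"
    by (rule sum.cong) auto
  finally have 1: "tdeg (xs[i := a]) = fst a + (\<Sum>l\<in>{..<length xs} - {i}. fst (xs ! l))" .
  have "tdeg xs = fst (xs ! i) + (\<Sum>l\<in>{..<length xs} - {i}. fst (xs ! l))"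
    unfolding tdeg_def using assms by (subst sum.remove[of _ i]) auto
  then show ?thesis using 1 by simp
qed

lemma Ksyms_update:
  assumes "xs \<in> Ksyms n p" "i < n" "x \<in> gr A q" "x \<in> K" "p + q = p' + fst (xs ! i)"
  shows "xs[i := (q, x)] \<in> Ksyms n p'"
proof -
  have len: "i < length xs" using assms(2) tsymsD(1)[OF KsymsD(1)[OF assms(1)]] by simp
  have "xs[i := (q, x)] \<in> tsyms A n" using tsyms_update[OF KsymsD(1)[OF assms(1)] assms(3)] .
  moreover have "snd ` set (xs[i := (q, x)]) \<subseteq> K"
    using assms(1,4) image_mono[OF set_update_subset_insert, of snd xs i "(q, x)"]
    by (auto simp: Ksyms_def)
  moreover have "tdeg (xs[i := (q, x)]) = p'"
    using tdeg_update[OF len, of "(q, x)"] assms(1,5) by (simp add: Ksyms_def)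
  ultimately show ?thesis by (simp add: Ksyms_def)
qed

lemma defect_at_Ksyms: "xs \<in> Ksyms n p \<Longrightarrow> i < n \<Longrightarrow> defect_at i xs \<in> Ksyms n p"
  unfolding defect_at_def
  using tsymsD(2)[OF KsymsD(1)] KsymsD(2)
  by (intro Ksyms_update[where p = p]) (auto intro: defect_gr defect_K)

lemma h_at_Ksyms:
  assumes "xs \<in> Ksyms n (Suc p)" "i < n"
  shows "Poly_Mapping.keys (h_at i xs) \<subseteq> Ksyms n p"
proof (cases "fst (xs ! i)")
  case (Suc q)
  have "snd (xs ! i) \<in> gr A (Suc q)" using tsymsD(2)[OF KsymsD(1)[OF assms(1)] assms(2)] Suc by simp
  then have "xs[i := (q, h q (snd (xs ! i)))] \<in> Ksyms n p"
    using h_props(1,2) Suc by (intro Ksyms_update[OF assms]) auto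
  then show ?thesis using Suc by (auto simp: h_at_def intro!: keys_scl_subset)
qed (simp add: h_at_def)

lemma Ksyms_tsyms: "Poly_Mapping.keys f \<subseteq> Ksyms n p \<Longrightarrow> Poly_Mapping.keys f \<subseteq> tsyms A n"
  using KsymsD(1) by blast

lemma homotopy:
  assumes f: "Poly_Mapping.keys f \<subseteq> tsyms A n" and i: "i < n"
  shows "lin_ext (tsym_diff A) (lin_ext (h_at i) f) + lin_ext (h_at i) (lin_ext (tsym_diff A) f)
    - (f - lin_ext (\<lambda>xs. sym (defect_at i xs)) f) \<in> tensor_rels A n"
  using f
proof (induction f rule: poly_mapping_linear_induct)
  case zero
  then show ?case using R_closed(3) by simp
next
  case (sym xs)
  then show ?case using homotopy_at[OF sym i] by simp
next
  case (add f g)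
  then show ?case using R_closed(1)[OF add.IH] by (simp add: lin_ext_add algebra_simps)
next
  case (scl a f)
  then show ?case using R_closed(2)[OF scl.IH, of a] by (simp add: lin_ext_scl)
qed

text \<open>In every position \<open>id - d h - h d\<close> is applied twice. By \<open>defect_defect\<close> this kills all entries of
  degree below \<open>k\<close>, and a symbol of degree below \<open>n k\<close> has such an entry.\<close>
primrec defects :: "nat \<Rightarrow> 'a tsym \<Rightarrow> 'a tsym" where
  "defects 0 xs = xs"
| "defects (Suc i) xs = defect_at i (defect_at i (defects i xs))"

lemma defects_Ksyms: "xs \<in> Ksyms n p \<Longrightarrow> i \<le> n \<Longrightarrow> defects i xs \<in> Ksyms n p"
proof (induction i)
  case (Suc i)
  then show ?case using defect_at_Ksyms[of "defect_at i (defects i xs)"] defect_at_Ksyms[of "defects i xs"]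
    by simp
qed simp

lemma defects_nth:
  assumes "length xs = n" "i \<le> n" "j < n"
  shows "defects i xs ! j = (if j < i then (fst (xs ! j), defect_map (fst (xs ! j)) (defect_map (fst (xs ! j)) (snd (xs ! j))))
    else xs ! j)"
proof -
  have len: "length (defects i xs) = n" for i using assms(1) by (induction i) (auto simp: defect_at_def)
  from assms(2) show ?thesis
  proof (induction i)
    case (Suc i)
    then have IH: "defects i xs ! j = (if j < i then (fst (xs ! j), defect_map (fst (xs ! j)) (defect_map (fst (xs ! j)) (snd (xs ! j))))
      else xs ! j)" by simp
    show ?case
    proof (cases "j = i")
      case True
      then show ?thesis using IH len[of i] assms(3) by (simp add: defect_at_def)
    next
      case False
      then show ?thesis using IH by (simp add: defect_at_def less_Suc_eq)
    qed
  qed simp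
qed

lemma zero_entry_rel:
  assumes "xs \<in> tsyms A n" "j < n" "snd (xs ! j) = \<zero>"
  shows "sym xs \<in> tensor_rels A n"
proof -
  have "xs[j := (fst (xs ! j), \<zero>)] = xs" using assms(3) by (metis list_update_id prod.collapse)
  then show ?thesis using rel_smult[OF assms(1,2) gr_zero, of "fst (xs ! j)" 0] by simp
qed

lemma defects_rel:
  assumes "xs \<in> Ksyms n p" "p < n * k"
  shows "sym (defects n xs) \<in> tensor_rels A n"
proof -
  have len: "length xs = n" using tsymsD(1)[OF KsymsD(1)[OF assms(1)]] .
  have "\<exists>j<n. fst (xs ! j) < k"
  proof (rule ccontr)
    assume "\<not> (\<exists>j<n. fst (xs ! j) < k)"
    then have "(\<Sum>j<n. k) \<le> (\<Sum>j<n. fst (xs ! j))" by (intro sum_mono) auto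
    then have "n * k \<le> tdeg xs" by (simp add: tdeg_def len)
    then show False using assms by (simp add: Ksyms_def)
  qed
  then obtain j where j: "j < n" "fst (xs ! j) < k" by blast
  have "snd (defects n xs ! j) = \<zero>"
    using defects_nth[OF len order_refl j(1)] j
      defect_defect[OF KsymsD(2)[OF assms(1) j(1)] tsymsD(2)[OF KsymsD(1)[OF assms(1)] j(1)] j(2)]
    by simp
  then show ?thesis
    using zero_entry_rel[OF KsymsD(1)[OF defects_Ksyms[OF assms(1) order_refl]] j(1)] by simp
qed

end

locale low_acyclic_power = low_acyclic A K k + T: cdga "tensor_power A n"
  for A :: "('a, 'm) cdga_scheme" (structure) and K k n
begin

abbreviation "T \<equiv> tensor_power A n"
abbreviation "cl \<equiv> tens.cl n"

lemma cl_in: "Poly_Mapping.keys f \<subseteq> tsyms A n \<Longrightarrow> cl f \<in> carrier T"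
  unfolding tensor_power_eq tens.Q_carrier by simp

lemma cl_diff: "Poly_Mapping.keys f \<subseteq> tsyms A n \<Longrightarrow> diff T (cl f) = cl (lin_ext (tsym_diff A) f)"
  using tens.Q_diff[of f n] T.diff_in[OF cl_in[of f]] pre_diff_in[of f n] by (simp add: tensor_power_eq)

lemma cl_add: "Poly_Mapping.keys f \<subseteq> tsyms A n \<Longrightarrow> Poly_Mapping.keys g \<subseteq> tsyms A n \<Longrightarrow>
    cl (f + g) = cl f \<oplus>\<^bsub>T\<^esub> cl g"
  using tens.Q_add[of f n g] by (simp add: tensor_power_eq)

lemma cl_scl: "Poly_Mapping.keys f \<subseteq> tsyms A n \<Longrightarrow> cl (scl a f) = a \<odot>\<^bsub>T\<^esub> cl f"
  using tens.Q_smult[of f n a] by (simp add: tensor_power_eq)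

lemma cl_zero_iff: "Poly_Mapping.keys f \<subseteq> tsyms A n \<Longrightarrow> cl f = \<zero>\<^bsub>T\<^esub> \<longleftrightarrow> f \<in> tensor_rels A n"
  using tens.cl_zero_iff[of f n] tens.Q_zero by (simp add: tensor_power_eq)

lemma keys_defect:
  "Poly_Mapping.keys f \<subseteq> Ksyms n p \<Longrightarrow> (\<And>xs. xs \<in> Ksyms n p \<Longrightarrow> \<phi> xs \<in> Ksyms n p) \<Longrightarrow>
    Poly_Mapping.keys (lin_ext (\<lambda>xs. sym (\<phi> xs)) f) \<subseteq> Ksyms n p"
  by (rule keys_lin_ext) auto

lemma homotopy_step:
  assumes f: "Poly_Mapping.keys f \<subseteq> Ksyms n (Suc p)" and cocycle: "diff T (cl f) = \<zero>\<^bsub>T\<^esub>" and i: "i < n"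
  shows "\<exists>u. Poly_Mapping.keys u \<subseteq> Ksyms n p \<and>
    cl f = diff T (cl u) \<oplus>\<^bsub>T\<^esub> cl (lin_ext (\<lambda>xs. sym (defect_at i xs)) f)"
proof (intro exI conjI)
  let ?u = "lin_ext (h_at i) f" and ?g = "lin_ext (\<lambda>xs. sym (defect_at i xs)) f"
  show u: "Poly_Mapping.keys ?u \<subseteq> Ksyms n p" using f h_at_Ksyms i by (intro keys_lin_ext) blast
  have ft: "Poly_Mapping.keys f \<subseteq> tsyms A n" using Ksyms_tsyms[OF f] .
  have gt: "Poly_Mapping.keys ?g \<subseteq> tsyms A n"
    using Ksyms_tsyms keys_defect[OF f] defect_at_Ksyms i by blast
  have ut: "Poly_Mapping.keys ?u \<subseteq> tsyms A n" using Ksyms_tsyms[OF u] .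
  note dut = pre_diff_in[OF ut]
  have "lin_ext (tsym_diff A) f \<in> tensor_rels A n"
    using cocycle cl_diff[OF ft] cl_zero_iff[OF pre_diff_in[OF ft]] by simp
  then have "lin_ext (h_at i) (lin_ext (tsym_diff A) f) \<in> tensor_rels A n" by (rule h_at_rels[OF i])
  then have "(lin_ext (tsym_diff A) ?u + lin_ext (h_at i) (lin_ext (tsym_diff A) f) - (f - ?g))
      - lin_ext (h_at i) (lin_ext (tsym_diff A) f) \<in> tensor_rels A n"
    by (rule R_closed(5)[OF homotopy[OF ft i]])
  then have "(lin_ext (tsym_diff A) ?u + ?g) - f \<in> tensor_rels A n" by (simp add: algebra_simps)
  moreover have k: "Poly_Mapping.keys (lin_ext (tsym_diff A) ?u + ?g) \<subseteq> tsyms A n"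
    using dut gt by (rule keys_add_subset)
  ultimately have "cl (lin_ext (tsym_diff A) ?u + ?g) = cl f"
    using tens.cl_eq_iff[of "lin_ext (tsym_diff A) ?u + ?g" n f] ft
      tens_minus[of "lin_ext (tsym_diff A) ?u + ?g" n f] by simp
  then show "cl f = diff T (cl ?u) \<oplus>\<^bsub>T\<^esub> cl ?g"
    using cl_add[OF dut gt] cl_diff[OF ut] by simp
qed

lemma homotopy_all:
  assumes f: "Poly_Mapping.keys f \<subseteq> Ksyms n (Suc p)" and cocycle: "diff T (cl f) = \<zero>\<^bsub>T\<^esub>"
    and i: "i \<le> n"
  shows "\<exists>u. Poly_Mapping.keys u \<subseteq> Ksyms n p \<and>
    cl f = diff T (cl u) \<oplus>\<^bsub>T\<^esub> cl (lin_ext (\<lambda>xs. sym (defects i xs)) f)"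
  using i
proof (induction i)
  case 0
  have "lin_ext (\<lambda>xs. sym (defects 0 xs)) f = f"
    using subset_UNIV[of "Poly_Mapping.keys f"]
    by (induction f rule: poly_mapping_linear_induct) (auto simp: lin_ext_add lin_ext_scl)
  moreover have "cl 0 = \<zero>\<^bsub>T\<^esub>" using cl_zero_iff[of 0] R_closed(3) by simp
  ultimately show ?case using cl_in[OF Ksyms_tsyms[OF f]] by (intro exI[of _ 0]) simp
next
  case (Suc i)
  let ?D = "\<lambda>g. lin_ext (\<lambda>xs. sym (defect_at i xs)) g"
  let ?f0 = "lin_ext (\<lambda>xs. sym (defects i xs)) f"
  have in': "i < n" using Suc.prems by simp
  have cocyc: "diff T b = \<zero>\<^bsub>T\<^esub>" if "a \<in> carrier T" "diff T a = \<zero>\<^bsub>T\<^esub>" "u \<in> carrier T" "b \<in> carrier T"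
    "a = diff T u \<oplus>\<^bsub>T\<^esub> b" for a b u
    using that T.diff_add[of "diff T u" b] T.diff_diff[of u] by simp
  obtain u where u: "Poly_Mapping.keys u \<subseteq> Ksyms n p" "cl f = diff T (cl u) \<oplus>\<^bsub>T\<^esub> cl ?f0"
    using Suc by auto
  have k0: "Poly_Mapping.keys ?f0 \<subseteq> Ksyms n (Suc p)"
    using keys_defect[OF f] defects_Ksyms in' by (metis less_imp_le)
  note c0 = cl_in[OF Ksyms_tsyms[OF k0]] and cu = cl_in[OF Ksyms_tsyms[OF u(1)]]
    and cf = cl_in[OF Ksyms_tsyms[OF f]]
  have d0: "diff T (cl ?f0) = \<zero>\<^bsub>T\<^esub>" by (rule cocyc[OF cf cocycle cu c0 u(2)])
  obtain v where v: "Poly_Mapping.keys v \<subseteq> Ksyms n p" "cl ?f0 = diff T (cl v) \<oplus>\<^bsub>T\<^esub> cl (?D ?f0)"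
    using homotopy_step[OF k0 d0 in'] by auto
  have k1: "Poly_Mapping.keys (?D ?f0) \<subseteq> Ksyms n (Suc p)"
    using keys_defect[OF k0] defect_at_Ksyms in' by blast
  note c1 = cl_in[OF Ksyms_tsyms[OF k1]] and cv = cl_in[OF Ksyms_tsyms[OF v(1)]]
  have d1: "diff T (cl (?D ?f0)) = \<zero>\<^bsub>T\<^esub>" by (rule cocyc[OF c0 d0 cv c1 v(2)])
  obtain w where w: "Poly_Mapping.keys w \<subseteq> Ksyms n p"
    "cl (?D ?f0) = diff T (cl w) \<oplus>\<^bsub>T\<^esub> cl (?D (?D ?f0))"
    using homotopy_step[OF k1 d1 in'] by auto
  have k2: "Poly_Mapping.keys (?D (?D ?f0)) \<subseteq> Ksyms n (Suc p)"
    using keys_defect[OF k1] defect_at_Ksyms in' by blast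
  note c2 = cl_in[OF Ksyms_tsyms[OF k2]] and cw = cl_in[OF Ksyms_tsyms[OF w(1)]]
  have e: "?D (?D ?f0) = lin_ext (\<lambda>xs. sym (defects (Suc i) xs)) f"
    by (simp add: lin_ext_comp)
  have kuv: "Poly_Mapping.keys (u + v) \<subseteq> Ksyms n p" using u(1) v(1) by (rule keys_add_subset)
  have cs: "cl (u + v + w) = cl u \<oplus>\<^bsub>T\<^esub> cl v \<oplus>\<^bsub>T\<^esub> cl w"
    using cl_add[OF Ksyms_tsyms[OF kuv] Ksyms_tsyms[OF w(1)]]
      cl_add[OF Ksyms_tsyms[OF u(1)] Ksyms_tsyms[OF v(1)]] by simp
  have "cl f = diff T (cl u) \<oplus>\<^bsub>T\<^esub> (diff T (cl v) \<oplus>\<^bsub>T\<^esub> (diff T (cl w) \<oplus>\<^bsub>T\<^esub> cl (?D (?D ?f0))))"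
    using u(2) v(2) w(2) by simp
  also have "\<dots> = diff T (cl (u + v + w)) \<oplus>\<^bsub>T\<^esub> cl (?D (?D ?f0))"
    unfolding cs using cu cv cw c2 by (simp add: T.diff_add T.add_assoc)
  finally have "cl f = diff T (cl (u + v + w)) \<oplus>\<^bsub>T\<^esub> cl (?D (?D ?f0))" .
  then show ?case unfolding e using keys_add_subset[OF kuv w(1)] by blast
qed

abbreviation "J \<equiv> tensor_sub A K n"

lemma J_gens: "pure_tensor A ` {xs \<in> tsyms A n. snd ` set xs \<subseteq> K} = (\<lambda>xs. cl (sym xs)) ` (\<Union>p. Ksyms n p)"
proof -
  have "pure_tensor A xs = cl (sym xs)" if "xs \<in> tsyms A n" for xs
    using tsymsD(1)[OF that] by (simp add: pure_tensor_def tens.cl_def)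
  then have "pure_tensor A ` {xs \<in> tsyms A n. snd ` set xs \<subseteq> K} =
      (\<lambda>xs. cl (sym xs)) ` {xs \<in> tsyms A n. snd ` set xs \<subseteq> K}" by (intro image_cong) auto
  moreover have "{xs \<in> tsyms A n. snd ` set xs \<subseteq> K} = (\<Union>p. Ksyms n p)" by (auto simp: Ksyms_def)
  ultimately show ?thesis by simp
qed

lemma Ksyms_cl_gr: "Poly_Mapping.keys f \<subseteq> Ksyms n p \<Longrightarrow> cl f \<in> gr T p"
  unfolding tensor_power_eq tens.Q_gr by (rule imageI) (auto simp: Ksyms_def)

lemma J_eq: "J = lspan T ((\<lambda>xs. cl (sym xs)) ` (\<Union>p. Ksyms n p))"
  by (simp add: tensor_sub_def J_gens)

lemma gens_gr: "(\<lambda>xs. cl (sym xs)) ` (\<Union>p. Ksyms n p) \<subseteq> (\<Union>p. gr T p)"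
  using Ksyms_cl_gr[of "sym xs" for xs] by fastforce

lemma gens_in: "(\<lambda>xs. cl (sym xs)) ` (\<Union>p. Ksyms n p) \<subseteq> carrier T"
  using gens_gr by blast

lemma J_sub: "submodule J rat_ring T"
  unfolding J_eq by (rule T.lspan_subspace[OF gens_in])

lemma cl_J: "Poly_Mapping.keys f \<subseteq> Ksyms n p \<Longrightarrow> cl f \<in> J"
proof (induction f rule: poly_mapping_linear_induct)
  case zero
  have "cl 0 = \<zero>\<^bsub>T\<^esub>" using cl_zero_iff[of 0] R_closed(3) by simp
  then show ?case using T.subspaceD(2)[OF J_sub] by simp
next
  case (sym xs)
  then show ?case unfolding J_eq by (intro T.lspan_incl) auto
next
  case (add f g)
  then show ?case using T.subspaceD(3)[OF J_sub] cl_add[OF Ksyms_tsyms Ksyms_tsyms] by simp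
next
  case (scl a f)
  then show ?case using T.subspaceD(4)[OF J_sub] cl_scl[OF Ksyms_tsyms] by simp
qed

lemma J_representative:
  assumes "z \<in> J" "z \<in> gr T p"
  shows "\<exists>f. Poly_Mapping.keys f \<subseteq> Ksyms n p \<and> z = cl f"
proof -
  let ?S = "(\<lambda>xs. cl (sym xs)) ` (\<Union>p. Ksyms n p) \<inter> gr T p"
  have "z \<in> lspan T ?S" by (rule T.homogeneous_lspan[OF gens_gr assms[unfolded J_eq]])
  moreover have "?S \<subseteq> carrier T" by auto
  moreover have z0: "cl 0 = \<zero>\<^bsub>T\<^esub>" using cl_zero_iff[of 0] R_closed(3) by simp
  ultimately show ?thesis
  proof (induction z rule: T.lspan_induct)
    case zero
    then show ?case by (intro exI[of _ 0]) simp
  next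
    case (add x y)
    then obtain f g where fg: "Poly_Mapping.keys f \<subseteq> Ksyms n p" "x = cl f"
      "Poly_Mapping.keys g \<subseteq> Ksyms n p" "y = cl g" by blast
    then have "x \<oplus>\<^bsub>T\<^esub> y = cl (f + g)" using cl_add[OF Ksyms_tsyms Ksyms_tsyms] by simp
    then show ?case using keys_add_subset[OF fg(1,3)] by blast
  next
    case (smult a x)
    then obtain f where f: "Poly_Mapping.keys f \<subseteq> Ksyms n p" "x = cl f" by blast
    then have "a \<odot>\<^bsub>T\<^esub> x = cl (scl a f)" using cl_scl[OF Ksyms_tsyms] by simp
    then show ?case using keys_scl_subset[OF f(1)] by blast
  next
    case (gen s)
    then obtain xs q where xs: "s = cl (sym xs)" "xs \<in> Ksyms n q" by blast
    show ?case
    proof (cases "q = p")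
      case True
      then show ?thesis using xs by (intro exI[of _ "sym xs"]) auto
    next
      case False
      have "s \<in> gr T q" using xs Ksyms_cl_gr[of "sym xs" q] by simp
      then have "s = \<zero>\<^bsub>T\<^esub>"
        using gen T.component_gr[of s q p] T.component_gr[of s p p] False by auto
      then show ?thesis using z0 by (intro exI[of _ 0]) simp
    qed
  qed
qed

text \<open>The part of the Kuenneth theorem that is needed. Every cocycle of \<open>K\<^sup>\<otimes>\<^sup>n\<close> is cohomologous to its image
  under all the maps \<open>id - d h - h d\<close>, applied twice, and this image is zero below degree \<open>n k\<close>.\<close>
theorem tensor_sub_acyclic:
  assumes "z \<in> J" "z \<in> gr T (Suc p)" "diff T z = \<zero>\<^bsub>T\<^esub>" "Suc p < n * k"
  shows "\<exists>j\<in>J \<inter> gr T p. diff T j = z"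
proof -
  obtain f where f: "Poly_Mapping.keys f \<subseteq> Ksyms n (Suc p)" "z = cl f"
    using J_representative[OF assms(1,2)] by blast
  let ?g = "lin_ext (\<lambda>xs. sym (defects n xs)) f"
  obtain u where u: "Poly_Mapping.keys u \<subseteq> Ksyms n p" "cl f = diff T (cl u) \<oplus>\<^bsub>T\<^esub> cl ?g"
    using homotopy_all[OF f(1) _ order_refl] assms(3) f(2) by auto
  have "?g \<in> tensor_rels A n" using f(1)
    by (induction f rule: poly_mapping_linear_induct)
      (use R_closed defects_rel assms(4) in \<open>auto simp: lin_ext_add lin_ext_scl\<close>)
  moreover have "Poly_Mapping.keys ?g \<subseteq> tsyms A n"
    by (rule Ksyms_tsyms[OF keys_defect[OF f(1) defects_Ksyms[OF _ order_refl]]])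
  ultimately have "cl ?g = \<zero>\<^bsub>T\<^esub>" using cl_zero_iff by simp
  then have "diff T (cl u) = z" using u(2) f(2) T.diff_in[OF cl_in[OF Ksyms_tsyms[OF u(1)]]] by simp
  then show ?thesis using cl_J[OF u(1)] Ksyms_cl_gr[OF u(1)] by blast
qed

end

section \<open>The kernel of a quasi-isomorphism onto a quotient\<close>

lemma coh_class_eq_iff:
  assumes "ratmod A" "submodule (coboundaries A p) rat_ring A" "x \<in> carrier A" "y \<in> carrier A"
  shows "coh_class A p x = coh_class A p y \<longleftrightarrow> x \<ominus>\<^bsub>A\<^esub> y \<in> coboundaries A p"
proof -
  interpret quotient_space A "coboundaries A p"
    using assms(1,2) by (intro quotient_space.intro quotient_space_axioms.intro)
  show ?thesis using cl_eq_iff[OF assms(3,4)] by (simp add: coh_class_def cl_def)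
qed

lemma coh_map_class:
  assumes A: "ratmod A" "submodule (coboundaries A p) rat_ring A"
    and B: "ratmod B" "submodule (coboundaries B p) rat_ring B"
    and f: "galg_hom A B f" "\<And>b. b \<in> coboundaries A p \<Longrightarrow> f b \<in> coboundaries B p"
    and z: "z \<in> carrier A"
  shows "coh_map B f p (coh_class A p z) = coh_class B p (f z)"
proof -
  interpret A: ratmod A by fact
  interpret B: ratmod B by fact
  interpret a: quotient_space A "coboundaries A p"
    using A by (intro quotient_space.intro quotient_space_axioms.intro)
  interpret b: quotient_space B "coboundaries B p"
    using B by (intro quotient_space.intro quotient_space_axioms.intro)
  have "b.cl (f x) = b.cl (f z)" if x: "x \<in> a.cl z" for x
  proof -
    have xc: "x \<in> carrier A" "x \<ominus>\<^bsub>A\<^esub> z \<in> coboundaries A p" using x a.mem_cl_iff[OF z] by auto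
    have "f x \<ominus>\<^bsub>B\<^esub> f z = f (x \<ominus>\<^bsub>A\<^esub> z)" using galg_hom_minus[OF f(1) A(1) B(1) xc(1) z] by simp
    then have "f x \<ominus>\<^bsub>B\<^esub> f z \<in> coboundaries B p" using f(2)[OF xc(2)] by simp
    then show ?thesis using b.cl_eq_iff[OF galg_homD(1)[OF f(1) xc(1)] galg_homD(1)[OF f(1) z]] by simp
  qed
  then have "(\<Union>x\<in>a.cl z. b.cl (f x)) = (\<Union>x\<in>a.cl z. b.cl (f z))" by (intro SUP_cong refl)
  also have "\<dots> = b.cl (f z)" using a.self_in_cl[OF z] by blast
  finally show ?thesis by (simp add: coh_map_def coh_class_def a.cl_def b.cl_def)
qed

lemma (in cdga) coboundaries_subspace: "submodule (coboundaries A p) rat_ring A"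
proof (cases p)
  case 0
  show ?thesis unfolding 0 coboundaries_def by (rule subspaceI) auto
next
  case (Suc q)
  show ?thesis
  proof (rule subspaceI)
    show "coboundaries A p \<subseteq> carrier A" by (auto simp: coboundaries_def Suc)
    show "\<zero> \<in> coboundaries A p" using diff_zero[symmetric] gr_zero[of q] unfolding coboundaries_def Suc nat.case by (rule image_eqI)
  next
    fix x y assume "x \<in> coboundaries A p" "y \<in> coboundaries A p"
    then obtain u v where "u \<in> gr A q" "v \<in> gr A q" "x = diff A u" "y = diff A v"
      by (auto simp: coboundaries_def Suc)
    then have "x \<oplus> y = diff A (u \<oplus> v)" "u \<oplus> v \<in> gr A q" using gr_closed(2) by (auto simp: diff_add)
    then show "x \<oplus> y \<in> coboundaries A p" by (auto simp: coboundaries_def Suc)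
  next
    fix a x assume "x \<in> coboundaries A p"
    then obtain u where "u \<in> gr A q" "x = diff A u" by (auto simp: coboundaries_def Suc)
    then have "a \<odot> x = diff A (a \<odot> u)" "a \<odot> u \<in> gr A q" using gr_closed(3) by (auto simp: diff_smult)
    then show "a \<odot> x \<in> coboundaries A p" by (auto simp: coboundaries_def Suc)
  qed
qed

lemma (in cdga) coboundariesD:
  assumes "b \<in> coboundaries A p"
  shows "b \<in> gr A p" "diff A b = \<zero>"
  using assms by (auto simp: coboundaries_def diff_gr diff_diff split: nat.splits)

locale quotient_model = T: cdga T + C: cdga C + q: quotient_space T J
  for T :: "('b, 'm) cdga_scheme" and C :: "('c, 'n) cdga_scheme" and J :: "'b set" +
  fixes i :: "'b \<Rightarrow> 'c" and \<pi> :: "'c \<Rightarrow> 'b set"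
  assumes quasi: "quasi_iso C (quot_cdga T J) \<pi>"
    and i_hom: "galg_hom T C i"
    and i_diff: "\<And>t. t \<in> carrier T \<Longrightarrow> i (diff T t) = diff C (i t)"
    and pi_i: "\<And>t. t \<in> carrier T \<Longrightarrow> \<pi> (i t) = J +>\<^bsub>T\<^esub> t"
begin

abbreviation "Q \<equiv> quot_cdga T J"

sublocale Q: ratmod Q by (rule q.Q_ratmod)

lemma pi_cl: "t \<in> carrier T \<Longrightarrow> \<pi> (i t) = q.cl t"
  using pi_i by (simp add: q.cl_def)

lemma pi_hom: "galg_hom C Q \<pi>" and pi_diff: "c \<in> carrier C \<Longrightarrow> \<pi> (diff C c) = diff Q (\<pi> c)"
  using quasi by (auto simp: quasi_iso_def cdga_hom_iff)

lemmas pi_simps = galg_homD[OF pi_hom] galg_hom_zero[OF pi_hom C.ratmod_axioms Q.ratmod_axioms]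
  galg_hom_minus[OF pi_hom C.ratmod_axioms Q.ratmod_axioms]

lemmas i_simps = galg_homD[OF i_hom]

definition N :: "'c set" where "N = {c \<in> carrier C. \<pi> c = \<zero>\<^bsub>Q\<^esub>}"

lemma N_I: "c \<in> carrier C \<Longrightarrow> \<pi> c = \<zero>\<^bsub>Q\<^esub> \<Longrightarrow> c \<in> N"
  by (simp add: N_def)

lemma N_D: "c \<in> N \<Longrightarrow> c \<in> carrier C" "c \<in> N \<Longrightarrow> \<pi> c = \<zero>\<^bsub>Q\<^esub>"
  by (simp_all add: N_def)

lemma i_mem_N: "t \<in> carrier T \<Longrightarrow> i t \<in> N \<longleftrightarrow> t \<in> J"
  using i_simps(1) pi_cl q.cl_zero_iff q.Q_zero by (simp add: N_def)

lemma N_sub: "submodule N rat_ring C"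
  by (rule C.subspaceI) (auto simp: N_def pi_simps)

lemma N_left: "c \<in> carrier C \<Longrightarrow> x \<in> N \<Longrightarrow> c \<otimes>\<^bsub>C\<^esub> x \<in> N"
proof (rule N_I)
  assume c: "c \<in> carrier C" and x: "x \<in> N"
  have "\<pi> (c \<otimes>\<^bsub>C\<^esub> x) = \<pi> (c \<otimes>\<^bsub>C\<^esub> \<zero>\<^bsub>C\<^esub>)"
    using c N_D[OF x] pi_simps(4)[OF c] pi_simps(7) C.zero_closed by metis
  then show "\<pi> (c \<otimes>\<^bsub>C\<^esub> x) = \<zero>\<^bsub>Q\<^esub>" using c pi_simps(7) by simp
qed (use N_D in auto)

lemma N_right: "c \<in> carrier C \<Longrightarrow> x \<in> N \<Longrightarrow> x \<otimes>\<^bsub>C\<^esub> c \<in> N"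
proof (rule N_I)
  assume c: "c \<in> carrier C" and x: "x \<in> N"
  have "\<pi> (x \<otimes>\<^bsub>C\<^esub> c) = \<pi> (\<zero>\<^bsub>C\<^esub> \<otimes>\<^bsub>C\<^esub> c)"
    using c N_D[OF x] pi_simps(4)[OF _ c] pi_simps(7) C.zero_closed by metis
  then show "\<pi> (x \<otimes>\<^bsub>C\<^esub> c) = \<zero>\<^bsub>Q\<^esub>" using c pi_simps(7) by simp
qed (use N_D in auto)

lemma N_diff: "x \<in> N \<Longrightarrow> diff C x \<in> N"
proof (rule N_I)
  assume x: "x \<in> N"
  have "\<pi> (diff C x) = \<pi> (diff C \<zero>\<^bsub>C\<^esub>)"
    using N_D[OF x] pi_diff pi_simps(7) C.zero_closed by metis
  then show "\<pi> (diff C x) = \<zero>\<^bsub>Q\<^esub>" using pi_simps(7) by simp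
qed (use N_D in auto)

lemma N_surj:
  assumes c: "c \<in> gr C p"
  shows "\<exists>t\<in>gr T p. c \<ominus>\<^bsub>C\<^esub> i t \<in> N"
proof -
  have "\<pi> c \<in> gr Q p" using pi_simps(6)[OF c] .
  then obtain t where t: "t \<in> gr T p" "\<pi> c = q.cl t" by (auto simp: q.Q_gr)
  have tc: "t \<in> carrier T" and cc: "c \<in> carrier C" using t(1) c by auto
  note ic = i_simps(1)[OF tc]
  have "\<pi> (c \<ominus>\<^bsub>C\<^esub> i t) = \<pi> (i t) \<ominus>\<^bsub>Q\<^esub> \<pi> (i t)"
    using pi_simps(8)[OF cc ic] t(2) pi_cl[OF tc] by simp
  then have "\<pi> (c \<ominus>\<^bsub>C\<^esub> i t) = \<zero>\<^bsub>Q\<^esub>" using pi_simps(1)[OF ic] by (simp add: a_minus_def Q.r_neg_self)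
  moreover have "c \<ominus>\<^bsub>C\<^esub> i t \<in> carrier C" using C.gr_closed(5)[OF c i_simps(6)[OF t(1)]] by blast
  ultimately show ?thesis using t(1) N_I by blast
qed

lemma Q_diff_cl: "t \<in> carrier T \<Longrightarrow> diff Q (q.cl t) = \<pi> (i (diff T t))"
  using pi_diff[of "i t"] i_simps(1) pi_cl i_diff by simp

lemma coboundaries_Q: "coboundaries Q p = \<pi> ` i ` coboundaries T p"
proof (cases p)
  case 0
  have "\<pi> (i \<zero>\<^bsub>T\<^esub>) = \<zero>\<^bsub>Q\<^esub>"
    using galg_hom_zero[OF i_hom T.ratmod_axioms C.ratmod_axioms] pi_simps(7) by simp
  then show ?thesis by (simp add: coboundaries_def 0)
next
  case (Suc r)
  have "diff Q (q.cl t) = \<pi> (i (diff T t))" if "t \<in> gr T r" for t using Q_diff_cl that by auto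
  then show ?thesis by (auto simp: coboundaries_def Suc q.Q_gr image_image)
qed

lemma i_coboundaries: "b \<in> coboundaries T p \<Longrightarrow> i b \<in> coboundaries C p"
  using galg_hom_zero[OF i_hom T.ratmod_axioms C.ratmod_axioms] i_diff i_simps(6)
  by (auto simp: coboundaries_def split: nat.splits)

lemma coboundaries_Q_sub: "submodule (coboundaries Q p) rat_ring Q"
proof -
  note B = T.subspaceD[OF T.coboundaries_subspace[of p]]
  have c: "b \<in> carrier T" if "b \<in> coboundaries T p" for b using B(1) that by blast
  show ?thesis unfolding coboundaries_Q
  proof (rule Q.subspaceI)
    show "\<pi> ` i ` coboundaries T p \<subseteq> carrier Q" using c i_simps(1) pi_simps(1) by auto
    have "\<pi> (i \<zero>\<^bsub>T\<^esub>) = \<zero>\<^bsub>Q\<^esub>"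
      using galg_hom_zero[OF i_hom T.ratmod_axioms C.ratmod_axioms] pi_simps(7) by simp
    then show "\<zero>\<^bsub>Q\<^esub> \<in> \<pi> ` i ` coboundaries T p" using B(2) by (metis image_eqI)
  next
    fix x y assume "x \<in> \<pi> ` i ` coboundaries T p" "y \<in> \<pi> ` i ` coboundaries T p"
    then obtain u v where *: "u \<in> coboundaries T p" "v \<in> coboundaries T p" "x = \<pi> (i u)" "y = \<pi> (i v)"
      by auto
    then have "x \<oplus>\<^bsub>Q\<^esub> y = \<pi> (i (u \<oplus>\<^bsub>T\<^esub> v))" using c i_simps(1,3) pi_simps(3) by simp
    then show "x \<oplus>\<^bsub>Q\<^esub> y \<in> \<pi> ` i ` coboundaries T p" using B(3)[OF *(1,2)] by blast
  next
    fix a x assume "x \<in> \<pi> ` i ` coboundaries T p"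
    then obtain u where *: "u \<in> coboundaries T p" "x = \<pi> (i u)" by auto
    then have "a \<odot>\<^bsub>Q\<^esub> x = \<pi> (i (a \<odot>\<^bsub>T\<^esub> u))" using c i_simps(1,5) pi_simps(5) by simp
    then show "a \<odot>\<^bsub>Q\<^esub> x \<in> \<pi> ` i ` coboundaries T p" using B(4)[OF *(1)] by blast
  qed
qed

lemma coh_map_pi: "z \<in> carrier C \<Longrightarrow> coh_map Q \<pi> p (coh_class C p z) = coh_class Q p (\<pi> z)"
proof (rule coh_map_class[OF C.ratmod_axioms C.coboundaries_subspace Q.ratmod_axioms coboundaries_Q_sub
    pi_hom])
  fix b assume b: "b \<in> coboundaries C p"
  show "\<pi> b \<in> coboundaries Q p"
  proof (cases p)
    case 0
    then show ?thesis using b pi_simps(7) by (simp add: coboundaries_def)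
  next
    case (Suc r)
    then obtain c where c: "c \<in> gr C r" "b = diff C c" using b by (auto simp: coboundaries_def)
    then have "\<pi> b = diff Q (\<pi> c)" using pi_diff by auto
    then show ?thesis using pi_simps(6)[OF c(1)] Suc by (auto simp: coboundaries_def)
  qed
qed

text \<open>This is the injectivity of \<open>H(\<pi>)\<close>: the class of \<open>x\<close> is mapped to zero.\<close>
lemma N_cocycle_exact:
  assumes x: "x \<in> N" "x \<in> gr C p" "diff C x = \<zero>\<^bsub>C\<^esub>"
  shows "x \<in> coboundaries C p"
proof -
  have xc: "x \<in> carrier C" using N_D(1)[OF x(1)] .
  have inj: "inj_on (coh_map Q \<pi> p) (cohomology C p)"
    using quasi by (auto simp: quasi_iso_def bij_betw_def)
  have "coh_map Q \<pi> p (coh_class C p x) = coh_map Q \<pi> p (coh_class C p \<zero>\<^bsub>C\<^esub>)"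
    using coh_map_pi[OF xc] coh_map_pi[OF C.zero_closed] N_D(2)[OF x(1)] pi_simps(7) by simp
  moreover have "coh_class C p x \<in> cohomology C p" "coh_class C p \<zero>\<^bsub>C\<^esub> \<in> cohomology C p"
    using x by (auto simp: cohomology_def cocycles_def)
  ultimately have "coh_class C p x = coh_class C p \<zero>\<^bsub>C\<^esub>" using inj by (auto dest: inj_onD)
  then have "x \<ominus>\<^bsub>C\<^esub> \<zero>\<^bsub>C\<^esub> \<in> coboundaries C p"
    using coh_class_eq_iff[OF C.ratmod_axioms C.coboundaries_subspace xc C.zero_closed] by simp
  then show ?thesis using xc by (simp add: a_minus_def)
qed

lemma N_acyclic_0: "x \<in> N \<Longrightarrow> x \<in> gr C 0 \<Longrightarrow> diff C x = \<zero>\<^bsub>C\<^esub> \<Longrightarrow> x = \<zero>\<^bsub>C\<^esub>"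
  using N_cocycle_exact[of x 0] by (simp add: coboundaries_def)

text \<open>A primitive \<open>c\<close> of a cocycle in the kernel of \<open>\<pi>\<close> is mapped to a cocycle. By surjectivity of
  \<open>H(\<pi>)\<close> it can be corrected by a cocycle so that it lies in the kernel itself.\<close>
lemma N_acyclic:
  assumes x: "x \<in> N" "x \<in> gr C (Suc p)" "diff C x = \<zero>\<^bsub>C\<^esub>"
  shows "\<exists>y\<in>N \<inter> gr C p. diff C y = x"
proof -
  obtain c where c: "c \<in> gr C p" "x = diff C c"
    using N_cocycle_exact[OF x] by (auto simp: coboundaries_def)
  have cc: "c \<in> carrier C" using c by auto
  have "diff Q (\<pi> c) = \<zero>\<^bsub>Q\<^esub>" using pi_diff[OF cc] c(2) N_D(2)[OF x(1)] by simp
  then have "coh_class Q p (\<pi> c) \<in> cohomology Q p"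
    using pi_simps(6)[OF c(1)] by (auto simp: cohomology_def cocycles_def)
  moreover have "cohomology Q p = coh_map Q \<pi> p ` coh_class C p ` cocycles C p"
    using quasi by (auto simp: quasi_iso_def bij_betw_def cohomology_def[of C])
  ultimately obtain e where "e \<in> cocycles C p"
    and e3: "coh_class Q p (\<pi> c) = coh_map Q \<pi> p (coh_class C p e)"
    by auto
  then have e: "e \<in> gr C p" "diff C e = \<zero>\<^bsub>C\<^esub>" by (simp_all add: cocycles_def)
  have ec: "e \<in> carrier C" using e by auto
  have "coh_class Q p (\<pi> c) = coh_class Q p (\<pi> e)" using e3 coh_map_pi[OF ec] by simp
  then have "\<pi> c \<ominus>\<^bsub>Q\<^esub> \<pi> e \<in> coboundaries Q p"
    using coh_class_eq_iff[OF Q.ratmod_axioms coboundaries_Q_sub pi_simps(1)[OF cc] pi_simps(1)[OF ec]]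
    by simp
  then obtain b where b: "b \<in> coboundaries T p" "\<pi> c \<ominus>\<^bsub>Q\<^esub> \<pi> e = \<pi> (i b)"
    by (auto simp: coboundaries_Q)
  note ib = C.coboundariesD[OF i_coboundaries[OF b(1)]]
  have ibc: "i b \<in> carrier C" using ib by blast
  let ?y = "(c \<ominus>\<^bsub>C\<^esub> e) \<ominus>\<^bsub>C\<^esub> i b"
  have ce: "c \<ominus>\<^bsub>C\<^esub> e \<in> gr C p" using c(1) e(1) by (rule C.gr_closed(5))
  have cec: "c \<ominus>\<^bsub>C\<^esub> e \<in> carrier C" using ce by blast
  have y: "?y \<in> gr C p" using ce ib(1) by (rule C.gr_closed(5))
  have "\<pi> ?y = \<pi> (i b) \<ominus>\<^bsub>Q\<^esub> \<pi> (i b)" using pi_simps(8)[OF cec ibc] pi_simps(8)[OF cc ec] b(2) by simp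
  then have "\<pi> ?y = \<zero>\<^bsub>Q\<^esub>" using pi_simps(1)[OF ibc] by (simp add: a_minus_def Q.r_neg_self)
  then have "?y \<in> N" using y by (intro N_I) auto
  moreover have "diff C ?y = x"
    using C.diff_minus[OF cec ibc] C.diff_minus[OF cc ec] e(2) ib(2) c(2) C.diff_in[OF cc]
    by (simp add: a_minus_def)
  ultimately show ?thesis using y by blast
qed

end

section \<open>The bound on the sectional category\<close>

lemma kernel_low_acyclic:
  fixes A :: "('a, 'm) cdga_scheme" and B :: "('b, 'n) cdga_scheme" and \<phi> :: "'a \<Rightarrow> 'b"
  defines "K \<equiv> a_kernel A B \<phi>"
  assumes A: "cdga A" and B: "cdga B" and \<phi>: "\<phi> \<in> cdga_hom A B"
    and H: "\<And>p. p < k \<Longrightarrow> cohomology (subcomplex A K) p = {coh_class (subcomplex A K) p \<zero>\<^bsub>A\<^esub>}"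
  shows "low_acyclic A K k"
proof -
  interpret A: cdga A by fact
  interpret B: cdga B by fact
  have g: "galg_hom A B \<phi>" and d: "\<And>x. x \<in> carrier A \<Longrightarrow> \<phi> (diff A x) = diff B (\<phi> x)"
    using \<phi> by (auto simp: cdga_hom_iff)
  note s = galg_homD[OF g] galg_hom_zero[OF g A.ratmod_axioms B.ratmod_axioms]
  have K: "x \<in> K \<longleftrightarrow> x \<in> carrier A \<and> \<phi> x = \<zero>\<^bsub>B\<^esub>" for x
    unfolding K_def by (simp add: a_kernel_def')
  have sub: "submodule K rat_ring A"
    by (rule A.subspaceI) (auto simp: K s)
  have dK: "diff A x \<in> K" if "x \<in> K" for x using that d by (simp add: K)
  have exact: "x \<in> coboundaries (subcomplex A K) p"
    if p: "p < k" and x: "x \<in> K" "x \<in> gr A p" "diff A x = \<zero>\<^bsub>A\<^esub>" for x p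
  proof -
    let ?S = "subcomplex A K"
    have simps: "gr ?S p = gr A p \<inter> K" "diff ?S = diff A" "\<zero>\<^bsub>?S\<^esub> = \<zero>\<^bsub>A\<^esub>" "add ?S = add A" for p
      by (simp_all add: subcomplex_def)
    have cosets: "coh_class ?S p z = (\<lambda>b. b \<oplus>\<^bsub>A\<^esub> z) ` coboundaries ?S p" for z
      by (auto simp: coh_class_def a_r_coset_def' simps)
    have sub: "coboundaries ?S p \<subseteq> carrier A"
      using A.diff_in by (auto simp: coboundaries_def simps split: nat.splits)
    have "\<zero>\<^bsub>A\<^esub> \<in> coboundaries ?S p"
    proof (cases p)
      case (Suc r)
      have "\<zero>\<^bsub>A\<^esub> \<in> gr A r \<inter> K" using s(7) by (simp add: K)
      then show ?thesis using Suc A.diff_zero by (force simp: coboundaries_def simps)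
    qed (simp add: coboundaries_def simps)
    then have "x \<in> coh_class ?S p x" using x(2) by (force simp: cosets)
    also have "coh_class ?S p x = coh_class ?S p \<zero>\<^bsub>A\<^esub>"
      using H[OF p] x by (auto simp: cohomology_def cocycles_def simps)
    finally show ?thesis using sub by (auto simp: cosets)
  qed
  show ?thesis
  proof (intro low_acyclic.intro low_acyclic_axioms.intro A sub dK)
    fix x assume "0 < k" "x \<in> K" "x \<in> gr A 0" "diff A x = \<zero>\<^bsub>A\<^esub>"
    then show "x = \<zero>\<^bsub>A\<^esub>" using exact[of 0 x] by (simp add: coboundaries_def subcomplex_def)
  next
    fix p x assume "Suc p < k" "x \<in> K" "x \<in> gr A (Suc p)" "diff A x = \<zero>\<^bsub>A\<^esub>"
    then show "\<exists>y\<in>K \<inter> gr A p. diff A y = x"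
      using exact[of "Suc p" x] by (auto simp: coboundaries_def subcomplex_def)
  qed
qed

lemma connected_cocycles:
  assumes "cdga T" "bij_betw (\<lambda>a. coh_class T 0 (a \<odot>\<^bsub>T\<^esub> \<one>\<^bsub>T\<^esub>)) UNIV (cohomology T 0)"
    and t: "t \<in> gr T 0" "diff T t = \<zero>\<^bsub>T\<^esub>"
  shows "\<exists>a. t = a \<odot>\<^bsub>T\<^esub> \<one>\<^bsub>T\<^esub>"
proof -
  interpret cdga T by fact
  have "coh_class T 0 t \<in> cohomology T 0" using t by (auto simp: cohomology_def cocycles_def)
  then obtain a where "coh_class T 0 t = coh_class T 0 (a \<odot>\<^bsub>T\<^esub> \<one>\<^bsub>T\<^esub>)"
    using assms(2) by (auto simp: bij_betw_def)
  then have "t \<ominus>\<^bsub>T\<^esub> a \<odot>\<^bsub>T\<^esub> \<one>\<^bsub>T\<^esub> \<in> coboundaries T 0"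
    using coh_class_eq_iff[OF ratmod_axioms coboundaries_subspace[of 0]] t(1) by auto
  then have "t \<ominus>\<^bsub>T\<^esub> a \<odot>\<^bsub>T\<^esub> \<one>\<^bsub>T\<^esub> = \<zero>\<^bsub>T\<^esub>" by (simp add: coboundaries_def)
  moreover have "(t \<ominus>\<^bsub>T\<^esub> a \<odot>\<^bsub>T\<^esub> \<one>\<^bsub>T\<^esub>) \<oplus>\<^bsub>T\<^esub> a \<odot>\<^bsub>T\<^esub> \<one>\<^bsub>T\<^esub> = t"
    using t(1) by (simp add: a_minus_def add_assoc l_neg_self)
  ultimately show ?thesis by auto
qed

text \<open>The power \<open>K\<^sup>\<otimes>\<^sup>n\<close> is acyclic up to degree \<open>l + 1\<close>, which exceeds the bound \<open>l - 1\<close> on the degrees of \<open>A\<close> by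
  two. One degree is lost in the long exact sequence, since the cohomology of \<open>K\<^sup>\<otimes>\<^sup>n\<close> in degree \<open>m + 1\<close> contributes
  to that of \<open>C / T\<close> in degree \<open>m\<close>. The other one makes it possible to choose \<open>m\<close> even, as the
  degree of the generators \<open>w\<close> of the contractible module has to be.\<close>
lemma multiplication_extends_to_model:
  fixes A :: "('a, 'm) cdga_scheme" and C :: "('c, 'n) cdga_scheme"
  assumes A: "cdga A" and K: "low_acyclic A K k"
    and top: "\<And>p. l \<le> p \<Longrightarrow> gr A p = {\<zero>\<^bsub>A\<^esub>}" and l: "0 < l" and n: "l + 1 < n * k"
    and model: "relative_sullivan_model (tensor_power A n)
      (quot_cdga (tensor_power A n) (tensor_sub A K n)) (\<lambda>x. tensor_sub A K n +>\<^bsub>tensor_power A n\<^esub> x) C i"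
  shows "\<exists>\<tau>\<in>cdga_hom C A. \<forall>t\<in>carrier (tensor_power A n). \<tau> (i t) = multiplication A t"
proof -
  let ?T = "tensor_power A n" and ?J = "tensor_sub A K n"
  have S: "relative_sullivan ?T C i" using model by (simp add: relative_sullivan_model_def)
  have T: "cdga ?T" and C: "cdga C" and i: "i \<in> cdga_hom ?T C"
    and conn: "bij_betw (\<lambda>a. coh_class ?T 0 (a \<odot>\<^bsub>?T\<^esub> \<one>\<^bsub>?T\<^esub>)) UNIV (cohomology ?T 0)"
    using S unfolding relative_sullivan_def by simp_all
  obtain V F where F: "free_extension ?T C i V" "\<forall>n. graded_subspace C (F n)" "\<forall>n. F n \<subseteq> F (Suc n)"
      "V = (\<Union>n. F n)" "diff C ` F 0 \<subseteq> i ` carrier ?T"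
      "\<forall>n. diff C ` F (Suc n) \<subseteq> generate_ring C (i ` carrier ?T \<union> F n)"
    using S unfolding relative_sullivan_def by (elim conjE exE) (rule that)
  obtain \<pi> where \<pi>: "quasi_iso C (quot_cdga ?T ?J) \<pi>" "\<forall>t\<in>carrier ?T. \<pi> (i t) = ?J +>\<^bsub>?T\<^esub> t"
    using model unfolding relative_sullivan_model_def by (elim conjE exE) (rule that)
  obtain X r where X: "X \<subseteq> (\<Union>p. gr C p)" "lspan C X = V" "linear_order_on X r"
    "\<And>c. c \<in> carrier C \<Longrightarrow> \<exists>!f. f ` monomials C X r \<subseteq> carrier ?T \<and>
      (\<forall>xs. xs \<notin> monomials C X r \<longrightarrow> f xs = \<zero>\<^bsub>?T\<^esub>) \<and> finite {xs. f xs \<noteq> \<zero>\<^bsub>?T\<^esub>} \<and>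
      c = (\<Oplus>\<^bsub>C\<^esub>xs\<in>{xs. f xs \<noteq> \<zero>\<^bsub>?T\<^esub>}. i (f xs) \<otimes>\<^bsub>C\<^esub> foldr (\<otimes>\<^bsub>C\<^esub>) xs \<one>\<^bsub>C\<^esub>)"
    using F(1) unfolding free_extension_def by (elim exE conjE) (rule that, assumption+, rule bspec)
  interpret A: cdga A by (rule A)
  interpret T: cdga ?T by (rule T)
  interpret C: cdga C by (rule C)
  interpret K: low_acyclic A K k by (rule K)
  interpret K: low_acyclic_power A K k n by unfold_locales
  have i': "galg_hom ?T C i" "\<And>t. t \<in> carrier ?T \<Longrightarrow> i (diff ?T t) = diff C (i t)"
    using i by (auto simp: cdga_hom_iff)
  interpret M: quotient_model ?T C ?J i \<pi>
    by (intro quotient_model.intro quotient_space.intro quotient_space_axioms.intro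
        quotient_model_axioms.intro T C T.ratmod_axioms K.J_sub \<pi>(1) i' \<pi>(2)[rule_format])
  define m where "m = (if even l then l else l - 1)"
  have m: "even m" "l \<le> Suc m" "m \<le> l" using l by (auto simp: m_def)
  have N_T: "\<exists>j\<in>gr ?T p. i j \<in> M.N \<and> diff ?T j = t"
    if t: "p \<le> m" "t \<in> gr ?T (Suc p)" "i t \<in> M.N" "diff ?T t = \<zero>\<^bsub>?T\<^esub>" for p t
  proof -
    have "t \<in> ?J" using M.i_mem_N t(2,3) by auto
    moreover have "Suc p < n * k" using t(1) m(3) n by simp
    ultimately obtain j where "j \<in> ?J" "j \<in> gr ?T p" "diff ?T j = t"
      using K.tensor_sub_acyclic[of t p] t(2,4) by auto
    then show ?thesis using M.i_mem_N by auto
  qed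
  have A_top: "\<And>p. m < p \<Longrightarrow> gr A p = {\<zero>\<^bsub>A\<^esub>}" using top m(2) by simp
  have "extension_problem ?T C i X r A F M.N m (multiplication A)"
  proof (intro extension_problem.intro free_ext.intro free_ext_axioms.intro
      extension_problem_axioms.intro)
    show "lspan C X = (\<Union>n. F n)" using X(2) F(4) by simp
  qed (fact T C A i' X F(2,3)[rule_format] F(5) F(6)[rule_format] connected_cocycles[OF T conn] m(1)
      M.N_sub M.N_left M.N_right M.N_diff M.N_acyclic M.N_acyclic_0 M.N_surj N_T
      A.multiplication_hom[OF T] A_top)+
  then show ?thesis by (rule extension_problem.exists_extension)
qed

theorem proposition19:
  fixes A :: "'a cdga" and B :: "'b cdga" and \<phi> :: "'a \<Rightarrow> 'b"
    and C :: "nat \<Rightarrow> 'c cdga" and i :: "nat \<Rightarrow> 'a tensor \<Rightarrow> 'c"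
    and k l :: nat
  assumes "cdga A" and "cdga B" and "\<phi> \<in> cdga_hom A B"
    and "\<phi> ` carrier A = carrier B"
    and "\<forall>p. coh_map B \<phi> p ` cohomology A p = cohomology B p"
    and "k > 0" and "l > 0"
    and "\<forall>p\<ge>l. gr A p = {\<zero>\<^bsub>A\<^esub>}"
    and "\<forall>p<k. cohomology (subcomplex A (a_kernel A B \<phi>)) p =
           {coh_class (subcomplex A (a_kernel A B \<phi>)) p \<zero>\<^bsub>A\<^esub>}"
    and "secat_models A B \<phi> C i"
  shows "ereal_of_enat (secat A C i) \<le> ereal (real (l + 1) / real k)"
proof -
  define m where "m = (l + 1) div k"
  have K: "low_acyclic A (a_kernel A B \<phi>) k" using assms(1-3,9) by (intro kernel_low_acyclic) auto
  have "l + 1 < (m + 1) * k"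
    using dividend_less_div_times[OF assms(6), of "l + 1"] by (simp add: m_def)
  then have "\<exists>\<tau>\<in>cdga_hom (C m) A. \<forall>t\<in>carrier (tensor_power A (m + 1)). \<tau> (i m t) = multiplication A t"
    using assms(8,10) unfolding secat_models_def Let_def
    by (intro multiplication_extends_to_model[OF assms(1) K _ assms(7)]) auto
  then have "secat A C i \<le> enat m" unfolding secat_def by (intro Inf_lower) blast
  then have "ereal_of_enat (secat A C i) \<le> ereal_of_enat (enat m)"
    by (rule ereal_of_enat_le_iff[THEN iffD2])
  also have "\<dots> \<le> ereal (real (l + 1) / real k)" using of_nat_div_le_of_nat[of "l + 1" k, where ?'a = real] by (simp add: m_def)
  finally show ?thesis .
qed

end
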